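(* Let $y_0 \in H^3(\Omega)\cap H^1_0(\Omega)$, and let $u\in\hat U$ and, for $\tau>0$, $u_\tau\in\hat U$, where $\bar u\in H^1(\Omega)$ (the common initial value of the elements of $\hat U$) is such that $y_1 := \Delta y_0 + \bar u \in H^1_0(\Omega)$. Let $y_\tau$ be the weak solution of the Cattaneo equation with delay $\tau$, right-hand side $u_\tau$ and initial data $y_0,y_1$, and let $y$ be the weak solution of the heat equation with right-hand side $u$ and initial datum $y_0$. Then there exists a constant $C>0$, independent of $\tau$, such that $$\|y_\tau - y\|_{L^2(0,T;H^1_0(\Omega))} \le C\,\|u_\tau-u\|_{L^2(0,T;L^2(\Omega))} + \tau\, C\left(\|u_\tau\|_{H^1(0,T;H^1(\Omega))} + \|y_0\|_{H^3(\Omega)}\right).$$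
   Context: $\Omega\subset\mathbb{R}^d$ is a bounded Lipschitz domain with boundary $\partial\Omega$, and $T>0$ is fixed. A prime denotes the (weak) time derivative. $(\cdot,\cdot)$ is the $L^2(\Omega)$ scalar product, $\langle\cdot,\cdot\rangle$ is the duality pairing between $H^{-1}(\Omega)$ and $H^1_0(\Omega)$, and $a[y,v]:=(\nabla y,\nabla v)$ for $y,v\in H^1_0(\Omega)$. Admissible set: for fixed $0<M<\infty$ and $\bar u\in H^1(\Omega)$, $$\hat U := \{u\in H^1(0,T;H^1(\Omega)) : \|u\|_{H^1(0,T;H^1(\Omega))}\le M \text{ and } u(0)=\bar u\},$$ where $u(0)$ is well defined since $H^1(0,T;H^1(\Omega))\hookrightarrow C([0,T];H^1(\Omega))$. Cattaneo equation (delay $\tau>0$): $\tau y_\tau''+y_\tau'-\Delta y_\tau=u_\tau$ in $(0,T)\times\Omega$, $y_\tau=0$ on $(0,T)\times\partial\Omega$, $y_\tau(0)=y_0$, $y_\tau'(0)=y_1$. Its weak solution is the unique $y_\tau\in Y(0,T):=\{v\in L^2(0,T;H^1_0(\Omega)) : v'\in L^2(0,T;L^2(\Omega)),\ v''\in L^2(0,T;H^{-1}(\Omega))\}$ satisfying the initial conditions and $$\int_0^T \tau\langle y_\tau'',v\rangle+(y_\tau',v)+a[y_\tau,v]\,dt=\int_0^T(u_\tau,v)\,dt\quad\text{for all } v\in L^2(0,T;H^1_0(\Omega)).$$ Heat equation: $y'-\Delta y=u$ in $(0,T)\times\Omega$, $y=0$ on $(0,T)\times\partial\Omega$, $y(0)=y_0$.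 Its weak solution is the unique $y\in W(0,T):=\{v\in L^2(0,T;H^1_0(\Omega)) : v'\in L^2(0,T;L^2(\Omega))\}$ satisfying $y(0)=y_0$ and $$\int_0^T (y',v)+a[y,v]\,dt=\int_0^T(u,v)\,dt\quad\text{for all } v\in L^2(0,T;H^1_0(\Omega)).$$ *)

theory Defs
  imports "HOL-Analysis.Analysis"
begin

text \<open>Near each boundary point, after a rigid change of coordinates, the domain is the strict
  epigraph of a Lipschitz function.  The vertical axis is spanned by the unit vector \<open>e\<close> and
  \<open>g\<close> is a function on the hyperplane orthogonal to \<open>e\<close>.\<close>

definition lipschitz_domain :: "'a::euclidean_space set \<Rightarrow> bool" where
  "lipschitz_domain \<Omega> \<longleftrightarrow> open \<Omega> \<and> connected \<Omega> \<and> \<Omega> \<noteq> {} \<and>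
     (\<forall>x\<in>frontier \<Omega>. \<exists>r>0. \<exists>e g L. norm e = 1 \<and> L-lipschitz_on {z. z \<bullet> e = 0} g \<and>
        \<Omega> \<inter> ball x r = {z \<in> ball x r. g (z - (z \<bullet> e) *\<^sub>R e) < z \<bullet> e})"

definition pderiv :: "'a::euclidean_space \<Rightarrow> ('a \<Rightarrow> real) \<Rightarrow> 'a \<Rightarrow> real" where
  "pderiv b f x = deriv (\<lambda>s. f (x + s *\<^sub>R b)) 0"

definition iter_pderiv :: "'a::euclidean_space list \<Rightarrow> ('a \<Rightarrow> real) \<Rightarrow> 'a \<Rightarrow> real" where
  "iter_pderiv bs f = foldr pderiv bs f"

definition test_functions :: "'a::euclidean_space set \<Rightarrow> ('a \<Rightarrow> real) set" where
  "test_functions \<Omega> = {\<phi>.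
     (\<forall>bs. set bs \<subseteq> Basis \<longrightarrow> (\<forall>x. iter_pderiv bs \<phi> differentiable (at x))) \<and>
     compact (closure {x. \<phi> x \<noteq> 0}) \<and> closure {x. \<phi> x \<noteq> 0} \<subseteq> \<Omega>}"

text \<open>Elements of function spaces over \<open>\<Omega>\<close> are represented by functions instead of classes modulo
  almost everywhere equality; values outside \<open>\<Omega>\<close> are irrelevant and norms are seminorms on the
  representatives.\<close>

definition square_integrable :: "'a::euclidean_space set \<Rightarrow> ('a \<Rightarrow> real) \<Rightarrow> bool" where
  "square_integrable \<Omega> f \<longleftrightarrow> f \<in> borel_measurable (lebesgue_on \<Omega>) \<and>
     integrable (lebesgue_on \<Omega>) (\<lambda>x. (f x)\<^sup>2)"

definition l2_inner :: "'a::euclidean_space set \<Rightarrow> ('a \<Rightarrow> real) \<Rightarrow> ('a \<Rightarrow> real) \<Rightarrow> real" where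
  "l2_inner \<Omega> f g = (LINT x|lebesgue_on \<Omega>. f x * g x)"

text \<open>\<open>g\<close> is the weak derivative in \<open>L\<^sup>2(\<Omega>)\<close> of \<open>f \<in> L\<^sup>2(\<Omega>)\<close> in the
  successive coordinate directions \<open>bs\<close>.\<close>

definition is_weak_pderiv ::
  "'a::euclidean_space set \<Rightarrow> 'a list \<Rightarrow> ('a \<Rightarrow> real) \<Rightarrow> ('a \<Rightarrow> real) \<Rightarrow> bool" where
  "is_weak_pderiv \<Omega> bs f g \<longleftrightarrow> square_integrable \<Omega> f \<and> square_integrable \<Omega> g \<and>
     (\<forall>\<phi>\<in>test_functions \<Omega>.
        (LINT x|lebesgue_on \<Omega>. f x * iter_pderiv bs \<phi> x) =
        (- 1) ^ length bs * (LINT x|lebesgue_on \<Omega>. g x * \<phi> x))"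

text \<open>The weak derivative is unique up to a null set, so the choice below only selects a
  representative.\<close>

definition weak_pderiv :: "'a::euclidean_space set \<Rightarrow> 'a list \<Rightarrow> ('a \<Rightarrow> real) \<Rightarrow> 'a \<Rightarrow> real" where
  "weak_pderiv \<Omega> bs f = (SOME g. is_weak_pderiv \<Omega> bs f g)"

definition weak_laplacian :: "'a::euclidean_space set \<Rightarrow> ('a \<Rightarrow> real) \<Rightarrow> 'a \<Rightarrow> real" where
  "weak_laplacian \<Omega> f x = (\<Sum>b\<in>Basis. weak_pderiv \<Omega> [b, b] f x)"

text \<open>A (semi)normed space of real functions on \<open>'x\<close> with pointwise operations.  For
  \<open>L\<^sup>2(\<Omega>)\<close> and the Sobolev spaces \<open>'x\<close> is the ambient Euclidean space; for the dual space
  \<open>'x\<close> is the type of functions on which the functionals act.\<close>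

record 'x fspace =
  elems :: "('x \<Rightarrow> real) set"
  fnorm :: "('x \<Rightarrow> real) \<Rightarrow> real"

definition L2_space :: "'a::euclidean_space set \<Rightarrow> 'a fspace" where
  "L2_space \<Omega> = \<lparr>elems = {f. square_integrable \<Omega> f}, fnorm = (\<lambda>f. sqrt (l2_inner \<Omega> f f))\<rparr>"

text \<open>The squared norm is the sum over \<open>j \<le> k\<close> of the squared \<open>L\<^sup>2\<close> norms of the
  derivative tensors of order \<open>j\<close>, that is, mixed derivatives are counted once for each order of
  differentiation.\<close>

definition sobolev :: "nat \<Rightarrow> 'a::euclidean_space set \<Rightarrow> 'a fspace" where
  "sobolev k \<Omega> = \<lparr>
     elems = {f. square_integrable \<Omega> f \<and>
       (\<forall>bs. set bs \<subseteq> Basis \<and> length bs \<le> k \<longrightarrow> (\<exists>g. is_weak_pderiv \<Omega> bs f g))},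
     fnorm = (\<lambda>f. sqrt (\<Sum>bs | set bs \<subseteq> Basis \<and> length bs \<le> k.
       (fnorm (L2_space \<Omega>) (weak_pderiv \<Omega> bs f))\<^sup>2))\<rparr>"

definition H1_0 :: "'a::euclidean_space set \<Rightarrow> 'a fspace" where
  "H1_0 \<Omega> = \<lparr>
     elems = {f \<in> elems (sobolev 1 \<Omega>).
       \<forall>\<epsilon>>0. \<exists>\<phi>\<in>test_functions \<Omega>. fnorm (sobolev 1 \<Omega>) (\<lambda>x. f x - \<phi> x) < \<epsilon>},
     fnorm = fnorm (sobolev 1 \<Omega>)\<rparr>"

definition dirichlet_form :: "'a::euclidean_space set \<Rightarrow> ('a \<Rightarrow> real) \<Rightarrow> ('a \<Rightarrow> real) \<Rightarrow> real" where
  "dirichlet_form \<Omega> f g =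
     (\<Sum>b\<in>Basis. l2_inner \<Omega> (weak_pderiv \<Omega> [b] f) (weak_pderiv \<Omega> [b] g))"

text \<open>Bounded linear functionals on \<open>H\<^sub>0\<^sup>1(\<Omega>)\<close>; the duality pairing of \<open>F\<close> and \<open>v\<close> is the
  application \<open>F v\<close>.\<close>

definition H_minus_1 :: "'a::euclidean_space set \<Rightarrow> ('a \<Rightarrow> real) fspace" where
  "H_minus_1 \<Omega> = \<lparr>
     elems = {F.
       (\<forall>v\<in>elems (H1_0 \<Omega>). \<forall>w\<in>elems (H1_0 \<Omega>). \<forall>a b.
          F (\<lambda>x. a * v x + b * w x) = a * F v + b * F w) \<and>
       (\<exists>K. \<forall>v\<in>elems (H1_0 \<Omega>). \<bar>F v\<bar> \<le> K * fnorm (H1_0 \<Omega>) v)},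
     fnorm = (\<lambda>F. SUP v\<in>{v \<in> elems (H1_0 \<Omega>). fnorm (H1_0 \<Omega>) v \<le> 1}. \<bar>F v\<bar>)\<rparr>"

text \<open>\<open>l2_inner \<Omega> f\<close>, a functional, is the image of \<open>f \<in> L\<^sup>2(\<Omega>)\<close> under the
  embedding of \<open>L\<^sup>2(\<Omega>)\<close> into the dual of \<open>H\<^sub>0\<^sup>1(\<Omega>)\<close>.\<close>

abbreviation time_measure :: "real \<Rightarrow> real measure" where
  "time_measure T \<equiv> lebesgue_on {0<..<T}"

definition simple_in :: "real \<Rightarrow> 'x fspace \<Rightarrow> (real \<Rightarrow> 'x \<Rightarrow> real) \<Rightarrow> bool" where
  "simple_in T X s \<longleftrightarrow> simple_function (time_measure T) s \<and> (\<forall>t\<in>{0<..<T}. s t \<in> elems X)"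

definition simple_integral :: "real \<Rightarrow> (real \<Rightarrow> 'x \<Rightarrow> real) \<Rightarrow> 'x \<Rightarrow> real" where
  "simple_integral T s x =
     (\<Sum>v\<in>s ` {0<..<T}. measure (time_measure T) (s -` {v} \<inter> {0<..<T}) * v x)"

definition strongly_measurable :: "real \<Rightarrow> 'x fspace \<Rightarrow> (real \<Rightarrow> 'x \<Rightarrow> real) \<Rightarrow> bool" where
  "strongly_measurable T X f \<longleftrightarrow> (AE t in time_measure T. f t \<in> elems X) \<and>
     (\<exists>s. (\<forall>n::nat. simple_in T X (s n)) \<and>
        (AE t in time_measure T. (\<lambda>n. fnorm X (\<lambda>x. f t x - s n t x)) \<longlonglongrightarrow> 0))"

text \<open>\<open>w\<close> is the Bochner integral over \<open>(0,T)\<close> of \<open>f\<close> with values in \<open>X\<close>.\<close>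

definition has_bochner_integral_in ::
  "real \<Rightarrow> 'x fspace \<Rightarrow> (real \<Rightarrow> 'x \<Rightarrow> real) \<Rightarrow> ('x \<Rightarrow> real) \<Rightarrow> bool" where
  "has_bochner_integral_in T X f w \<longleftrightarrow> w \<in> elems X \<and> strongly_measurable T X f \<and>
     (\<exists>s. (\<forall>n::nat. simple_in T X (s n)) \<and>
        (\<lambda>n. \<integral>\<^sup>+t. ennreal (fnorm X (\<lambda>x. f t x - s n t x)) \<partial>time_measure T) \<longlonglongrightarrow> 0 \<and>
        (\<lambda>n. fnorm X (\<lambda>x. simple_integral T (s n) x - w x)) \<longlonglongrightarrow> 0)"

definition L2t :: "real \<Rightarrow> 'x fspace \<Rightarrow> (real \<Rightarrow> 'x \<Rightarrow> real) set" where
  "L2t T X = {f. strongly_measurable T X f \<and> integrable (time_measure T) (\<lambda>t. (fnorm X (f t))\<^sup>2)}"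

definition L2t_norm :: "real \<Rightarrow> 'x fspace \<Rightarrow> (real \<Rightarrow> 'x \<Rightarrow> real) \<Rightarrow> real" where
  "L2t_norm T X f = sqrt (LINT t|time_measure T. (fnorm X (f t))\<^sup>2)"

definition is_time_deriv ::
  "real \<Rightarrow> 'x fspace \<Rightarrow> (real \<Rightarrow> 'x \<Rightarrow> real) \<Rightarrow> (real \<Rightarrow> 'x \<Rightarrow> real) \<Rightarrow> bool" where
  "is_time_deriv T X f g \<longleftrightarrow> f \<in> L2t T X \<and> g \<in> L2t T X \<and>
     (\<forall>\<phi>\<in>test_functions {0<..<T}. \<exists>w.
        has_bochner_integral_in T X (\<lambda>t x. deriv \<phi> t * f t x) w \<and>
        has_bochner_integral_in T X (\<lambda>t x. \<phi> t * g t x) (\<lambda>x. - w x))"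

text \<open>As in space, the choice only selects a representative.\<close>

definition time_deriv :: "real \<Rightarrow> 'x fspace \<Rightarrow> (real \<Rightarrow> 'x \<Rightarrow> real) \<Rightarrow> real \<Rightarrow> 'x \<Rightarrow> real" where
  "time_deriv T X f = (SOME g. is_time_deriv T X f g)"

definition H1t :: "real \<Rightarrow> 'x fspace \<Rightarrow> (real \<Rightarrow> 'x \<Rightarrow> real) set" where
  "H1t T X = {f \<in> L2t T X. \<exists>g. is_time_deriv T X f g}"

definition H1t_norm :: "real \<Rightarrow> 'x fspace \<Rightarrow> (real \<Rightarrow> 'x \<Rightarrow> real) \<Rightarrow> real" where
  "H1t_norm T X f = sqrt ((L2t_norm T X f)\<^sup>2 + (L2t_norm T X (time_deriv T X f))\<^sup>2)"

text \<open>The representative of \<open>f\<close> that is continuous on \<open>[0,T]\<close> with values in \<open>X\<close> exists and takes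
  the value \<open>f0\<close> at time 0.\<close>

definition has_initial_value ::
  "real \<Rightarrow> 'x fspace \<Rightarrow> (real \<Rightarrow> 'x \<Rightarrow> real) \<Rightarrow> ('x \<Rightarrow> real) \<Rightarrow> bool" where
  "has_initial_value T X f f0 \<longleftrightarrow> f0 \<in> elems X \<and> (\<exists>w.
     (\<forall>t\<in>{0..T}. w t \<in> elems X \<and>
        ((\<lambda>s. fnorm X (\<lambda>x. w s x - w t x)) \<longlongrightarrow> 0) (at t within {0..T})) \<and>
     (AE t in time_measure T. fnorm X (\<lambda>x. f t x - w t x) = 0) \<and>
     fnorm X (\<lambda>x. w 0 x - f0 x) = 0)"

definition admissible_controls ::
  "'a::euclidean_space set \<Rightarrow> real \<Rightarrow> real \<Rightarrow> ('a \<Rightarrow> real) \<Rightarrow> (real \<Rightarrow> 'a \<Rightarrow> real) set" where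
  "admissible_controls \<Omega> T M ubar = {u \<in> H1t T (sobolev 1 \<Omega>).
     H1t_norm T (sobolev 1 \<Omega>) u \<le> M \<and> has_initial_value T (sobolev 1 \<Omega>) u ubar}"

definition W_space :: "'a::euclidean_space set \<Rightarrow> real \<Rightarrow> (real \<Rightarrow> 'a \<Rightarrow> real) set" where
  "W_space \<Omega> T = {y \<in> L2t T (H1_0 \<Omega>). \<exists>y'. is_time_deriv T (L2_space \<Omega>) y y'}"

abbreviation first_deriv :: "'a::euclidean_space set \<Rightarrow> real \<Rightarrow> (real \<Rightarrow> 'a \<Rightarrow> real) \<Rightarrow> real \<Rightarrow> 'a \<Rightarrow> real"
  where "first_deriv \<Omega> T y \<equiv> time_deriv T (L2_space \<Omega>) y"

definition Y_space :: "'a::euclidean_space set \<Rightarrow> real \<Rightarrow> (real \<Rightarrow> 'a \<Rightarrow> real) set" where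
  "Y_space \<Omega> T = {y \<in> L2t T (H1_0 \<Omega>). (\<exists>y'. is_time_deriv T (L2_space \<Omega>) y y') \<and>
     (\<exists>y''. is_time_deriv T (H_minus_1 \<Omega>) (\<lambda>t. l2_inner \<Omega> (first_deriv \<Omega> T y t)) y'')}"

abbreviation second_deriv ::
  "'a::euclidean_space set \<Rightarrow> real \<Rightarrow> (real \<Rightarrow> 'a \<Rightarrow> real) \<Rightarrow> real \<Rightarrow> ('a \<Rightarrow> real) \<Rightarrow> real"
  where "second_deriv \<Omega> T y \<equiv>
    time_deriv T (H_minus_1 \<Omega>) (\<lambda>t. l2_inner \<Omega> (first_deriv \<Omega> T y t))"

text \<open>The initial value of the first derivative is taken in the dual of \<open>H\<^sub>0\<^sup>1(\<Omega>)\<close>, where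
  membership in \<open>Y_space\<close> provides a continuous representative.\<close>

definition cattaneo_weak_solution ::
  "'a::euclidean_space set \<Rightarrow> real \<Rightarrow> real \<Rightarrow> (real \<Rightarrow> 'a \<Rightarrow> real) \<Rightarrow> ('a \<Rightarrow> real) \<Rightarrow> ('a \<Rightarrow> real)
    \<Rightarrow> (real \<Rightarrow> 'a \<Rightarrow> real) \<Rightarrow> bool" where
  "cattaneo_weak_solution \<Omega> T \<tau> u y0 y1 y \<longleftrightarrow> y \<in> Y_space \<Omega> T \<and>
     has_initial_value T (L2_space \<Omega>) y y0 \<and>
     has_initial_value T (H_minus_1 \<Omega>) (\<lambda>t. l2_inner \<Omega> (first_deriv \<Omega> T y t)) (l2_inner \<Omega> y1) \<and>
     (\<forall>v\<in>L2t T (H1_0 \<Omega>).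
        (LINT t|time_measure T. \<tau> * second_deriv \<Omega> T y t (v t)
           + l2_inner \<Omega> (first_deriv \<Omega> T y t) (v t) + dirichlet_form \<Omega> (y t) (v t)) =
        (LINT t|time_measure T. l2_inner \<Omega> (u t) (v t)))"

definition heat_weak_solution ::
  "'a::euclidean_space set \<Rightarrow> real \<Rightarrow> (real \<Rightarrow> 'a \<Rightarrow> real) \<Rightarrow> ('a \<Rightarrow> real)
    \<Rightarrow> (real \<Rightarrow> 'a \<Rightarrow> real) \<Rightarrow> bool" where
  "heat_weak_solution \<Omega> T u y0 y \<longleftrightarrow> y \<in> W_space \<Omega> T \<and>
     has_initial_value T (L2_space \<Omega>) y y0 \<and>
     (\<forall>v\<in>L2t T (H1_0 \<Omega>).
        (LINT t|time_measure T.
           l2_inner \<Omega> (first_deriv \<Omega> T y t) (v t) + dirichlet_form \<Omega> (y t) (v t)) =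
        (LINT t|time_measure T. l2_inner \<Omega> (u t) (v t)))"

end

theory Submission
  imports Defs
begin

text \<open>Write \<open>y\<close> for the solution of the heat equation, \<open>y\<^sub>\<tau>\<close> for the solution of the Cattaneo equation and
  \<open>e = y\<^sub>\<tau> - y\<close>.  The error \<open>e\<close> starts at 0 and solves the heat equation \<open>e' - \<Delta> e = (u\<^sub>\<tau> - u) - \<tau> y\<^sub>\<tau>''\<close>.
  Testing with \<open>e\<close> itself bounds \<open>e\<close> by a constant times \<open>\<parallel>u\<^sub>\<tau> - u\<parallel> + \<tau> \<parallel>y\<^sub>\<tau>''\<parallel>\<close>, with norms in
  \<open>L\<^sup>2(0,T;L\<^sup>2)\<close> (\<open>parabolic_estimate\<close>).  Indeed, the
  square of \<open>\<parallel>e(t)\<parallel>\<close> is at most twice the work of the load, hence at most \<open>2 D \<parallel>e\<parallel>\<close> with \<open>D\<close> the norm of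
  the load; integration over \<open>t\<close> gives \<open>\<parallel>e\<parallel> \<le> 2 T D\<close>, and the Dirichlet part of the norm follows.

  It remains to bound \<open>y\<^sub>\<tau>''\<close> in \<open>L\<^sup>2(0,T;L\<^sup>2)\<close> uniformly in \<open>\<tau>\<close>, although a priori it only has values in
  the dual space.  Formally, the differentiated equation \<open>\<tau> y\<^sub>\<tau>''' + y\<^sub>\<tau>'' - \<Delta> y\<^sub>\<tau>' = u\<^sub>\<tau>'\<close> is tested with
  \<open>y\<^sub>\<tau>''\<close>; the compatibility condition \<open>y\<^sub>1 = \<Delta> y\<^sub>0 + u\<^sub>\<tau>(0)\<close> says that \<open>y\<^sub>\<tau>''(0) = 0\<close>, so that the inertia
  term is nonnegative and its factor \<open>\<tau>\<close> does no harm.  To make this rigorous, the displacement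
  \<open>z = y\<^sub>\<tau> - y\<^sub>0 - t y\<^sub>1\<close> is extended by 0 to negative times.  It satisfies a causal equation, obtained by
  integrating the Cattaneo equation in time, whose backward second difference quotient of step \<open>\<epsilon>\<close> is an
  equation for \<open>\<xi>\<close>, the difference quotient of \<open>z\<close>.  Since \<open>\<xi>\<close> has values in \<open>H\<^sub>0\<^sup>1\<close>, it is an admissible test
  function.  In the resulting identity the inertia and elastic terms have the form \<open>\<integral>\<integral> B (f t) (f s)\<close> with a
  positive semidefinite \<open>B\<close>, which is formally \<open>B (\<integral>f) (\<integral>f)\<close> and thus nonnegative
  (\<open>double_integral_nonneg\<close>).  The work of the control is absorbed by Young's inequality, and the work of the
  force exerted by \<open>y\<^sub>1\<close> by the supremum in time of the elastic term.  The bound for \<open>\<xi>\<close> does not depend on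
  \<open>\<epsilon>\<close> or \<open>\<tau>\<close> (\<open>dissipation_bound\<close>), and letting \<open>\<epsilon>\<close> tend to 0 against step functions transfers it to
  \<open>y\<^sub>\<tau>''\<close> (\<open>acceleration_bound\<close>).

  The constants are expressed by the data as follows.  The Dirichlet norm of \<open>y\<^sub>1\<close> is bounded by the \<open>H\<^sup>3\<close>
  norm of \<open>y\<^sub>0\<close> and the \<open>H\<^sup>1\<close> norm of the initial control (\<open>dirichlet_norm_laplacian_le\<close>), and the latter by
  the norm of \<open>u\<^sub>\<tau>\<close> in \<open>H\<^sup>1(0,T;H\<^sup>1)\<close> (\<open>initial_value_le_H1t_norm\<close>).

  All statements about functions of time with values in a function space are reduced to scalar functions of
  time.  Elements of \<open>L\<^sup>2(0,T;X)\<close> are replaced by Borel representatives on the whole line that vanish outside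
  \<open>(0,T)\<close> (\<open>L2_representative\<close>), and weak time derivatives with initial values by the identity
  \<open>F (f t) = F f\<^sub>0 + \<integral>\<^sub>0\<^sup>t F (f' r) dr\<close> for bounded functionals \<open>F\<close> (\<open>initial_value_representatives\<close>), which
  is the lemma of du Bois-Reymond applied to \<open>F\<close> of the continuous representative.\<close>

section \<open>Smooth bump functions\<close>

definition smooth :: "(real \<Rightarrow> real) \<Rightarrow> bool" where
  "smooth f \<longleftrightarrow> (\<forall>k x. (deriv ^^ k) f differentiable (at x))"

text \<open>Smoothness proofs exhibit a class of differentiable functions that is closed under differentiation.\<close>

lemma smooth_coinduct:
  assumes "P f"
    and step: "\<And>g. P g \<Longrightarrow> (\<forall>x. g differentiable (at x)) \<and> P (deriv g)"
  shows "smooth f"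
proof -
  have "P ((deriv ^^ k) f)" for k
    by (induction k) (use assms in auto)
  then show ?thesis
    using step unfolding smooth_def by blast
qed

lemma smooth_deriv: "smooth f \<Longrightarrow> smooth (deriv f)"
  unfolding smooth_def by (metis funpow_Suc_right comp_apply)

lemma smooth_DERIV: "smooth f \<Longrightarrow> (f has_real_derivative deriv f x) (at x)"
  unfolding smooth_def by (metis DERIV_deriv_iff_real_differentiable funpow_0)

lemma smooth_differentiable: "smooth f \<Longrightarrow> f differentiable (at x)"
  unfolding smooth_def by (metis funpow_0)

lemma smooth_mult:
  assumes "smooth f" "smooth g"
  shows "smooth (\<lambda>x. f x * g x)"
proof -
  \<comment> \<open>By the product rule, finite sums of products of smooth functions are closed under differentiation.\<close>
  define P where "P h \<longleftrightarrow> (\<exists>L. (\<forall>(f,g)\<in>set L. smooth f \<and> smooth g) \<and>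
     h = (\<lambda>x. \<Sum>(f,g)\<leftarrow>L. f x * g x))" for h :: "real \<Rightarrow> real"
  show ?thesis
  proof (rule smooth_coinduct[of P])
    show "P (\<lambda>x. f x * g x)"
      unfolding P_def by (rule exI[of _ "[(f,g)]"]) (use assms in auto)
    fix h assume "P h"
    then obtain L where L: "\<forall>(f,g)\<in>set L. smooth f \<and> smooth g"
      and h: "h = (\<lambda>x. \<Sum>(f,g)\<leftarrow>L. f x * g x)"
      unfolding P_def by blast
    define L' where "L' = concat (map (\<lambda>(f,g). [(deriv f, g), (f, deriv g)]) L)"
    have D: "((\<lambda>x. \<Sum>(f,g)\<leftarrow>L. f x * g x) has_real_derivative
        (\<Sum>(f,g)\<leftarrow>concat (map (\<lambda>(f,g). [(deriv f, g), (f, deriv g)]) L). f x * g x)) (at x)" for x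
      using L
    proof (induction L)
      case (Cons p L)
      obtain f g where p: "p = (f,g)" by force
      have "smooth f" "smooth g" using Cons.prems p by auto
      then have "((\<lambda>x. f x * g x) has_real_derivative deriv f x * g x + f x * deriv g x) (at x)"
        by (auto intro!: derivative_eq_intros smooth_DERIV)
      moreover have "((\<lambda>x. \<Sum>(f,g)\<leftarrow>L. f x * g x) has_real_derivative
        (\<Sum>(f,g)\<leftarrow>concat (map (\<lambda>(f,g). [(deriv f, g), (f, deriv g)]) L). f x * g x)) (at x)"
        using Cons by auto
      ultimately have "((\<lambda>x. f x * g x + (\<Sum>(f,g)\<leftarrow>L. f x * g x)) has_real_derivative
         (deriv f x * g x + f x * deriv g x) +
         (\<Sum>(f,g)\<leftarrow>concat (map (\<lambda>(f,g). [(deriv f, g), (f, deriv g)]) L). f x * g x)) (at x)"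
        by (rule DERIV_add)
      then show ?case by (simp add: p add.assoc)
    qed simp
    have "deriv h = (\<lambda>x. \<Sum>(f,g)\<leftarrow>L'. f x * g x)"
      unfolding h L'_def by (rule ext, rule DERIV_imp_deriv, rule D)
    moreover have "\<forall>(f,g)\<in>set L'. smooth f \<and> smooth g"
      using L by (auto simp: L'_def intro: smooth_deriv)
    ultimately have "P (deriv h)" unfolding P_def by blast
    moreover have "\<forall>x. h differentiable (at x)"
      unfolding h using D real_differentiable_def by blast
    ultimately show "(\<forall>x. h differentiable (at x)) \<and> P (deriv h)" by blast
  qed
qed

lemma smooth_affine:
  assumes "smooth f"
  shows "smooth (\<lambda>x. f (c * x + d))"
proof -
  define P where "P h \<longleftrightarrow> (\<exists>g k. smooth g \<and> h = (\<lambda>x. k * g (c * x + d)))" for h :: "real \<Rightarrow> real"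
  show ?thesis
  proof (rule smooth_coinduct[of P])
    show "P (\<lambda>x. f (c * x + d))"
      unfolding P_def by (rule exI[of _ f], rule exI[of _ 1]) (use assms in auto)
    fix h assume "P h"
    then obtain g k where g: "smooth g" and h: "h = (\<lambda>x. k * g (c * x + d))"
      unfolding P_def by blast
    have D: "(h has_real_derivative k * c * deriv g (c * x + d)) (at x)" for x
      unfolding h
      by (auto intro!: derivative_eq_intros DERIV_chain2[OF smooth_DERIV[OF g]])
    have "deriv h = (\<lambda>x. (k * c) * deriv g (c * x + d))"
      by (rule ext, rule DERIV_imp_deriv, rule D)
    then have "P (deriv h)" unfolding P_def using smooth_deriv[OF g] by blast
    moreover have "\<forall>x. h differentiable (at x)"
      using D real_differentiable_def by blast
    ultimately show "(\<forall>x. h differentiable (at x)) \<and> P (deriv h)" by blast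
  qed
qed

text \<open>The derivative of \<open>exp (- 1/x)\<close>, extended by 0, is not of the same form; with a polynomial in
  \<open>1/x\<close> as an additional factor, the family is closed under differentiation.\<close>

definition flat :: "real poly \<Rightarrow> real \<Rightarrow> real" where
  "flat p x = (if x > 0 then poly p (1 / x) * exp (- (1 / x)) else 0)"

lemma flat_tendsto_0: "(flat p \<longlongrightarrow> 0) (at 0)"
proof -
  have "((\<lambda>t. poly p t * exp (- t)) \<longlongrightarrow> 0) at_top"
  proof -
    have "((\<lambda>t. \<Sum>i\<le>degree p. coeff p i * (t ^ i / exp t)) \<longlongrightarrow> (\<Sum>i\<le>degree p. coeff p i * 0)) at_top"
      by (intro tendsto_intros tendsto_power_div_exp_0)
    then show ?thesis
      by (simp add: poly_altdef sum_distrib_right exp_minus divide_inverse mult.assoc)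
  qed
  then have "((\<lambda>x. poly p (1/x) * exp (- (1/x))) \<longlongrightarrow> 0) (at_right 0)"
    by (rule filterlim_compose) (simp add: inverse_eq_divide[symmetric] filterlim_inverse_at_top_right)
  then have "(flat p \<longlongrightarrow> 0) (at_right 0)"
    by (rule Lim_transform_eventually)
       (auto simp: flat_def eventually_at_filter)
  moreover have "(flat p \<longlongrightarrow> 0) (at_left 0)"
    by (rule Lim_transform_eventually[of "\<lambda>_. 0"]) (auto simp: flat_def eventually_at_filter)
  ultimately show ?thesis
    by (simp add: filterlim_at_split)
qed

lemma flat_DERIV:
  "(flat p has_real_derivative flat ((p - Polynomial.pderiv p) * [:0,0,1:]) x) (at x)"
proof -
  consider "x > 0" | "x < 0" | "x = 0" by linarith
  then show ?thesis
  proof cases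
    case 1
    have "((\<lambda>x. poly p (1/x) * exp (- (1/x))) has_real_derivative
       flat ((p - Polynomial.pderiv p) * [:0,0,1:]) x) (at x)"
      using 1 by (auto intro!: derivative_eq_intros DERIV_chain2[OF poly_DERIV]
        simp: flat_def field_simps power2_eq_square)
    then show ?thesis
      by (rule has_field_derivative_transform_within_open[of _ _ _ "{0<..}"]) (use 1 in \<open>auto simp: flat_def\<close>)
  next
    case 2
    have "((\<lambda>x. 0) has_real_derivative
       flat ((p - Polynomial.pderiv p) * [:0,0,1:]) x) (at x)"
      using 2 by (simp add: flat_def)
    then show ?thesis
      by (rule has_field_derivative_transform_within_open[of _ _ _ "{..<0}"]) (use 2 in \<open>auto simp: flat_def\<close>)
  next
    case 3
    \<comment> \<open>The difference quotient at 0 belongs to the same family, with \<open>p\<close> multiplied by its argument.\<close>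
    have "((\<lambda>y. (flat p y - flat p 0) / (y - 0)) \<longlongrightarrow> 0) (at 0)"
      by (rule Lim_transform_eventually[OF flat_tendsto_0[of "p * [:0,1:]"]])
         (auto simp: flat_def eventually_at_filter)
    then show ?thesis using 3
      by (simp add: has_field_derivative_iff flat_def)
  qed
qed

lemma smooth_flat: "smooth (flat p)"
proof (rule smooth_coinduct[of "\<lambda>f. \<exists>p. f = flat p"])
  fix g assume "\<exists>p. g = flat p"
  then obtain p where g: "g = flat p" by blast
  have "deriv g = flat ((p - Polynomial.pderiv p) * [:0,0,1:])"
    unfolding g by (rule ext, rule DERIV_imp_deriv, rule flat_DERIV)
  then show "(\<forall>x. g differentiable (at x)) \<and> (\<exists>p. deriv g = flat p)"
    using flat_DERIV g real_differentiable_def by blast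
qed blast

abbreviation ramp :: "real \<Rightarrow> real" where "ramp \<equiv> flat 1"

lemma ramp_bounds: "0 \<le> ramp x" "ramp x \<le> 1"
  by (auto simp: flat_def)

lemma ramp_eq_0_iff: "ramp x = 0 \<longleftrightarrow> x \<le> 0"
  by (auto simp: flat_def)

lemma ramp_tendsto:
  "(\<lambda>n. ramp (real (Suc n) * x)) \<longlonglongrightarrow> (if x > 0 then 1 else 0)"
proof (cases "x > 0")
  case True
  have "(\<lambda>n. exp (- (1/x) * (1 / real (Suc n)))) \<longlonglongrightarrow> exp (- (1/x) * 0)"
    by (intro tendsto_intros LIMSEQ_Suc[OF lim_1_over_n])
  then show ?thesis using True
    by (simp add: flat_def zero_less_mult_iff mult.commute)
next
  case False
  then have "ramp (real (Suc n) * x) = 0" for n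
    by (simp add: ramp_eq_0_iff mult_nonneg_nonpos)
  then show ?thesis using False by simp
qed

definition basis_product :: "('a::euclidean_space \<Rightarrow> real \<Rightarrow> real) \<Rightarrow> 'a \<Rightarrow> real" where
  "basis_product h x = (\<Prod>b\<in>Basis. h b (x \<bullet> b))"

text \<open>Differentiation acts on a single factor, so that products of smooth functions of the coordinates stay
  products of this kind.\<close>

lemma pderiv_basis_product:
  fixes h :: "'a::euclidean_space \<Rightarrow> real \<Rightarrow> real"
  assumes "\<And>c. smooth (h c)" "b \<in> Basis"
  shows "pderiv b (basis_product h) = basis_product (h(b := deriv (h b)))"
proof
  fix x :: 'a
  have split: "basis_product g y = g b (y \<bullet> b) * (\<Prod>c\<in>Basis - {b}. g c (y \<bullet> c))" for g y
    unfolding basis_product_def by (rule prod.remove) (use assms in auto)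
  have "basis_product h (x + s *\<^sub>R b) = h b (x \<bullet> b + s) * (\<Prod>c\<in>Basis - {b}. h c (x \<bullet> c))" for s
    unfolding split using \<open>b \<in> Basis\<close>
    by (auto simp: inner_simps inner_Basis intro!: arg_cong2[where f=times] prod.cong split: if_splits)
  moreover have "((\<lambda>s. h b (x \<bullet> b + s) * (\<Prod>c\<in>Basis - {b}. h c (x \<bullet> c))) has_real_derivative
     deriv (h b) (x \<bullet> b) * (\<Prod>c\<in>Basis - {b}. h c (x \<bullet> c))) (at 0)"
  proof (rule DERIV_cmult_right)
    have "((\<lambda>s. x \<bullet> b + s) has_real_derivative 1) (at 0)"
      by (auto intro!: derivative_eq_intros)
    then show "((\<lambda>s. h b (x \<bullet> b + s)) has_real_derivative deriv (h b) (x \<bullet> b)) (at 0)"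
      using DERIV_chain2[of "h b" "deriv (h b) (x \<bullet> b)" "\<lambda>s. x \<bullet> b + s" 0 1 UNIV]
        smooth_DERIV[OF assms(1), of b "x \<bullet> b"] by simp
  qed
  ultimately have "pderiv b (basis_product h) x
      = deriv (h b) (x \<bullet> b) * (\<Prod>c\<in>Basis - {b}. h c (x \<bullet> c))"
    unfolding pderiv_def by (simp add: DERIV_imp_deriv)
  then show "pderiv b (basis_product h) x = basis_product (h(b := deriv (h b))) x"
    unfolding split[of "h(b := deriv (h b))"] by simp
qed

lemma basis_product_differentiable:
  fixes h :: "'a::euclidean_space \<Rightarrow> real \<Rightarrow> real"
  assumes "\<And>c. smooth (h c)"
  shows "basis_product h differentiable (at x)"
proof -
  have "\<exists>f'. ((\<lambda>x. h b (x \<bullet> b)) has_derivative f') (at x)" for b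
    using differentiable_chain_at[of "\<lambda>x. x \<bullet> b" x "h b"] smooth_differentiable[OF assms]
    by (auto simp: o_def differentiable_def intro: bounded_linear_imp_has_derivative bounded_linear_inner_left)
  then obtain f' where "\<And>b. ((\<lambda>x. h b (x \<bullet> b)) has_derivative f' b) (at x)"
    by metis
  then show ?thesis
    unfolding basis_product_def[abs_def] differentiable_def
    using has_derivative_prod[of Basis "\<lambda>b x. h b (x \<bullet> b)" f' x UNIV] by blast
qed

lemma iter_pderiv_basis_product:
  fixes h :: "'a::euclidean_space \<Rightarrow> real \<Rightarrow> real"
  assumes "\<And>c. smooth (h c)" "set bs \<subseteq> Basis"
  shows "\<exists>g. (\<forall>c. smooth (g c)) \<and> iter_pderiv bs (basis_product h) = basis_product g"
  using assms(2)
proof (induction bs)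
  case Nil
  then show ?case using assms(1) by (auto simp: iter_pderiv_def)
next
  case (Cons b bs)
  then obtain g where g: "\<And>c. smooth (g c)" "iter_pderiv bs (basis_product h) = basis_product g"
    by auto
  have "iter_pderiv (b # bs) (basis_product h) = basis_product (g(b := deriv (g b)))"
    using g Cons.prems pderiv_basis_product[of g b] by (simp add: iter_pderiv_def)
  moreover have "\<forall>c. smooth ((g(b := deriv (g b))) c)"
    using g smooth_deriv by simp
  ultimately show ?case by blast
qed

text \<open>The factors are positive exactly inside the edges of the box and tend to 1 there as the slope \<open>n + 1\<close>
  grows, so that the bumps increase to the indicator of the open box.\<close>

definition box_bump :: "'a::euclidean_space \<Rightarrow> 'a \<Rightarrow> nat \<Rightarrow> 'a \<Rightarrow> real" where
  "box_bump a c n =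
     basis_product (\<lambda>b s. ramp (real (Suc n) * (s - a \<bullet> b)) * ramp (real (Suc n) * (c \<bullet> b - s)))"

lemma box_bump_factor_smooth:
  "smooth (\<lambda>s. ramp (real (Suc n) * (s - \<alpha>)) * ramp (real (Suc n) * (\<gamma> - s)))"
proof (rule smooth_mult)
  show "smooth (\<lambda>s. ramp (real (Suc n) * (s - \<alpha>)))"
    using smooth_affine[OF smooth_flat[of 1], of "real (Suc n)" "- real (Suc n) * \<alpha>"]
    by (simp add: algebra_simps)
  show "smooth (\<lambda>s. ramp (real (Suc n) * (\<gamma> - s)))"
    using smooth_affine[OF smooth_flat[of 1], of "- real (Suc n)" "real (Suc n) * \<gamma>"]
    by (simp add: algebra_simps)
qed

lemma box_bump_support: "box_bump a c n x \<noteq> 0 \<longleftrightarrow> x \<in> box a c"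
  by (auto simp: box_bump_def basis_product_def ramp_eq_0_iff mem_box mult_le_0_iff not_le)

lemma box_bump_bounds: "0 \<le> box_bump a c n x" "box_bump a c n x \<le> 1"
  unfolding box_bump_def basis_product_def
  by (auto intro!: prod_nonneg prod_le_1 mult_le_one simp: ramp_bounds)

lemma box_bump_tendsto: "(\<lambda>n. box_bump a c n x) \<longlonglongrightarrow> indicator (box a c) x"
proof -
  have "(\<lambda>n. box_bump a c n x) \<longlonglongrightarrow>
      (\<Prod>b\<in>Basis. (if x \<bullet> b - a \<bullet> b > 0 then 1 else 0) * (if c \<bullet> b - x \<bullet> b > 0 then 1 else 0))"
    unfolding box_bump_def basis_product_def
    by (intro tendsto_prod tendsto_mult ramp_tendsto)
  also have "(\<Prod>b\<in>Basis. (if x \<bullet> b - a \<bullet> b > 0 then 1 else 0) * (if c \<bullet> b - x \<bullet> b > 0 then 1 else 0))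
      = (indicator (box a c) x :: real)"
    by (auto simp: mem_box indicator_def intro!: prod.neutral)
  finally show ?thesis .
qed

lemma box_bump_test:
  assumes "cbox a c \<subseteq> \<Omega>"
  shows "box_bump a c n \<in> test_functions \<Omega>"
proof -
  have "{x. box_bump a c n x \<noteq> 0} = box a c"
    using box_bump_support by blast
  moreover have "closure (box a c) \<subseteq> cbox a c"
    by (simp add: box_subset_cbox closed_cbox closure_minimal)
  moreover have "iter_pderiv bs (box_bump a c n) differentiable at x" if bs: "set bs \<subseteq> Basis" for bs x
  proof -
    obtain g where "\<forall>c. smooth (g c)" "iter_pderiv bs (box_bump a c n) = basis_product g"
      using iter_pderiv_basis_product[where bs = bs and h = "\<lambda>b s. ramp (real (Suc n) * (s - a \<bullet> b)) *
          ramp (real (Suc n) * (c \<bullet> b - s))"] box_bump_factor_smooth bs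
      unfolding box_bump_def by blast
    then show ?thesis using basis_product_differentiable by auto
  qed
  moreover have "compact (closure (box a c))"
    using bounded_box[of a c] by (simp only: compact_closure)
  ultimately show ?thesis
    using assms unfolding test_functions_def by auto
qed

section \<open>Calculus of test functions\<close>

lemma test_differentiable:
  "\<phi> \<in> test_functions \<Omega> \<Longrightarrow> set bs \<subseteq> Basis \<Longrightarrow> iter_pderiv bs \<phi> differentiable (at x)"
  by (auto simp: test_functions_def)

lemma directional_DERIV:
  assumes "f differentiable (at (x + s *\<^sub>R b))"
  shows "((\<lambda>s. f (x + s *\<^sub>R b)) has_real_derivative pderiv b f (x + s *\<^sub>R b)) (at s)"
proof -
  obtain f' where f': "(f has_derivative f') (at (x + s *\<^sub>R b))"
    using assms differentiable_def by blast
  then interpret f': bounded_linear f' by (rule has_derivative_bounded_linear)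
  have *: "((\<lambda>r. f (y + r *\<^sub>R b)) has_real_derivative f' b) (at r)"
    if "y + r *\<^sub>R b = x + s *\<^sub>R b" for y r
  proof -
    have "((\<lambda>r. y + r *\<^sub>R b) has_derivative (\<lambda>h. h *\<^sub>R b)) (at r)"
      by (auto intro!: derivative_eq_intros)
    then have "((\<lambda>r. f (y + r *\<^sub>R b)) has_derivative (\<lambda>h. f' (h *\<^sub>R b))) (at r)"
      using has_derivative_compose[of "\<lambda>r. y + r *\<^sub>R b" _ r UNIV f f'] f' that by simp
    then show ?thesis
      by (simp add: has_field_derivative_def f'.scaleR mult.commute[of "f' b"] mult_commute_abs)
  qed
  have "pderiv b f (x + s *\<^sub>R b) = f' b"
    unfolding pderiv_def by (rule DERIV_imp_deriv, rule *) simp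
  then show ?thesis using *[of x s] by simp
qed

lemma pderiv_DERIV_0:
  "f differentiable (at x) \<Longrightarrow> ((\<lambda>s. f (x + s *\<^sub>R b)) has_real_derivative pderiv b f x) (at 0)"
  using directional_DERIV[of f x 0 b] by simp

lemma pderiv_lincomb:
  assumes "f differentiable (at x)" "g differentiable (at x)"
  shows "pderiv b (\<lambda>x. \<alpha> * f x + \<beta> * g x) x = \<alpha> * pderiv b f x + \<beta> * pderiv b g x"
  unfolding pderiv_def[of b "\<lambda>x. \<alpha> * f x + \<beta> * g x"]
  by (rule DERIV_imp_deriv)
     (auto intro!: derivative_eq_intros pderiv_DERIV_0 assms)

lemma iter_pderiv_lincomb:
  assumes "f \<in> test_functions \<Omega>" "g \<in> test_functions \<Omega>" "set bs \<subseteq> Basis"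
  shows "iter_pderiv bs (\<lambda>x. \<alpha> * f x + \<beta> * g x)
    = (\<lambda>x. \<alpha> * iter_pderiv bs f x + \<beta> * iter_pderiv bs g x)"
  using assms(3)
proof (induction bs)
  case (Cons b bs)
  then have "iter_pderiv bs f differentiable (at x)" "iter_pderiv bs g differentiable (at x)" for x
    using test_differentiable assms by auto
  with Cons show ?case
    by (simp add: iter_pderiv_def pderiv_lincomb)
qed (simp add: iter_pderiv_def)

lemma compact_support_subset:
  fixes f :: "'a::euclidean_space \<Rightarrow> real"
  assumes "compact K" "{x. f x \<noteq> 0} \<subseteq> K"
  shows "compact (closure {x. f x \<noteq> 0})" "closure {x. f x \<noteq> 0} \<subseteq> K"
proof -
  show *: "closure {x. f x \<noteq> 0} \<subseteq> K"
    using assms by (simp add: closure_minimal compact_imp_closed)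
  show "compact (closure {x. f x \<noteq> 0})"
    using assms by (meson bounded_subset compact_closure compact_imp_bounded)
qed

lemma test_lincomb:
  assumes "f \<in> test_functions \<Omega>" "g \<in> test_functions \<Omega>"
  shows "(\<lambda>x. \<alpha> * f x + \<beta> * g x) \<in> test_functions \<Omega>"
proof -
  let ?K = "closure {x. f x \<noteq> 0} \<union> closure {x. g x \<noteq> 0}"
  have K: "compact ?K" "?K \<subseteq> \<Omega>"
    using assms by (auto simp: test_functions_def)
  have "{x. \<alpha> * f x + \<beta> * g x \<noteq> 0} \<subseteq> {x. f x \<noteq> 0} \<union> {x. g x \<noteq> 0}"
    by auto
  also have "\<dots> \<subseteq> ?K"
    by (intro Un_mono closure_subset)
  finally have S: "{x. \<alpha> * f x + \<beta> * g x \<noteq> 0} \<subseteq> ?K" .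
  have "iter_pderiv bs (\<lambda>x. \<alpha> * f x + \<beta> * g x) differentiable (at x)" if "set bs \<subseteq> Basis" for bs x
    unfolding iter_pderiv_lincomb[OF assms that]
    using test_differentiable[OF assms(1) that] test_differentiable[OF assms(2) that]
    by (intro differentiable_add differentiable_mult differentiable_const)
  then show ?thesis
    using compact_support_subset[OF K(1) S] K(2) unfolding test_functions_def by auto
qed

lemma iter_pderiv_append: "iter_pderiv (bs @ cs) f = iter_pderiv bs (iter_pderiv cs f)"
  by (simp add: iter_pderiv_def)

lemma iter_pderiv_Cons: "iter_pderiv (b # bs) f = pderiv b (iter_pderiv bs f)"
  by (simp add: iter_pderiv_def)

lemma iter_pderiv_Nil [simp]: "iter_pderiv [] f = f"
  by (simp add: iter_pderiv_def)

lemma pderiv_support: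
  assumes "pderiv b f x \<noteq> 0" shows "x \<in> closure {x. f x \<noteq> 0}"
proof (rule ccontr)
  assume x: "x \<notin> closure {x. f x \<noteq> 0}"
  define U where "U = - closure {x. f x \<noteq> 0}"
  have U: "open U" "x \<in> U" "\<And>y. y \<in> U \<Longrightarrow> f y = 0"
    using x closure_subset[of "{x. f x \<noteq> 0}"] unfolding U_def by auto
  have "((\<lambda>s. x + s *\<^sub>R b) \<longlongrightarrow> x + 0 *\<^sub>R b) (nhds 0)"
    by (intro tendsto_intros filterlim_ident)
  then have "\<forall>\<^sub>F s in nhds 0. x + s *\<^sub>R b \<in> U"
    using U topological_tendstoD by fastforce
  then have "\<forall>\<^sub>F s in nhds 0. f (x + s *\<^sub>R b) = (\<lambda>_. 0) s"
    using U(3) by (auto elim: eventually_mono)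
  then have "pderiv b f x = deriv (\<lambda>_. 0) (0::real)"
    unfolding pderiv_def by (rule deriv_cong_ev) simp
  then show False using assms by simp
qed

lemma test_pderiv:
  assumes "f \<in> test_functions \<Omega>" "b \<in> Basis"
  shows "pderiv b f \<in> test_functions \<Omega>"
proof -
  have "iter_pderiv bs (pderiv b f) differentiable (at x)" if "set bs \<subseteq> Basis" for bs x
    using test_differentiable[OF assms(1), of "bs @ [b]"] assms(2) that
    by (simp add: iter_pderiv_append iter_pderiv_Cons)
  moreover have "compact (closure {x. f x \<noteq> 0})" "closure {x. f x \<noteq> 0} \<subseteq> \<Omega>"
    using assms by (auto simp: test_functions_def)
  moreover have "{x. pderiv b f x \<noteq> 0} \<subseteq> closure {x. f x \<noteq> 0}"
    using pderiv_support by blast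
  ultimately show ?thesis
    using compact_support_subset[of "closure {x. f x \<noteq> 0}" "pderiv b f"]
    unfolding test_functions_def by auto
qed

lemma test_iter_pderiv:
  "f \<in> test_functions \<Omega> \<Longrightarrow> set bs \<subseteq> Basis \<Longrightarrow> iter_pderiv bs f \<in> test_functions \<Omega>"
  by (induction bs) (auto simp: iter_pderiv_Cons intro: test_pderiv)

lemma test_continuous: "f \<in> test_functions \<Omega> \<Longrightarrow> continuous_on S f"
  using test_differentiable[of f \<Omega> "[]"]
  by (auto intro: continuous_at_imp_continuous_on differentiable_imp_continuous_within)

lemma test_zero_outside: "f \<in> test_functions \<Omega> \<Longrightarrow> x \<notin> \<Omega> \<Longrightarrow> f x = 0"
  using closure_subset[of "{x. f x \<noteq> 0}"] by (auto simp: test_functions_def)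

lemma continuous_compact_support_bounded:
  fixes f :: "'a::euclidean_space \<Rightarrow> real"
  assumes "continuous_on UNIV f" "compact (closure {x. f x \<noteq> 0})"
  obtains B where "\<And>x. \<bar>f x\<bar> \<le> B" "B \<ge> 0"
proof -
  have "bounded (f ` closure {x. f x \<noteq> 0})"
    using assms by (meson compact_continuous_image compact_imp_bounded continuous_on_subset subset_UNIV)
  then obtain B where B: "\<And>x. x \<in> closure {x. f x \<noteq> 0} \<Longrightarrow> \<bar>f x\<bar> \<le> B"
    by (auto simp: bounded_iff)
  have "\<bar>f x\<bar> \<le> max B 0" for x
    using B[of x] closure_subset[of "{x. f x \<noteq> 0}"] by (cases "f x = 0") force+
  then show ?thesis using that[of "max B 0"] by simp
qed

lemma test_bounded:
  assumes "f \<in> test_functions \<Omega>"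
  obtains B where "\<And>x. \<bar>f x\<bar> \<le> B" "B \<ge> 0"
  using continuous_compact_support_bounded[OF test_continuous[OF assms]] assms
  unfolding test_functions_def by blast

lemma continuous_compact_support_integrable:
  fixes f :: "'a::euclidean_space \<Rightarrow> real"
  assumes "continuous_on UNIV f" "compact (closure {x. f x \<noteq> 0})"
  shows "integrable lborel f"
proof -
  let ?K = "closure {x. f x \<noteq> 0}"
  have "set_integrable lborel ?K f"
    unfolding set_integrable_def
    using assms by (intro borel_integrable_compact) (auto intro: continuous_on_subset)
  moreover have "(\<lambda>x. indicator ?K x *\<^sub>R f x) = f"
    using closure_subset[of "{x. f x \<noteq> 0}"] by (auto simp: indicator_def fun_eq_iff)
  ultimately show ?thesis by (simp add: set_integrable_def)
qed

text \<open>Translations preserve the integral of \<open>f\<close>, so the difference quotients in direction \<open>b\<close> have integral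
  zero; they converge to \<open>g\<close> dominatedly.\<close>

lemma integral_directional_derivative_eq_0:
  fixes f g :: "'a::euclidean_space \<Rightarrow> real"
  assumes f: "continuous_on UNIV f" "compact (closure {x. f x \<noteq> 0})"
    and g: "continuous_on UNIV g" "compact (closure {x. g x \<noteq> 0})"
    and D: "\<And>x s. ((\<lambda>s. f (x + s *\<^sub>R b)) has_real_derivative g (x + s *\<^sub>R b)) (at s)"
  shows "integral\<^sup>L lborel g = 0"
proof -
  obtain B where B: "\<And>x. \<bar>g x\<bar> \<le> B" "B \<ge> 0"
    using continuous_compact_support_bounded[OF g] by blast
  have int_f: "integrable lborel f" using continuous_compact_support_integrable[OF f] .
  have fm: "f \<in> borel_measurable borel"
    using f borel_measurable_continuous_onI by blast
  have gm: "g \<in> borel_measurable borel"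
    using g borel_measurable_continuous_onI by blast
  define q where "q n x = (f (x + (1 / real (Suc n)) *\<^sub>R b) - f x) * real (Suc n)" for n x
  obtain R where R: "R > 0" "closure {x. f x \<noteq> 0} \<subseteq> cball 0 R"
    using compact_imp_bounded[OF f(2)] by (auto simp: bounded_pos subset_iff)
  let ?K = "cball (0::'a) (R + norm b)"
  \<comment> \<open>The mean value theorem bounds the quotients; translations by at most \<open>b\<close> keep the support in \<open>?K\<close>.\<close>
  have q_le: "\<bar>q n x\<bar> \<le> indicator ?K x * B" for n x
  proof (cases "x \<in> ?K")
    case True
    let ?h = "1 / real (Suc n)"
    obtain s where s: "f (x + ?h *\<^sub>R b) - f (x + 0 *\<^sub>R b) = ?h * g (x + s *\<^sub>R b)"
      using MVT2[of 0 ?h "\<lambda>s. f (x + s *\<^sub>R b)" "\<lambda>s. g (x + s *\<^sub>R b)"] D by auto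
    then have "q n x = g (x + s *\<^sub>R b)"
      by (simp add: q_def)
    then show ?thesis using B True by simp
  next
    case False
    have z: "f y = 0" if "norm y > R" for y
      using that R(2) closure_subset[of "{x. f x \<noteq> 0}"] by (auto simp: subset_iff)
    have "norm ((1 / real (Suc n)) *\<^sub>R b) \<le> norm b"
      by (simp add: divide_le_eq algebra_simps)
    then have "norm (x + (1 / real (Suc n)) *\<^sub>R b) > R" "norm x > R"
      using False norm_diff_ineq[of x "(1 / real (Suc n)) *\<^sub>R b"] norm_ge_zero[of b]
      by (auto simp del: norm_ge_zero)
    then show ?thesis using z B by (simp add: q_def)
  qed
  have "(\<lambda>n. integral\<^sup>L lborel (q n)) \<longlonglongrightarrow> integral\<^sup>L lborel g"
  proof (rule integral_dominated_convergence[where w = "\<lambda>x. indicator ?K x * B"])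
    show "integrable lborel (\<lambda>x. indicator ?K x * B)"
      by (intro integrable_mult_left integrable_real_indicator emeasure_bounded_finite) auto
    show "AE x in lborel. (\<lambda>n. q n x) \<longlonglongrightarrow> g x"
    proof (rule AE_I2)
      fix x
      have "((\<lambda>s. (f (x + s *\<^sub>R b) - f x) / s) \<longlongrightarrow> g x) (at 0)"
        using D[of x 0] by (simp add: DERIV_def)
      moreover have "filterlim (\<lambda>n. 1 / real (Suc n)) (at 0) sequentially"
        by (rule filterlim_atI[OF LIMSEQ_Suc[OF lim_1_over_n]]) auto
      ultimately have "(\<lambda>n. (f (x + (1 / real (Suc n)) *\<^sub>R b) - f x) / (1 / real (Suc n))) \<longlonglongrightarrow> g x"
        by (rule filterlim_compose)
      then show "(\<lambda>n. q n x) \<longlonglongrightarrow> g x" by (simp add: q_def)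
    qed
    show "q n \<in> borel_measurable lborel" for n
      unfolding q_def using fm by measurable
  qed (use gm q_le in auto)
  moreover have "integral\<^sup>L lborel (q n) = 0" for n
  proof -
    let ?c = "(1 / real (Suc n)) *\<^sub>R b"
    have eq: "integral\<^sup>L lborel (\<lambda>x. f (x + ?c)) = integral\<^sup>L lborel f"
      "integrable lborel (\<lambda>x. f (x + ?c))"
    proof -
      have d: "distr lborel borel (\<lambda>x. ?c + x) = lborel" by (simp add: lborel_distr_plus)
      show "integral\<^sup>L lborel (\<lambda>x. f (x + ?c)) = integral\<^sup>L lborel f"
        using fm by (subst (2) d[symmetric]) (simp add: integral_distr add.commute)
      show "integrable lborel (\<lambda>x. f (x + ?c))"
        using int_f fm by (subst (asm) d[symmetric]) (simp add: integrable_distr_eq add.commute)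
    qed
    show ?thesis
      unfolding q_def using eq int_f by simp
  qed
  ultimately show ?thesis
    by (simp add: LIMSEQ_const_iff)
qed

text \<open>The product \<open>f * g\<close> has a directional derivative with vanishing integral.\<close>

lemma test_integral_by_parts:
  fixes f g :: "'a::euclidean_space \<Rightarrow> real"
  assumes f: "f \<in> test_functions \<Omega>" and g: "g \<in> test_functions \<Omega>" and b: "b \<in> Basis"
  shows "(LINT x|lborel. f x * pderiv b g x) = - (LINT x|lborel. pderiv b f x * g x)"
proof -
  have cont: "continuous_on UNIV f" "continuous_on UNIV g"
    "continuous_on UNIV (pderiv b f)" "continuous_on UNIV (pderiv b g)"
    using f g test_pderiv[OF _ b] test_continuous by blast+
  have K: "compact (closure {x. f x \<noteq> 0})" using f by (simp add: test_functions_def)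
  have supp: "{x. f x * p x \<noteq> 0} \<subseteq> closure {x. f x \<noteq> 0}"
     "{x. pderiv b f x * p x \<noteq> 0} \<subseteq> closure {x. f x \<noteq> 0}"
     "{x. f x * p x + pderiv b f x * q x \<noteq> 0} \<subseteq> closure {x. f x \<noteq> 0}" for p q
    using closure_subset[of "{x. f x \<noteq> 0}"] pderiv_support[of b f]
    by (auto simp: subset_iff) (metis add_cancel_right_right mult_eq_0_iff)
  note cs = compact_support_subset(1)[OF K supp(1)] compact_support_subset(1)[OF K supp(2)]
    compact_support_subset(1)[OF K supp(3)]
  have "(LINT x|lborel. f x * pderiv b g x + pderiv b f x * g x) = 0"
  proof (rule integral_directional_derivative_eq_0[of "\<lambda>x. f x * g x"])
    show "((\<lambda>s. f (x + s *\<^sub>R b) * g (x + s *\<^sub>R b)) has_real_derivative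
        f (x + s *\<^sub>R b) * pderiv b g (x + s *\<^sub>R b) + pderiv b f (x + s *\<^sub>R b) * g (x + s *\<^sub>R b)) (at s)" for x s
      using f g test_differentiable[of _ \<Omega> "[]"]
      by (auto intro!: derivative_eq_intros directional_DERIV)
  qed (use cont cs in \<open>auto intro!: continuous_intros\<close>)
  moreover have "integrable lborel (\<lambda>x. f x * pderiv b g x)" "integrable lborel (\<lambda>x. pderiv b f x * g x)"
    using cont cs by (auto intro!: continuous_compact_support_integrable continuous_intros)
  ultimately show ?thesis by simp
qed

section \<open>The fundamental lemma of the calculus of variations\<close>

text \<open>Boxes form an intersection-stable generator of the Borel sets, so the measures with densities given by
  the positive and the negative part of \<open>g\<close> coincide.\<close>

lemma integral_eq_0_on_boxes_imp_AE_0: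
  fixes g :: "'a::euclidean_space \<Rightarrow> real"
  assumes g: "integrable lborel g" and 0: "\<And>a c. (LINT x|lborel. indicator (box a c) x * g x) = 0"
  shows "AE x in lborel. g x = 0"
proof -
  let ?p = "\<lambda>x. ennreal (g x)" and ?n = "\<lambda>x. ennreal (- g x)"
  have [measurable]: "g \<in> borel_measurable borel" using g by auto
  have "density lborel ?p = density lborel ?n"
  proof (rule measure_eqI_generator_eq[where E = "range (\<lambda>(a, b). box a b::'a set)" and \<Omega> = UNIV
        and A = "\<lambda>n. box (- real n *\<^sub>R One) (real n *\<^sub>R One)"])
    show "Int_stable (range (\<lambda>(a, b). box a b::'a set))"
      by (auto simp: Int_stable_def box_Int_box)
    show "sets (density lborel ?p) = sigma_sets UNIV (range (\<lambda>(a, b). box a b))"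
      "sets (density lborel ?n) = sigma_sets UNIV (range (\<lambda>(a, b). box a b))"
      by (simp_all add: borel_eq_box)
    have fin: "(\<integral>\<^sup>+x. ?p x * indicator X x \<partial>lborel) < \<infinity>" "(\<integral>\<^sup>+x. ?n x * indicator X x \<partial>lborel) < \<infinity>" for X
    proof -
      have "(\<integral>\<^sup>+x. ?p x * indicator X x \<partial>lborel) \<le> (\<integral>\<^sup>+x. ennreal (norm (g x)) \<partial>lborel)"
        "(\<integral>\<^sup>+x. ?n x * indicator X x \<partial>lborel) \<le> (\<integral>\<^sup>+x. ennreal (norm (g x)) \<partial>lborel)"
        by (auto intro!: nn_integral_mono ennreal_leI split: split_indicator)
      then show "(\<integral>\<^sup>+x. ?p x * indicator X x \<partial>lborel) < \<infinity>" "(\<integral>\<^sup>+x. ?n x * indicator X x \<partial>lborel) < \<infinity>"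
        using g unfolding integrable_iff_bounded by auto
    qed
    show "emeasure (density lborel ?p) (box (- real n *\<^sub>R One) (real n *\<^sub>R One)) \<noteq> \<infinity>" for n
      using fin by (simp add: emeasure_density less_top)
    fix X :: "'a set" assume "X \<in> range (\<lambda>(a, b). box a b)"
    then obtain a c where X: "X = box a c" by auto
    let ?i = "indicator (box a c) :: 'a \<Rightarrow> real"
    have i: "integrable lborel (\<lambda>x. ?i x * g x)"
      using integrable_mult_indicator[OF _ g, of "box a c"] by simp
    have e: "ennreal (?i x * g x) = ?p x * indicator X x" "ennreal (- (?i x * g x)) = ?n x * indicator X x" for x
      by (auto simp: X split: split_indicator)
    have "enn2real (\<integral>\<^sup>+x. ?p x * indicator X x \<partial>lborel) = enn2real (\<integral>\<^sup>+x. ?n x * indicator X x \<partial>lborel)"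
      using real_lebesgue_integral_def[OF i] 0[of a c] by (simp add: e)
    then have "(\<integral>\<^sup>+x. ?p x * indicator X x \<partial>lborel) = (\<integral>\<^sup>+x. ?n x * indicator X x \<partial>lborel)"
      using fin[of X] by (metis ennreal_enn2real infinity_ennreal_def)
    then show "emeasure (density lborel ?p) X = emeasure (density lborel ?n) X"
      by (simp add: emeasure_density X)
  next
    show "(\<Union>i. box (- real i *\<^sub>R One) (real i *\<^sub>R One)) = (UNIV::'a set)"
      by (simp add: UN_box_eq_UNIV[symmetric])
  qed auto
  then have "AE x in lborel. ?p x = ?n x"
    by (intro sigma_finite_measure.density_unique_iff[THEN iffD1, OF sigma_finite_lborel]) auto
  then show ?thesis
  proof (rule AE_mp, intro AE_I2 impI)
    fix x assume "?p x = ?n x"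
    then show "g x = 0"
      by (metis ennreal_eq_0_iff ennreal_neg neg_le_0_iff_le antisym linear)
  qed
qed

lemma AE_lebesgue_on_iff:
  "S \<in> sets lebesgue \<Longrightarrow> (AE x in lebesgue_on S. P x) \<longleftrightarrow> (AE x in lebesgue. x \<in> S \<longrightarrow> P x)"
  by (subst AE_restrict_space_iff) auto

text \<open>Bumps transfer the hypothesis to the indicators of boxes whose closure lies in \<open>\<Omega>\<close>; countably many such
  boxes cover \<open>\<Omega>\<close>.\<close>

lemma test_integral_0_imp_AE_0:
  fixes g :: "'a::euclidean_space \<Rightarrow> real"
  assumes "open \<Omega>" and g: "integrable (lebesgue_on \<Omega>) g"
    and 0: "\<And>\<phi>. \<phi> \<in> test_functions \<Omega> \<Longrightarrow> (LINT x|lebesgue_on \<Omega>. g x * \<phi> x) = 0"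
  shows "AE x in lebesgue_on \<Omega>. g x = 0"
proof -
  have \<Omega>: "\<Omega> \<inter> space lebesgue \<in> sets lebesgue" "\<Omega> \<in> sets lebesgue"
    using \<open>open \<Omega>\<close> by auto
  \<comment> \<open>The argument with boxes concerns Borel functions, whence the Borel representative \<open>G\<close> of \<open>g\<close>.\<close>
  have int: "integrable lebesgue (\<lambda>x. indicator \<Omega> x * g x)"
    using g integrable_restrict_space[OF \<Omega>(1), of g] by simp
  then obtain G where G: "G \<in> borel_measurable lborel"
    and ae: "AE x in lborel. indicator \<Omega> x * g x = G x"
    using completion_ex_borel_measurable_real[of _ lborel] by blast
  have ae': "AE x in lebesgue. indicator \<Omega> x * g x = G x"
    using ae by (rule AE_completion)
  have [measurable]: "G \<in> borel_measurable borel" using G by simp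
  have "integrable lebesgue G"
    using int ae' integrable_cong_AE_imp[of lebesgue _ G] G
    by (meson AE_cong borel_measurable_integrable eq_commute integrable_cong_AE measurable_completion)
  then have intG: "integrable lborel G"
    by (subst (asm) integrable_completion) (use G in auto)
  have zero: "(LINT x|lborel. indicator (box a c) x * G x) = 0" if "cbox a c \<subseteq> \<Omega>" for a c
  proof -
    have "(\<lambda>n. LINT x|lborel. box_bump a c n x * G x) \<longlonglongrightarrow> (LINT x|lborel. indicator (box a c) x * G x)"
    proof (rule integral_dominated_convergence[where w = "\<lambda>x. \<bar>G x\<bar>"])
      show "AE x in lborel. (\<lambda>n. box_bump a c n x * G x) \<longlonglongrightarrow> indicator (box a c) x * G x"
        by (intro AE_I2 tendsto_mult box_bump_tendsto tendsto_const)
      have bm: "box_bump a c n \<in> borel_measurable borel" for n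
        using test_continuous[OF box_bump_test[OF that]] borel_measurable_continuous_onI by blast
      show "(\<lambda>x. box_bump a c n x * G x) \<in> borel_measurable lborel" for n
        using bm by measurable
      show "AE x in lborel. norm (box_bump a c n x * G x) \<le> \<bar>G x\<bar>" for n
        using box_bump_bounds[of a c n] by (intro AE_I2) (simp add: abs_mult mult_left_le_one_le)
    qed (use intG in auto)
    moreover have "(LINT x|lborel. box_bump a c n x * G x) = 0" for n
    proof -
      have t: "box_bump a c n \<in> test_functions \<Omega>" by (rule box_bump_test[OF that])
      then have bm: "box_bump a c n \<in> borel_measurable borel"
        using test_continuous borel_measurable_continuous_onI by blast
      have "(LINT x|lborel. box_bump a c n x * G x) = (LINT x|lebesgue. box_bump a c n x * G x)"
        using bm by (subst integral_completion) auto
      also have "\<dots> = (LINT x|lebesgue. indicator \<Omega> x * (g x * box_bump a c n x))"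
      proof (rule integral_cong_AE)
        show "AE x in lebesgue. box_bump a c n x * G x = indicator \<Omega> x * (g x * box_bump a c n x)"
          using ae' by eventually_elim (simp add: mult_ac)
        have "(\<lambda>x. (indicator \<Omega> x * g x) * box_bump a c n x) \<in> borel_measurable lebesgue"
        proof (rule borel_measurable_times[OF borel_measurable_integrable[OF int]])
          show "box_bump a c n \<in> borel_measurable lebesgue"
            using bm by (intro measurable_completion) simp
        qed
        then show "(\<lambda>x. indicator \<Omega> x * (g x * box_bump a c n x)) \<in> borel_measurable lebesgue"
          by (simp add: mult.assoc)
        show "(\<lambda>x. box_bump a c n x * G x) \<in> borel_measurable lebesgue"
          using bm by (intro measurable_completion) simp
      qed
      also have "\<dots> = (LINT x|lebesgue_on \<Omega>. g x * box_bump a c n x)"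
        using integral_restrict_space[OF \<Omega>(1), of "\<lambda>x. g x * box_bump a c n x"] by simp
      finally show ?thesis using 0[OF t] by simp
    qed
    ultimately show ?thesis by (simp add: LIMSEQ_const_iff)
  qed
  have on_box: "AE x in lebesgue. x \<in> cbox a c \<longrightarrow> G x = 0" if "cbox a c \<subseteq> \<Omega>" for a c
  proof -
    have "AE x in lborel. indicator (box a c) x * G x = 0"
    proof (rule integral_eq_0_on_boxes_imp_AE_0)
      show "integrable lborel (\<lambda>x. indicator (box a c) x * G x)"
        using integrable_mult_indicator[OF _ intG, of "box a c"] by simp
      fix a' c'
      \<comment> \<open>An arbitrary box is cut down to its intersection with \<open>box a c\<close>, which is a box with closure in \<open>\<Omega>\<close>.\<close>
      define p q where "p = (\<Sum>i\<in>Basis. max (a' \<bullet> i) (a \<bullet> i) *\<^sub>R i)"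
        and "q = (\<Sum>i\<in>Basis. min (c' \<bullet> i) (c \<bullet> i) *\<^sub>R i)"
      have pq: "box a' c' \<inter> box a c = box p q"
        unfolding p_def q_def by (rule box_Int_box)
      have "cbox p q \<subseteq> cbox a c"
        unfolding p_def q_def by (auto simp: mem_box)
      then have "cbox p q \<subseteq> \<Omega>" using that by blast
      then have "(LINT x|lborel. indicator (box p q) x * G x) = 0" by (rule zero)
      moreover have "(\<lambda>x. indicator (box a' c') x * (indicator (box a c) x * G x)) = (\<lambda>x. indicator (box p q) x * G x)"
        unfolding pq[symmetric] by (auto simp: fun_eq_iff split: split_indicator)
      ultimately show "(LINT x|lborel. indicator (box a' c') x * (indicator (box a c) x * G x)) = 0"
        by (simp only:)
    qed
    then have "AE x in lebesgue. indicator (box a c) x * G x = 0"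
      by (rule AE_completion)
    moreover have "AE x in lebesgue. x \<notin> cbox a c - box a c"
      using negligible_frontier_interval[of a c] negligible_iff_null_sets AE_not_in by blast
    ultimately show ?thesis
      by eventually_elim (auto simp: indicator_def split: if_splits)
  qed
  obtain D where D: "countable D" "D \<subseteq> Pow \<Omega>" "\<And>X. X \<in> D \<Longrightarrow> \<exists>a b. X = cbox a b" "\<Union>D = \<Omega>"
    using open_countable_Union_open_cbox[OF \<open>open \<Omega>\<close>] by blast
  have "AE x in lebesgue. \<forall>X\<in>D. x \<in> X \<longrightarrow> G x = 0"
    using D on_box by (subst AE_ball_countable) (auto, blast)
  then have "AE x in lebesgue. x \<in> \<Omega> \<longrightarrow> G x = 0"
    using D(4) by (auto elim!: eventually_mono)
  then have "AE x in lebesgue. x \<in> \<Omega> \<longrightarrow> g x = 0"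
    using ae' by eventually_elim auto
  then show ?thesis
    using AE_lebesgue_on_iff[OF \<Omega>(2)] by blast
qed

section \<open>Continuous functions with an integrable weak derivative\<close>

text \<open>The derivative of \<open>ramp\<close> is a probability density, because \<open>ramp\<close> increases from 0 to 1.\<close>

lemma deriv_ramp: "(ramp has_real_derivative flat [:0,0,1:] x) (at x)"
  using flat_DERIV[of 1 x] by simp

lemma ramp_at_top: "(ramp \<longlongrightarrow> 1) at_top"
proof -
  have "((\<lambda>x::real. exp (- inverse x)) \<longlongrightarrow> exp (- 0)) at_top"
    by (intro tendsto_exp tendsto_minus tendsto_inverse_0_at_top filterlim_ident)
  then have "((\<lambda>x. exp (- (1/x))) \<longlongrightarrow> (1::real)) at_top" by (simp add: inverse_eq_divide)
  then show ?thesis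
    by (rule Lim_transform_eventually)
       (use eventually_gt_at_top[of 0] in \<open>auto elim!: eventually_mono simp: flat_def\<close>)
qed

lemma ramp_density:
  "integrable lborel (flat [:0,0,1:])" "integral\<^sup>L lborel (flat [:0,0,1:]) = 1"
proof -
  have b: "flat [:0,0,1:] \<in> borel_measurable borel"
    by (intro borel_measurable_continuous_onI continuous_at_imp_continuous_on ballI
        DERIV_isCont[OF flat_DERIV])
  have nn: "0 \<le> flat [:0,0,1:] x" for x
    by (simp add: flat_def)
  note lim = ramp_at_top
  have "(\<integral>\<^sup>+x. ennreal (flat [:0,0,1:] x) * indicator {0..} x \<partial>lborel) = ennreal (1 - ramp 0)"
    by (rule nn_integral_FTC_atLeast[OF b deriv_ramp nn lim])
  moreover have "ennreal (flat [:0,0,1:] x) * indicator {0..} x = ennreal (flat [:0,0,1:] x)" for x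
    by (auto simp: flat_def split: split_indicator)
  ultimately have "(\<integral>\<^sup>+x. ennreal (flat [:0,0,1:] x) \<partial>lborel) = ennreal 1"
    by (simp add: flat_def)
  then have "has_bochner_integral lborel (flat [:0,0,1:]) 1"
    using b nn by (intro has_bochner_integral_nn_integral) auto
  then show "integrable lborel (flat [:0,0,1:])" "integral\<^sup>L lborel (flat [:0,0,1:]) = 1"
    by (auto simp: has_bochner_integral_iff)
qed

text \<open>The rescaled density concentrates at \<open>a\<close>, where the cutoff at \<open>c\<close> tends to 1.\<close>

lemma ramp_approximates_point:
  fixes P :: "real \<Rightarrow> real"
  assumes P: "P \<in> borel_measurable borel" "\<And>x. \<bar>P x\<bar> \<le> B" "isCont P a" and "a < c"
  shows "(\<lambda>n. LINT x|lborel. real (Suc n) * flat [:0,0,1:] (real (Suc n) * (x - a))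
             * ramp (real (Suc n) * (c - x)) * P x) \<longlonglongrightarrow> P a"
proof -
  let ?f = "flat [:0,0,1:]"
  have fb[measurable]: "?f \<in> borel_measurable borel" using ramp_density(1) by auto
  have rb[measurable]: "ramp \<in> borel_measurable borel"
    by (intro borel_measurable_continuous_onI continuous_at_imp_continuous_on ballI
        DERIV_isCont[OF flat_DERIV])
  have [measurable]: "P \<in> borel_measurable borel" by fact
  \<comment> \<open>Substitution of \<open>x = a + y / n\<close> leaves a fixed density.\<close>
  have eq: "(LINT x|lborel. real (Suc n) * ?f (real (Suc n) * (x - a))
             * ramp (real (Suc n) * (c - x)) * P x)
     = (LINT y|lborel. ?f y * ramp (real (Suc n) * (c - a) - y) * P (a + y / real (Suc n)))" for n
  proof -
    define k where "k = real (Suc n)"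
    have k: "k > 0" by (simp add: k_def)
    have "k * (a + 1 / k * y - a) = y" "k * (c - (a + 1 / k * y)) = k * (c - a) - y" "a + 1 / k * y = a + y / k" for y
      using k by (simp_all add: field_simps)
    then have "(LINT x|lborel. k * ?f (k * (x - a)) * ramp (k * (c - x)) * P x)
      = \<bar>1 / k\<bar> *\<^sub>R (LINT y|lborel. k * (?f y * ramp (k * (c - a) - y) * P (a + y / k)))"
      using k by (subst lborel_integral_real_affine[where c = "1 / k" and t = a]) (simp_all add: mult.assoc)
    also have "\<dots> = (LINT y|lborel. ?f y * ramp (k * (c - a) - y) * P (a + y / k))"
      using k by simp
    finally show ?thesis by (simp add: k_def)
  qed
  have "(\<lambda>n. LINT y|lborel. ?f y * ramp (real (Suc n) * (c - a) - y) * P (a + y / real (Suc n)))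
     \<longlonglongrightarrow> (LINT y|lborel. ?f y * 1 * P a)"
  proof (rule integral_dominated_convergence[where w = "\<lambda>y. ?f y * B"])
    show "AE y in lborel. (\<lambda>n. ?f y * ramp (real (Suc n) * (c - a) - y) * P (a + y / real (Suc n)))
        \<longlonglongrightarrow> ?f y * 1 * P a"
    proof (rule AE_I2, intro tendsto_mult tendsto_const)
      fix y
      have "filterlim (\<lambda>n. real (Suc n)) at_top sequentially"
        by (rule filterlim_compose[OF filterlim_real_sequentially filterlim_Suc])
      then have top: "filterlim (\<lambda>n. (c - a) * real (Suc n)) at_top sequentially"
        using \<open>a < c\<close> by (intro filterlim_tendsto_pos_mult_at_top[OF tendsto_const]) auto
      have top2: "filterlim (\<lambda>n. - y + (c - a) * real (Suc n)) at_top sequentially"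
        by (rule filterlim_tendsto_add_at_top[OF tendsto_const top])
      from filterlim_compose[OF ramp_at_top top2]
      show "(\<lambda>n. ramp (real (Suc n) * (c - a) - y)) \<longlonglongrightarrow> 1"
        by (simp add: mult.commute)
      have "(\<lambda>n. a + y * (1 / real (Suc n))) \<longlonglongrightarrow> a + y * 0"
        by (intro tendsto_intros LIMSEQ_Suc[OF lim_1_over_n])
      then have "(\<lambda>n. a + y / real (Suc n)) \<longlonglongrightarrow> a" by simp
      then show "(\<lambda>n. P (a + y / real (Suc n))) \<longlonglongrightarrow> P a"
        using P(3) isCont_tendsto_compose by blast
    qed
    show "AE y in lborel. norm (?f y * ramp (real (Suc n) * (c - a) - y) * P (a + y / real (Suc n))) \<le> ?f y * B" for n
    proof (rule AE_I2)
      fix y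
      have "\<bar>ramp (real (Suc n) * (c - a) - y) * P (a + y / real (Suc n))\<bar> \<le> 1 * B"
        unfolding abs_mult using ramp_bounds P(2) by (intro mult_mono) auto
      then have "?f y * \<bar>ramp (real (Suc n) * (c - a) - y) * P (a + y / real (Suc n))\<bar> \<le> ?f y * B"
        by (intro mult_left_mono) (auto simp: flat_def)
      moreover have "?f y \<ge> 0" by (simp add: flat_def)
      ultimately show "norm (?f y * ramp (real (Suc n) * (c - a) - y) * P (a + y / real (Suc n))) \<le> ?f y * B"
        by (simp add: abs_mult mult.assoc)
    qed
    show "(\<lambda>y. ?f y * ramp (real (Suc n) * (c - a) - y) * P (a + y / real (Suc n))) \<in> borel_measurable lborel" for n
      by measurable
  qed (use ramp_density in auto)
  then show ?thesis
    unfolding eq using ramp_density by simp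
qed

text \<open>Test with the bumps of the interval from \<open>a\<close> to \<open>c\<close>: their derivatives approximate the difference of
  the point masses at \<open>a\<close> and \<open>c\<close>, and the bumps themselves tend to the indicator of the interval.\<close>

lemma weak_derivative_imp_increment:
  fixes p q :: "real \<Rightarrow> real"
  assumes p: "continuous_on {0..T} p" and q: "integrable lborel q"
    and weak: "\<And>\<phi>. \<phi> \<in> test_functions {0<..<T} \<Longrightarrow>
      (LINT t|lborel. indicator {0<..<T} t * (deriv \<phi> t * p t)) = - (LINT t|lborel. \<phi> t * q t)"
    and ac: "0 < a" "a < c" "c < T"
  shows "p c - p a = (LINT t|lborel. indicator {a<..<c} t * q t)"
proof -
  define P where "P t = indicator {0<..<T} t * p t" for t
  have [measurable]: "q \<in> borel_measurable borel" using q by auto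
  have "(\<lambda>x. indicator {0<..<T} x *\<^sub>R p x) \<in> borel_measurable borel"
    by (rule borel_measurable_continuous_on_indicator) (use p in \<open>auto intro: continuous_on_subset\<close>)
  then have Pm[measurable]: "P \<in> borel_measurable borel" by (simp add: P_def[abs_def])
  have "bounded (p ` {0..T})"
    using p by (simp add: compact_continuous_image compact_imp_bounded)
  then obtain B where "\<forall>y\<in>p ` {0..T}. norm y \<le> B" unfolding bounded_iff by blast
  then have B: "\<And>x. x \<in> {0..T} \<Longrightarrow> \<bar>p x\<bar> \<le> B" by auto
  have "B \<ge> 0" using B[of a] ac by fastforce
  then have PB: "\<bar>P x\<bar> \<le> B" for x
    using B[of x] by (auto simp: P_def split: split_indicator)
  have contP: "isCont P x" if "0 < x" "x < T" for x
  proof -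
    have "isCont p x"
      using p that by (intro continuous_on_interior) auto
    moreover have "\<forall>\<^sub>F y in nhds x. y \<in> {0<..<T}"
      using that by (intro eventually_nhds_in_open) auto
    then have "\<forall>\<^sub>F y in nhds x. P y = p y"
      by eventually_elim (auto simp: P_def)
    ultimately show ?thesis using isCont_cong by blast
  qed
  let ?f = "flat [:0,0,1:]"
  let ?N = "\<lambda>n. real (Suc n)"
  have bump: "box_bump a c n x = ramp (?N n * (x - a)) * ramp (?N n * (c - x))" for n x
    by (simp add: box_bump_def basis_product_def)
  have test: "box_bump a c n \<in> test_functions {0<..<T}" for n
    using ac by (intro box_bump_test) auto
  have rb[measurable]: "ramp \<in> borel_measurable borel" "?f \<in> borel_measurable borel"
    by (auto intro!: borel_measurable_continuous_onI continuous_at_imp_continuous_on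
        DERIV_isCont[OF flat_DERIV])
  have deriv: "deriv (box_bump a c n) x = ?N n * ?f (?N n * (x - a)) * ramp (?N n * (c - x))
        - ?N n * ramp (?N n * (x - a)) * ?f (?N n * (c - x))" for n x
  proof (rule DERIV_imp_deriv)
    show "(box_bump a c n has_real_derivative ?N n * ?f (?N n * (x - a)) * ramp (?N n * (c - x))
        - ?N n * ramp (?N n * (x - a)) * ?f (?N n * (c - x))) (at x)"
      unfolding bump[abs_def]
      by (auto intro!: derivative_eq_intros DERIV_chain2[OF deriv_ramp] simp: algebra_simps)
  qed
  define L where "L n = (LINT x|lborel. ?N n * ?f (?N n * (x - a)) * ramp (?N n * (c - x)) * P x)" for n
  define R where "R n = (LINT x|lborel. ?N n * ?f (?N n * (c - x)) * ramp (?N n * (x - a)) * P x)" for n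
  have L: "L \<longlonglongrightarrow> P a"
    unfolding L_def using ac by (intro ramp_approximates_point[OF Pm PB contP]) auto
  have R: "R \<longlonglongrightarrow> P c"
  proof -
    \<comment> \<open>Reflection turns the right end point into a left end point.\<close>
    have e: "R n = (LINT x|lborel. ?N n * ?f (?N n * (x - (- c))) * ramp (?N n * (- a - x)) * P (- x))" for n
      unfolding R_def by (subst lborel_integral_real_affine[where c = "-1" and t = 0]) (auto simp: add.commute)
    have "isCont (\<lambda>x. P (- x)) (- c)"
      using contP[of c] ac by (intro continuous_at_compose[of "- c" uminus P, unfolded o_def] ) (auto intro: continuous_intros)
    from ramp_approximates_point[OF _ _ this, of B "- a"] show ?thesis
      unfolding e using PB ac by simp
  qed
  have f_bdd: "integrable lborel (\<lambda>x. ?N n * ?f (?N n * (x - a)) * ramp (?N n * (c - x)) * P x)" for n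
  proof (rule Bochner_Integration.integrable_bound)
    show "integrable lborel (\<lambda>x. ?N n * B * ?f (- ?N n * a + ?N n * x))"
      using lborel_integrable_real_affine[OF ramp_density(1), of "?N n" "- ?N n * a"] by simp
    show "AE x in lborel. norm (?N n * ?f (?N n * (x - a)) * ramp (?N n * (c - x)) * P x)
        \<le> norm (?N n * B * ?f (- ?N n * a + ?N n * x))"
    proof (rule AE_I2)
      fix x
      have "\<bar>ramp (?N n * (c - x)) * P x\<bar> \<le> 1 * B"
        unfolding abs_mult using ramp_bounds PB by (intro mult_mono) auto
      then have "(?N n * \<bar>?f (?N n * (x - a))\<bar>) * \<bar>ramp (?N n * (c - x)) * P x\<bar> \<le> (?N n * \<bar>?f (?N n * (x - a))\<bar>) * B"
        by (intro mult_left_mono) auto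
      moreover have "?N n * (x - a) = - ?N n * a + ?N n * x" by (simp add: algebra_simps)
      ultimately show "norm (?N n * ?f (?N n * (x - a)) * ramp (?N n * (c - x)) * P x)
        \<le> norm (?N n * B * ?f (- ?N n * a + ?N n * x))"
        using \<open>B \<ge> 0\<close> by (simp add: abs_mult mult_ac)
    qed
  qed measurable
  have g_bdd: "integrable lborel (\<lambda>x. ?N n * ?f (?N n * (c - x)) * ramp (?N n * (x - a)) * P x)" for n
  proof (rule Bochner_Integration.integrable_bound)
    show "integrable lborel (\<lambda>x. ?N n * B * ?f (?N n * c + (- ?N n) * x))"
      using lborel_integrable_real_affine[OF ramp_density(1), of "- ?N n" "?N n * c"] by simp
    show "AE x in lborel. norm (?N n * ?f (?N n * (c - x)) * ramp (?N n * (x - a)) * P x)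
        \<le> norm (?N n * B * ?f (?N n * c + (- ?N n) * x))"
    proof (rule AE_I2)
      fix x
      have "\<bar>ramp (?N n * (x - a)) * P x\<bar> \<le> 1 * B"
        unfolding abs_mult using ramp_bounds PB by (intro mult_mono) auto
      then have "(?N n * \<bar>?f (?N n * (c - x))\<bar>) * \<bar>ramp (?N n * (x - a)) * P x\<bar> \<le> (?N n * \<bar>?f (?N n * (c - x))\<bar>) * B"
        by (intro mult_left_mono) auto
      moreover have "?N n * (c - x) = ?N n * c + (- ?N n) * x" by (simp add: algebra_simps)
      ultimately show "norm (?N n * ?f (?N n * (c - x)) * ramp (?N n * (x - a)) * P x)
        \<le> norm (?N n * B * ?f (?N n * c + (- ?N n) * x))"
        using \<open>B \<ge> 0\<close> by (simp add: abs_mult mult_ac)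
    qed
  qed measurable
  have "L n - R n = (LINT t|lborel. indicator {0<..<T} t * (deriv (box_bump a c n) t * p t))" for n
  proof -
    have "L n - R n = (LINT x|lborel. ?N n * ?f (?N n * (x - a)) * ramp (?N n * (c - x)) * P x
       - ?N n * ?f (?N n * (c - x)) * ramp (?N n * (x - a)) * P x)"
      unfolding L_def R_def by (rule Bochner_Integration.integral_diff[OF f_bdd g_bdd, symmetric])
    also have "\<dots> = (LINT t|lborel. indicator {0<..<T} t * (deriv (box_bump a c n) t * p t))"
      by (rule Bochner_Integration.integral_cong) (auto simp: deriv P_def algebra_simps)
    finally show ?thesis .
  qed
  then have LR: "L n - R n = - (LINT t|lborel. box_bump a c n t * q t)" for n
    using weak[OF test] by simp
  have "(\<lambda>n. LINT t|lborel. box_bump a c n t * q t) \<longlonglongrightarrow> (LINT t|lborel. indicator (box a c) t * q t)"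
  proof (rule integral_dominated_convergence[where w = "\<lambda>x. \<bar>q x\<bar>"])
    show "AE x in lborel. (\<lambda>n. box_bump a c n x * q x) \<longlonglongrightarrow> indicator (box a c) x * q x"
      by (intro AE_I2 tendsto_mult box_bump_tendsto tendsto_const)
    show "(\<lambda>x. box_bump a c n x * q x) \<in> borel_measurable lborel" for n
      unfolding bump[abs_def] by measurable
    show "AE x in lborel. norm (box_bump a c n x * q x) \<le> \<bar>q x\<bar>" for n
      using box_bump_bounds[of a c n] by (intro AE_I2) (simp add: abs_mult mult_left_le_one_le)
  qed (use q in auto)
  moreover have "(\<lambda>n. R n - L n) \<longlonglongrightarrow> P c - P a"
    using L R by (intro tendsto_diff)
  moreover have "R n - L n = (LINT t|lborel. box_bump a c n t * q t)" for n
    using LR[of n] by simp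
  ultimately have "(LINT t|lborel. indicator (box a c) t * q t) = P c - P a"
    by (simp add: LIMSEQ_unique)
  then show ?thesis using ac by (simp add: P_def box_real)
qed

text \<open>The lemma of du Bois-Reymond.  Continuity at 0 allows the left end point of the increment to tend to 0.\<close>

lemma weak_derivative_imp_integral:
  fixes p q :: "real \<Rightarrow> real"
  assumes p: "continuous_on {0..T} p" and q: "integrable lborel q"
    and weak: "\<And>\<phi>. \<phi> \<in> test_functions {0<..<T} \<Longrightarrow>
      (LINT t|lborel. indicator {0<..<T} t * (deriv \<phi> t * p t)) = - (LINT t|lborel. \<phi> t * q t)"
    and c: "0 < c" "c < T"
  shows "p c = p 0 + (LINT t|lborel. indicator {0<..<c} t * q t)"
proof -
  define a where "a n = c / (2 + real n)" for n :: nat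
  have a: "0 < a n" "a n < c" for n
    using c by (auto simp: a_def divide_less_eq field_simps add_pos_nonneg)
  have a0: "a \<longlonglongrightarrow> 0"
  proof -
    have "(\<lambda>n. c * (1 / real (n + 2))) \<longlonglongrightarrow> c * 0"
      by (intro tendsto_intros LIMSEQ_ignore_initial_segment[OF lim_1_over_n])
    then show ?thesis by (simp add: a_def[abs_def] add.commute)
  qed
  have [measurable]: "q \<in> borel_measurable borel" using q by auto
  have "(\<lambda>n. p (a n)) \<longlonglongrightarrow> p 0"
    by (rule continuous_on_tendsto_compose[OF p a0]) (use a c in \<open>auto intro!: always_eventually less_imp_le intro: less_trans order_less_imp_le\<close>)
  then have 1: "(\<lambda>n. p c - p (a n)) \<longlonglongrightarrow> p c - p 0" by (intro tendsto_intros)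
  have 2: "(\<lambda>n. LINT t|lborel. indicator {a n<..<c} t * q t) \<longlonglongrightarrow> (LINT t|lborel. indicator {0<..<c} t * q t)"
  proof (rule integral_dominated_convergence[where w = "\<lambda>t. \<bar>q t\<bar>"])
    show "AE t in lborel. (\<lambda>n. indicator {a n<..<c} t * q t) \<longlonglongrightarrow> indicator {0<..<c} t * q t"
    proof (rule AE_I2, intro tendsto_mult tendsto_const)
      fix t
      show "(\<lambda>n. indicator {a n<..<c} t :: real) \<longlonglongrightarrow> indicator {0<..<c} t"
      proof (cases "t > 0")
        case True
        then have "\<forall>\<^sub>F n in sequentially. a n < t" using a0 by (simp add: order_tendstoD(2))
        then have "\<forall>\<^sub>F n in sequentially. (indicator {0<..<c} t :: real) = indicator {a n<..<c} t"
          by eventually_elim (use True in \<open>auto simp: indicator_def\<close>)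
        then show ?thesis by (rule Lim_transform_eventually[OF tendsto_const])
      next
        case False
        then have "indicator {a n<..<c} t = (0::real)" for n using a(1)[of n] by (auto simp: indicator_def)
        then show ?thesis using False by simp
      qed
    qed
  qed (use q in \<open>auto split: split_indicator\<close>)
  have "p c - p (a n) = (LINT t|lborel. indicator {a n<..<c} t * q t)" for n
    using weak_derivative_imp_increment[OF p q weak] a c by blast
  then have "p c - p 0 = (LINT t|lborel. indicator {0<..<c} t * q t)"
    using LIMSEQ_unique[OF 1] 2 by simp
  then show ?thesis by simp
qed

section \<open>Semi-inner products\<close>

(* The Sobolev space of order 1 is to be matched as written, not as order Suc 0. *)

declare One_nat_def [simp del]

lemma nonneg_quadratic_discriminant:
  fixes A B C :: real
  assumes q: "\<And>t. 0 \<le> A + 2 * t * B + t\<^sup>2 * C" and C: "0 \<le> C"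
  shows "B\<^sup>2 \<le> A * C"
proof (cases "C = 0")
  case True
  have "B = 0"
  proof (rule ccontr)
    assume "B \<noteq> 0"
    then have "2 * (- (A + 1) / (2 * B)) * B = - (A + 1)" by simp
    then show False using q[of "- (A + 1) / (2 * B)"] True by simp
  qed
  then show ?thesis using True by simp
next
  case False
  then have pos: "C > 0" using C by linarith
  have "0 \<le> (A + 2 * (- B / C) * B + (- B / C)\<^sup>2 * C) * C"
    by (rule mult_nonneg_nonneg[OF q less_imp_le[OF pos]])
  also have "\<dots> = A * C - B\<^sup>2"
    using pos by (simp add: field_simps power2_eq_square)
  finally show ?thesis by simp
qed

text \<open>Functions that agree almost everywhere are not identified, so the inner products at hand are only
  semidefinite.\<close>

locale semi_inner_product =
  fixes V :: "('x \<Rightarrow> real) set" and B :: "('x \<Rightarrow> real) \<Rightarrow> ('x \<Rightarrow> real) \<Rightarrow> real"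
  assumes zero_in: "(\<lambda>_. 0) \<in> V"
    and lin_in: "f \<in> V \<Longrightarrow> g \<in> V \<Longrightarrow> (\<lambda>x. a * f x + b * g x) \<in> V"
    and lin_left: "f \<in> V \<Longrightarrow> g \<in> V \<Longrightarrow> h \<in> V \<Longrightarrow> B (\<lambda>x. a * f x + b * g x) h = a * B f h + b * B g h"
    and sym: "f \<in> V \<Longrightarrow> g \<in> V \<Longrightarrow> B f g = B g f"
    and nonneg: "f \<in> V \<Longrightarrow> 0 \<le> B f f"
begin

lemma lin_right:
  "f \<in> V \<Longrightarrow> g \<in> V \<Longrightarrow> h \<in> V \<Longrightarrow> B h (\<lambda>x. a * f x + b * g x) = a * B h f + b * B h g"
  using lin_left[of f g h a b] lin_in[of f g a b] sym[of h "\<lambda>x. a * f x + b * g x"] sym[of f h] sym[of g h]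
  by simp

lemma square_expand:
  assumes "f \<in> V" "g \<in> V"
  shows "B (\<lambda>x. a * f x + b * g x) (\<lambda>x. a * f x + b * g x) = a\<^sup>2 * B f f + 2 * a * b * B f g + b\<^sup>2 * B g g"
  using assms by (simp add: lin_left lin_right lin_in sym[of g f] power2_eq_square algebra_simps)

lemma cauchy_schwarz_square:
  assumes "f \<in> V" "g \<in> V"
  shows "(B f g)\<^sup>2 \<le> B f f * B g g"
proof (rule nonneg_quadratic_discriminant)
  show "0 \<le> B f f + 2 * t * B f g + t\<^sup>2 * B g g" for t
    using square_expand[OF assms, of 1 t] nonneg[OF lin_in[OF assms, of 1 t]] by simp
qed (rule nonneg[OF assms(2)])

lemma cauchy_schwarz: "f \<in> V \<Longrightarrow> g \<in> V \<Longrightarrow> \<bar>B f g\<bar> \<le> sqrt (B f f) * sqrt (B g g)"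
  using real_sqrt_le_mono[OF cauchy_schwarz_square] by (simp add: real_sqrt_mult)

lemma norm_scale: "f \<in> V \<Longrightarrow> sqrt (B (\<lambda>x. a * f x) (\<lambda>x. a * f x)) = \<bar>a\<bar> * sqrt (B f f)"
  using square_expand[of f f a 0] by (simp add: real_sqrt_mult)

lemma norm_triangle:
  assumes "f \<in> V" "g \<in> V"
  shows "sqrt (B (\<lambda>x. f x + g x) (\<lambda>x. f x + g x)) \<le> sqrt (B f f) + sqrt (B g g)"
proof (rule real_le_lsqrt)
  have "B (\<lambda>x. f x + g x) (\<lambda>x. f x + g x) = B f f + 2 * B f g + B g g"
    using square_expand[OF assms, of 1 1] by simp
  also have "\<dots> \<le> B f f + 2 * (sqrt (B f f) * sqrt (B g g)) + B g g"
    using cauchy_schwarz[OF assms] by simp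
  also have "\<dots> = (sqrt (B f f) + sqrt (B g g))\<^sup>2"
    using nonneg assms by (simp add: power2_sum)
  finally show "B (\<lambda>x. f x + g x) (\<lambda>x. f x + g x) \<le> (sqrt (B f f) + sqrt (B g g))\<^sup>2" .
qed (use nonneg assms in auto)

lemma sum_in: "(\<And>i. i \<in> I \<Longrightarrow> f i \<in> V) \<Longrightarrow> (\<lambda>x. \<Sum>i\<in>I. c i * f i x) \<in> V"
proof (induction I rule: infinite_finite_induct)
  case (insert i I)
  then show ?case using lin_in[of "f i" "\<lambda>x. \<Sum>i\<in>I. c i * f i x" "c i" 1] by simp
qed (use zero_in in auto)

end

lemma semi_inner_product_subspace:
  assumes "semi_inner_product V B" "W \<subseteq> V" "(\<lambda>_. 0) \<in> W"
    "\<And>f g a b. f \<in> W \<Longrightarrow> g \<in> W \<Longrightarrow> (\<lambda>x. a * f x + b * g x) \<in> W"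
  shows "semi_inner_product W B"
proof -
  interpret semi_inner_product V B by fact
  show ?thesis
    using assms(2-4) by unfold_locales (auto intro: lin_left sym nonneg simp: subset_iff)
qed

section \<open>Square integrable functions and Sobolev spaces\<close>

lemma square_integrable_product:
  assumes "square_integrable \<Omega> f" "square_integrable \<Omega> g"
  shows "integrable (lebesgue_on \<Omega>) (\<lambda>x. f x * g x)"
proof (rule Bochner_Integration.integrable_bound)
  show "integrable (lebesgue_on \<Omega>) (\<lambda>x. (f x)\<^sup>2 + (g x)\<^sup>2)"
    using assms by (auto simp: square_integrable_def)
  show "AE x in lebesgue_on \<Omega>. norm (f x * g x) \<le> norm ((f x)\<^sup>2 + (g x)\<^sup>2)"
  proof (rule AE_I2)
    fix x
    have "2 * \<bar>f x * g x\<bar> \<le> (f x)\<^sup>2 + (g x)\<^sup>2"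
      using sum_squares_bound[of "\<bar>f x\<bar>" "\<bar>g x\<bar>"] by (simp add: abs_mult)
    then show "norm (f x * g x) \<le> norm ((f x)\<^sup>2 + (g x)\<^sup>2)" by simp
  qed
qed (use assms in \<open>auto simp: square_integrable_def\<close>)

lemma square_integrable_lincomb:
  assumes "square_integrable \<Omega> f" "square_integrable \<Omega> g"
  shows "square_integrable \<Omega> (\<lambda>x. a * f x + b * g x)"
proof -
  have "integrable (lebesgue_on \<Omega>) (\<lambda>x. a\<^sup>2 * (f x)\<^sup>2 + 2 * a * b * (f x * g x) + b\<^sup>2 * (g x)\<^sup>2)"
    using assms square_integrable_product[OF assms] by (auto simp: square_integrable_def)
  moreover have "a\<^sup>2 * (f x)\<^sup>2 + 2 * a * b * (f x * g x) + b\<^sup>2 * (g x)\<^sup>2 = (a * f x + b * g x)\<^sup>2" for x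
    by (simp add: power2_sum power_mult_distrib)
  ultimately show ?thesis
    using assms by (auto simp: square_integrable_def)
qed

lemma l2_semi_inner_product:
  "semi_inner_product {f. square_integrable \<Omega> f} (l2_inner \<Omega>)"
proof
  fix f g h :: "'a::euclidean_space \<Rightarrow> real" and a b :: real
  assume *: "f \<in> {f. square_integrable \<Omega> f}" "g \<in> {f. square_integrable \<Omega> f}"
    "h \<in> {f. square_integrable \<Omega> f}"
  have "l2_inner \<Omega> (\<lambda>x. a * f x + b * g x) h
      = (LINT x|lebesgue_on \<Omega>. a * (f x * h x) + b * (g x * h x))"
    unfolding l2_inner_def by (simp add: algebra_simps)
  then show "l2_inner \<Omega> (\<lambda>x. a * f x + b * g x) h = a * l2_inner \<Omega> f h + b * l2_inner \<Omega> g h"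
    using * by (simp add: l2_inner_def square_integrable_product)
next
  show "l2_inner \<Omega> f g = l2_inner \<Omega> g f" for f g
    by (simp add: l2_inner_def mult.commute)
  show "0 \<le> l2_inner \<Omega> f f" for f
    by (simp add: l2_inner_def)
  show "(\<lambda>_. 0) \<in> {f. square_integrable \<Omega> f}"
    by (simp add: square_integrable_def)
qed (auto simp: square_integrable_lincomb)

lemma l2_inner_cong_AE:
  assumes "square_integrable \<Omega> f" "square_integrable \<Omega> f'" "square_integrable \<Omega> g" "square_integrable \<Omega> g'"
    "AE x in lebesgue_on \<Omega>. f x = f' x" "AE x in lebesgue_on \<Omega>. g x = g' x"
  shows "l2_inner \<Omega> f g = l2_inner \<Omega> f' g'"
  unfolding l2_inner_def
proof (rule integral_cong_AE)
  show "AE x in lebesgue_on \<Omega>. f x * g x = f' x * g' x"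
    using assms(5,6) by eventually_elim simp
qed (use assms square_integrable_product in blast)+

lemma finite_Basis_lists [simp]: "finite {bs. set bs \<subseteq> (Basis :: 'a::euclidean_space set) \<and> length bs \<le> k}"
  by (rule finite_lists_length_le) simp

definition sobolev_inner :: "nat \<Rightarrow> 'a::euclidean_space set \<Rightarrow> ('a \<Rightarrow> real) \<Rightarrow> ('a \<Rightarrow> real) \<Rightarrow> real" where
  "sobolev_inner k \<Omega> f g = (\<Sum>bs | set bs \<subseteq> Basis \<and> length bs \<le> k.
     l2_inner \<Omega> (weak_pderiv \<Omega> bs f) (weak_pderiv \<Omega> bs g))"

lemma l2_inner_nonneg: "0 \<le> l2_inner \<Omega> f f"
  unfolding l2_inner_def by simp

lemma fnorm_L2: "fnorm (L2_space \<Omega>) f = sqrt (l2_inner \<Omega> f f)"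
  by (simp add: L2_space_def)

lemma elems_L2: "f \<in> elems (L2_space \<Omega>) \<longleftrightarrow> square_integrable \<Omega> f"
  by (simp add: L2_space_def)

lemma fnorm_sobolev: "fnorm (sobolev k \<Omega>) f = sqrt (sobolev_inner k \<Omega> f f)"
  by (simp add: sobolev_def sobolev_inner_def fnorm_L2 l2_inner_nonneg)

lemma fnorm_H1_0: "fnorm (H1_0 \<Omega>) = fnorm (sobolev 1 \<Omega>)"
  by (simp add: H1_0_def)

lemma H1_0_subset: "f \<in> elems (H1_0 \<Omega>) \<Longrightarrow> f \<in> elems (sobolev 1 \<Omega>)"
  by (simp add: H1_0_def)

lemma sobolev_square_integrable: "f \<in> elems (sobolev k \<Omega>) \<Longrightarrow> square_integrable \<Omega> f"
  by (simp add: sobolev_def)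

lemma sobolev_weak_pderiv:
  "f \<in> elems (sobolev k \<Omega>) \<Longrightarrow> set bs \<subseteq> Basis \<Longrightarrow> length bs \<le> k \<Longrightarrow> is_weak_pderiv \<Omega> bs f (weak_pderiv \<Omega> bs f)"
  unfolding weak_pderiv_def sobolev_def by (auto intro: someI2_ex[of "is_weak_pderiv \<Omega> bs f"])

lemma weak_square_integrable: "is_weak_pderiv \<Omega> bs f g \<Longrightarrow> square_integrable \<Omega> g"
  by (simp add: is_weak_pderiv_def)

lemma Basis_lists_le_1:
  "{bs. set bs \<subseteq> Basis \<and> length bs \<le> 1} = insert [] ((\<lambda>b. [b]) ` (Basis :: 'a::euclidean_space set))"
  by (auto simp: One_nat_def le_Suc_eq length_Suc_conv)

locale bounded_domain =
  fixes \<Omega> :: "'a::euclidean_space set"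
  assumes open_domain: "open \<Omega>" and bounded_domain: "bounded \<Omega>"
begin

lemma domain_measurable [simp]: "\<Omega> \<in> sets lebesgue" "\<Omega> \<inter> space lebesgue \<in> sets lebesgue"
  using open_domain by auto

lemma finite_measure_domain: "finite_measure (lebesgue_on \<Omega>)"
proof (rule finite_measureI)
  have "\<Omega> \<in> lmeasurable"
    using bounded_domain domain_measurable by (intro bounded_set_imp_lmeasurable) auto
  then show "emeasure (lebesgue_on \<Omega>) (space (lebesgue_on \<Omega>)) \<noteq> \<infinity>"
    by (simp add: emeasure_restrict_space fmeasurableD2 del: emeasure_completion)
qed

lemma square_integrable_integrable:
  assumes "square_integrable \<Omega> f" shows "integrable (lebesgue_on \<Omega>) f"
proof -
  interpret finite_measure "lebesgue_on \<Omega>" by (rule finite_measure_domain)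
  have "square_integrable \<Omega> (\<lambda>_. 1)" by (simp add: square_integrable_def)
  from square_integrable_product[OF assms this] show ?thesis by simp
qed

lemma test_square_integrable:
  assumes "\<phi> \<in> test_functions \<Omega>" shows "square_integrable \<Omega> \<phi>"
proof -
  interpret finite_measure "lebesgue_on \<Omega>" by (rule finite_measure_domain)
  have m: "\<phi> \<in> borel_measurable (lebesgue_on \<Omega>)"
    using test_continuous[OF assms] by (intro continuous_imp_measurable_on_sets_lebesgue) auto
  obtain B where B: "\<And>x. \<bar>\<phi> x\<bar> \<le> B" using test_bounded[OF assms] by blast
  have "(\<phi> x)\<^sup>2 \<le> B\<^sup>2" for x
    using B[of x] by (simp add: abs_le_square_iff[symmetric])
  then have "integrable (lebesgue_on \<Omega>) (\<lambda>x. (\<phi> x)\<^sup>2)"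
    using m by (intro integrable_const_bound[where B = "B\<^sup>2"]) auto
  then show ?thesis using m by (simp add: square_integrable_def)
qed

text \<open>The difference of two weak derivatives annihilates all test functions.\<close>

lemma weak_pderiv_unique:
  assumes "is_weak_pderiv \<Omega> bs f g" "is_weak_pderiv \<Omega> bs f h"
  shows "AE x in lebesgue_on \<Omega>. g x = h x"
proof -
  have "AE x in lebesgue_on \<Omega>. g x - h x = 0"
  proof (rule test_integral_0_imp_AE_0[OF open_domain])
    have sq: "square_integrable \<Omega> g" "square_integrable \<Omega> h"
      using assms by (auto simp: is_weak_pderiv_def)
    then show "integrable (lebesgue_on \<Omega>) (\<lambda>x. g x - h x)"
      by (intro Bochner_Integration.integrable_diff square_integrable_integrable)
    fix \<phi> assume \<phi>: "\<phi> \<in> test_functions \<Omega>"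
    have "(LINT x|lebesgue_on \<Omega>. g x * \<phi> x) = (LINT x|lebesgue_on \<Omega>. h x * \<phi> x)"
    proof -
      have "(- 1) ^ length bs * (LINT x|lebesgue_on \<Omega>. g x * \<phi> x)
          = (- 1) ^ length bs * (LINT x|lebesgue_on \<Omega>. h x * \<phi> x)"
        using assms(1)[unfolded is_weak_pderiv_def, THEN conjunct2, THEN conjunct2, THEN bspec, OF \<phi>]
          assms(2)[unfolded is_weak_pderiv_def, THEN conjunct2, THEN conjunct2, THEN bspec, OF \<phi>] by simp
      then show ?thesis by simp
    qed
    then show "(LINT x|lebesgue_on \<Omega>. (g x - h x) * \<phi> x) = 0"
      using square_integrable_product[OF sq(1) test_square_integrable[OF \<phi>]]
        square_integrable_product[OF sq(2) test_square_integrable[OF \<phi>]]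
      by (simp add: left_diff_distrib)
  qed
  then show ?thesis by eventually_elim simp
qed

lemma is_weak_pderiv_lincomb:
  assumes f: "is_weak_pderiv \<Omega> bs f f'" and g: "is_weak_pderiv \<Omega> bs g g'" and bs: "set bs \<subseteq> Basis"
  shows "is_weak_pderiv \<Omega> bs (\<lambda>x. a * f x + b * g x) (\<lambda>x. a * f' x + b * g' x)"
  unfolding is_weak_pderiv_def
proof (intro conjI ballI)
  have sq: "square_integrable \<Omega> f" "square_integrable \<Omega> g" "square_integrable \<Omega> f'" "square_integrable \<Omega> g'"
    using f g by (auto simp: is_weak_pderiv_def)
  then show "square_integrable \<Omega> (\<lambda>x. a * f x + b * g x)" "square_integrable \<Omega> (\<lambda>x. a * f' x + b * g' x)"
    by (auto intro: square_integrable_lincomb)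
  fix \<phi> assume \<phi>: "\<phi> \<in> test_functions \<Omega>"
  have *: "(LINT x|lebesgue_on \<Omega>. (a * p x + b * q x) * \<psi> x)
     = a * (LINT x|lebesgue_on \<Omega>. p x * \<psi> x) + b * (LINT x|lebesgue_on \<Omega>. q x * \<psi> x)"
    if "square_integrable \<Omega> p" "square_integrable \<Omega> q" "\<psi> \<in> test_functions \<Omega>" for p q \<psi>
    using square_integrable_product[OF that(1) test_square_integrable[OF that(3)]]
      square_integrable_product[OF that(2) test_square_integrable[OF that(3)]]
    by (simp add: distrib_right mult.assoc)
  show "(LINT x|lebesgue_on \<Omega>. (a * f x + b * g x) * iter_pderiv bs \<phi> x) =
        (- 1) ^ length bs * (LINT x|lebesgue_on \<Omega>. (a * f' x + b * g' x) * \<phi> x)"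
    using f g \<phi> unfolding *[OF sq(1,2) test_iter_pderiv[OF \<phi> bs]] *[OF sq(3,4) \<phi>] is_weak_pderiv_def
    by (simp add: algebra_simps)
qed

text \<open>By uniqueness, the derivative selected by \<open>weak_pderiv\<close> may be replaced by any other weak derivative in
  inner products, which is the only way in which it enters norms and forms.\<close>

lemma l2_inner_weak:
  assumes "is_weak_pderiv \<Omega> bs f f'" "is_weak_pderiv \<Omega> cs g g'"
  shows "l2_inner \<Omega> (weak_pderiv \<Omega> bs f) (weak_pderiv \<Omega> cs g) = l2_inner \<Omega> f' g'"
proof -
  have w: "is_weak_pderiv \<Omega> bs f (weak_pderiv \<Omega> bs f)" "is_weak_pderiv \<Omega> cs g (weak_pderiv \<Omega> cs g)"
    unfolding weak_pderiv_def
    by (rule someI[of "is_weak_pderiv \<Omega> bs f", OF assms(1)], rule someI[of "is_weak_pderiv \<Omega> cs g", OF assms(2)])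
  show ?thesis
    by (rule l2_inner_cong_AE)
       (rule weak_square_integrable[OF w(1)] weak_square_integrable[OF assms(1)]
         weak_square_integrable[OF w(2)] weak_square_integrable[OF assms(2)]
         weak_pderiv_unique[OF w(1) assms(1)] weak_pderiv_unique[OF w(2) assms(2)])+
qed

lemma sobolev_lincomb:
  assumes "f \<in> elems (sobolev k \<Omega>)" "g \<in> elems (sobolev k \<Omega>)"
  shows "(\<lambda>x. a * f x + b * g x) \<in> elems (sobolev k \<Omega>)"
proof -
  have "\<exists>h. is_weak_pderiv \<Omega> bs (\<lambda>x. a * f x + b * g x) h"
    if "set bs \<subseteq> Basis" "length bs \<le> k" for bs
    using is_weak_pderiv_lincomb[OF sobolev_weak_pderiv[OF assms(1) that] sobolev_weak_pderiv[OF assms(2) that] that(1)]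
    by blast
  then show ?thesis
    using assms square_integrable_lincomb by (auto simp: sobolev_def)
qed

lemma is_weak_pderiv_zero: "is_weak_pderiv \<Omega> bs (\<lambda>_. 0) (\<lambda>_. 0)"
  by (simp add: is_weak_pderiv_def square_integrable_def)

lemma zero_sobolev: "(\<lambda>_. 0) \<in> elems (sobolev k \<Omega>)"
  using is_weak_pderiv_zero by (auto simp: sobolev_def square_integrable_def)

lemma l2_inner_weak_lincomb:
  assumes "f \<in> elems (sobolev k \<Omega>)" "g \<in> elems (sobolev k \<Omega>)" "h \<in> elems (sobolev k \<Omega>)"
    "set bs \<subseteq> Basis" "length bs \<le> k"
  shows "l2_inner \<Omega> (weak_pderiv \<Omega> bs (\<lambda>x. a * f x + b * g x)) (weak_pderiv \<Omega> bs h) =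
    a * l2_inner \<Omega> (weak_pderiv \<Omega> bs f) (weak_pderiv \<Omega> bs h) + b * l2_inner \<Omega> (weak_pderiv \<Omega> bs g) (weak_pderiv \<Omega> bs h)"
proof -
  note w = assms(1-3)[THEN sobolev_weak_pderiv, OF assms(4,5)]
  interpret semi_inner_product "{f. square_integrable \<Omega> f}" "l2_inner \<Omega>" by (rule l2_semi_inner_product)
  show ?thesis
    unfolding l2_inner_weak[OF is_weak_pderiv_lincomb[OF w(1,2) assms(4)] w(3)]
    using w by (simp add: lin_left is_weak_pderiv_def)
qed

lemma sobolev_semi_inner_product: "semi_inner_product (elems (sobolev k \<Omega>)) (sobolev_inner k \<Omega>)"
proof
  fix f g h :: "'a \<Rightarrow> real" and a b :: real
  assume *: "f \<in> elems (sobolev k \<Omega>)" "g \<in> elems (sobolev k \<Omega>)" "h \<in> elems (sobolev k \<Omega>)"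
  show "sobolev_inner k \<Omega> (\<lambda>x. a * f x + b * g x) h = a * sobolev_inner k \<Omega> f h + b * sobolev_inner k \<Omega> g h"
    using * by (simp add: sobolev_inner_def l2_inner_weak_lincomb sum.distrib sum_distrib_left)
next
  show "0 \<le> sobolev_inner k \<Omega> f f" for f
    unfolding sobolev_inner_def by (intro sum_nonneg l2_inner_nonneg)
  show "sobolev_inner k \<Omega> f g = sobolev_inner k \<Omega> g f" for f g
    unfolding sobolev_inner_def l2_inner_def by (simp add: mult.commute)
qed (auto intro: zero_sobolev sobolev_lincomb)

lemma dirichlet_semi_inner_product: "semi_inner_product (elems (sobolev 1 \<Omega>)) (dirichlet_form \<Omega>)"
proof
  fix f g h :: "'a \<Rightarrow> real" and a b :: real
  assume *: "f \<in> elems (sobolev 1 \<Omega>)" "g \<in> elems (sobolev 1 \<Omega>)" "h \<in> elems (sobolev 1 \<Omega>)"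
  show "dirichlet_form \<Omega> (\<lambda>x. a * f x + b * g x) h = a * dirichlet_form \<Omega> f h + b * dirichlet_form \<Omega> g h"
    using * by (simp add: dirichlet_form_def l2_inner_weak_lincomb[where k = 1] sum.distrib sum_distrib_left)
next
  show "0 \<le> dirichlet_form \<Omega> f f" for f
    unfolding dirichlet_form_def by (intro sum_nonneg l2_inner_nonneg)
  show "dirichlet_form \<Omega> f g = dirichlet_form \<Omega> g f" for f g
    unfolding dirichlet_form_def l2_inner_def by (simp add: mult.commute)
qed (auto intro: zero_sobolev sobolev_lincomb)

lemma is_weak_pderiv_Nil: "square_integrable \<Omega> f \<Longrightarrow> is_weak_pderiv \<Omega> [] f f"
  by (simp add: is_weak_pderiv_def)

lemma sobolev_1_inner:
  assumes "f \<in> elems (sobolev 1 \<Omega>)" "g \<in> elems (sobolev 1 \<Omega>)"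
  shows "sobolev_inner 1 \<Omega> f g = l2_inner \<Omega> f g + dirichlet_form \<Omega> f g"
proof -
  have "sobolev_inner 1 \<Omega> f g = l2_inner \<Omega> (weak_pderiv \<Omega> [] f) (weak_pderiv \<Omega> [] g) + dirichlet_form \<Omega> f g"
    unfolding sobolev_inner_def Basis_lists_le_1 dirichlet_form_def
    by (subst sum.insert) (auto simp: sum.reindex inj_on_def)
  then show ?thesis
    using l2_inner_weak[OF is_weak_pderiv_Nil is_weak_pderiv_Nil] assms sobolev_square_integrable by metis
qed

lemma l2_norm_le_sobolev_1: "f \<in> elems (sobolev 1 \<Omega>) \<Longrightarrow> l2_inner \<Omega> f f \<le> (fnorm (sobolev 1 \<Omega>) f)\<^sup>2"
  and dirichlet_le_sobolev_1: "f \<in> elems (sobolev 1 \<Omega>) \<Longrightarrow> dirichlet_form \<Omega> f f \<le> (fnorm (sobolev 1 \<Omega>) f)\<^sup>2"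
  using semi_inner_product.nonneg[OF dirichlet_semi_inner_product, of f] l2_inner_nonneg[of \<Omega> f]
    semi_inner_product.nonneg[OF sobolev_semi_inner_product, of f 1]
  by (auto simp: fnorm_sobolev sobolev_1_inner)

lemma l2_norm_weak_pderiv_le:
  assumes "set bs \<subseteq> Basis" "length bs \<le> k"
  shows "sqrt (l2_inner \<Omega> (weak_pderiv \<Omega> bs f) (weak_pderiv \<Omega> bs f)) \<le> fnorm (sobolev k \<Omega>) f"
  unfolding fnorm_sobolev sobolev_inner_def
  using assms by (intro real_sqrt_le_mono member_le_sum[where f = "\<lambda>bs. l2_inner \<Omega> (weak_pderiv \<Omega> bs f) (weak_pderiv \<Omega> bs f)"])
     (auto intro: l2_inner_nonneg)

lemma lebesgue_on_test_integral:
  assumes "\<phi> \<in> test_functions \<Omega>" "f \<in> borel_measurable borel"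
  shows "(LINT x|lebesgue_on \<Omega>. f x * \<phi> x) = (LINT x|lborel. f x * \<phi> x)"
proof -
  have m: "\<phi> \<in> borel_measurable borel"
    using test_continuous[OF assms(1)] borel_measurable_continuous_onI by blast
  have "(LINT x|lebesgue_on \<Omega>. f x * \<phi> x) = (LINT x|lebesgue. indicator \<Omega> x *\<^sub>R (f x * \<phi> x))"
    by (rule integral_restrict_space) simp
  also have "\<dots> = (LINT x|lebesgue. f x * \<phi> x)"
    using test_zero_outside[OF assms(1)] by (intro Bochner_Integration.integral_cong) (auto split: split_indicator)
  also have "\<dots> = (LINT x|lborel. f x * \<phi> x)"
    using m assms(2) by (subst integral_completion) auto
  finally show ?thesis .
qed

text \<open>Partial integration identifies classical and weak derivatives.\<close>

lemma test_is_weak_pderiv: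
  assumes "\<phi> \<in> test_functions \<Omega>" "b \<in> Basis"
  shows "is_weak_pderiv \<Omega> [b] \<phi> (pderiv b \<phi>)"
  unfolding is_weak_pderiv_def
proof (intro conjI ballI)
  show "square_integrable \<Omega> \<phi>" "square_integrable \<Omega> (pderiv b \<phi>)"
    using assms test_pderiv test_square_integrable by blast+
  fix \<psi> assume \<psi>: "\<psi> \<in> test_functions \<Omega>"
  have m: "f \<in> borel_measurable borel" if "f \<in> test_functions \<Omega>" for f :: "'a \<Rightarrow> real"
    using test_continuous[OF that] borel_measurable_continuous_onI by blast
  show "(LINT x|lebesgue_on \<Omega>. \<phi> x * iter_pderiv [b] \<psi> x) =
        (- 1) ^ length [b] * (LINT x|lebesgue_on \<Omega>. pderiv b \<phi> x * \<psi> x)"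
    using test_integral_by_parts[OF assms(1) \<psi> assms(2)]
      lebesgue_on_test_integral[OF test_pderiv[OF \<psi> assms(2)] m[OF assms(1)]]
      lebesgue_on_test_integral[OF \<psi> m[OF test_pderiv[OF assms]]]
    by (simp add: iter_pderiv_Cons)
qed

lemma test_in_sobolev_1:
  assumes "\<phi> \<in> test_functions \<Omega>" shows "\<phi> \<in> elems (sobolev 1 \<Omega>)"
proof -
  have "\<exists>g. is_weak_pderiv \<Omega> bs \<phi> g" if "set bs \<subseteq> Basis" "length bs \<le> 1" for bs
  proof -
    have "bs \<in> insert [] ((\<lambda>b. [b]) ` Basis)" using that Basis_lists_le_1 by blast
    then show ?thesis
      using is_weak_pderiv_Nil[OF test_square_integrable[OF assms]] test_is_weak_pderiv[OF assms] by blast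
  qed
  then show ?thesis using test_square_integrable[OF assms] by (simp add: sobolev_def)
qed

lemma H1_0_lincomb:
  assumes f: "f \<in> elems (H1_0 \<Omega>)" and g: "g \<in> elems (H1_0 \<Omega>)"
  shows "(\<lambda>x. a * f x + b * g x) \<in> elems (H1_0 \<Omega>)"
proof -
  interpret S: semi_inner_product "elems (sobolev 1 \<Omega>)" "sobolev_inner 1 \<Omega>"
    by (rule sobolev_semi_inner_product)
  have fg: "f \<in> elems (sobolev 1 \<Omega>)" "g \<in> elems (sobolev 1 \<Omega>)" using f g H1_0_subset by auto
  have "\<exists>\<eta>\<in>test_functions \<Omega>. fnorm (sobolev 1 \<Omega>) (\<lambda>x. (a * f x + b * g x) - \<eta> x) < \<epsilon>" if "\<epsilon> > 0" for \<epsilon>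
  proof -
    define \<delta> where "\<delta> = \<epsilon> / (\<bar>a\<bar> + \<bar>b\<bar> + 1)"
    have \<delta>: "\<delta> > 0" using that by (simp add: \<delta>_def)
    obtain \<phi> \<psi> where t: "\<phi> \<in> test_functions \<Omega>" "\<psi> \<in> test_functions \<Omega>"
      and le: "fnorm (sobolev 1 \<Omega>) (\<lambda>x. f x - \<phi> x) < \<delta>" "fnorm (sobolev 1 \<Omega>) (\<lambda>x. g x - \<psi> x) < \<delta>"
      using f g \<delta> unfolding H1_0_def by auto metis
    have d: "(\<lambda>x. f x - \<phi> x) \<in> elems (sobolev 1 \<Omega>)" "(\<lambda>x. g x - \<psi> x) \<in> elems (sobolev 1 \<Omega>)"
      using S.lin_in[OF fg(1) test_in_sobolev_1[OF t(1)], of 1 "-1"]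
        S.lin_in[OF fg(2) test_in_sobolev_1[OF t(2)], of 1 "-1"] by auto
    have d': "(\<lambda>x. a * (f x - \<phi> x)) \<in> elems (sobolev 1 \<Omega>)" "(\<lambda>x. b * (g x - \<psi> x)) \<in> elems (sobolev 1 \<Omega>)"
      using S.lin_in[OF d(1) d(1), of a 0] S.lin_in[OF d(2) d(2), of b 0] by auto
    have "fnorm (sobolev 1 \<Omega>) (\<lambda>x. (a * f x + b * g x) - (a * \<phi> x + b * \<psi> x))
        = fnorm (sobolev 1 \<Omega>) (\<lambda>x. a * (f x - \<phi> x) + b * (g x - \<psi> x))"
      by (simp add: algebra_simps)
    also have "\<dots> \<le> \<bar>a\<bar> * fnorm (sobolev 1 \<Omega>) (\<lambda>x. f x - \<phi> x) + \<bar>b\<bar> * fnorm (sobolev 1 \<Omega>) (\<lambda>x. g x - \<psi> x)"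
      using S.norm_triangle[OF d'] S.norm_scale[OF d(1), of a] S.norm_scale[OF d(2), of b]
      by (simp add: fnorm_sobolev)
    also have "\<dots> \<le> \<bar>a\<bar> * \<delta> + \<bar>b\<bar> * \<delta>"
      using le by (intro add_mono mult_left_mono) auto
    also have "\<dots> < (\<bar>a\<bar> + \<bar>b\<bar> + 1) * \<delta>" using \<delta> by (simp add: algebra_simps)
    also have "\<dots> = \<epsilon>"
    proof -
      have "\<bar>a\<bar> + \<bar>b\<bar> + 1 \<noteq> 0" by linarith
      then show ?thesis by (simp add: \<delta>_def)
    qed
    finally show ?thesis using test_lincomb[OF t, of a b] by (intro bexI)
  qed
  then show ?thesis using sobolev_lincomb[OF fg] by (simp add: H1_0_def)
qed

lemma zero_test: "(\<lambda>_. 0) \<in> test_functions \<Omega>"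
proof -
  have "iter_pderiv bs (\<lambda>_. 0) = (\<lambda>_::'a. 0)" for bs
    by (induction bs) (auto simp: iter_pderiv_Cons pderiv_def)
  then show ?thesis by (simp add: test_functions_def)
qed

lemma zero_H1_0: "(\<lambda>_. 0) \<in> elems (H1_0 \<Omega>)"
  using zero_sobolev[of 1] zero_test semi_inner_product.norm_scale[OF sobolev_semi_inner_product zero_sobolev, of 1 0]
  by (auto simp: H1_0_def fnorm_sobolev intro!: bexI[of _ "\<lambda>_. 0"])

lemma H1_0_semi_inner_product: "semi_inner_product (elems (H1_0 \<Omega>)) (sobolev_inner 1 \<Omega>)"
  by (rule semi_inner_product_subspace[OF sobolev_semi_inner_product])
     (auto intro: H1_0_subset zero_H1_0 H1_0_lincomb)

lemma H1_0_dirichlet: "semi_inner_product (elems (H1_0 \<Omega>)) (dirichlet_form \<Omega>)"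
  by (rule semi_inner_product_subspace[OF dirichlet_semi_inner_product])
     (auto intro: H1_0_subset zero_H1_0 H1_0_lincomb)

lemma sum_weak_pderiv:
  assumes "\<And>i. i \<in> I \<Longrightarrow> is_weak_pderiv \<Omega> bs (f i) (g i)" "set bs \<subseteq> Basis"
  shows "is_weak_pderiv \<Omega> bs (\<lambda>x. \<Sum>i\<in>I. f i x) (\<lambda>x. \<Sum>i\<in>I. g i x)"
  using assms(1)
proof (induction I rule: infinite_finite_induct)
  case (insert i I)
  then show ?case
    using is_weak_pderiv_lincomb[OF _ _ assms(2), of "f i" "g i" _ _ 1 1] by simp
qed (auto simp: is_weak_pderiv_zero)

text \<open>Test \<open>f\<close> with the test functions \<open>iter_pderiv cs \<phi>\<close>.\<close>

lemma is_weak_pderiv_append: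
  assumes "is_weak_pderiv \<Omega> bs f g" "is_weak_pderiv \<Omega> (bs @ cs) f h" "set bs \<subseteq> Basis" "set cs \<subseteq> Basis"
  shows "is_weak_pderiv \<Omega> cs g h"
  unfolding is_weak_pderiv_def
proof (intro conjI ballI)
  fix \<phi> assume \<phi>: "\<phi> \<in> test_functions \<Omega>"
  note w1 = assms(1)[unfolded is_weak_pderiv_def, THEN conjunct2, THEN conjunct2, THEN bspec, OF test_iter_pderiv[OF \<phi> assms(4)]]
  note w2 = assms(2)[unfolded is_weak_pderiv_def, THEN conjunct2, THEN conjunct2, THEN bspec, OF \<phi>]
  have "(- 1) ^ length bs * (LINT x|lebesgue_on \<Omega>. g x * iter_pderiv cs \<phi> x)
     = (- 1) ^ length bs * ((- 1) ^ length cs * (LINT x|lebesgue_on \<Omega>. h x * \<phi> x))"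
    using w1 w2 by (simp only: iter_pderiv_append length_append power_add mult.assoc)
  then show "(LINT x|lebesgue_on \<Omega>. g x * iter_pderiv cs \<phi> x)
     = (- 1) ^ length cs * (LINT x|lebesgue_on \<Omega>. h x * \<phi> x)"
    by simp
qed (use assms in \<open>auto simp: is_weak_pderiv_def\<close>)

lemma weak_laplacian_square_integrable:
  assumes "f \<in> elems (sobolev k \<Omega>)" "2 \<le> k"
  shows "square_integrable \<Omega> (weak_laplacian \<Omega> f)"
proof -
  interpret semi_inner_product "{f. square_integrable \<Omega> f}" "l2_inner \<Omega>" by (rule l2_semi_inner_product)
  have "(\<lambda>x. \<Sum>b\<in>Basis. 1 * weak_pderiv \<Omega> [b, b] f x) \<in> {f. square_integrable \<Omega> f}"
    using assms by (intro sum_in) (auto intro!: weak_square_integrable sobolev_weak_pderiv)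
  then show ?thesis by (simp add: weak_laplacian_def[abs_def])
qed

text \<open>Green's formula holds by definition of the weak derivatives when \<open>v\<close> is a test function, and
  both sides are continuous in \<open>v\<close>.\<close>

lemma dirichlet_form_laplacian:
  assumes f: "f \<in> elems (sobolev k \<Omega>)" "2 \<le> k" "f \<in> elems (sobolev 1 \<Omega>)" and v: "v \<in> elems (H1_0 \<Omega>)"
  shows "dirichlet_form \<Omega> f v = - l2_inner \<Omega> (weak_laplacian \<Omega> f) v"
proof -
  interpret L: semi_inner_product "{f. square_integrable \<Omega> f}" "l2_inner \<Omega>" by (rule l2_semi_inner_product)
  interpret D: semi_inner_product "elems (sobolev 1 \<Omega>)" "dirichlet_form \<Omega>" by (rule dirichlet_semi_inner_product)
  note lap = weak_laplacian_square_integrable[OF f(1,2)]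
  \<comment> \<open>Both sides are bounded by \<open>K\<close> times the Sobolev norm of \<open>v\<close>.\<close>
  define K where "K = sqrt (dirichlet_form \<Omega> f f) + sqrt (l2_inner \<Omega> (weak_laplacian \<Omega> f) (weak_laplacian \<Omega> f))"
  have K: "K \<ge> 0" using D.nonneg[OF f(3)] by (simp add: K_def l2_inner_nonneg)
  have test: "dirichlet_form \<Omega> f \<phi> = - l2_inner \<Omega> (weak_laplacian \<Omega> f) \<phi>" if \<phi>: "\<phi> \<in> test_functions \<Omega>" for \<phi>
  proof -
    have "l2_inner \<Omega> (weak_pderiv \<Omega> [b] f) (weak_pderiv \<Omega> [b] \<phi>) = - l2_inner \<Omega> (weak_pderiv \<Omega> [b, b] f) \<phi>"
      if b: "b \<in> Basis" for b
    proof -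
      have w: "is_weak_pderiv \<Omega> [b] f (weak_pderiv \<Omega> [b] f)"
        using sobolev_weak_pderiv[OF f(1), of "[b]"] f b by simp
      have "is_weak_pderiv \<Omega> [b] (weak_pderiv \<Omega> [b] f) (weak_pderiv \<Omega> [b, b] f)"
        using is_weak_pderiv_append[OF w, of "[b]"] sobolev_weak_pderiv[OF f(1), of "[b, b]"] f b by simp
      then show ?thesis
        unfolding l2_inner_weak[OF w test_is_weak_pderiv[OF \<phi> b]] using \<phi>
        by (simp add: is_weak_pderiv_def l2_inner_def iter_pderiv_Cons)
    qed
    then have "dirichlet_form \<Omega> f \<phi> = - (\<Sum>b\<in>Basis. l2_inner \<Omega> (weak_pderiv \<Omega> [b, b] f) \<phi>)"
      by (simp add: dirichlet_form_def sum_negf)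
    also have "(\<Sum>b\<in>Basis. l2_inner \<Omega> (weak_pderiv \<Omega> [b, b] f) \<phi>) = l2_inner \<Omega> (weak_laplacian \<Omega> f) \<phi>"
      unfolding l2_inner_def weak_laplacian_def sum_distrib_right
      using f test_square_integrable[OF \<phi>]
      by (intro Bochner_Integration.integral_sum[symmetric] square_integrable_product)
         (auto intro!: weak_square_integrable sobolev_weak_pderiv)
    finally show ?thesis .
  qed
  have v1: "v \<in> elems (sobolev 1 \<Omega>)" using v H1_0_subset by blast
  have "\<bar>dirichlet_form \<Omega> f v + l2_inner \<Omega> (weak_laplacian \<Omega> f) v\<bar> \<le> \<epsilon>" if "\<epsilon> > 0" for \<epsilon>
  proof -
    have pos: "\<epsilon> / (K + 1) > 0" using that K by simp
    obtain \<phi> where \<phi>: "\<phi> \<in> test_functions \<Omega>" and le: "fnorm (sobolev 1 \<Omega>) (\<lambda>x. v x - \<phi> x) < \<epsilon> / (K + 1)"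
      using v pos unfolding H1_0_def by auto
    let ?d = "\<lambda>x. v x - \<phi> x"
    have p1: "\<phi> \<in> elems (sobolev 1 \<Omega>)" by (rule test_in_sobolev_1[OF \<phi>])
    have d1: "?d \<in> elems (sobolev 1 \<Omega>)" using D.lin_in[OF v1 p1, of 1 "-1"] by simp
    have eq: "dirichlet_form \<Omega> f v = dirichlet_form \<Omega> f ?d + dirichlet_form \<Omega> f \<phi>"
      "l2_inner \<Omega> (weak_laplacian \<Omega> f) v = l2_inner \<Omega> (weak_laplacian \<Omega> f) ?d + l2_inner \<Omega> (weak_laplacian \<Omega> f) \<phi>"
      using D.lin_right[OF d1 p1 f(3), of 1 1] L.lin_right[of ?d \<phi> "weak_laplacian \<Omega> f" 1 1]
        lap d1 p1 sobolev_square_integrable by auto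
    have "\<bar>dirichlet_form \<Omega> f v + l2_inner \<Omega> (weak_laplacian \<Omega> f) v\<bar>
        \<le> \<bar>dirichlet_form \<Omega> f ?d\<bar> + \<bar>l2_inner \<Omega> (weak_laplacian \<Omega> f) ?d\<bar>"
      unfolding eq using test[OF \<phi>] by linarith
    also have "\<dots> \<le> sqrt (dirichlet_form \<Omega> f f) * sqrt (dirichlet_form \<Omega> ?d ?d) +
        sqrt (l2_inner \<Omega> (weak_laplacian \<Omega> f) (weak_laplacian \<Omega> f)) * sqrt (l2_inner \<Omega> ?d ?d)"
      using D.cauchy_schwarz[OF f(3) d1] L.cauchy_schwarz[of "weak_laplacian \<Omega> f" ?d] lap
        sobolev_square_integrable[OF d1] by (intro add_mono) auto
    also have "\<dots> \<le> K * fnorm (sobolev 1 \<Omega>) ?d"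
      unfolding K_def distrib_right
      using real_sqrt_le_mono[OF l2_norm_le_sobolev_1[OF d1]] real_sqrt_le_mono[OF dirichlet_le_sobolev_1[OF d1]]
        D.nonneg[OF f(3)] semi_inner_product.nonneg[OF sobolev_semi_inner_product d1]
      by (intro add_mono mult_left_mono) (auto simp: l2_inner_nonneg fnorm_sobolev)
    also have "\<dots> \<le> K * (\<epsilon> / (K + 1))" using le K by (intro mult_left_mono) auto
    also have "\<dots> \<le> \<epsilon>" using that K by (simp add: field_simps)
    finally show ?thesis .
  qed
  then have "\<bar>dirichlet_form \<Omega> f v + l2_inner \<Omega> (weak_laplacian \<Omega> f) v\<bar> \<le> 0"
    by (rule field_le_epsilon[of _ 0, simplified])
  then show ?thesis by linarith
qed

lemma l2_norm_sum_le:
  assumes "\<And>i. i \<in> I \<Longrightarrow> square_integrable \<Omega> (f i)"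
  shows "sqrt (l2_inner \<Omega> (\<lambda>x. \<Sum>i\<in>I. f i x) (\<lambda>x. \<Sum>i\<in>I. f i x)) \<le> (\<Sum>i\<in>I. sqrt (l2_inner \<Omega> (f i) (f i)))"
  using assms
proof (induction I rule: infinite_finite_induct)
  case (insert i I)
  interpret L: semi_inner_product "{f. square_integrable \<Omega> f}" "l2_inner \<Omega>" by (rule l2_semi_inner_product)
  have "(\<lambda>x. \<Sum>i\<in>I. 1 * f i x) \<in> {f. square_integrable \<Omega> f}"
    using insert by (intro L.sum_in) auto
  then show ?case
    using insert L.norm_triangle[of "f i" "\<lambda>x. \<Sum>i\<in>I. f i x"] by auto
qed (auto simp: l2_inner_def)

text \<open>A first derivative of the Laplacian is a sum of \<open>DIM('a)\<close> third derivatives, and the Dirichlet norm is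
  at most the sum of the norms of \<open>DIM('a)\<close> first derivatives.  The estimate is applied to the initial
  velocity.\<close>

lemma dirichlet_norm_laplacian_le:
  assumes f: "f \<in> elems (sobolev 3 \<Omega>)" and g: "g \<in> elems (sobolev 1 \<Omega>)"
  shows "sqrt (dirichlet_form \<Omega> (\<lambda>x. weak_laplacian \<Omega> f x + g x) (\<lambda>x. weak_laplacian \<Omega> f x + g x))
     \<le> real (DIM('a)) * real (Suc (DIM('a))) * (fnorm (sobolev 3 \<Omega>) f + fnorm (sobolev 1 \<Omega>) g)"
proof -
  interpret L: semi_inner_product "{f. square_integrable \<Omega> f}" "l2_inner \<Omega>" by (rule l2_semi_inner_product)
  let ?h = "\<lambda>x. weak_laplacian \<Omega> f x + g x"
  let ?N = "fnorm (sobolev 3 \<Omega>) f + fnorm (sobolev 1 \<Omega>) g"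
  have nn: "0 \<le> fnorm (sobolev 3 \<Omega>) f" "0 \<le> fnorm (sobolev 1 \<Omega>) g"
    using semi_inner_product.nonneg[OF sobolev_semi_inner_product] f g by (auto simp: fnorm_sobolev)
  have b_le: "sqrt (l2_inner \<Omega> (weak_pderiv \<Omega> [b] ?h) (weak_pderiv \<Omega> [b] ?h)) \<le> real (Suc (DIM('a))) * ?N"
    if b: "b \<in> Basis" for b
  proof -
    let ?d = "\<lambda>c. weak_pderiv \<Omega> [c, c, b] f"
    have wc: "is_weak_pderiv \<Omega> [b] (weak_pderiv \<Omega> [c, c] f) (?d c)" if "c \<in> Basis" for c
      using is_weak_pderiv_append[of "[c, c]" f "weak_pderiv \<Omega> [c, c] f" "[b]" "?d c"]
        sobolev_weak_pderiv[OF f, of "[c, c]"] sobolev_weak_pderiv[OF f, of "[c, c, b]"] b that by simp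
    have wg: "is_weak_pderiv \<Omega> [b] g (weak_pderiv \<Omega> [b] g)"
      using sobolev_weak_pderiv[OF g, of "[b]"] b by simp
    have wl: "is_weak_pderiv \<Omega> [b] (weak_laplacian \<Omega> f) (\<lambda>x. \<Sum>c\<in>Basis. ?d c x)"
      using sum_weak_pderiv[of Basis "[b]" "\<lambda>c. weak_pderiv \<Omega> [c, c] f" ?d] wc b
      by (simp add: weak_laplacian_def[abs_def])
    have wh: "is_weak_pderiv \<Omega> [b] ?h (\<lambda>x. (\<Sum>c\<in>Basis. ?d c x) + weak_pderiv \<Omega> [b] g x)"
      using is_weak_pderiv_lincomb[OF wl wg, of 1 1] b by simp
    have "sqrt (l2_inner \<Omega> (weak_pderiv \<Omega> [b] ?h) (weak_pderiv \<Omega> [b] ?h))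
       \<le> sqrt (l2_inner \<Omega> (\<lambda>x. \<Sum>c\<in>Basis. ?d c x) (\<lambda>x. \<Sum>c\<in>Basis. ?d c x))
         + sqrt (l2_inner \<Omega> (weak_pderiv \<Omega> [b] g) (weak_pderiv \<Omega> [b] g))"
      unfolding l2_inner_weak[OF wh wh]
      using weak_square_integrable[OF wl] weak_square_integrable[OF wg] by (intro L.norm_triangle) auto
    also have "\<dots> \<le> (\<Sum>c\<in>(Basis::'a set). fnorm (sobolev 3 \<Omega>) f) + fnorm (sobolev 1 \<Omega>) g"
    proof (rule add_mono)
      have "sqrt (l2_inner \<Omega> (\<lambda>x. \<Sum>c\<in>Basis. ?d c x) (\<lambda>x. \<Sum>c\<in>Basis. ?d c x))
          \<le> (\<Sum>c\<in>Basis. sqrt (l2_inner \<Omega> (?d c) (?d c)))"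
        using wc weak_square_integrable by (intro l2_norm_sum_le) blast
      also have "\<dots> \<le> (\<Sum>c\<in>(Basis::'a set). fnorm (sobolev 3 \<Omega>) f)"
        using b by (intro sum_mono l2_norm_weak_pderiv_le) auto
      finally show "sqrt (l2_inner \<Omega> (\<lambda>x. \<Sum>c\<in>Basis. ?d c x) (\<lambda>x. \<Sum>c\<in>Basis. ?d c x))
          \<le> (\<Sum>c\<in>(Basis::'a set). fnorm (sobolev 3 \<Omega>) f)" .
      show "sqrt (l2_inner \<Omega> (weak_pderiv \<Omega> [b] g) (weak_pderiv \<Omega> [b] g)) \<le> fnorm (sobolev 1 \<Omega>) g"
        using b by (intro l2_norm_weak_pderiv_le) auto
    qed
    also have "\<dots> \<le> real (Suc (DIM('a))) * ?N"
      using nn by (simp add: algebra_simps)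
    finally show ?thesis .
  qed
  have "sqrt (dirichlet_form \<Omega> ?h ?h) \<le> (\<Sum>b\<in>Basis. sqrt (l2_inner \<Omega> (weak_pderiv \<Omega> [b] ?h) (weak_pderiv \<Omega> [b] ?h)))"
    unfolding dirichlet_form_def using L2_set_le_sum[of Basis "\<lambda>b. sqrt (l2_inner \<Omega> (weak_pderiv \<Omega> [b] ?h) (weak_pderiv \<Omega> [b] ?h))"]
    by (simp add: L2_set_def l2_inner_nonneg)
  also have "\<dots> \<le> (\<Sum>b\<in>(Basis::'a set). real (Suc (DIM('a))) * ?N)"
    by (intro sum_mono b_le)
  finally show ?thesis by (simp add: mult.assoc)
qed

end

section \<open>Measurable functions of time with values in a function space\<close>

text \<open>The laws shared by the spaces \<open>L\<^sup>2\<close>, \<open>H\<^sup>k\<close>, \<open>H\<^sub>0\<^sup>1\<close> and the dual space, so that measurability and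
  integration in time are treated once for all of them.\<close>

locale seminormed_fspace =
  fixes X :: "'x fspace"
  assumes zero_elems: "(\<lambda>_. 0) \<in> elems X"
    and lin_elems: "f \<in> elems X \<Longrightarrow> g \<in> elems X \<Longrightarrow> (\<lambda>x. a * f x + b * g x) \<in> elems X"
    and fnorm_scale: "f \<in> elems X \<Longrightarrow> fnorm X (\<lambda>x. a * f x) = \<bar>a\<bar> * fnorm X f"
    and fnorm_triangle: "f \<in> elems X \<Longrightarrow> g \<in> elems X \<Longrightarrow> fnorm X (\<lambda>x. f x + g x) \<le> fnorm X f + fnorm X g"
    and fnorm_nonneg: "f \<in> elems X \<Longrightarrow> 0 \<le> fnorm X f"
begin

lemma fnorm_zero [simp]: "fnorm X (\<lambda>_. 0) = 0"
  using fnorm_scale[OF zero_elems, of 0] by simp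

lemma scale_elems: "f \<in> elems X \<Longrightarrow> (\<lambda>x. a * f x) \<in> elems X"
  using lin_elems[of f f a 0] by simp

lemma add_elems: "f \<in> elems X \<Longrightarrow> g \<in> elems X \<Longrightarrow> (\<lambda>x. f x + g x) \<in> elems X"
  using lin_elems[of f g 1 1] by simp

lemma diff_elems: "f \<in> elems X \<Longrightarrow> g \<in> elems X \<Longrightarrow> (\<lambda>x. f x - g x) \<in> elems X"
  using lin_elems[of f g 1 "-1"] by simp

lemma fnorm_minus_commute:
  "f \<in> elems X \<Longrightarrow> g \<in> elems X \<Longrightarrow> fnorm X (\<lambda>x. f x - g x) = fnorm X (\<lambda>x. g x - f x)"
  using fnorm_scale[OF diff_elems, of f g "-1"] by simp

lemma fnorm_diff_triangle:
  assumes "f \<in> elems X" "g \<in> elems X"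
  shows "fnorm X f \<le> fnorm X (\<lambda>x. f x - g x) + fnorm X g"
  using fnorm_triangle[OF diff_elems[OF assms] assms(2)] by simp

lemma fnorm_diff_abs:
  assumes "f \<in> elems X" "g \<in> elems X"
  shows "\<bar>fnorm X g - fnorm X f\<bar> \<le> fnorm X (\<lambda>x. f x - g x)"
  using fnorm_diff_triangle[OF assms] fnorm_diff_triangle[OF assms(2,1)] fnorm_minus_commute[OF assms]
  by linarith

end

lemma semi_inner_product_fspace:
  assumes "semi_inner_product (elems X) B" "\<And>f. fnorm X f = sqrt (B f f)"
  shows "seminormed_fspace X"
proof -
  interpret semi_inner_product "elems X" B by fact
  show ?thesis
    by unfold_locales
      (auto simp: assms(2) zero_in lin_in norm_scale norm_triangle nonneg)
qed

text \<open>In contrast to \<open>strongly_measurable\<close>, everything holds at every time and the step functions are Borel.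
  Composition with translations and measurability on products then need no treatment of null sets.\<close>

definition strongly_borel :: "'x fspace \<Rightarrow> (real \<Rightarrow> 'x \<Rightarrow> real) \<Rightarrow> bool" where
  "strongly_borel X f \<longleftrightarrow> (\<forall>t. f t \<in> elems X) \<and>
     (\<exists>s. (\<forall>n::nat. simple_function borel (s n) \<and> (\<forall>t. s n t \<in> elems X)) \<and>
        (\<forall>t. (\<lambda>n. fnorm X (\<lambda>x. f t x - s n t x)) \<longlonglongrightarrow> 0))"

lemma strongly_borel_elems: "strongly_borel X f \<Longrightarrow> f t \<in> elems X"
  by (simp add: strongly_borel_def)

lemma strongly_borel_shift:
  assumes "strongly_borel X f" shows "strongly_borel X (\<lambda>t. f (t - c))"
proof -
  obtain s where s: "\<And>n::nat. simple_function borel (s n)" "\<And>n t. s n t \<in> elems X"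
     "\<And>t. (\<lambda>n. fnorm X (\<lambda>x. f t x - s n t x)) \<longlonglongrightarrow> 0"
    using assms unfolding strongly_borel_def by blast
  have "simple_function borel (\<lambda>t. s n (t - c))" for n
    by (rule simple_function_comp[OF _ s(1)]) simp
  then show ?thesis
    using assms s unfolding strongly_borel_def by (intro conjI exI[of _ "\<lambda>n t. s n (t - c)"]) auto
qed

context seminormed_fspace
begin

lemma strongly_borel_const: "v \<in> elems X \<Longrightarrow> strongly_borel X (\<lambda>_. v)"
  unfolding strongly_borel_def by (auto intro!: exI[of _ "\<lambda>_ _. v"])

lemma strongly_borel_add:
  assumes f: "strongly_borel X f" and g: "strongly_borel X g"
  shows "strongly_borel X (\<lambda>t x. f t x + g t x)"
proof -
  obtain s where s: "\<And>n::nat. simple_function borel (s n)" "\<And>n t. s n t \<in> elems X"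
     "\<And>t. (\<lambda>n. fnorm X (\<lambda>x. f t x - s n t x)) \<longlonglongrightarrow> 0"
    using f unfolding strongly_borel_def by blast
  obtain r where r: "\<And>n::nat. simple_function borel (r n)" "\<And>n t. r n t \<in> elems X"
     "\<And>t. (\<lambda>n. fnorm X (\<lambda>x. g t x - r n t x)) \<longlonglongrightarrow> 0"
    using g unfolding strongly_borel_def by blast
  have el: "f t \<in> elems X" "g t \<in> elems X" for t
    using f g strongly_borel_elems by auto
  have "(\<lambda>n. fnorm X (\<lambda>x. (f t x + g t x) - (s n t x + r n t x))) \<longlonglongrightarrow> 0" for t
  proof (rule tendsto_sandwich[OF _ _ tendsto_const])
    show "(\<lambda>n. fnorm X (\<lambda>x. f t x - s n t x) + fnorm X (\<lambda>x. g t x - r n t x)) \<longlonglongrightarrow> 0"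
      using tendsto_add[OF s(3) r(3)] by simp
    show "\<forall>\<^sub>F n in sequentially. fnorm X (\<lambda>x. (f t x + g t x) - (s n t x + r n t x))
        \<le> fnorm X (\<lambda>x. f t x - s n t x) + fnorm X (\<lambda>x. g t x - r n t x)"
      using fnorm_triangle[OF diff_elems[OF el(1) s(2)] diff_elems[OF el(2) r(2)]]
      by (simp add: algebra_simps)
    show "\<forall>\<^sub>F n in sequentially. 0 \<le> fnorm X (\<lambda>x. (f t x + g t x) - (s n t x + r n t x))"
      by (intro always_eventually allI fnorm_nonneg diff_elems add_elems el s r)
  qed
  moreover have "simple_function borel (\<lambda>t x. s n t x + r n t x)" for n
    using simple_function_compose2[OF s(1) r(1), of "\<lambda>u v x. u x + v x"] by simp
  ultimately show ?thesis
    using el s r add_elems unfolding strongly_borel_def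
    by (intro conjI exI[of _ "\<lambda>n t x. s n t x + r n t x"]) auto
qed

lemma strongly_borel_scale:
  fixes \<alpha> :: "real \<Rightarrow> real"
  assumes f: "strongly_borel X f" and \<alpha>: "\<alpha> \<in> borel_measurable borel"
  shows "strongly_borel X (\<lambda>t x. \<alpha> t * f t x)"
proof -
  obtain s where s: "\<And>n::nat. simple_function borel (s n)" "\<And>n t. s n t \<in> elems X"
     "\<And>t. (\<lambda>n. fnorm X (\<lambda>x. f t x - s n t x)) \<longlonglongrightarrow> 0"
    using f unfolding strongly_borel_def by blast
  obtain a :: "nat \<Rightarrow> real \<Rightarrow> real" where a: "\<And>n. simple_function borel (a n)" "\<And>t. (\<lambda>n. a n t) \<longlonglongrightarrow> \<alpha> t"
    using borel_measurable_implies_sequence_metric[OF \<alpha>, of 0] by auto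
  have el: "f t \<in> elems X" for t
    using f strongly_borel_elems by auto
  have "(\<lambda>n. fnorm X (\<lambda>x. \<alpha> t * f t x - a n t * s n t x)) \<longlonglongrightarrow> 0" for t
  proof (rule tendsto_sandwich[OF _ _ tendsto_const])
    have "(\<lambda>n. \<bar>\<alpha> t - a n t\<bar> * fnorm X (f t) + \<bar>a n t\<bar> * fnorm X (\<lambda>x. f t x - s n t x))
        \<longlonglongrightarrow> \<bar>\<alpha> t - \<alpha> t\<bar> * fnorm X (f t) + \<bar>\<alpha> t\<bar> * 0"
      by (intro tendsto_intros a s)
    then show "(\<lambda>n. \<bar>\<alpha> t - a n t\<bar> * fnorm X (f t) + \<bar>a n t\<bar> * fnorm X (\<lambda>x. f t x - s n t x)) \<longlonglongrightarrow> 0"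
      by simp
    show "\<forall>\<^sub>F n in sequentially. fnorm X (\<lambda>x. \<alpha> t * f t x - a n t * s n t x)
        \<le> \<bar>\<alpha> t - a n t\<bar> * fnorm X (f t) + \<bar>a n t\<bar> * fnorm X (\<lambda>x. f t x - s n t x)"
    proof (rule always_eventually, rule allI)
      fix n
      have "fnorm X (\<lambda>x. \<alpha> t * f t x - a n t * s n t x)
         = fnorm X (\<lambda>x. (\<alpha> t - a n t) * f t x + a n t * (f t x - s n t x))"
        by (simp add: algebra_simps)
      also have "\<dots> \<le> fnorm X (\<lambda>x. (\<alpha> t - a n t) * f t x) + fnorm X (\<lambda>x. a n t * (f t x - s n t x))"
        by (intro fnorm_triangle scale_elems diff_elems el s)
      also have "\<dots> = \<bar>\<alpha> t - a n t\<bar> * fnorm X (f t) + \<bar>a n t\<bar> * fnorm X (\<lambda>x. f t x - s n t x)"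
        using fnorm_scale[OF el] fnorm_scale[OF diff_elems[OF el s(2)]] by simp
      finally show "fnorm X (\<lambda>x. \<alpha> t * f t x - a n t * s n t x)
        \<le> \<bar>\<alpha> t - a n t\<bar> * fnorm X (f t) + \<bar>a n t\<bar> * fnorm X (\<lambda>x. f t x - s n t x)" .
    qed
    show "\<forall>\<^sub>F n in sequentially. 0 \<le> fnorm X (\<lambda>x. \<alpha> t * f t x - a n t * s n t x)"
      by (intro always_eventually allI fnorm_nonneg diff_elems scale_elems el s)
  qed
  moreover have "simple_function borel (\<lambda>t x. a n t * s n t x)" for n
    using simple_function_compose2[OF a(1) s(1), of "\<lambda>u v x. u * v x"] by simp
  ultimately show ?thesis
    using el s scale_elems unfolding strongly_borel_def
    by (intro conjI exI[of _ "\<lambda>n t x. a n t * s n t x"]) auto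
qed

lemma strongly_borel_lincomb:
  assumes "strongly_borel X f" "strongly_borel X g"
  shows "strongly_borel X (\<lambda>t x. a * f t x + b * g t x)"
  using strongly_borel_add[OF strongly_borel_scale[OF assms(1), of "\<lambda>_. a"] strongly_borel_scale[OF assms(2), of "\<lambda>_. b"]]
  by simp

lemma strongly_borel_norm:
  assumes "strongly_borel X f" shows "(\<lambda>t. fnorm X (f t)) \<in> borel_measurable borel"
proof -
  obtain s where s: "\<And>n::nat. simple_function borel (s n)" "\<And>n t. s n t \<in> elems X"
     "\<And>t. (\<lambda>n. fnorm X (\<lambda>x. f t x - s n t x)) \<longlonglongrightarrow> 0"
    using assms unfolding strongly_borel_def by blast
  show ?thesis
  proof (rule borel_measurable_LIMSEQ_real)
    show "(\<lambda>t. fnorm X (s n t)) \<in> borel_measurable borel" for n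
      using simple_function_compose1[OF s(1), of "fnorm X"] by (rule borel_measurable_simple_function)
    show "(\<lambda>n. fnorm X (s n t)) \<longlonglongrightarrow> fnorm X (f t)" for t
    proof (rule LIM_zero_cancel, rule tendsto_rabs_zero_cancel, rule tendsto_sandwich[OF _ _ tendsto_const s(3)])
      show "\<forall>\<^sub>F n in sequentially. \<bar>fnorm X (s n t) - fnorm X (f t)\<bar> \<le> fnorm X (\<lambda>x. f t x - s n t x)"
        using fnorm_diff_abs[OF strongly_borel_elems[OF assms] s(2)] by simp
    qed simp
  qed
qed

text \<open>Cutting the approximants off where their norm exceeds twice the norm of the limit does not
  affect convergence and provides the domination that limits under integrals need.\<close>

lemma strongly_borel_dominated:
  assumes "strongly_borel X f"
  obtains s where "\<And>n::nat. simple_function borel (s n)" "\<And>n t. s n t \<in> elems X"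
     "\<And>t. (\<lambda>n. fnorm X (\<lambda>x. f t x - s n t x)) \<longlonglongrightarrow> 0" "\<And>n t. fnorm X (s n t) \<le> 2 * fnorm X (f t)"
proof -
  obtain s where s: "\<And>n::nat. simple_function borel (s n)" "\<And>n t. s n t \<in> elems X"
     "\<And>t. (\<lambda>n. fnorm X (\<lambda>x. f t x - s n t x)) \<longlonglongrightarrow> 0"
    using assms unfolding strongly_borel_def by blast
  note el = strongly_borel_elems[OF assms]
  define r where "r n t = (if fnorm X (s n t) \<le> 2 * fnorm X (f t) then s n t else (\<lambda>_. 0))" for n t
  have meas: "(\<lambda>t. fnorm X (s n t)) \<in> borel_measurable borel" for n
    using simple_function_compose1[OF s(1), of "fnorm X"] by (rule borel_measurable_simple_function)
  have "simple_function borel (r n)" for n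
    unfolding r_def using meas strongly_borel_norm[OF assms]
    by (intro simple_function_If s) auto
  moreover have "r n t \<in> elems X" for n t
    using s(2) zero_elems by (simp add: r_def)
  moreover have "(\<lambda>n. fnorm X (\<lambda>x. f t x - r n t x)) \<longlonglongrightarrow> 0" for t
  proof (cases "fnorm X (f t) = 0")
    case True
    have "fnorm X (\<lambda>x. f t x - r n t x) \<le> 0" for n
    proof -
      have "fnorm X (r n t) \<le> 0" using True by (simp add: r_def)
      then show ?thesis
        using fnorm_triangle[OF el[of t] scale_elems[of "r n t" "-1"]] fnorm_scale[of "r n t" "-1"]
          True s(2) zero_elems by (simp add: r_def split: if_splits)
    qed
    then have "fnorm X (\<lambda>x. f t x - r n t x) = 0" for n
      using fnorm_nonneg[OF diff_elems[OF el]] \<open>\<And>n t. r n t \<in> elems X\<close> by (simp add: order_antisym)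
    then show ?thesis by simp
  next
    case False
    then have pos: "fnorm X (f t) > 0" using fnorm_nonneg[OF el, of t] by simp
    have "\<forall>\<^sub>F n in sequentially. fnorm X (\<lambda>x. f t x - s n t x) < fnorm X (f t)"
      using s(3)[of t] pos by (rule order_tendstoD)
    then have "\<forall>\<^sub>F n in sequentially. fnorm X (\<lambda>x. f t x - s n t x) = fnorm X (\<lambda>x. f t x - r n t x)"
    proof eventually_elim
      case (elim n)
      have "fnorm X (s n t) \<le> 2 * fnorm X (f t)"
        using fnorm_diff_abs[OF el[of t] s(2)[of n t]] elim by linarith
      then show ?case by (simp add: r_def)
    qed
    then show ?thesis by (rule Lim_transform_eventually[OF s(3)])
  qed
  moreover have "fnorm X (r n t) \<le> 2 * fnorm X (f t)" for n t
    using fnorm_nonneg[OF el, of t] by (simp add: r_def)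
  ultimately show ?thesis using that by blast
qed

text \<open>Step functions for the Lebesgue measure agree with Borel step functions off a null set; on a Borel null
  set that contains these null sets and the times without convergence, the representative is set to 0.\<close>

lemma strongly_measurable_representative:
  assumes "strongly_measurable T X f"
  obtains g where "strongly_borel X g" "\<And>t. t \<notin> {0<..<T} \<Longrightarrow> g t = (\<lambda>_. 0)"
    "AE t in lborel. t \<in> {0<..<T} \<longrightarrow> f t = g t"
proof -
  define S where "S = {0<..<T}"
  have S[simp]: "S \<in> sets lebesgue" "S \<in> sets borel" by (auto simp: S_def)
  obtain s where s: "\<And>n::nat. simple_in T X (s n)"
    and lim: "AE t in time_measure T. (\<lambda>n. fnorm X (\<lambda>x. f t x - s n t x)) \<longlonglongrightarrow> 0"
    and el: "AE t in time_measure T. f t \<in> elems X"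
    using assms unfolding strongly_measurable_def by blast
  define s1 where "s1 n t = (if t \<in> S then s n t else (\<lambda>_. 0))" for n t
  have "simple_function lebesgue (s1 n)" for n
    unfolding simple_function_def
  proof (intro conjI ballI)
    have sf: "finite (s n ` S)" "\<And>v. s n -` {v} \<inter> S \<in> sets lebesgue"
    proof -
      have *: "simple_function (lebesgue_on S) (s n)" using s unfolding simple_in_def S_def by blast
      then show "finite (s n ` S)" by (simp add: simple_function_def)
      have "s n -` {v} \<inter> S \<in> sets (lebesgue_on S)" for v
        using simple_functionD(2)[OF *, of "{v}"] by simp
      then show "s n -` {v} \<inter> S \<in> sets lebesgue" for v
        by (simp add: sets_restrict_space_iff)
    qed
    have "s1 n ` space lebesgue \<subseteq> insert (\<lambda>_. 0) (s n ` S)"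
      by (auto simp: s1_def)
    then show "finite (s1 n ` space lebesgue)"
      using sf(1) finite_subset by blast
    fix v
    have "s1 n -` {v} \<inter> space lebesgue = (s n -` {v} \<inter> S) \<union> (if v = (\<lambda>_. 0) then - S else {})"
      by (auto simp: s1_def split: if_splits)
    moreover have "- S \<in> sets lebesgue" using S by (metis Compl_in_sets_lebesgue)
    ultimately show "s1 n -` {v} \<inter> space lebesgue \<in> sets lebesgue"
      using sf(2) by auto
  qed
  then have "\<forall>n. \<exists>s'. simple_function lborel s' \<and> (AE t in lborel. s1 n t = s' t)"
    using completion_ex_simple_function by blast
  then obtain s2 where s2: "\<And>n. simple_function lborel (s2 n)" "\<And>n. AE t in lborel. s1 n t = s2 n t"
    by metis
  have "AE t in lborel. t \<in> S \<longrightarrow> (\<forall>n. s1 n t = s2 n t) \<and> f t \<in> elems X \<and> (\<lambda>n. fnorm X (\<lambda>x. f t x - s n t x)) \<longlonglongrightarrow> 0"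
  proof -
    have "AE t in lborel. t \<in> S \<longrightarrow> (\<lambda>n. fnorm X (\<lambda>x. f t x - s n t x)) \<longlonglongrightarrow> 0"
      using lim unfolding S_def[symmetric] AE_lebesgue_on_iff[OF S(1)] AE_completion_iff .
    moreover have "AE t in lborel. t \<in> S \<longrightarrow> f t \<in> elems X"
      using el unfolding S_def[symmetric] AE_lebesgue_on_iff[OF S(1)] AE_completion_iff .
    moreover have "AE t in lborel. \<forall>n. s1 n t = s2 n t"
      using s2(2) by (simp add: AE_all_countable)
    ultimately show ?thesis by eventually_elim auto
  qed
  then obtain N where N: "N \<in> null_sets lborel"
    and good: "\<And>t. t \<notin> N \<Longrightarrow> t \<in> S \<Longrightarrow> (\<forall>n. s1 n t = s2 n t) \<and> f t \<in> elems X \<and> (\<lambda>n. fnorm X (\<lambda>x. f t x - s n t x)) \<longlonglongrightarrow> 0"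
  proof -
    assume *: "\<And>N. N \<in> null_sets lborel \<Longrightarrow> (\<And>t. t \<notin> N \<Longrightarrow> t \<in> S \<Longrightarrow> (\<forall>n. s1 n t = s2 n t) \<and> f t \<in> elems X \<and>
       (\<lambda>n. fnorm X (\<lambda>x. f t x - s n t x)) \<longlonglongrightarrow> 0) \<Longrightarrow> thesis"
    assume "AE t in lborel. t \<in> S \<longrightarrow> (\<forall>n. s1 n t = s2 n t) \<and> f t \<in> elems X \<and> (\<lambda>n. fnorm X (\<lambda>x. f t x - s n t x)) \<longlonglongrightarrow> 0"
    then obtain N where N: "N \<in> null_sets lborel" and sub: "{t \<in> space lborel. \<not> (t \<in> S \<longrightarrow> (\<forall>n. s1 n t = s2 n t) \<and> f t \<in> elems X \<and>
       (\<lambda>n. fnorm X (\<lambda>x. f t x - s n t x)) \<longlonglongrightarrow> 0)} \<subseteq> N"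
      unfolding eventually_ae_filter by blast
    show thesis
    proof (rule *[OF N])
      fix t assume "t \<notin> N" "t \<in> S"
      then show "(\<forall>n. s1 n t = s2 n t) \<and> f t \<in> elems X \<and> (\<lambda>n. fnorm X (\<lambda>x. f t x - s n t x)) \<longlonglongrightarrow> 0"
        using sub[THEN subsetD, of t] by auto
    qed
  qed
  have Nb: "N \<in> sets borel" using N by auto
  define g where "g t = (if t \<in> S - N then f t else (\<lambda>_. 0))" for t
  define r where "r n t = (if t \<in> S - N then s2 n t else (\<lambda>_. 0))" for n t
  have sb: "simple_function borel (s2 n)" for n
    using s2(1) by (simp add: simple_function_def)
  have r_eq: "r n t = s n t" if "t \<in> S - N" for n t
    using good[of t] that by (auto simp: r_def s1_def)
  have "strongly_borel X g"
    unfolding strongly_borel_def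
  proof (intro conjI allI exI[of _ r])
    show "g t \<in> elems X" for t using good[of t] zero_elems by (auto simp: g_def)
    show "simple_function borel (r n)" for n
      unfolding r_def using Nb by (intro simple_function_If_set sb) auto
    show "r n t \<in> elems X" for n t
    proof (cases "t \<in> S - N")
      case True
      then show ?thesis using r_eq s unfolding simple_in_def S_def by auto
    next
      case False
      then have "r n t = (\<lambda>_. 0)" unfolding r_def by (rule if_not_P)
      then show ?thesis using zero_elems by simp
    qed
    show "(\<lambda>n. fnorm X (\<lambda>x. g t x - r n t x)) \<longlonglongrightarrow> 0" for t
    proof (cases "t \<in> S - N")
      case True
      then show ?thesis using r_eq good[of t] by (simp add: g_def)
    next
      case False
      then have "g t = (\<lambda>_. 0)" "r n t = (\<lambda>_. 0)" for n by (auto simp: g_def r_def)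
      then show ?thesis by simp
    qed
  qed
  moreover have "g t = (\<lambda>_. 0)" if "t \<notin> {0<..<T}" for t
    using that by (auto simp: g_def S_def)
  moreover have "AE t in lborel. t \<in> {0<..<T} \<longrightarrow> f t = g t"
    using AE_not_in[OF N] by eventually_elim (auto simp: g_def S_def)
  ultimately show ?thesis using that by blast
qed

end

lemma integrable_indicator_Ioo:
  "integrable lborel (indicator {a<..<b} :: real \<Rightarrow> real)" for a b :: real
  using emeasure_bounded_finite[of "{a<..<b}"] by (intro integrable_real_indicator) auto

lemma measurable_indicator_triangle [measurable]:
  "(\<lambda>z::real \<times> real. indicator {..<fst z} (snd z) :: real) \<in> borel_measurable (borel \<Otimes>\<^sub>M borel)"
  "(\<lambda>z::real \<times> real. indicator {..<snd z} (fst z) :: real) \<in> borel_measurable (borel \<Otimes>\<^sub>M borel)"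
  "(\<lambda>z::real \<times> real. indicator {snd z<..} (fst z) :: real) \<in> borel_measurable (borel \<Otimes>\<^sub>M borel)"
proof -
  have "{z::real \<times> real. snd z < fst z} \<in> sets (borel \<Otimes>\<^sub>M borel)"
    "{z::real \<times> real. fst z < snd z} \<in> sets (borel \<Otimes>\<^sub>M borel)"
    unfolding borel_prod by (auto intro!: borel_open open_Collect_less continuous_intros)
  then have "(indicator {z::real \<times> real. snd z < fst z} :: _ \<Rightarrow> real) \<in> borel_measurable (borel \<Otimes>\<^sub>M borel)"
    "(indicator {z::real \<times> real. fst z < snd z} :: _ \<Rightarrow> real) \<in> borel_measurable (borel \<Otimes>\<^sub>M borel)"
    by (auto intro!: borel_measurable_indicator)
  moreover have
    "(\<lambda>z::real \<times> real. indicator {..<fst z} (snd z)) = (indicator {z. snd z < fst z} :: _ \<Rightarrow> real)"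
    "(\<lambda>z::real \<times> real. indicator {..<snd z} (fst z)) = (indicator {z. fst z < snd z} :: _ \<Rightarrow> real)"
    "(\<lambda>z::real \<times> real. indicator {snd z<..} (fst z)) = (indicator {z. snd z < fst z} :: _ \<Rightarrow> real)"
    by (auto simp: fun_eq_iff indicator_def)
  ultimately show
    "(\<lambda>z::real \<times> real. indicator {..<fst z} (snd z) :: real) \<in> borel_measurable (borel \<Otimes>\<^sub>M borel)"
    "(\<lambda>z::real \<times> real. indicator {..<snd z} (fst z) :: real) \<in> borel_measurable (borel \<Otimes>\<^sub>M borel)"
    "(\<lambda>z::real \<times> real. indicator {snd z<..} (fst z) :: real) \<in> borel_measurable (borel \<Otimes>\<^sub>M borel)"
    by (simp_all only:)
qed

lemma integral_indicator_Ioo: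
  fixes h :: "real \<Rightarrow> real"
  assumes "\<And>r. r \<le> 0 \<Longrightarrow> h r = 0"
  shows "(LINT r|lborel. indicator {0<..<t} r * h r) = (LINT r|lborel. indicator {..<t} r * h r)"
  using assms by (intro Bochner_Integration.integral_cong refl) (auto simp: indicator_def)

lemma integrable_tensor:
  fixes f g :: "real \<Rightarrow> real"
  assumes f: "integrable lborel f" and g: "integrable lborel g"
  shows "integrable (lborel \<Otimes>\<^sub>M lborel) (\<lambda>(t, s). f t * g s)"
proof (rule lborel_pair.Fubini_integrable)
  have [measurable]: "f \<in> borel_measurable borel" "g \<in> borel_measurable borel"
    using f g by auto
  show "(\<lambda>(t, s). f t * g s) \<in> borel_measurable (lborel \<Otimes>\<^sub>M lborel)"
    by measurable
  show "integrable lborel (\<lambda>t. LINT s|lborel. norm (case (t, s) of (t, s) \<Rightarrow> f t * g s))"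
    using f by (simp add: abs_mult)
  show "AE t in lborel. integrable lborel (\<lambda>s. case (t, s) of (t, s) \<Rightarrow> f t * g s)"
    using g by simp
qed

text \<open>Integrals over the interval become integrals over the whole line, where Fubini's theorem and
  translations apply.\<close>

lemma time_measure_transfer:
  fixes h H :: "real \<Rightarrow> real"
  assumes H: "H \<in> borel_measurable borel" "\<And>t. t \<notin> {0<..<T} \<Longrightarrow> H t = 0"
    and ae: "AE t in lborel. t \<in> {0<..<T} \<longrightarrow> h t = H t"
  shows "(LINT t|time_measure T. h t) = (LINT t|lborel. H t)"
    and "integrable (time_measure T) h \<longleftrightarrow> integrable lborel H"
proof -
  have S: "{0<..<T} \<inter> space lebesgue \<in> sets lebesgue" by auto
  have ae': "AE t in lebesgue. H t = indicator {0<..<T} t *\<^sub>R h t"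
    by (rule AE_completion, use ae in eventually_elim) (use H(2) in \<open>auto simp: indicator_def\<close>)
  have Hm: "H \<in> borel_measurable lebesgue" using H(1) by (intro measurable_completion) simp
  have hm: "(\<lambda>t. indicator {0<..<T} t *\<^sub>R h t) \<in> borel_measurable lebesgue"
    by (rule borel_measurable_AE[OF Hm ae'])
  show "(LINT t|time_measure T. h t) = (LINT t|lborel. H t)"
    using integral_cong_AE[OF Hm hm ae'] H(1)
    by (simp add: integral_restrict_space[OF S] integral_completion)
  show "integrable (time_measure T) h \<longleftrightarrow> integrable lborel H"
    using integrable_cong_AE[OF Hm hm ae'] H(1)
    by (simp add: integrable_restrict_space[OF S] integrable_completion)
qed

text \<open>The extension by 0 gives a meaning to time shifts and difference quotients near the ends of the
  interval.\<close>

definition L2_representative :: "real \<Rightarrow> 'x fspace \<Rightarrow> (real \<Rightarrow> 'x \<Rightarrow> real) \<Rightarrow> bool" where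
  "L2_representative T X f \<longleftrightarrow> strongly_borel X f \<and> (\<forall>t. t \<notin> {0<..<T} \<longrightarrow> f t = (\<lambda>_. 0)) \<and>
     integrable lborel (\<lambda>t. (fnorm X (f t))\<^sup>2)"

definition bounded_functional :: "'x fspace \<Rightarrow> (('x \<Rightarrow> real) \<Rightarrow> real) \<Rightarrow> bool" where
  "bounded_functional X F \<longleftrightarrow>
       (\<forall>v\<in>elems X. \<forall>w\<in>elems X. \<forall>a b. F (\<lambda>x. a * v x + b * w x) = a * F v + b * F w) \<and>
       (\<exists>K. \<forall>v\<in>elems X. \<bar>F v\<bar> \<le> K * fnorm X v)"

lemma bounded_functional_lin:
  "bounded_functional X F \<Longrightarrow> v \<in> elems X \<Longrightarrow> w \<in> elems X \<Longrightarrow> F (\<lambda>x. a * v x + b * w x) = a * F v + b * F w"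
  by (simp add: bounded_functional_def)

context seminormed_fspace
begin

lemma bounded_functional_scale:
  "bounded_functional X F \<Longrightarrow> v \<in> elems X \<Longrightarrow> F (\<lambda>x. a * v x) = a * F v"
  using bounded_functional_lin[of X F v v a 0] by simp

lemma bounded_functional_diff:
  "bounded_functional X F \<Longrightarrow> v \<in> elems X \<Longrightarrow> w \<in> elems X \<Longrightarrow> F (\<lambda>x. v x - w x) = F v - F w"
  using bounded_functional_lin[of X F v w 1 "-1"] by simp

lemma bounded_functional_bound:
  assumes "bounded_functional X F"
  obtains K where "K \<ge> 0" "\<And>v. v \<in> elems X \<Longrightarrow> \<bar>F v\<bar> \<le> K * fnorm X v"
proof -
  obtain K where K: "\<And>v. v \<in> elems X \<Longrightarrow> \<bar>F v\<bar> \<le> K * fnorm X v"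
    using assms unfolding bounded_functional_def by blast
  have "\<bar>F v\<bar> \<le> \<bar>K\<bar> * fnorm X v" if "v \<in> elems X" for v
    using K[OF that] mult_right_mono[OF abs_ge_self[of K] fnorm_nonneg[OF that]] by linarith
  then show ?thesis using that[of "\<bar>K\<bar>"] by auto
qed

lemma bounded_functional_null:
  assumes "bounded_functional X F" "v \<in> elems X" "w \<in> elems X" "fnorm X (\<lambda>x. v x - w x) = 0"
  shows "F v = F w"
proof -
  obtain K where "\<And>v. v \<in> elems X \<Longrightarrow> \<bar>F v\<bar> \<le> K * fnorm X v"
    using bounded_functional_bound[OF assms(1)] by blast
  from this[OF diff_elems[OF assms(2,3)]] show ?thesis
    using bounded_functional_diff[OF assms(1-3)] assms(4) by simp
qed

lemma linear_combination:
  assumes "finite A" "A \<subseteq> elems X"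
  shows "(\<lambda>x. \<Sum>v\<in>A. c v * v x) \<in> elems X"
    and "bounded_functional X F \<Longrightarrow> F (\<lambda>x. \<Sum>v\<in>A. c v * v x) = (\<Sum>v\<in>A. c v * F v)"
    and "fnorm X (\<lambda>x. \<Sum>v\<in>A. c v * v x) \<le> (\<Sum>v\<in>A. \<bar>c v\<bar> * fnorm X v)"
proof -
  have "(\<lambda>x. \<Sum>v\<in>A. c v * v x) \<in> elems X \<and>
    (bounded_functional X F \<longrightarrow> F (\<lambda>x. \<Sum>v\<in>A. c v * v x) = (\<Sum>v\<in>A. c v * F v)) \<and>
    fnorm X (\<lambda>x. \<Sum>v\<in>A. c v * v x) \<le> (\<Sum>v\<in>A. \<bar>c v\<bar> * fnorm X v)"
    using assms
  proof (induction A)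
    case empty
    then show ?case using zero_elems bounded_functional_scale[OF _ zero_elems, of F 0] by auto
  next
    case (insert v A)
    let ?s = "\<lambda>x. \<Sum>v\<in>A. c v * v x"
    have v: "v \<in> elems X" and s: "?s \<in> elems X" using insert by auto
    show ?case
      using insert lin_elems[OF v s, of "c v" 1] bounded_functional_lin[OF _ v s, of F "c v" 1]
        fnorm_triangle[OF scale_elems[OF v, of "c v"] s] fnorm_scale[OF v, of "c v"] by auto
  qed
  then show "(\<lambda>x. \<Sum>v\<in>A. c v * v x) \<in> elems X"
    "bounded_functional X F \<Longrightarrow> F (\<lambda>x. \<Sum>v\<in>A. c v * v x) = (\<Sum>v\<in>A. c v * F v)"
    "fnorm X (\<lambda>x. \<Sum>v\<in>A. c v * v x) \<le> (\<Sum>v\<in>A. \<bar>c v\<bar> * fnorm X v)"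
    by blast+
qed

lemma strongly_borel_functional:
  assumes f: "strongly_borel X f" and F: "bounded_functional X F"
  shows "(\<lambda>t. F (f t)) \<in> borel_measurable borel"
proof -
  obtain s where s: "\<And>n::nat. simple_function borel (s n)" "\<And>n t. s n t \<in> elems X"
     "\<And>t. (\<lambda>n. fnorm X (\<lambda>x. f t x - s n t x)) \<longlonglongrightarrow> 0"
    using f unfolding strongly_borel_def by blast
  obtain K where K: "K \<ge> 0" "\<And>v. v \<in> elems X \<Longrightarrow> \<bar>F v\<bar> \<le> K * fnorm X v"
    using bounded_functional_bound[OF F] by blast
  note el = strongly_borel_elems[OF f]
  show ?thesis
  proof (rule borel_measurable_LIMSEQ_real)
    show "(\<lambda>t. F (s n t)) \<in> borel_measurable borel" for n
      using simple_function_compose1[OF s(1), of F] by (rule borel_measurable_simple_function)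
    fix t
    have "(\<lambda>n. F (f t) - F (s n t)) \<longlonglongrightarrow> 0"
    proof (rule tendsto_rabs_zero_cancel, rule tendsto_sandwich[OF _ _ tendsto_const])
      show "(\<lambda>n. K * fnorm X (\<lambda>x. f t x - s n t x)) \<longlonglongrightarrow> 0"
        using tendsto_mult_left[OF s(3), of K] by simp
      show "\<forall>\<^sub>F n in sequentially. \<bar>F (f t) - F (s n t)\<bar> \<le> K * fnorm X (\<lambda>x. f t x - s n t x)"
        using K(2)[OF diff_elems[OF el s(2)]] bounded_functional_diff[OF F el s(2)] by simp
    qed simp
    then show "(\<lambda>n. F (s n t)) \<longlonglongrightarrow> F (f t)"
      using tendsto_diff[OF tendsto_const[of "F (f t)"], of "\<lambda>n. F (f t) - F (s n t)" 0 sequentially] by simp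
  qed
qed

lemma L2_representative_exists:
  assumes "f \<in> L2t T X"
  obtains g where "L2_representative T X g" "AE t in lborel. t \<in> {0<..<T} \<longrightarrow> f t = g t"
proof -
  obtain g where g: "strongly_borel X g" "\<And>t. t \<notin> {0<..<T} \<Longrightarrow> g t = (\<lambda>_. 0)"
    "AE t in lborel. t \<in> {0<..<T} \<longrightarrow> f t = g t"
    using strongly_measurable_representative assms unfolding L2t_def by blast
  have "integrable lborel (\<lambda>t. (fnorm X (g t))\<^sup>2)"
  proof (subst time_measure_transfer(2)[symmetric])
    show "AE t in lborel. t \<in> {0<..<T} \<longrightarrow> (fnorm X (f t))\<^sup>2 = (fnorm X (g t))\<^sup>2"
      using g(3) by eventually_elim auto
  qed (use assms g strongly_borel_norm[OF g(1)] in \<open>auto simp: L2t_def\<close>)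
  then show ?thesis using g that unfolding L2_representative_def by blast
qed

lemma L2_representative_norm:
  assumes "L2_representative T X g" "AE t in lborel. t \<in> {0<..<T} \<longrightarrow> f t = g t"
  shows "L2t_norm T X f = sqrt (LINT t|lborel. (fnorm X (g t))\<^sup>2)"
  unfolding L2t_norm_def
proof (subst time_measure_transfer(1))
  show "AE t in lborel. t \<in> {0<..<T} \<longrightarrow> (fnorm X (f t))\<^sup>2 = (fnorm X (g t))\<^sup>2"
    using assms(2) by eventually_elim auto
qed (use assms strongly_borel_norm in \<open>auto simp: L2_representative_def\<close>)

lemma L2_representative_L2t:
  assumes "L2_representative T X g" shows "g \<in> L2t T X"
proof -
  have g: "strongly_borel X g" using assms by (simp add: L2_representative_def)
  obtain s where s: "\<And>n::nat. simple_function borel (s n)" "\<And>n t. s n t \<in> elems X"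
     "\<And>t. (\<lambda>n. fnorm X (\<lambda>x. g t x - s n t x)) \<longlonglongrightarrow> 0"
    using g unfolding strongly_borel_def by blast
  have "simple_in T X (s n)" for n
  proof -
    have "(\<lambda>t::real. t) \<in> lebesgue_on {0<..<T} \<rightarrow>\<^sub>M borel"
      by (intro measurable_restrict_space1 measurable_completion) simp
    from simple_function_comp[OF this s(1)] show ?thesis
      using s(2) by (simp add: simple_in_def)
  qed
  then have "strongly_measurable T X g"
    using strongly_borel_elems[OF g] s(3) unfolding strongly_measurable_def
    by (intro conjI exI[of _ s]) auto
  moreover have "integrable (time_measure T) (\<lambda>t. (fnorm X (g t))\<^sup>2)"
    using assms strongly_borel_norm[OF g] fnorm_zero
    by (subst time_measure_transfer(2)[where H = "\<lambda>t. (fnorm X (g t))\<^sup>2"]) (auto simp: L2_representative_def)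
  ultimately show ?thesis by (simp add: L2t_def)
qed

lemma L2_representative_integrable_norm:
  assumes "L2_representative T X g" shows "integrable lborel (\<lambda>t. fnorm X (g t))"
proof (rule Bochner_Integration.integrable_bound)
  have g: "strongly_borel X g" using assms by (simp add: L2_representative_def)
  show "integrable lborel (\<lambda>t. indicator {0<..<T} t + (fnorm X (g t))\<^sup>2)"
    using assms
    by (intro Bochner_Integration.integrable_add integrable_indicator_Ioo) (simp add: L2_representative_def)
  show "(\<lambda>t. fnorm X (g t)) \<in> borel_measurable lborel"
    using strongly_borel_norm[OF g] by simp
  show "AE t in lborel. norm (fnorm X (g t)) \<le> norm (indicator {0<..<T} t + (fnorm X (g t))\<^sup>2)"
  proof (rule AE_I2)
    fix t
    have "2 * \<bar>fnorm X (g t)\<bar> \<le> 1 + (fnorm X (g t))\<^sup>2"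
      using sum_squares_bound[of 1 "\<bar>fnorm X (g t)\<bar>"] by simp
    then show "norm (fnorm X (g t)) \<le> norm (indicator {0<..<T} t + (fnorm X (g t))\<^sup>2)"
      using assms by (cases "t \<in> {0<..<T}") (auto simp: L2_representative_def)
  qed
qed

lemma L2_representative_functional:
  assumes g: "L2_representative T X g" and F: "bounded_functional X F"
  shows "integrable lborel (\<lambda>t. F (g t))"
proof -
  obtain K where K: "K \<ge> 0" "\<And>v. v \<in> elems X \<Longrightarrow> \<bar>F v\<bar> \<le> K * fnorm X v"
    using bounded_functional_bound[OF F] by blast
  have sb: "strongly_borel X g" using g by (simp add: L2_representative_def)
  show ?thesis
  proof (rule Bochner_Integration.integrable_bound)
    show "integrable lborel (\<lambda>t. K * fnorm X (g t))"
      using L2_representative_integrable_norm[OF g] by simp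
    show "AE t in lborel. norm (F (g t)) \<le> norm (K * fnorm X (g t))"
    proof (rule AE_I2)
      fix t
      show "norm (F (g t)) \<le> norm (K * fnorm X (g t))"
        using order_trans[OF K(2)[OF strongly_borel_elems[OF sb, of t]] abs_ge_self] by simp
    qed
  qed (use strongly_borel_functional[OF sb F] in simp)
qed

section \<open>Initial values and weak time derivatives in scalar form\<close>

text \<open>For step functions both sides agree by linearity, and \<open>F\<close> is continuous.\<close>

lemma functional_of_bochner_integral:
  assumes w: "has_bochner_integral_in T X f w" and F: "bounded_functional X F"
    and int: "integrable (time_measure T) (\<lambda>t. F (f t))"
  shows "F w = (LINT t|time_measure T. F (f t))"
proof -
  let ?M = "time_measure T"
  obtain s where s: "\<And>n::nat. simple_in T X (s n)"
    and l1: "(\<lambda>n. \<integral>\<^sup>+t. ennreal (fnorm X (\<lambda>x. f t x - s n t x)) \<partial>?M) \<longlonglongrightarrow> 0"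
    and l2: "(\<lambda>n. fnorm X (\<lambda>x. simple_integral T (s n) x - w x)) \<longlonglongrightarrow> 0"
    using w unfolding has_bochner_integral_in_def by blast
  have wX: "w \<in> elems X" and fX: "AE t in ?M. f t \<in> elems X"
    using w unfolding has_bochner_integral_in_def strongly_measurable_def by auto
  obtain K where K: "K \<ge> 0" "\<And>v. v \<in> elems X \<Longrightarrow> \<bar>F v\<bar> \<le> K * fnorm X v"
    using bounded_functional_bound[OF F] by blast
  have sf: "simple_function ?M (s n)" "\<And>t. t \<in> {0<..<T} \<Longrightarrow> s n t \<in> elems X" for n
    using s unfolding simple_in_def by auto
  interpret M: finite_measure ?M
    by (intro finite_measure_lebesgue_on) auto
  have fin: "finite (s n ` {0<..<T})" "s n ` {0<..<T} \<subseteq> elems X" for n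
    using simple_functionD(1)[OF sf(1)] sf(2) by auto
  have F_s: "simple_function ?M (\<lambda>t. F (s n t))" for n
    using simple_function_compose1[OF sf(1), of F] .
  have int_s: "integrable ?M (\<lambda>t. F (s n t))" for n
  proof -
    have "finite ((\<lambda>t. F (s n t)) ` {0<..<T})" using simple_functionD(1)[OF F_s] by simp
    then obtain B where "\<forall>y\<in>(\<lambda>t. F (s n t)) ` {0<..<T}. norm y \<le> B"
      using finite_imp_bounded[of "(\<lambda>t. F (s n t)) ` {0<..<T}"] unfolding bounded_iff by blast
    then have "\<And>t. t \<in> {0<..<T} \<Longrightarrow> \<bar>F (s n t)\<bar> \<le> B" by auto
    then show ?thesis
      using borel_measurable_simple_function[OF F_s]
      by (intro M.integrable_const_bound[where B = B]) auto
  qed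
  have simp_int: "F (simple_integral T (s n)) = (LINT t|?M. F (s n t))" for n
  proof -
    have "F (simple_integral T (s n)) = (\<Sum>v\<in>s n ` {0<..<T}. measure ?M (s n -` {v} \<inter> {0<..<T}) * F v)"
      unfolding simple_integral_def
      by (rule linear_combination(2)[OF fin F])
    also have "\<dots> = (\<Sum>v\<in>s n ` {0<..<T}. (LINT t|?M. indicator (s n -` {v} \<inter> {0<..<T}) t * F v))"
      using simple_functionD(2)[OF sf(1)] by (simp add: M.emeasure_eq_measure)
    also have "\<dots> = (LINT t|?M. (\<Sum>v\<in>s n ` {0<..<T}. indicator (s n -` {v} \<inter> {0<..<T}) t * F v))"
      using simple_functionD(2)[OF sf(1)]
      by (intro Bochner_Integration.integral_sum[symmetric] integrable_mult_left integrable_real_indicator)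
         (auto simp: M.emeasure_eq_measure)
    also have "\<dots> = (LINT t|?M. F (s n t))"
    proof (rule Bochner_Integration.integral_cong[OF refl])
      fix t assume "t \<in> space ?M"
      then have t: "t \<in> {0<..<T}" by simp
      have "(\<Sum>v\<in>s n ` {0<..<T}. indicator (s n -` {v} \<inter> {0<..<T}) t * F v)
         = (\<Sum>v\<in>s n ` {0<..<T}. if v = s n t then F v else 0)"
        using t by (intro sum.cong) (auto simp: indicator_def)
      also have "\<dots> = F (s n t)" using t fin(1) by simp
      finally show "(\<Sum>v\<in>s n ` {0<..<T}. indicator (s n -` {v} \<inter> {0<..<T}) t * F v) = F (s n t)" .
    qed
    finally show ?thesis .
  qed
  have "(\<lambda>n. F (simple_integral T (s n)) - F w) \<longlonglongrightarrow> 0"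
  proof (rule tendsto_rabs_zero_cancel, rule tendsto_sandwich[OF _ _ tendsto_const])
    show "(\<lambda>n. K * fnorm X (\<lambda>x. simple_integral T (s n) x - w x)) \<longlonglongrightarrow> 0"
      using tendsto_mult_left[OF l2, of K] by simp
    have si: "simple_integral T (s n) \<in> elems X" for n
      unfolding simple_integral_def[abs_def]
      by (rule linear_combination(1)[OF fin])
    show "\<forall>\<^sub>F n in sequentially. \<bar>F (simple_integral T (s n)) - F w\<bar> \<le> K * fnorm X (\<lambda>x. simple_integral T (s n) x - w x)"
      using K(2)[OF diff_elems[OF si wX]] bounded_functional_diff[OF F si wX] by simp
  qed simp
  then have A: "(\<lambda>n. LINT t|?M. F (s n t)) \<longlonglongrightarrow> F w"
    using LIM_zero_iff simp_int by auto
  have "(\<lambda>n. LINT t|?M. F (s n t)) \<longlonglongrightarrow> (LINT t|?M. F (f t))"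
  proof (rule tendsto_L1_int)
    show "(\<lambda>n. \<integral>\<^sup>+t. norm (F (s n t) - F (f t)) \<partial>?M) \<longlonglongrightarrow> 0"
    proof (rule tendsto_sandwich[OF _ _ tendsto_const])
      show "(\<lambda>n. ennreal K * (\<integral>\<^sup>+t. ennreal (fnorm X (\<lambda>x. f t x - s n t x)) \<partial>?M)) \<longlonglongrightarrow> 0"
        using ennreal_tendsto_cmult[OF _ l1, of "ennreal K"] by simp
      show "\<forall>\<^sub>F n in sequentially. (\<integral>\<^sup>+t. norm (F (s n t) - F (f t)) \<partial>?M)
         \<le> ennreal K * (\<integral>\<^sup>+t. ennreal (fnorm X (\<lambda>x. f t x - s n t x)) \<partial>?M)"
      proof (rule always_eventually, rule allI)
        fix n
        have "(\<integral>\<^sup>+t. norm (F (s n t) - F (f t)) \<partial>?M) \<le> (\<integral>\<^sup>+t. ennreal K * ennreal (fnorm X (\<lambda>x. f t x - s n t x)) \<partial>?M)"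
        proof (rule nn_integral_mono_AE)
          have "AE t in ?M. t \<in> {0<..<T}" by (auto intro: AE_I2)
          with fX show "AE t in ?M. ennreal (norm (F (s n t) - F (f t))) \<le> ennreal K * ennreal (fnorm X (\<lambda>x. f t x - s n t x))"
          proof eventually_elim
            case (elim t)
            have "norm (F (s n t) - F (f t)) \<le> K * fnorm X (\<lambda>x. f t x - s n t x)"
              using K(2)[OF diff_elems[OF elim(1) sf(2)[OF elim(2)]]] bounded_functional_diff[OF F elim(1) sf(2)[OF elim(2)]]
              by (simp add: abs_minus_commute)
            then show ?case using K(1) by (simp add: ennreal_mult'[symmetric] ennreal_leI)
          qed
        qed
        also have "\<dots> = ennreal K * (\<integral>\<^sup>+t. ennreal (fnorm X (\<lambda>x. f t x - s n t x)) \<partial>?M)"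
        proof -
          \<comment> \<open>The constant may leave the integral only if the norm is measurable, which representatives provide.\<close>
          have "strongly_measurable T X (s n)"
            using sf s unfolding strongly_measurable_def by (intro conjI exI[of _ "\<lambda>_. s n"]) auto
          then obtain r where r: "strongly_borel X r" "AE t in lborel. t \<in> {0<..<T} \<longrightarrow> s n t = r t"
            using strongly_measurable_representative by blast
          obtain g where g: "strongly_borel X g" "AE t in lborel. t \<in> {0<..<T} \<longrightarrow> f t = g t"
            using w strongly_measurable_representative unfolding has_bochner_integral_in_def by blast
          have m: "(\<lambda>t. ennreal (fnorm X (\<lambda>x. 1 * g t x + (-1) * r t x))) \<in> borel_measurable ?M"
            using strongly_borel_norm[OF strongly_borel_lincomb[OF g(1) r(1), of 1 "-1"]]
            by (intro measurable_restrict_space1 measurable_completion measurable_compose[OF _ measurable_ennreal]) simp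
          have "AE t in lborel. t \<in> {0<..<T} \<longrightarrow>
              fnorm X (\<lambda>x. f t x - s n t x) = fnorm X (\<lambda>x. 1 * g t x + (-1) * r t x)"
            using g(2) r(2) by eventually_elim auto
          then have ae: "AE t in ?M. fnorm X (\<lambda>x. f t x - s n t x) = fnorm X (\<lambda>x. 1 * g t x + (-1) * r t x)"
            by (subst AE_lebesgue_on_iff) (auto simp: AE_completion_iff)
          have "(\<integral>\<^sup>+t. ennreal K * ennreal (fnorm X (\<lambda>x. f t x - s n t x)) \<partial>?M)
             = (\<integral>\<^sup>+t. ennreal K * ennreal (fnorm X (\<lambda>x. 1 * g t x + (-1) * r t x)) \<partial>?M)"
            by (rule nn_integral_cong_AE, use ae in eventually_elim) simp
          also have "\<dots> = ennreal K * (\<integral>\<^sup>+t. ennreal (fnorm X (\<lambda>x. 1 * g t x + (-1) * r t x)) \<partial>?M)"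
            by (rule nn_integral_cmult[OF m])
          also have "(\<integral>\<^sup>+t. ennreal (fnorm X (\<lambda>x. 1 * g t x + (-1) * r t x)) \<partial>?M)
             = (\<integral>\<^sup>+t. ennreal (fnorm X (\<lambda>x. f t x - s n t x)) \<partial>?M)"
            by (rule nn_integral_cong_AE, use ae in eventually_elim) simp
          finally show ?thesis .
        qed
        finally show "(\<integral>\<^sup>+t. norm (F (s n t) - F (f t)) \<partial>?M)
         \<le> ennreal K * (\<integral>\<^sup>+t. ennreal (fnorm X (\<lambda>x. f t x - s n t x)) \<partial>?M)" .
      qed
    qed auto
  qed (use int int_s in auto)
  then show ?thesis using A LIMSEQ_unique by blast
qed

text \<open>Let \<open>w\<close> be the continuous representative of \<open>f\<close>.  The scalar function \<open>F (w t)\<close> has the weak derivative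
  \<open>F (g1 t)\<close>, so that \<open>weak_derivative_imp_integral\<close> applies.  A single null set serves all \<open>F\<close>, because it
  only stems from the equality of \<open>f\<close> and \<open>w\<close>.\<close>

lemma has_initial_value_integral:
  assumes der: "is_time_deriv T X f g" and ini: "has_initial_value T X f f0" and "T > 0"
    and rep: "L2_representative T X g1" "AE t in lborel. t \<in> {0<..<T} \<longrightarrow> g t = g1 t"
  shows "AE t in lborel. t \<in> {0<..<T} \<longrightarrow> f t \<in> elems X \<and>
    (\<forall>F. bounded_functional X F \<longrightarrow> F (f t) = F f0 + (LINT r|lborel. indicator {0<..<t} r * F (g1 r)))"
proof -
  obtain w where w: "\<And>t. t \<in> {0..T} \<Longrightarrow> w t \<in> elems X"
      "\<And>t. t \<in> {0..T} \<Longrightarrow> ((\<lambda>s. fnorm X (\<lambda>x. w s x - w t x)) \<longlongrightarrow> 0) (at t within {0..T})"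
    and fw: "AE t in time_measure T. fnorm X (\<lambda>x. f t x - w t x) = 0"
    and w0: "fnorm X (\<lambda>x. w 0 x - f0 x) = 0" and f0: "f0 \<in> elems X"
    using ini unfolding has_initial_value_def by blast
  have fX: "AE t in time_measure T. f t \<in> elems X"
    using der unfolding is_time_deriv_def L2t_def strongly_measurable_def by blast
  have fw': "AE t in lborel. t \<in> {0<..<T} \<longrightarrow> fnorm X (\<lambda>x. f t x - w t x) = 0"
    using fw by (subst (asm) AE_lebesgue_on_iff) (auto simp: AE_completion_iff)
  have fX': "AE t in lborel. t \<in> {0<..<T} \<longrightarrow> f t \<in> elems X"
    using fX by (subst (asm) AE_lebesgue_on_iff) (auto simp: AE_completion_iff)
  have sb: "strongly_borel X g1" using rep by (simp add: L2_representative_def)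
  have main: "F (w c) = F f0 + (LINT r|lborel. indicator {0<..<c} r * F (g1 r))"
    if F: "bounded_functional X F" and c: "c \<in> {0<..<T}" for F c
  proof -
    obtain K where K: "K \<ge> 0" "\<And>v. v \<in> elems X \<Longrightarrow> \<bar>F v\<bar> \<le> K * fnorm X v"
      using bounded_functional_bound[OF F] by blast
    define p where "p t = F (w t)" for t
    have p: "continuous_on {0..T} p"
      unfolding continuous_on_def
    proof
      fix t assume t: "t \<in> {0..T}"
      show "(p \<longlongrightarrow> p t) (at t within {0..T})"
      proof (rule LIM_zero_cancel, rule tendsto_rabs_zero_cancel, rule tendsto_sandwich[OF _ _ tendsto_const])
        show "((\<lambda>s. K * fnorm X (\<lambda>x. w s x - w t x)) \<longlongrightarrow> 0) (at t within {0..T})"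
          using tendsto_mult_left[OF w(2)[OF t], of K] by simp
        have "\<forall>\<^sub>F s in at t within {0..T}. s \<in> {0..T}"
          by (simp add: eventually_at_filter)
        then show "\<forall>\<^sub>F s in at t within {0..T}. \<bar>p s - p t\<bar> \<le> K * fnorm X (\<lambda>x. w s x - w t x)"
        proof eventually_elim
          case (elim s)
          show ?case
            using K(2)[OF diff_elems[OF w(1)[OF elim] w(1)[OF t]]] bounded_functional_diff[OF F w(1)[OF elim] w(1)[OF t]]
            by (simp add: p_def)
        qed
      qed simp
    qed
    define q where "q t = F (g1 t)" for t
    have q: "integrable lborel q"
      unfolding q_def by (rule L2_representative_functional[OF rep(1) F])
    have [measurable]: "q \<in> borel_measurable borel" using q by auto
    have q0: "q t = 0" if "t \<notin> {0<..<T}" for t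
      using that rep(1) bounded_functional_scale[OF F zero_elems, of 0] by (simp add: q_def L2_representative_def)
    have "p c = p 0 + (LINT r|lborel. indicator {0<..<c} r * q r)"
    proof (rule weak_derivative_imp_integral[OF p q])
      fix \<phi> assume \<phi>: "\<phi> \<in> test_functions {0<..<T}"
      have d: "deriv \<phi> = pderiv 1 \<phi>"
      proof
        fix x
        have "\<phi> differentiable (at x)" using test_differentiable[OF \<phi>, of "[]"] by simp
        from pderiv_DERIV_0[OF this, of 1] have "((\<lambda>s. \<phi> (x + s)) has_real_derivative pderiv 1 \<phi> x) (at 0)"
          by simp
        then have "(\<phi> has_real_derivative pderiv 1 \<phi> x) (at x)"
          using DERIV_shift[of \<phi> "pderiv 1 \<phi> x" 0 x] by (simp add: add.commute)
        then show "deriv \<phi> x = pderiv 1 \<phi> x" by (rule DERIV_imp_deriv)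
      qed
      have d\<phi>: "deriv \<phi> \<in> test_functions {0<..<T}"
        unfolding d using test_pderiv[OF \<phi>, of 1] by simp
      have [measurable]: "\<phi> \<in> borel_measurable borel" "deriv \<phi> \<in> borel_measurable borel"
        using test_continuous[OF \<phi>] test_continuous[OF d\<phi>] borel_measurable_continuous_onI by blast+
      obtain B where B: "\<And>x. \<bar>\<phi> x\<bar> \<le> B" using test_bounded[OF \<phi>] by blast
      obtain B' where B': "\<And>x. \<bar>deriv \<phi> x\<bar> \<le> B'" "B' \<ge> 0" using test_bounded[OF d\<phi>] by blast
      obtain v where v: "has_bochner_integral_in T X (\<lambda>t x. deriv \<phi> t * f t x) v"
        "has_bochner_integral_in T X (\<lambda>t x. \<phi> t * g t x) (\<lambda>x. - v x)"
        using der \<phi> unfolding is_time_deriv_def by blast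
      have vX: "v \<in> elems X" using v unfolding has_bochner_integral_in_def by blast
      define P where "P t = indicator {0<..<T} t * p t" for t
      have "(\<lambda>x. indicator {0<..<T} x *\<^sub>R p x) \<in> borel_measurable borel"
        by (rule borel_measurable_continuous_on_indicator) (use p in \<open>auto intro: continuous_on_subset\<close>)
      then have [measurable]: "P \<in> borel_measurable borel" by (simp add: P_def[abs_def])
      have "bounded (p ` {0..T})"
        using p by (simp add: compact_continuous_image compact_imp_bounded)
      then obtain D where "\<forall>y\<in>p ` {0..T}. norm y \<le> D" unfolding bounded_iff by blast
      then have D: "\<And>x. x \<in> {0..T} \<Longrightarrow> \<bar>p x\<bar> \<le> D" by auto
      have ae1: "AE t in lborel. t \<in> {0<..<T} \<longrightarrow> F (\<lambda>x. deriv \<phi> t * f t x) = deriv \<phi> t * P t"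
        using fw' fX'
      proof eventually_elim
        case (elim t)
        show ?case
        proof
          assume t: "t \<in> {0<..<T}"
          then have "F (f t) = F (w t)"
            using elim w(1)[of t] by (intro bounded_functional_null[OF F]) auto
          then show "F (\<lambda>x. deriv \<phi> t * f t x) = deriv \<phi> t * P t"
            using elim t by (simp add: bounded_functional_scale[OF F] P_def p_def)
        qed
      qed
      have intP: "integrable lborel (\<lambda>t. deriv \<phi> t * P t)"
      proof (rule Bochner_Integration.integrable_bound)
        show "integrable lborel (\<lambda>t. B' * D * indicator {0<..<T} t)"
          by (intro integrable_mult_right integrable_indicator_Ioo)
        show "AE t in lborel. norm (deriv \<phi> t * P t) \<le> norm (B' * D * indicator {0<..<T} t)"
        proof (rule AE_I2)
          fix t
          show "norm (deriv \<phi> t * P t) \<le> norm (B' * D * indicator {0<..<T} t)"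
          proof (cases "t \<in> {0<..<T}")
            case True
            have "\<bar>deriv \<phi> t\<bar> * \<bar>p t\<bar> \<le> B' * D"
              using True B' D[of t] by (intro mult_mono) auto
            then have "\<bar>deriv \<phi> t\<bar> * \<bar>p t\<bar> \<le> \<bar>B' * D\<bar>" by linarith
            then show ?thesis using True by (simp add: P_def abs_mult)
          qed (simp add: P_def)
        qed
      qed simp
      note tr1 = time_measure_transfer[OF _ _ ae1]
      have 1: "F v = (LINT t|lborel. deriv \<phi> t * P t)"
        using functional_of_bochner_integral[OF v(1) F] tr1 intP by (simp add: P_def)
      have ae2: "AE t in lborel. t \<in> {0<..<T} \<longrightarrow> F (\<lambda>x. \<phi> t * g t x) = \<phi> t * q t"
        using rep(2) by eventually_elim
          (auto simp: q_def bounded_functional_scale[OF F strongly_borel_elems[OF sb]])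
      have intq: "integrable lborel (\<lambda>t. \<phi> t * q t)"
      proof (rule Bochner_Integration.integrable_bound)
        show "integrable lborel (\<lambda>t. B * q t)" using q by simp
        show "AE t in lborel. norm (\<phi> t * q t) \<le> norm (B * q t)"
          using B by (intro AE_I2) (simp add: abs_mult, meson abs_ge_self abs_ge_zero mult_right_mono order_trans)
      qed simp
      note tr2 = time_measure_transfer[OF _ _ ae2]
      have 2: "F (\<lambda>x. - v x) = (LINT t|lborel. \<phi> t * q t)"
        using functional_of_bochner_integral[OF v(2) F] tr2 intq q0 by simp
      have "F (\<lambda>x. - v x) = - F v"
        using bounded_functional_scale[OF F vX, of "-1"] by simp
      then have "(LINT t|lborel. deriv \<phi> t * P t) = - (LINT t|lborel. \<phi> t * q t)"
        using 1 2 by simp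
      moreover have "deriv \<phi> t * P t = indicator {0<..<T} t * (deriv \<phi> t * p t)" for t
        by (simp add: P_def)
      ultimately show "(LINT t|lborel. indicator {0<..<T} t * (deriv \<phi> t * p t)) = - (LINT t|lborel. \<phi> t * q t)"
        by simp
    qed (use c in auto)
    moreover have "p 0 = F f0"
      unfolding p_def using w(1)[of 0] \<open>T > 0\<close> by (intro bounded_functional_null[OF F _ f0 w0]) auto
    ultimately show ?thesis by (simp add: p_def q_def)
  qed
  show ?thesis
    using fw' fX'
  proof eventually_elim
    case (elim t)
    show ?case
    proof (intro impI conjI allI)
      assume t: "t \<in> {0<..<T}"
      then show "f t \<in> elems X" using elim by blast
      fix F assume F: "bounded_functional X F"
      have "F (f t) = F (w t)"
        using elim w(1)[of t] t by (intro bounded_functional_null[OF F]) auto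
      then show "F (f t) = F f0 + (LINT r|lborel. indicator {0<..<t} r * F (g1 r))"
        using main[OF F t] by simp
    qed
  qed
qed

text \<open>As \<open>g1\<close> vanishes before time 0, the integral may start at minus infinity.  In this form primitives
  commute with translations in time.\<close>

lemma initial_value_representatives:
  assumes der: "is_time_deriv T X f g" and ini: "has_initial_value T X f f0" and "T > 0"
    and f1: "AE t in lborel. t \<in> {0<..<T} \<longrightarrow> f t = f1 t"
    and g1: "L2_representative T X g1" "AE t in lborel. t \<in> {0<..<T} \<longrightarrow> g t = g1 t"
    and F: "\<And>i. i \<in> A \<Longrightarrow> bounded_functional X (F i)"
  shows "AE t in lborel. t \<in> {0<..<T} \<longrightarrow>
    (\<forall>i\<in>A. F i (f1 t) = F i f0 + (LINT r|lborel. indicator {..<t} r * F i (g1 r)))"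
  using has_initial_value_integral[OF der ini \<open>T > 0\<close> g1] f1
proof eventually_elim
  case (elim t)
  show ?case
  proof (intro impI ballI)
    fix i assume t: "t \<in> {0<..<T}" and i: "i \<in> A"
    have "F i (g1 r) = 0" if "r \<le> 0" for r
      using g1(1) that bounded_functional_scale[OF F[OF i] zero_elems, of 0] by (simp add: L2_representative_def)
    then show "F i (f1 t) = F i f0 + (LINT r|lborel. indicator {..<t} r * F i (g1 r))"
      using elim t F[OF i] integral_indicator_Ioo[of "\<lambda>r. F i (g1 r)" t] by auto
  qed
qed

end

section \<open>Pairings and operations on representatives\<close>

text \<open>A bounded bilinear pairing of two function spaces: an inner product, or the duality pairing.  Limits
  under the pairing only use its additivity.\<close>

locale pairing =
  X: seminormed_fspace X + Y: seminormed_fspace Y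
  for X :: "'x fspace" and Y :: "'y fspace" +
  fixes P :: "('x \<Rightarrow> real) \<Rightarrow> ('y \<Rightarrow> real) \<Rightarrow> real"
  assumes diff_left: "u \<in> elems X \<Longrightarrow> u' \<in> elems X \<Longrightarrow> v \<in> elems Y \<Longrightarrow> P (\<lambda>x. u x - u' x) v = P u v - P u' v"
    and diff_right: "u \<in> elems X \<Longrightarrow> v \<in> elems Y \<Longrightarrow> v' \<in> elems Y \<Longrightarrow> P u (\<lambda>x. v x - v' x) = P u v - P u v'"
    and bound: "u \<in> elems X \<Longrightarrow> v \<in> elems Y \<Longrightarrow> \<bar>P u v\<bar> \<le> fnorm X u * fnorm Y v"
begin

lemma pairing_tendsto:
  assumes "\<And>n. u n \<in> elems X" "\<And>n. v n \<in> elems Y" "a \<in> elems X" "b \<in> elems Y"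
    and u: "(\<lambda>n. fnorm X (\<lambda>x. a x - u n x)) \<longlonglongrightarrow> 0" and v: "(\<lambda>n. fnorm Y (\<lambda>x. b x - v n x)) \<longlonglongrightarrow> 0"
  shows "(\<lambda>n. P (u n) (v n)) \<longlonglongrightarrow> P a b"
proof -
  have "(\<lambda>n. P a b - P (u n) (v n)) \<longlonglongrightarrow> 0"
  proof (rule tendsto_rabs_zero_cancel, rule tendsto_sandwich[OF _ _ tendsto_const])
    have "(\<lambda>n. fnorm X (\<lambda>x. a x - u n x) * fnorm Y b + (fnorm X (\<lambda>x. a x - u n x) + fnorm X a) * fnorm Y (\<lambda>x. b x - v n x))
       \<longlonglongrightarrow> 0 * fnorm Y b + (0 + fnorm X a) * 0"
      by (intro tendsto_intros u v)
    then show "(\<lambda>n. fnorm X (\<lambda>x. a x - u n x) * fnorm Y b + (fnorm X (\<lambda>x. a x - u n x) + fnorm X a) * fnorm Y (\<lambda>x. b x - v n x))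
       \<longlonglongrightarrow> 0" by simp
    show "\<forall>\<^sub>F n in sequentially. \<bar>P a b - P (u n) (v n)\<bar>
       \<le> fnorm X (\<lambda>x. a x - u n x) * fnorm Y b + (fnorm X (\<lambda>x. a x - u n x) + fnorm X a) * fnorm Y (\<lambda>x. b x - v n x)"
    proof (rule always_eventually, rule allI)
      fix n
      have "P a b - P (u n) (v n) = P (\<lambda>x. a x - u n x) b + P (u n) (\<lambda>x. b x - v n x)"
        using assms by (simp add: diff_left diff_right)
      moreover have "\<bar>P (\<lambda>x. a x - u n x) b\<bar> \<le> fnorm X (\<lambda>x. a x - u n x) * fnorm Y b"
        by (intro bound X.diff_elems assms)
      moreover have "\<bar>P (u n) (\<lambda>x. b x - v n x)\<bar> \<le> fnorm X (u n) * fnorm Y (\<lambda>x. b x - v n x)"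
        by (intro bound Y.diff_elems assms)
      moreover have "fnorm X (u n) * fnorm Y (\<lambda>x. b x - v n x)
         \<le> (fnorm X (\<lambda>x. a x - u n x) + fnorm X a) * fnorm Y (\<lambda>x. b x - v n x)"
      proof (rule mult_right_mono)
        show "fnorm X (u n) \<le> fnorm X (\<lambda>x. a x - u n x) + fnorm X a"
          using X.fnorm_diff_triangle[OF assms(1,3), of n] X.fnorm_minus_commute[OF assms(1,3), of n] by simp
        show "0 \<le> fnorm Y (\<lambda>x. b x - v n x)" by (intro Y.fnorm_nonneg Y.diff_elems assms)
      qed
      ultimately show "\<bar>P a b - P (u n) (v n)\<bar>
       \<le> fnorm X (\<lambda>x. a x - u n x) * fnorm Y b + (fnorm X (\<lambda>x. a x - u n x) + fnorm X a) * fnorm Y (\<lambda>x. b x - v n x)"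
        by linarith
    qed
  qed simp
  then show ?thesis
    using tendsto_diff[OF tendsto_const[of "P a b"], of "\<lambda>n. P a b - P (u n) (v n)" 0 sequentially] by simp
qed

lemma pairing_measurable2:
  assumes f: "strongly_borel X f" and g: "strongly_borel Y g"
  shows "(\<lambda>(t, s). P (f t) (g s)) \<in> borel_measurable (borel \<Otimes>\<^sub>M borel)"
proof -
  obtain s where s: "\<And>n::nat. simple_function borel (s n)" "\<And>n t. s n t \<in> elems X"
     "\<And>t. (\<lambda>n. fnorm X (\<lambda>x. f t x - s n t x)) \<longlonglongrightarrow> 0"
    using f unfolding strongly_borel_def by blast
  obtain r where r: "\<And>n::nat. simple_function borel (r n)" "\<And>n t. r n t \<in> elems Y"
     "\<And>t. (\<lambda>n. fnorm Y (\<lambda>x. g t x - r n t x)) \<longlonglongrightarrow> 0"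
    using g unfolding strongly_borel_def by blast
  show ?thesis
    unfolding split_beta'
  proof (rule borel_measurable_LIMSEQ_real)
    fix z :: "real \<times> real"
    show "(\<lambda>n. P (s n (fst z)) (r n (snd z))) \<longlonglongrightarrow> P (f (fst z)) (g (snd z))"
      by (intro pairing_tendsto s r strongly_borel_elems[OF f] strongly_borel_elems[OF g])
  next
    fix n
    have "simple_function (borel \<Otimes>\<^sub>M borel) (\<lambda>z. s n (fst z))" "simple_function (borel \<Otimes>\<^sub>M borel) (\<lambda>z. r n (snd z))"
      by (rule simple_function_comp[OF _ s(1)], simp) (rule simple_function_comp[OF _ r(1)], simp)
    from simple_function_compose2[OF this, of P]
    show "(\<lambda>z. P (s n (fst z)) (r n (snd z))) \<in> borel_measurable (borel \<Otimes>\<^sub>M borel)"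
      by (rule borel_measurable_simple_function)
  qed
qed

lemma pairing_measurable:
  assumes "strongly_borel X f" "strongly_borel Y g"
  shows "(\<lambda>t. P (f t) (g t)) \<in> borel_measurable borel"
proof -
  have "(\<lambda>t::real. (t, t)) \<in> borel \<rightarrow>\<^sub>M borel \<Otimes>\<^sub>M borel" by simp
  from measurable_compose[OF this pairing_measurable2[OF assms]] show ?thesis by simp
qed

lemma pairing_integrable:
  assumes f: "L2_representative T X f" and g: "L2_representative T Y g"
  shows "integrable lborel (\<lambda>t. P (f t) (g t))"
proof (rule Bochner_Integration.integrable_bound)
  have sb: "strongly_borel X f" "strongly_borel Y g"
    using f g by (auto simp: L2_representative_def)
  show "integrable lborel (\<lambda>t. (fnorm X (f t))\<^sup>2 + (fnorm Y (g t))\<^sup>2)"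
    using f g by (auto simp: L2_representative_def)
  show "(\<lambda>t. P (f t) (g t)) \<in> borel_measurable lborel"
    using pairing_measurable[OF sb] by simp
  show "AE t in lborel. norm (P (f t) (g t)) \<le> norm ((fnorm X (f t))\<^sup>2 + (fnorm Y (g t))\<^sup>2)"
  proof (rule AE_I2)
    fix t
    have n: "0 \<le> fnorm X (f t) * fnorm Y (g t)"
      using X.fnorm_nonneg[OF strongly_borel_elems[OF sb(1)]] Y.fnorm_nonneg[OF strongly_borel_elems[OF sb(2)]] by simp
    have "2 * (fnorm X (f t) * fnorm Y (g t)) \<le> (fnorm X (f t))\<^sup>2 + (fnorm Y (g t))\<^sup>2"
      using sum_squares_bound[of "fnorm X (f t)" "fnorm Y (g t)"] by (simp add: mult.assoc)
    with n have "fnorm X (f t) * fnorm Y (g t) \<le> (fnorm X (f t))\<^sup>2 + (fnorm Y (g t))\<^sup>2" by linarith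
    then show "norm (P (f t) (g t)) \<le> norm ((fnorm X (f t))\<^sup>2 + (fnorm Y (g t))\<^sup>2)"
      using bound[OF strongly_borel_elems[OF sb(1)] strongly_borel_elems[OF sb(2)], of t t] by simp
  qed
qed

text \<open>On the time square, the pairing is dominated by a product of two integrable functions of one time
  variable each, so that integrability of the norms suffices.\<close>

lemma pairing_integrable2:
  assumes f: "L2_representative T X f" and g: "L2_representative S Y g"
  shows "integrable (lborel \<Otimes>\<^sub>M lborel) (\<lambda>(t, s). P (f t) (g s))"
proof (rule Bochner_Integration.integrable_bound)
  have sb: "strongly_borel X f" "strongly_borel Y g"
    using f g by (auto simp: L2_representative_def)
  show "integrable (lborel \<Otimes>\<^sub>M lborel) (\<lambda>(t, s). fnorm X (f t) * fnorm Y (g s))"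
    using X.L2_representative_integrable_norm[OF f] Y.L2_representative_integrable_norm[OF g]
    by (rule integrable_tensor)
  show "(\<lambda>(t, s). P (f t) (g s)) \<in> borel_measurable (lborel \<Otimes>\<^sub>M lborel)"
    using pairing_measurable2[OF sb] by (simp add: measurable_cong_sets[OF sets_pair_measure_cong[OF sets_lborel sets_lborel] refl])
  show "AE z in lborel \<Otimes>\<^sub>M lborel. norm (case z of (t, s) \<Rightarrow> P (f t) (g s)) \<le> norm (case z of (t, s) \<Rightarrow> fnorm X (f t) * fnorm Y (g s))"
  proof (rule AE_I2, clarsimp)
    fix t s
    show "\<bar>P (f t) (g s)\<bar> \<le> \<bar>fnorm X (f t) * fnorm Y (g s)\<bar>"
      using order_trans[OF bound[OF strongly_borel_elems[OF sb(1)] strongly_borel_elems[OF sb(2)]] abs_ge_self] .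
  qed
qed

end

lemma strongly_borel_embedding:
  assumes f: "strongly_borel X f" and "seminormed_fspace X" "seminormed_fspace Y"
    and sub: "elems X \<subseteq> elems Y" and le: "\<And>v. v \<in> elems X \<Longrightarrow> fnorm Y v \<le> fnorm X v"
  shows "strongly_borel Y f"
proof -
  interpret X: seminormed_fspace X by fact
  interpret Y: seminormed_fspace Y by fact
  obtain s where s: "\<And>n::nat. simple_function borel (s n)" "\<And>n t. s n t \<in> elems X"
     "\<And>t. (\<lambda>n. fnorm X (\<lambda>x. f t x - s n t x)) \<longlonglongrightarrow> 0"
    using f unfolding strongly_borel_def by blast
  have el: "(\<lambda>x. f t x - s n t x) \<in> elems X" for t n
    by (intro X.diff_elems strongly_borel_elems[OF f] s)
  have "(\<lambda>n. fnorm Y (\<lambda>x. f t x - s n t x)) \<longlonglongrightarrow> 0" for t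
  proof (rule tendsto_sandwich[OF _ _ tendsto_const s(3)])
    show "\<forall>\<^sub>F n in sequentially. fnorm Y (\<lambda>x. f t x - s n t x) \<le> fnorm X (\<lambda>x. f t x - s n t x)"
      using le[OF el] by simp
    show "\<forall>\<^sub>F n in sequentially. 0 \<le> fnorm Y (\<lambda>x. f t x - s n t x)"
      using Y.fnorm_nonneg[OF subsetD[OF sub el]] by simp
  qed
  then show ?thesis
    using s sub strongly_borel_elems[OF f] unfolding strongly_borel_def
    by (intro conjI exI[of _ s]) auto
qed

lemma L2_representative_embedding:
  assumes f: "L2_representative T X f" and X: "seminormed_fspace X" and Y: "seminormed_fspace Y"
    and sub: "elems X \<subseteq> elems Y" and le: "\<And>v. v \<in> elems X \<Longrightarrow> fnorm Y v \<le> fnorm X v"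
  shows "L2_representative T Y f"
proof -
  interpret X: seminormed_fspace X by fact
  interpret Y: seminormed_fspace Y by fact
  have fX: "strongly_borel X f" using f by (simp add: L2_representative_def)
  have sb: "strongly_borel Y f"
    by (rule strongly_borel_embedding[OF fX X Y sub le])
  moreover have "integrable lborel (\<lambda>t. (fnorm Y (f t))\<^sup>2)"
  proof (rule Bochner_Integration.integrable_bound)
    show "integrable lborel (\<lambda>t. (fnorm X (f t))\<^sup>2)" using f by (simp add: L2_representative_def)
    show "(\<lambda>t. (fnorm Y (f t))\<^sup>2) \<in> borel_measurable lborel"
      using Y.strongly_borel_norm[OF sb] by simp
    show "AE t in lborel. norm ((fnorm Y (f t))\<^sup>2) \<le> norm ((fnorm X (f t))\<^sup>2)"
      using le[OF strongly_borel_elems[OF fX]] Y.fnorm_nonneg[OF strongly_borel_elems[OF sb]]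
      by (intro AE_I2) (simp add: power_mono)
  qed
  ultimately show ?thesis using f by (simp add: L2_representative_def)
qed

context seminormed_fspace
begin

lemma L2_representative_lincomb:
  assumes f: "L2_representative T X f" and g: "L2_representative T X g"
  shows "L2_representative T X (\<lambda>t x. a * f t x + b * g t x)"
proof -
  have sb: "strongly_borel X f" "strongly_borel X g" using f g by (auto simp: L2_representative_def)
  note sb3 = strongly_borel_lincomb[OF sb, of a b]
  have "integrable lborel (\<lambda>t. (fnorm X (\<lambda>x. a * f t x + b * g t x))\<^sup>2)"
  proof (rule Bochner_Integration.integrable_bound)
    show "integrable lborel (\<lambda>t. 2 * a\<^sup>2 * (fnorm X (f t))\<^sup>2 + 2 * b\<^sup>2 * (fnorm X (g t))\<^sup>2)"
      using f g by (auto simp: L2_representative_def)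
    show "(\<lambda>t. (fnorm X (\<lambda>x. a * f t x + b * g t x))\<^sup>2) \<in> borel_measurable lborel"
      using strongly_borel_norm[OF sb3] by simp
    show "AE t in lborel. norm ((fnorm X (\<lambda>x. a * f t x + b * g t x))\<^sup>2)
       \<le> norm (2 * a\<^sup>2 * (fnorm X (f t))\<^sup>2 + 2 * b\<^sup>2 * (fnorm X (g t))\<^sup>2)"
    proof (rule AE_I2)
      fix t
      note el = strongly_borel_elems[OF sb(1), of t] strongly_borel_elems[OF sb(2), of t]
      have "fnorm X (\<lambda>x. a * f t x + b * g t x) \<le> \<bar>a\<bar> * fnorm X (f t) + \<bar>b\<bar> * fnorm X (g t)"
        using fnorm_triangle[OF scale_elems[OF el(1), of a] scale_elems[OF el(2), of b]] fnorm_scale[OF el(1)] fnorm_scale[OF el(2)]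
        by simp
      moreover have "0 \<le> fnorm X (\<lambda>x. a * f t x + b * g t x)"
        by (rule fnorm_nonneg[OF lin_elems[OF el]])
      ultimately have "(fnorm X (\<lambda>x. a * f t x + b * g t x))\<^sup>2 \<le> (\<bar>a\<bar> * fnorm X (f t) + \<bar>b\<bar> * fnorm X (g t))\<^sup>2"
        by (rule power_mono)
      also have "\<dots> \<le> 2 * (\<bar>a\<bar> * fnorm X (f t))\<^sup>2 + 2 * (\<bar>b\<bar> * fnorm X (g t))\<^sup>2"
        using sum_squares_bound[of "\<bar>a\<bar> * fnorm X (f t)" "\<bar>b\<bar> * fnorm X (g t)"] by (simp add: power2_sum)
      finally show "norm ((fnorm X (\<lambda>x. a * f t x + b * g t x))\<^sup>2)
       \<le> norm (2 * a\<^sup>2 * (fnorm X (f t))\<^sup>2 + 2 * b\<^sup>2 * (fnorm X (g t))\<^sup>2)"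
        by (simp add: power_mult_distrib)
    qed
  qed
  then show ?thesis using f g sb3 by (simp add: L2_representative_def)
qed

lemma L2_representative_mono:
  assumes "L2_representative T X f" "T \<le> S" shows "L2_representative S X f"
  using assms by (auto simp: L2_representative_def)

lemma L2_representative_indicator:
  assumes f: "L2_representative T X f" and A: "A \<in> sets borel"
  shows "L2_representative T X (\<lambda>t x. indicator A t * f t x)"
proof -
  have sb: "strongly_borel X f" using f by (auto simp: L2_representative_def)
  have sb2: "strongly_borel X (\<lambda>t x. indicator A t * f t x)"
    using A by (intro strongly_borel_scale[OF sb]) simp
  have "(fnorm X (\<lambda>x. indicator A t * f t x))\<^sup>2 = indicator A t * (fnorm X (f t))\<^sup>2" for t
    using fnorm_scale[OF strongly_borel_elems[OF sb], of "indicator A t" t] by (simp split: split_indicator)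
  moreover have "integrable lborel (\<lambda>t. indicator A t * (fnorm X (f t))\<^sup>2)"
    using integrable_mult_indicator[OF _ , of A lborel "\<lambda>t. (fnorm X (f t))\<^sup>2"] f A
    by (simp add: L2_representative_def)
  ultimately show ?thesis using f sb2 by (simp add: L2_representative_def)
qed

lemma L2_representative_cut:
  assumes f: "strongly_borel X f" and b: "\<And>t. t \<in> {0<..<T} \<Longrightarrow> fnorm X (f t) \<le> B"
  shows "L2_representative T X (\<lambda>t x. indicator {0<..<T} t * f t x)"
proof -
  have sb2: "strongly_borel X (\<lambda>t x. indicator {0<..<T} t * f t x)"
    by (intro strongly_borel_scale[OF f]) simp
  have "integrable lborel (\<lambda>t. (fnorm X (\<lambda>x. indicator {0<..<T} t * f t x))\<^sup>2)"
  proof (rule Bochner_Integration.integrable_bound)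
    show "integrable lborel (\<lambda>t. B\<^sup>2 * indicator {0<..<T} t)"
      by (intro integrable_mult_right integrable_indicator_Ioo)
    show "(\<lambda>t. (fnorm X (\<lambda>x. indicator {0<..<T} t * f t x))\<^sup>2) \<in> borel_measurable lborel"
      using strongly_borel_norm[OF sb2] by simp
    show "AE t in lborel. norm ((fnorm X (\<lambda>x. indicator {0<..<T} t * f t x))\<^sup>2) \<le> norm (B\<^sup>2 * indicator {0<..<T} t)"
      using b fnorm_nonneg[OF strongly_borel_elems[OF f]]
      by (intro AE_I2) (auto simp: indicator_def power_mono)
  qed
  then show ?thesis using sb2 by (simp add: L2_representative_def)
qed

lemma L2_representative_shift:
  assumes f: "L2_representative T X f" and c: "0 \<le> c" "T + c \<le> S"
  shows "L2_representative S X (\<lambda>t. f (t - c))"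
proof -
  have "integrable lborel (\<lambda>t. (fnorm X (f (- c + 1 * t)))\<^sup>2)"
    using f by (intro lborel_integrable_real_affine) (auto simp: L2_representative_def)
  then show ?thesis
    using f c strongly_borel_shift[of X f c] by (auto simp: L2_representative_def)
qed

end

lemma pairing_of_inner:
  assumes "semi_inner_product (elems X) B" "seminormed_fspace X"
    and le: "\<And>u. u \<in> elems X \<Longrightarrow> B u u \<le> (fnorm X u)\<^sup>2"
  shows "pairing X X B"
proof -
  interpret semi_inner_product "elems X" B by fact
  interpret seminormed_fspace X by fact
  show ?thesis
  proof (intro pairing.intro pairing_axioms.intro)
    fix u v v' assume *: "u \<in> elems X" "v \<in> elems X" "v' \<in> elems X"
    show "B u (\<lambda>x. v x - v' x) = B u v - B u v'"
      using lin_right[OF *(2,3,1), of 1 "-1"] by simp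
  next
    fix u u' v assume *: "u \<in> elems X" "u' \<in> elems X" "v \<in> elems X"
    show "B (\<lambda>x. u x - u' x) v = B u v - B u' v"
      using lin_left[OF *, of 1 "-1"] by simp
  next
    fix u v assume *: "u \<in> elems X" "v \<in> elems X"
    have "sqrt (B u u) \<le> fnorm X u" "sqrt (B v v) \<le> fnorm X v"
      using le fnorm_nonneg * by (auto intro: real_le_lsqrt nonneg)
    then show "\<bar>B u v\<bar> \<le> fnorm X u * fnorm X v"
      using order_trans[OF cauchy_schwarz[OF *] mult_mono] nonneg * fnorm_nonneg by simp
  qed (rule assms(2))+
qed

section \<open>Positive double integrals in time\<close>

text \<open>Integrating a symmetric kernel over a triangle gives half of its integral over the square,
  since the diagonal is a null set.\<close>

lemma triangle_integral:
  fixes k :: "real \<Rightarrow> real \<Rightarrow> real"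
  assumes k: "integrable (lborel \<Otimes>\<^sub>M lborel) (\<lambda>(t, s). k t s)" and sym: "\<And>t s. k t s = k s t"
  shows "(LINT t|lborel. LINT s|lborel. indicator {..<t} s * k t s) = (LINT t|lborel. LINT s|lborel. k t s) / 2"
    and "integrable lborel (\<lambda>t. LINT s|lborel. indicator {..<t} s * k t s)"
proof -
  have [measurable]: "(\<lambda>(t, s). k t s) \<in> borel_measurable (borel \<Otimes>\<^sub>M borel)"
    using borel_measurable_integrable[OF k] by simp
  let ?l = "\<lambda>t s. indicator {..<t} s * k t s" and ?u = "\<lambda>t s. indicator {..<s} t * k t s"
  have l: "integrable (lborel \<Otimes>\<^sub>M lborel) (\<lambda>(t, s). ?l t s)"
    by (rule Bochner_Integration.integrable_bound[OF k])
       (measurable, auto simp: indicator_def)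
  have u: "integrable (lborel \<Otimes>\<^sub>M lborel) (\<lambda>(t, s). ?u t s)"
    by (rule Bochner_Integration.integrable_bound[OF k])
       (measurable, auto simp: indicator_def)
  have i: "integrable lborel (\<lambda>t. LINT s|lborel. ?l t s)" "integrable lborel (\<lambda>t. LINT s|lborel. ?u t s)"
    using lborel_pair.integrable_fst[OF l] lborel_pair.integrable_fst[OF u] by simp_all
  then show "integrable lborel (\<lambda>t. LINT s|lborel. indicator {..<t} s * k t s)" by simp
  have "(LINT t|lborel. LINT s|lborel. ?l t s) = (LINT s|lborel. LINT t|lborel. ?l t s)"
    using lborel_pair.Fubini_integral[OF l] by simp
  also have "\<dots> = (LINT t|lborel. LINT s|lborel. ?u t s)"
    by (simp add: sym)
  finally have eq: "(LINT t|lborel. LINT s|lborel. ?l t s) = (LINT t|lborel. LINT s|lborel. ?u t s)" .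
  have "(LINT t|lborel. LINT s|lborel. k t s) = (LINT t|lborel. (LINT s|lborel. ?l t s) + (LINT s|lborel. ?u t s))"
  proof (rule integral_cong_AE)
    show "(\<lambda>t. LINT s|lborel. k t s) \<in> borel_measurable lborel"
      using lborel_pair.integrable_fst[OF k] by (auto dest: borel_measurable_integrable)
    show "(\<lambda>t. (LINT s|lborel. ?l t s) + (LINT s|lborel. ?u t s)) \<in> borel_measurable lborel"
      using i by (auto dest: borel_measurable_integrable)
    show "AE t in lborel. (LINT s|lborel. k t s) = (LINT s|lborel. ?l t s) + (LINT s|lborel. ?u t s)"
      using lborel_pair.AE_integrable_fst[OF l] lborel_pair.AE_integrable_fst[OF u] lborel_pair.AE_integrable_fst[OF k]
    proof eventually_elim
      case (elim t)
      have "(LINT s|lborel. k t s) = (LINT s|lborel. ?l t s + ?u t s)"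
      proof (rule integral_cong_AE)
        show "AE s in lborel. k t s = ?l t s + ?u t s"
          using AE_lborel_singleton[of t] by eventually_elim (auto simp: indicator_def)
      qed (use elim in \<open>auto dest: borel_measurable_integrable\<close>)
      also have "\<dots> = (LINT s|lborel. ?l t s) + (LINT s|lborel. ?u t s)"
        using elim by (intro Bochner_Integration.integral_add) auto
      finally show ?case .
    qed
  qed
  also have "\<dots> = (LINT t|lborel. LINT s|lborel. ?l t s) + (LINT t|lborel. LINT s|lborel. ?u t s)"
    by (rule Bochner_Integration.integral_add[OF i])
  finally show "(LINT t|lborel. LINT s|lborel. indicator {..<t} s * k t s) = (LINT t|lborel. LINT s|lborel. k t s) / 2"
    using eq by simp
qed

lemma (in seminormed_fspace) L2_representative_simple_approximation:
  assumes f: "L2_representative T X f"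
  obtains s where "\<And>n::nat. simple_function borel (s n)" "\<And>n. L2_representative T X (s n)"
     "\<And>t. (\<lambda>n. fnorm X (\<lambda>x. f t x - s n t x)) \<longlonglongrightarrow> 0" "\<And>n t. fnorm X (s n t) \<le> 2 * fnorm X (f t)"
proof -
  have sb: "strongly_borel X f" using f by (simp add: L2_representative_def)
  have f0: "f t = (\<lambda>_. 0)" if "t \<notin> {0<..<T}" for t using f that by (simp add: L2_representative_def)
  obtain r where r: "\<And>n::nat. simple_function borel (r n)" "\<And>n t. r n t \<in> elems X"
     "\<And>t. (\<lambda>n. fnorm X (\<lambda>x. f t x - r n t x)) \<longlonglongrightarrow> 0" "\<And>n t. fnorm X (r n t) \<le> 2 * fnorm X (f t)"
    using strongly_borel_dominated[OF sb] by blast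
  define s where "s n t = (if t \<in> {0<..<T} then r n t else (\<lambda>_. 0))" for n t
  have s1: "simple_function borel (s n)" for n
    unfolding s_def by (intro simple_function_If_set r) auto
  have s2: "s n t \<in> elems X" for n t
    using r zero_elems by (simp add: s_def)
  have s3: "(\<lambda>n. fnorm X (\<lambda>x. f t x - s n t x)) \<longlonglongrightarrow> 0" for t
  proof (cases "t \<in> {0<..<T}")
    case True
    then have "s n t = r n t" for n by (simp add: s_def)
    then show ?thesis using r(3)[of t] by simp
  next
    case False
    then have "s n t = (\<lambda>_. 0)" for n unfolding s_def by (rule if_not_P)
    then show ?thesis using f0[OF False] by simp
  qed
  have s4: "fnorm X (s n t) \<le> 2 * fnorm X (f t)" for n t
    using r(4)[of n t] fnorm_nonneg[OF strongly_borel_elems[OF sb], of t] by (simp add: s_def)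
  have s0: "s n t = (\<lambda>_. 0)" if "t \<notin> {0<..<T}" for n t
    using that unfolding s_def by (rule if_not_P)
  have sbs: "strongly_borel X (s n)" for n
    unfolding strongly_borel_def using s1 s2 by (auto intro!: exI[of _ "\<lambda>_. s n"])
  have srep: "L2_representative T X (s n)" for n
  proof -
    have "integrable lborel (\<lambda>t. (fnorm X (s n t))\<^sup>2)"
    proof (rule Bochner_Integration.integrable_bound)
      show "integrable lborel (\<lambda>t. 4 * (fnorm X (f t))\<^sup>2)" using f by (simp add: L2_representative_def)
      show "(\<lambda>t. (fnorm X (s n t))\<^sup>2) \<in> borel_measurable lborel"
        using strongly_borel_norm[OF sbs] by simp
      show "AE t in lborel. norm ((fnorm X (s n t))\<^sup>2) \<le> norm (4 * (fnorm X (f t))\<^sup>2)"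
      proof (rule AE_I2)
        fix t
        have "(fnorm X (s n t))\<^sup>2 \<le> (2 * fnorm X (f t))\<^sup>2"
          using s4 fnorm_nonneg[OF s2] by (rule power_mono)
        then show "norm ((fnorm X (s n t))\<^sup>2) \<le> norm (4 * (fnorm X (f t))\<^sup>2)"
          by (simp add: power_mult_distrib)
      qed
    qed
    then show ?thesis using sbs s0 by (simp add: L2_representative_def)
  qed
  show ?thesis by (rule that[OF s1 srep s3 s4])
qed

text \<open>The double integral of \<open>B (f t) (f s)\<close> is formally the square of the Bochner integral of
  \<open>f\<close>, which need not exist in the space; for step functions it is the square of a finite linear
  combination, and the general case follows by dominated convergence.\<close>

lemma double_integral_nonneg:
  assumes B: "semi_inner_product (elems X) B" and P: "pairing X X B" and f: "L2_representative T X f"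
  shows "0 \<le> (LINT t|lborel. LINT s|lborel. B (f t) (f s))"
proof -
  interpret semi_inner_product "elems X" B by fact
  interpret pairing X X B by fact
  have sb: "strongly_borel X f" using f by (simp add: L2_representative_def)
  obtain s where s1: "\<And>n::nat. simple_function borel (s n)" and srep: "\<And>n. L2_representative T X (s n)"
    and s3: "\<And>t. (\<lambda>n. fnorm X (\<lambda>x. f t x - s n t x)) \<longlonglongrightarrow> 0" and s4: "\<And>n t. fnorm X (s n t) \<le> 2 * fnorm X (f t)"
    using X.L2_representative_simple_approximation[OF f] by blast
  have s2: "s n t \<in> elems X" and s0: "t \<notin> {0<..<T} \<Longrightarrow> s n t = (\<lambda>_. 0)" for n t
    using srep[of n] by (auto simp: L2_representative_def intro: strongly_borel_elems)
  have step: "0 \<le> (LINT t|lborel. LINT s'|lborel. B (s n t) (s n s'))" for n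
  proof -
    \<comment> \<open>The value 0 is excluded, since it is taken on a set of infinite measure.\<close>
    define U where "U = range (s n) - {\<lambda>_. 0}"
    have U: "finite U" "\<And>v. v \<in> U \<Longrightarrow> v \<in> elems X"
      using simple_functionD(1)[OF s1, of n] s2 by (auto simp: U_def)
    define A where "A v = {t. s n t = v}" for v
    have Ab: "A v \<in> sets borel" for v
      using simple_functionD(2)[OF s1, of n "{v}"] by (simp add: A_def vimage_def)
    have Aint: "integrable lborel (indicator (A v) :: real \<Rightarrow> real)" if "v \<in> U" for v
    proof (rule integrable_real_indicator)
      have "A v \<subseteq> {0<..<T}"
      proof
        fix t assume "t \<in> A v"
        then have "s n t \<noteq> (\<lambda>_. 0)" using that by (auto simp: A_def U_def)
        then show "t \<in> {0<..<T}" using s0[of t n] by blast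
      qed
      then have "bounded (A v)" by (rule bounded_subset[rotated]) simp
      then show "emeasure lborel (A v) < \<infinity>" by (rule emeasure_bounded_finite)
      show "A v \<in> sets lborel" using Ab by simp
    qed
    define c where "c v = (LINT t|lborel. indicator (A v) t :: real)" for v
    \<comment> \<open>\<open>w\<close> is the integral of the step function.\<close>
    define w where "w = (\<lambda>x. \<Sum>v\<in>U. c v * v x)"
    have wX: "w \<in> elems X" unfolding w_def using U by (intro X.linear_combination(1)) auto
    have Bw: "B w u = (\<Sum>v\<in>U. c v * B v u)" if u: "u \<in> elems X" for u
    proof -
      have "bounded_functional X (\<lambda>w. B w u)"
        unfolding bounded_functional_def
        by (intro conjI ballI allI exI[of _ "fnorm X u"] lin_left u) (use bound[OF _ u] in \<open>auto simp: mult.commute\<close>)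
      then show ?thesis unfolding w_def using U by (intro X.linear_combination(2)) auto
    qed
    have expand: "B (s n t) u = (\<Sum>v\<in>U. indicator (A v) t * B v u)" if u: "u \<in> elems X" for t u
    proof (cases "s n t \<in> U")
      case True
      have "(\<Sum>v\<in>U. indicator (A v) t * B v u) = (\<Sum>v\<in>U. if v = s n t then B v u else 0)"
        by (intro sum.cong) (auto simp: A_def indicator_def)
      then show ?thesis using True U(1) by simp
    next
      case False
      then have z: "s n t = (\<lambda>_. 0)" by (auto simp: U_def)
      have "(\<Sum>v\<in>U. indicator (A v) t * B v u) = 0"
        using False by (intro sum.neutral) (auto simp: A_def indicator_def)
      then show ?thesis using z lin_left[OF X.zero_elems X.zero_elems u, of 0 0] by simp
    qed
    have integrate: "(LINT t|lborel. B (s n t) u) = B w u" if u: "u \<in> elems X" for u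
    proof -
      have "(LINT t|lborel. B (s n t) u) = (\<Sum>v\<in>U. (LINT t|lborel. indicator (A v) t * B v u))"
        unfolding expand[OF u] using Aint by (intro Bochner_Integration.integral_sum) auto
      also have "\<dots> = (\<Sum>v\<in>U. c v * B v u)" by (simp add: c_def)
      finally show ?thesis using Bw[OF u] by simp
    qed
    have "(LINT s'|lborel. B (s n t) (s n s')) = B w (s n t)" for t
      using integrate[OF s2, of n t] sym[OF s2 s2] by simp
    then have "(LINT t|lborel. LINT s'|lborel. B (s n t) (s n s')) = (LINT t|lborel. B (s n t) w)"
      using sym[OF wX s2] by simp
    also have "\<dots> = B w w" by (rule integrate[OF wX])
    finally show ?thesis using nonneg[OF wX] by simp
  qed
  have int_n: "integrable (lborel \<Otimes>\<^sub>M lborel) (\<lambda>(t, s'). B (s n t) (s n s'))" for n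
    by (rule pairing_integrable2[OF srep srep])
  have int_f: "integrable (lborel \<Otimes>\<^sub>M lborel) (\<lambda>(t, s'). B (f t) (f s'))"
    by (rule pairing_integrable2[OF f f])
  have "(\<lambda>n. LINT z|(lborel \<Otimes>\<^sub>M lborel). (case z of (t, s') \<Rightarrow> B (s n t) (s n s')))
     \<longlonglongrightarrow> (LINT z|(lborel \<Otimes>\<^sub>M lborel). (case z of (t, s') \<Rightarrow> B (f t) (f s')))"
  proof (rule integral_dominated_convergence[where w = "\<lambda>(t, s'). (2 * fnorm X (f t)) * (2 * fnorm X (f s'))"])
    show "integrable (lborel \<Otimes>\<^sub>M lborel) (\<lambda>(t, s'). (2 * fnorm X (f t)) * (2 * fnorm X (f s')))"
      using X.L2_representative_integrable_norm[OF f] by (intro integrable_tensor) auto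
    show "AE z in lborel \<Otimes>\<^sub>M lborel. (\<lambda>n. case z of (t, s') \<Rightarrow> B (s n t) (s n s')) \<longlonglongrightarrow> (case z of (t, s') \<Rightarrow> B (f t) (f s'))"
      by (rule AE_I2, clarsimp) (intro pairing_tendsto s2 s3 strongly_borel_elems[OF sb])
    show "AE z in lborel \<Otimes>\<^sub>M lborel. norm (case z of (t, s') \<Rightarrow> B (s n t) (s n s'))
       \<le> (case z of (t, s') \<Rightarrow> (2 * fnorm X (f t)) * (2 * fnorm X (f s')))" for n
    proof (rule AE_I2, clarify)
      fix t s'
      have "\<bar>B (s n t) (s n s')\<bar> \<le> fnorm X (s n t) * fnorm X (s n s')"
        by (intro bound s2)
      also have "\<dots> \<le> (2 * fnorm X (f t)) * (2 * fnorm X (f s'))"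
        using s4 X.fnorm_nonneg s2 strongly_borel_elems[OF sb] by (intro mult_mono) auto
      finally show "norm (B (s n t) (s n s')) \<le> (2 * fnorm X (f t)) * (2 * fnorm X (f s'))" by simp
    qed
  qed (use int_n int_f in \<open>auto dest: borel_measurable_integrable\<close>)
  moreover have "(LINT z|(lborel \<Otimes>\<^sub>M lborel). (case z of (t, s') \<Rightarrow> B (s n t) (s n s'))) \<ge> 0" for n
    using step[of n] lborel_pair.integral_fst[OF int_n[of n]] by simp
  ultimately have "0 \<le> (LINT z|(lborel \<Otimes>\<^sub>M lborel). (case z of (t, s') \<Rightarrow> B (f t) (f s')))"
    by (intro LIMSEQ_le_const) auto
  then show ?thesis using lborel_pair.integral_fst[OF int_f] by simp
qed

lemma integral_cauchy_schwarz:
  fixes f g :: "real \<Rightarrow> real"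
  assumes "f \<in> borel_measurable borel" "g \<in> borel_measurable borel"
    "integrable lborel (\<lambda>t. (f t)\<^sup>2)" "integrable lborel (\<lambda>t. (g t)\<^sup>2)"
  shows "\<bar>LINT t|lborel. f t * g t\<bar> \<le> sqrt (LINT t|lborel. (f t)\<^sup>2) * sqrt (LINT t|lborel. (g t)\<^sup>2)"
proof -
  interpret semi_inner_product "{f. square_integrable UNIV f}" "l2_inner (UNIV :: real set)"
    by (rule l2_semi_inner_product)
  have *: "f \<in> borel_measurable lebesgue" "g \<in> borel_measurable lebesgue"
    using assms by (auto intro: measurable_completion)
  have "f \<in> {f. square_integrable UNIV f}" "g \<in> {f. square_integrable UNIV f}"
    using assms * by (auto simp: square_integrable_def lebesgue_on_UNIV_eq integrable_completion)
  from cauchy_schwarz[OF this] show ?thesis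
    using assms by (simp add: l2_inner_def lebesgue_on_UNIV_eq integral_completion power2_eq_square)
qed

section \<open>Second difference quotients and the hat kernel\<close>

text \<open>The second difference quotient of the positive part: the triangular probability density on the
  interval from 0 to \<open>2 \<epsilon>\<close>.  It arises because \<open>max 0 (t - s)\<close> is the kernel of the double primitive.\<close>

definition hat :: "real \<Rightarrow> real \<Rightarrow> real" where
  "hat \<epsilon> x = (max 0 x - 2 * max 0 (x - \<epsilon>) + max 0 (x - 2 * \<epsilon>)) / \<epsilon>\<^sup>2"

lemma hat_nonneg: "\<epsilon> > 0 \<Longrightarrow> 0 \<le> hat \<epsilon> x"
  by (auto simp: hat_def max_def)

lemma hat_zero: "\<epsilon> > 0 \<Longrightarrow> x \<le> 0 \<or> 2 * \<epsilon> \<le> x \<Longrightarrow> hat \<epsilon> x = 0"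
  by (auto simp: hat_def max_def)

lemma hat_measurable [measurable]: "hat \<epsilon> \<in> borel_measurable borel"
  unfolding hat_def by measurable

text \<open>The kernel is the derivative of the second difference quotient \<open>K\<close> of \<open>(max 0 x)\<^sup>2 / 2\<close>.\<close>

lemma hat_integral:
  assumes "\<epsilon> > 0" shows "integrable lborel (hat \<epsilon>)" "integral\<^sup>L lborel (hat \<epsilon>) = 1"
proof -
  define p :: "real \<Rightarrow> real" where "p x = (max 0 x)\<^sup>2 / 2" for x
  have p: "(p has_real_derivative max 0 x) (at x)" for x
  proof -
    consider "x > 0" | "x < 0" | "x = 0" by linarith
    then show ?thesis
    proof cases
      case 1
      have "((\<lambda>x. x\<^sup>2 / 2) has_real_derivative x) (at x)" by (auto intro!: derivative_eq_intros)
      then have "(p has_real_derivative x) (at x)"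
        by (rule has_field_derivative_transform_within_open[of _ _ _ "{0<..}"]) (use 1 in \<open>auto simp: p_def\<close>)
      then show ?thesis using 1 by simp
    next
      case 2
      have "((\<lambda>x. 0) has_real_derivative 0) (at x)" by simp
      then have "(p has_real_derivative 0) (at x)"
        by (rule has_field_derivative_transform_within_open[of _ _ _ "{..<0}"]) (use 2 in \<open>auto simp: p_def\<close>)
      then show ?thesis using 2 by simp
    next
      case 3
      have "((\<lambda>y. max 0 y / 2 * (max 0 y / y)) \<longlongrightarrow> 0) (at (0::real))"
      proof (rule Lim_null_comparison)
        show "\<forall>\<^sub>F y in at (0::real). norm (max 0 y / 2 * (max 0 y / y)) \<le> \<bar>y\<bar>"
          by (rule always_eventually) (auto simp: max_def)
        show "((\<lambda>y::real. \<bar>y\<bar>) \<longlongrightarrow> 0) (at 0)" by (rule tendsto_eq_intros | simp)+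
      qed
      then show ?thesis using 3
        by (simp add: has_field_derivative_iff p_def power2_eq_square)
    qed
  qed
  define K where "K x = (p x - 2 * p (x - \<epsilon>) + p (x - 2 * \<epsilon>)) / \<epsilon>\<^sup>2" for x
  have K: "(K has_real_derivative hat \<epsilon> x) (at x)" for x
  proof -
    have "((\<lambda>x. p x - 2 * p (x - \<epsilon>) + p (x - 2 * \<epsilon>)) has_real_derivative
        max 0 x - 2 * max 0 (x - \<epsilon>) + max 0 (x - 2 * \<epsilon>)) (at x)"
      by (auto intro!: derivative_eq_intros DERIV_chain2[OF p])
    from DERIV_cdivide[OF this, of "\<epsilon>\<^sup>2"] show ?thesis
      unfolding K_def hat_def .
  qed
  have "has_bochner_integral lborel (\<lambda>x. hat \<epsilon> x * indicator {0..2 * \<epsilon>} x) (K (2 * \<epsilon>) - K 0)"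
  proof (rule has_bochner_integral_FTC_Icc_real)
    show "DERIV K x :> hat \<epsilon> x" for x by (rule K)
    show "isCont (hat \<epsilon>) x" for x unfolding hat_def by (intro continuous_intros) (use assms in auto)
  qed (use assms in auto)
  moreover have "hat \<epsilon> x * indicator {0..2 * \<epsilon>} x = hat \<epsilon> x" for x
    using hat_zero[OF assms, of x] by (cases "x \<in> {0..2 * \<epsilon>}") auto
  moreover have "K (2 * \<epsilon>) - K 0 = 1"
    using assms by (simp add: K_def p_def power2_eq_square max_def field_simps)
  ultimately have "has_bochner_integral lborel (hat \<epsilon>) 1" by simp
  then show "integrable lborel (hat \<epsilon>)" "integral\<^sup>L lborel (hat \<epsilon>) = 1"
    by (auto simp: has_bochner_integral_iff)
qed

lemma hat_scale: "\<epsilon> > 0 \<Longrightarrow> \<epsilon> * hat \<epsilon> (\<epsilon> * y) = hat 1 y"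
proof -
  assume e: "\<epsilon> > 0"
  have "max 0 (\<epsilon> * y) = \<epsilon> * max 0 y" "max 0 (\<epsilon> * y - \<epsilon>) = \<epsilon> * max 0 (y - 1)"
    "max 0 (\<epsilon> * y - 2 * \<epsilon>) = \<epsilon> * max 0 (y - 2)"
    using e by (auto simp: max_def zero_le_mult_iff algebra_simps)
  then show ?thesis using e by (simp add: hat_def field_simps power2_eq_square)
qed

text \<open>The kernels are rescalings of \<open>hat 1\<close>, hence an approximate identity.\<close>

lemma hat_mollify:
  fixes \<theta> :: "real \<Rightarrow> real"
  assumes \<theta>: "\<theta> \<in> borel_measurable borel" "\<And>t. \<bar>\<theta> t\<bar> \<le> B" "isCont \<theta> \<sigma>"
  shows "(\<lambda>n. LINT t|lborel. hat (1 / real (Suc n)) (t - \<sigma>) * \<theta> t) \<longlonglongrightarrow> \<theta> \<sigma>"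
proof -
  have [measurable]: "\<theta> \<in> borel_measurable borel" by fact
  have eq: "(LINT t|lborel. hat \<epsilon> (t - \<sigma>) * \<theta> t) = (LINT y|lborel. hat 1 y * \<theta> (\<sigma> + \<epsilon> * y))"
    if "\<epsilon> > 0" for \<epsilon>
    using that by (subst lborel_integral_real_affine[of \<epsilon> _ \<sigma>]) (auto simp: hat_scale[symmetric] mult.assoc)
  have "(\<lambda>n. LINT y|lborel. hat 1 y * \<theta> (\<sigma> + 1 / real (Suc n) * y)) \<longlonglongrightarrow> (LINT y|lborel. hat 1 y * \<theta> \<sigma>)"
  proof (rule integral_dominated_convergence[where w = "\<lambda>y. hat 1 y * B"])
    show "AE y in lborel. (\<lambda>n. hat 1 y * \<theta> (\<sigma> + 1 / real (Suc n) * y)) \<longlonglongrightarrow> hat 1 y * \<theta> \<sigma>"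
    proof (rule AE_I2, intro tendsto_mult tendsto_const)
      fix y
      have "(\<lambda>n. \<sigma> + 1 / real (Suc n) * y) \<longlonglongrightarrow> \<sigma> + 0 * y"
        by (intro tendsto_intros LIMSEQ_Suc[OF lim_1_over_n])
      then show "(\<lambda>n. \<theta> (\<sigma> + 1 / real (Suc n) * y)) \<longlonglongrightarrow> \<theta> \<sigma>"
        using \<theta>(3) isCont_tendsto_compose by fastforce
    qed
    show "AE y in lborel. norm (hat 1 y * \<theta> (\<sigma> + 1 / real (Suc n) * y)) \<le> hat 1 y * B" for n
      using \<theta>(2) hat_nonneg[of 1] by (intro AE_I2) (simp add: abs_mult mult_left_mono)
  qed (use hat_integral[of 1] in auto)
  then show ?thesis
    using hat_integral[of 1] by (simp add: eq)
qed

text \<open>Backward differences only involve the past, so that equations up to time \<open>T\<close> yield equations for the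
  difference quotients up to time \<open>T\<close>.\<close>

definition second_difference :: "real \<Rightarrow> (real \<Rightarrow> real) \<Rightarrow> real \<Rightarrow> real" where
  "second_difference \<epsilon> p t = (p t - 2 * p (t - \<epsilon>) + p (t - 2 * \<epsilon>)) / \<epsilon>\<^sup>2"

lemma second_difference_cong:
  "p t = q t \<Longrightarrow> p (t - \<epsilon>) = q (t - \<epsilon>) \<Longrightarrow> p (t - 2 * \<epsilon>) = q (t - 2 * \<epsilon>) \<Longrightarrow>
    second_difference \<epsilon> p t = second_difference \<epsilon> q t"
  by (simp add: second_difference_def)

lemma second_difference_lincomb:
  "second_difference \<epsilon> (\<lambda>t. c * p t + q t + r t) t =
    c * second_difference \<epsilon> p t + second_difference \<epsilon> q t + second_difference \<epsilon> r t"
  by (simp add: second_difference_def add_divide_distrib diff_divide_distrib algebra_simps)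

lemma second_difference_eq:
  "second_difference \<epsilon> p t = (1 / \<epsilon>\<^sup>2) * (1 * p t + (- 2) * p (t - \<epsilon>)) + (1 / \<epsilon>\<^sup>2) * p (t - 2 * \<epsilon>)"
  by (simp add: second_difference_def add_divide_distrib diff_divide_distrib)

lemma (in seminormed_fspace) L2_representative_second_difference:
  assumes f: "L2_representative T X f" and "\<epsilon> > 0"
  shows "L2_representative (T + 2 * \<epsilon>) X (\<lambda>t x. second_difference \<epsilon> (\<lambda>t. f t x) t)"
  unfolding second_difference_eq using \<open>\<epsilon> > 0\<close>
  by (intro L2_representative_lincomb L2_representative_shift[OF f, of "2 * \<epsilon>"] L2_representative_shift[OF f, of \<epsilon>]
      L2_representative_mono[OF f]) auto

lemma (in seminormed_fspace) functional_second_difference: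
  assumes "bounded_functional X F" "\<And>t. f t \<in> elems X"
  shows "F (\<lambda>x. second_difference \<epsilon> (\<lambda>t. f t x) t) = second_difference \<epsilon> (\<lambda>t. F (f t)) t"
  unfolding second_difference_eq
  by (simp only: bounded_functional_lin[OF assms(1) lin_elems[OF assms(2) assms(2)] assms(2)]
    bounded_functional_lin[OF assms(1) assms(2) assms(2)])

lemma integral_shift:
  fixes h :: "real \<Rightarrow> real"
  shows "(LINT r|lborel. h (r - c)) = (LINT r|lborel. h r)"
  using lborel_integral_real_affine[of 1 h "- c"] by simp

lemma integral_reflect:
  fixes h :: "real \<Rightarrow> real"
  shows "(LINT r|lborel. h (c - r)) = (LINT r|lborel. h r)"
  using lborel_integral_real_affine[of "-1" h c] by simp

lemma integrable_shift:
  fixes h :: "real \<Rightarrow> real"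
  shows "integrable lborel h \<Longrightarrow> integrable lborel (\<lambda>r. h (r - c))"
  using lborel_integrable_real_affine[of h 1 "- c"] by simp

lemma integrable_indicator_mult:
  fixes h :: "real \<Rightarrow> real"
  shows "integrable lborel h \<Longrightarrow> A \<in> sets borel \<Longrightarrow> integrable lborel (\<lambda>r. indicator A r * h r)"
  using integrable_mult_indicator[of A lborel h] by simp

lemma second_difference_primitive:
  assumes h: "integrable lborel h"
  shows "second_difference \<epsilon> (\<lambda>t. LINT r|lborel. indicator {..<t} r * h r) t
    = (LINT r|lborel. indicator {..<t} r * second_difference \<epsilon> h r)"
proof -
  have s: "(LINT r|lborel. indicator {..<t - c} r * h r) = (LINT r|lborel. indicator {..<t} r * h (r - c))" for c
    using integral_shift[of "\<lambda>r. indicator {..<t - c} r * h r" c] by (simp add: indicator_def)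
  have i: "integrable lborel (\<lambda>r. indicator {..<t} r * h (r - c))" for c
    by (intro integrable_indicator_mult integrable_shift h) auto
  have "(LINT r|lborel. indicator {..<t} r * second_difference \<epsilon> h r)
    = (LINT r|lborel. (indicator {..<t} r * h (r - 0) - 2 * (indicator {..<t} r * h (r - \<epsilon>))
       + indicator {..<t} r * h (r - 2 * \<epsilon>)) / \<epsilon>\<^sup>2)"
    by (simp add: second_difference_def algebra_simps)
  also have "\<dots> = ((LINT r|lborel. indicator {..<t} r * h (r - 0)) - 2 * (LINT r|lborel. indicator {..<t} r * h (r - \<epsilon>))
       + (LINT r|lborel. indicator {..<t} r * h (r - 2 * \<epsilon>))) / \<epsilon>\<^sup>2"
    using i[of 0] i[of \<epsilon>] i[of "2 * \<epsilon>"] by simp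
  finally have eq: "(LINT r|lborel. indicator {..<t} r * second_difference \<epsilon> h r) = \<dots>" .
  show ?thesis
    unfolding eq by (simp add: second_difference_def s)
qed

lemma integrable_positive_part_mult:
  fixes h :: "real \<Rightarrow> real"
  assumes h: "integrable lborel h" "\<And>s. s \<le> 0 \<Longrightarrow> h s = 0"
  shows "integrable lborel (\<lambda>s. max 0 (t - s) * h s)"
proof (rule Bochner_Integration.integrable_bound)
  show "integrable lborel (\<lambda>s. \<bar>t\<bar> * h s)" using h by simp
  have [measurable]: "h \<in> borel_measurable borel" using h by auto
  show "(\<lambda>s. max 0 (t - s) * h s) \<in> borel_measurable lborel" by measurable
  show "AE s in lborel. norm (max 0 (t - s) * h s) \<le> norm (\<bar>t\<bar> * h s)"
  proof (rule AE_I2)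
    fix s
    show "norm (max 0 (t - s) * h s) \<le> norm (\<bar>t\<bar> * h s)"
      using h(2)[of s] by (cases "s \<le> 0") (auto simp: abs_mult intro!: mult_right_mono)
  qed
qed

lemma second_difference_double_primitive:
  assumes h: "integrable lborel h" "\<And>s. s \<le> 0 \<Longrightarrow> h s = 0"
  shows "second_difference \<epsilon> (\<lambda>t. LINT s|lborel. max 0 (t - s) * h s) t = (LINT s|lborel. hat \<epsilon> (t - s) * h s)"
proof -
  note i = integrable_positive_part_mult[OF h]
  have "(LINT s|lborel. hat \<epsilon> (t - s) * h s)
    = (LINT s|lborel. (max 0 (t - s) * h s - 2 * (max 0 (t - \<epsilon> - s) * h s) + max 0 (t - 2 * \<epsilon> - s) * h s) / \<epsilon>\<^sup>2)"
    by (simp add: hat_def algebra_simps)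
  also have "\<dots> = ((LINT s|lborel. max 0 (t - s) * h s) - 2 * (LINT s|lborel. max 0 (t - \<epsilon> - s) * h s)
     + (LINT s|lborel. max 0 (t - 2 * \<epsilon> - s) * h s)) / \<epsilon>\<^sup>2"
    using i by simp
  finally show ?thesis by (simp add: second_difference_def)
qed

lemma AE_shift:
  fixes c :: real
  assumes "AE t in lborel. Q t" shows "AE t in lborel. Q (t - c)"
proof -
  obtain N where N: "N \<in> null_sets lborel" "{t \<in> space lborel. \<not> Q t} \<subseteq> N"
    using assms unfolding eventually_ae_filter by blast
  have [measurable]: "N \<in> sets borel" using N by auto
  have "AE t in lborel. - c + 1 * t \<notin> N"
    by (rule AE_borel_affine) (use AE_not_in[OF N(1)] in auto)
  then show ?thesis
    by eventually_elim (use N(2) in auto)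
qed

text \<open>The hat kernel is a probability density in either variable.\<close>

lemma hat_tensor_fst:
  assumes q: "integrable lborel q" and "\<epsilon> > 0"
  shows "integrable (lborel \<Otimes>\<^sub>M lborel) (\<lambda>(t, s). hat \<epsilon> (t - s) * q t)"
    and "(LINT t|lborel. LINT s|lborel. hat \<epsilon> (t - s) * q t) = integral\<^sup>L lborel q"
proof -
  have [measurable]: "q \<in> borel_measurable borel" using q by auto
  have e: "(LINT s|lborel. hat \<epsilon> (t - s)) = 1" for t
    using integral_reflect[of "hat \<epsilon>" t] hat_integral[OF \<open>\<epsilon> > 0\<close>] by simp
  have i: "integrable lborel (\<lambda>s. hat \<epsilon> (t - s))" for t
    using lborel_integrable_real_affine[OF hat_integral(1)[OF \<open>\<epsilon> > 0\<close>], of "-1" t] by simp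
  show "(LINT t|lborel. LINT s|lborel. hat \<epsilon> (t - s) * q t) = integral\<^sup>L lborel q"
    by (simp add: e)
  show "integrable (lborel \<Otimes>\<^sub>M lborel) (\<lambda>(t, s). hat \<epsilon> (t - s) * q t)"
  proof (rule lborel_pair.Fubini_integrable)
    show "(\<lambda>(t, s). hat \<epsilon> (t - s) * q t) \<in> borel_measurable (lborel \<Otimes>\<^sub>M lborel)" by measurable
    show "AE t in lborel. integrable lborel (\<lambda>s. case (t, s) of (t, s) \<Rightarrow> hat \<epsilon> (t - s) * q t)"
      using i by simp
    show "integrable lborel (\<lambda>t. LINT s|lborel. norm (case (t, s) of (t, s) \<Rightarrow> hat \<epsilon> (t - s) * q t))"
      using q hat_nonneg[OF \<open>\<epsilon> > 0\<close>] by (simp add: abs_mult e)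
  qed
qed

lemma hat_tensor_snd:
  assumes q: "integrable lborel q" and "\<epsilon> > 0"
  shows "integrable (lborel \<Otimes>\<^sub>M lborel) (\<lambda>(t, s). hat \<epsilon> (t - s) * q s)"
    and "(LINT t|lborel. LINT s|lborel. hat \<epsilon> (t - s) * q s) = integral\<^sup>L lborel q"
proof -
  have [measurable]: "q \<in> borel_measurable borel" using q by auto
  have e: "(LINT t|lborel. hat \<epsilon> (t - s)) = 1" for s
    using integral_shift[of "hat \<epsilon>" s] hat_integral[OF \<open>\<epsilon> > 0\<close>] by simp
  have i: "integrable lborel (\<lambda>t. hat \<epsilon> (t - s))" for s
    using integrable_shift[OF hat_integral(1)[OF \<open>\<epsilon> > 0\<close>]] by simp
  have sw: "integrable (lborel \<Otimes>\<^sub>M lborel) (\<lambda>(s, t). hat \<epsilon> (t - s) * q s)"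
  proof (rule lborel_pair.Fubini_integrable)
    show "(\<lambda>(s, t). hat \<epsilon> (t - s) * q s) \<in> borel_measurable (lborel \<Otimes>\<^sub>M lborel)" by measurable
    show "AE s in lborel. integrable lborel (\<lambda>t. case (s, t) of (s, t) \<Rightarrow> hat \<epsilon> (t - s) * q s)"
      using i by simp
    show "integrable lborel (\<lambda>s. LINT t|lborel. norm (case (s, t) of (s, t) \<Rightarrow> hat \<epsilon> (t - s) * q s))"
      using q hat_nonneg[OF \<open>\<epsilon> > 0\<close>] by (simp add: abs_mult e)
  qed
  from lborel_pair.integrable_product_swap[OF sw]
  show *: "integrable (lborel \<Otimes>\<^sub>M lborel) (\<lambda>(t, s). hat \<epsilon> (t - s) * q s)"
    by (simp add: split_beta')
  show "(LINT t|lborel. LINT s|lborel. hat \<epsilon> (t - s) * q s) = integral\<^sup>L lborel q"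
    using lborel_pair.Fubini_integral[OF *] by (simp add: e)
qed

section \<open>The function spaces over a bounded domain\<close>

text \<open>Scaling to the unit ball gives the duality bound.  If \<open>v\<close> has norm 0, then boundedness of the functional
  forces \<open>F v = 0\<close> instead.\<close>

lemma seminormed_H_minus_1:
  fixes \<Omega> :: "'a::euclidean_space set"
  assumes V: "seminormed_fspace (H1_0 \<Omega>)"
  shows "seminormed_fspace (H_minus_1 \<Omega>)"
    and "\<And>F v. F \<in> elems (H_minus_1 \<Omega>) \<Longrightarrow> v \<in> elems (H1_0 \<Omega>) \<Longrightarrow> \<bar>F v\<bar> \<le> fnorm (H_minus_1 \<Omega>) F * fnorm (H1_0 \<Omega>) v"
proof -
  interpret V: seminormed_fspace "H1_0 \<Omega>" by fact
  define U where "U = {v \<in> elems (H1_0 \<Omega>). fnorm (H1_0 \<Omega>) v \<le> 1}"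
  have el: "F \<in> elems (H_minus_1 \<Omega>) \<longleftrightarrow> bounded_functional (H1_0 \<Omega>) F" for F
    by (simp add: H_minus_1_def bounded_functional_def)
  have nm: "fnorm (H_minus_1 \<Omega>) F = (SUP v\<in>U. \<bar>F v\<bar>)" for F
    by (simp add: H_minus_1_def U_def)
  have U0: "(\<lambda>_. 0) \<in> U" by (simp add: U_def V.zero_elems)
  have bdd: "bdd_above ((\<lambda>v. \<bar>F v\<bar>) ` U)" if F: "bounded_functional (H1_0 \<Omega>) F" for F
  proof -
    obtain K where K: "K \<ge> 0" "\<And>v. v \<in> elems (H1_0 \<Omega>) \<Longrightarrow> \<bar>F v\<bar> \<le> K * fnorm (H1_0 \<Omega>) v"
      using V.bounded_functional_bound[OF F] by blast
    have "\<bar>F v\<bar> \<le> K" if "v \<in> U" for v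
      using K(2)[of v] K(1) that mult_left_mono[of "fnorm (H1_0 \<Omega>) v" 1 K] by (auto simp: U_def)
    then show ?thesis by (rule bdd_aboveI2)
  qed
  have upper: "\<bar>F v\<bar> \<le> fnorm (H_minus_1 \<Omega>) F" if "bounded_functional (H1_0 \<Omega>) F" "v \<in> U" for F v
    unfolding nm using that bdd by (intro cSUP_upper)
  have least: "fnorm (H_minus_1 \<Omega>) F \<le> K" if "\<And>v. v \<in> U \<Longrightarrow> \<bar>F v\<bar> \<le> K" for F K
    unfolding nm using that U0 by (intro cSUP_least) auto
  have nn: "0 \<le> fnorm (H_minus_1 \<Omega>) F" if "bounded_functional (H1_0 \<Omega>) F" for F
    using order_trans[OF abs_ge_zero upper[OF that U0]] .
  have lin: "bounded_functional (H1_0 \<Omega>) (\<lambda>v. a * F v + b * G v)"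
    if F: "bounded_functional (H1_0 \<Omega>) F" and G: "bounded_functional (H1_0 \<Omega>) G" for F G a b
  proof -
    obtain K where K: "K \<ge> 0" "\<And>v. v \<in> elems (H1_0 \<Omega>) \<Longrightarrow> \<bar>F v\<bar> \<le> K * fnorm (H1_0 \<Omega>) v"
      using V.bounded_functional_bound[OF F] by blast
    obtain L where L: "L \<ge> 0" "\<And>v. v \<in> elems (H1_0 \<Omega>) \<Longrightarrow> \<bar>G v\<bar> \<le> L * fnorm (H1_0 \<Omega>) v"
      using V.bounded_functional_bound[OF G] by blast
    have "\<bar>a * F v + b * G v\<bar> \<le> (\<bar>a\<bar> * K + \<bar>b\<bar> * L) * fnorm (H1_0 \<Omega>) v" if "v \<in> elems (H1_0 \<Omega>)" for v
    proof -
      have "\<bar>a * F v + b * G v\<bar> \<le> \<bar>a\<bar> * \<bar>F v\<bar> + \<bar>b\<bar> * \<bar>G v\<bar>"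
        using abs_triangle_ineq[of "a * F v" "b * G v"] by (simp add: abs_mult)
      also have "\<dots> \<le> \<bar>a\<bar> * (K * fnorm (H1_0 \<Omega>) v) + \<bar>b\<bar> * (L * fnorm (H1_0 \<Omega>) v)"
        using K(2)[OF that] L(2)[OF that] by (intro add_mono mult_left_mono) auto
      finally show ?thesis by (simp add: algebra_simps)
    qed
    moreover have "a * F (\<lambda>x. c * v x + d * w x) + b * G (\<lambda>x. c * v x + d * w x)
        = c * (a * F v + b * G v) + d * (a * F w + b * G w)"
      if "v \<in> elems (H1_0 \<Omega>)" "w \<in> elems (H1_0 \<Omega>)" for v w c d
      using bounded_functional_lin[OF F that] bounded_functional_lin[OF G that] by (simp add: algebra_simps)
    ultimately show ?thesis unfolding bounded_functional_def by blast
  qed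
  have scale_le: "fnorm (H_minus_1 \<Omega>) (\<lambda>v. a * F v) \<le> \<bar>a\<bar> * fnorm (H_minus_1 \<Omega>) F"
    if F: "bounded_functional (H1_0 \<Omega>) F" for F a
    by (rule least) (use upper[OF F] in \<open>auto simp: abs_mult intro!: mult_left_mono\<close>)
  show "seminormed_fspace (H_minus_1 \<Omega>)"
  proof
    have "bounded_functional (H1_0 \<Omega>) (\<lambda>_. 0)"
      unfolding bounded_functional_def by (auto intro!: exI[of _ 0])
    then show "(\<lambda>_. 0) \<in> elems (H_minus_1 \<Omega>)" by (simp add: el)
  next
    fix F G a b assume "F \<in> elems (H_minus_1 \<Omega>)" "G \<in> elems (H_minus_1 \<Omega>)"
    then show "(\<lambda>x. a * F x + b * G x) \<in> elems (H_minus_1 \<Omega>)" using lin by (simp add: el)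
  next
    fix F a assume "F \<in> elems (H_minus_1 \<Omega>)"
    then have F: "bounded_functional (H1_0 \<Omega>) F" by (simp add: el)
    show "fnorm (H_minus_1 \<Omega>) (\<lambda>x. a * F x) = \<bar>a\<bar> * fnorm (H_minus_1 \<Omega>) F"
    proof (cases "a = 0")
      case True
      then show ?thesis using least[of "\<lambda>_. 0" 0] nn[OF lin[OF F F, of 0 0]] by simp
    next
      case False
      have aF: "bounded_functional (H1_0 \<Omega>) (\<lambda>v. a * F v)" using lin[OF F F, of a 0] by simp
      have "fnorm (H_minus_1 \<Omega>) F \<le> \<bar>1 / a\<bar> * fnorm (H_minus_1 \<Omega>) (\<lambda>v. a * F v)"
        using scale_le[OF aF, of "1 / a"] False by simp
      then have "\<bar>a\<bar> * fnorm (H_minus_1 \<Omega>) F \<le> fnorm (H_minus_1 \<Omega>) (\<lambda>v. a * F v)"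
        using False by (simp add: field_simps)
      then show ?thesis using scale_le[OF F, of a] by simp
    qed
  next
    fix F G assume "F \<in> elems (H_minus_1 \<Omega>)" "G \<in> elems (H_minus_1 \<Omega>)"
    then have F: "bounded_functional (H1_0 \<Omega>) F" and G: "bounded_functional (H1_0 \<Omega>) G" by (simp_all add: el)
    show "fnorm (H_minus_1 \<Omega>) (\<lambda>x. F x + G x) \<le> fnorm (H_minus_1 \<Omega>) F + fnorm (H_minus_1 \<Omega>) G"
      by (rule least) (use upper[OF F] upper[OF G] abs_triangle_ineq order_trans add_mono in meson)
  next
    fix F assume "F \<in> elems (H_minus_1 \<Omega>)"
    then show "0 \<le> fnorm (H_minus_1 \<Omega>) F" using nn by (simp add: el)
  qed
  show "\<bar>F v\<bar> \<le> fnorm (H_minus_1 \<Omega>) F * fnorm (H1_0 \<Omega>) v"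
    if "F \<in> elems (H_minus_1 \<Omega>)" and v: "v \<in> elems (H1_0 \<Omega>)" for F v
  proof -
    have F: "bounded_functional (H1_0 \<Omega>) F" using that by (simp add: el)
    show ?thesis
    proof (cases "fnorm (H1_0 \<Omega>) v = 0")
      case True
      then show ?thesis
        using V.bounded_functional_null[OF F v V.zero_elems] V.bounded_functional_scale[OF F v, of 0] by simp
    next
      case False
      then have pos: "fnorm (H1_0 \<Omega>) v > 0" using V.fnorm_nonneg[OF v] by simp
      let ?c = "1 / fnorm (H1_0 \<Omega>) v"
      have "(\<lambda>x. ?c * v x) \<in> U"
        using V.scale_elems[OF v, of ?c] V.fnorm_scale[OF v, of ?c] pos by (simp add: U_def)
      from upper[OF F this] have "\<bar>?c * F v\<bar> \<le> fnorm (H_minus_1 \<Omega>) F"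
        using V.bounded_functional_scale[OF F v, of ?c] by simp
      then show ?thesis using pos by (simp add: abs_mult field_simps)
    qed
  qed
qed

lemma fspace_L2: "seminormed_fspace (L2_space \<Omega>)"
  by (rule semi_inner_product_fspace[of _ "l2_inner \<Omega>"])
     (use l2_semi_inner_product[of \<Omega>] in \<open>simp_all add: L2_space_def\<close>)

context bounded_domain
begin

lemma fspace_sobolev: "seminormed_fspace (sobolev k \<Omega>)"
  by (rule semi_inner_product_fspace[OF sobolev_semi_inner_product fnorm_sobolev])

lemma fspace_H1_0: "seminormed_fspace (H1_0 \<Omega>)"
  by (rule semi_inner_product_fspace[OF H1_0_semi_inner_product]) (simp add: fnorm_H1_0 fnorm_sobolev)

end

sublocale bounded_domain \<subseteq> L: seminormed_fspace "L2_space \<Omega>" by (rule fspace_L2)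
sublocale bounded_domain \<subseteq> S: seminormed_fspace "sobolev 1 \<Omega>" by (rule fspace_sobolev)
sublocale bounded_domain \<subseteq> V: seminormed_fspace "H1_0 \<Omega>" by (rule fspace_H1_0)
sublocale bounded_domain \<subseteq> D: seminormed_fspace "H_minus_1 \<Omega>" by (rule seminormed_H_minus_1[OF fspace_H1_0])

sublocale bounded_domain \<subseteq> L_ip: semi_inner_product "elems (L2_space \<Omega>)" "l2_inner \<Omega>"
  using l2_semi_inner_product[of \<Omega>] by (simp add: L2_space_def)
sublocale bounded_domain \<subseteq> V_ip: semi_inner_product "elems (H1_0 \<Omega>)" "dirichlet_form \<Omega>"
  by (rule H1_0_dirichlet)

sublocale bounded_domain \<subseteq> LL: pairing "L2_space \<Omega>" "L2_space \<Omega>" "l2_inner \<Omega>"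
  by (rule pairing_of_inner[OF L_ip.semi_inner_product_axioms L.seminormed_fspace_axioms])
     (simp add: fnorm_L2 l2_inner_nonneg)
sublocale bounded_domain \<subseteq> VV: pairing "H1_0 \<Omega>" "H1_0 \<Omega>" "dirichlet_form \<Omega>"
  by (rule pairing_of_inner[OF V_ip.semi_inner_product_axioms V.seminormed_fspace_axioms])
     (simp add: fnorm_H1_0 dirichlet_le_sobolev_1 H1_0_subset)
sublocale bounded_domain \<subseteq> DV: pairing "H_minus_1 \<Omega>" "H1_0 \<Omega>" "\<lambda>F v. F v"
proof (intro pairing.intro pairing_axioms.intro)
  fix F v v' assume F: "F \<in> elems (H_minus_1 \<Omega>)" and v: "v \<in> elems (H1_0 \<Omega>)" "v' \<in> elems (H1_0 \<Omega>)"
  have "bounded_functional (H1_0 \<Omega>) F"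
    using F by (simp add: H_minus_1_def bounded_functional_def)
  then show "F (\<lambda>x. v x - v' x) = F v - F v'" by (rule V.bounded_functional_diff[OF _ v])
qed (simp_all add: seminormed_H_minus_1(2)[OF fspace_H1_0] D.seminormed_fspace_axioms V.seminormed_fspace_axioms)

context bounded_domain
begin

lemma H1_0_to_L2:
  "v \<in> elems (H1_0 \<Omega>) \<Longrightarrow> v \<in> elems (L2_space \<Omega>)"
  "v \<in> elems (H1_0 \<Omega>) \<Longrightarrow> fnorm (L2_space \<Omega>) v \<le> fnorm (H1_0 \<Omega>) v"
proof -
  assume v: "v \<in> elems (H1_0 \<Omega>)"
  then show "v \<in> elems (L2_space \<Omega>)"
    using sobolev_square_integrable[OF H1_0_subset[OF v]] by (simp add: elems_L2)
  show "fnorm (L2_space \<Omega>) v \<le> fnorm (H1_0 \<Omega>) v"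
    using real_sqrt_le_mono[OF l2_norm_le_sobolev_1[OF H1_0_subset[OF v]]] S.fnorm_nonneg[OF H1_0_subset[OF v]]
    by (simp add: fnorm_L2 fnorm_H1_0)
qed

lemma L2_representative_H1_0_L2:
  "L2_representative T (H1_0 \<Omega>) f \<Longrightarrow> L2_representative T (L2_space \<Omega>) f"
  by (rule L2_representative_embedding[OF _ fspace_H1_0 fspace_L2]) (auto intro: H1_0_to_L2)

lemma functional_l2: "\<psi> \<in> elems (L2_space \<Omega>) \<Longrightarrow> bounded_functional (L2_space \<Omega>) (\<lambda>f. l2_inner \<Omega> f \<psi>)"
  unfolding bounded_functional_def
  by (intro conjI ballI allI exI[of _ "fnorm (L2_space \<Omega>) \<psi>"] L_ip.lin_left)
     (use LL.bound in \<open>auto simp: mult.commute\<close>)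

lemma functional_dirichlet: "v \<in> elems (H1_0 \<Omega>) \<Longrightarrow> bounded_functional (H1_0 \<Omega>) (\<lambda>f. dirichlet_form \<Omega> f v)"
  unfolding bounded_functional_def
  by (intro conjI ballI allI exI[of _ "fnorm (H1_0 \<Omega>) v"] V_ip.lin_left)
     (use VV.bound in \<open>auto simp: mult.commute\<close>)

lemma functional_evaluation: "v \<in> elems (H1_0 \<Omega>) \<Longrightarrow> bounded_functional (H_minus_1 \<Omega>) (\<lambda>F. F v)"
  unfolding bounded_functional_def
  by (intro conjI ballI allI exI[of _ "fnorm (H1_0 \<Omega>) v"])
     (use DV.bound in \<open>auto simp: mult.commute\<close>)

lemma L2_rep_elems: "L2_representative T X f \<Longrightarrow> f t \<in> elems X"
  by (auto simp: L2_representative_def intro: strongly_borel_elems)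

lemma l2_zero: "\<psi> \<in> elems (L2_space \<Omega>) \<Longrightarrow> l2_inner \<Omega> (\<lambda>_. 0) \<psi> = 0"
  using L_ip.lin_left[OF L_ip.zero_in L_ip.zero_in, of \<psi> 0 0] by simp

lemma dirichlet_zero: "v \<in> elems (H1_0 \<Omega>) \<Longrightarrow> dirichlet_form \<Omega> (\<lambda>_. 0) v = 0"
  using V_ip.lin_left[OF V_ip.zero_in V_ip.zero_in, of v 0 0] by simp

text \<open>Formally the Cauchy-Schwarz inequality for \<open>v\<close> and the integral of \<open>f\<close>.  As this integral is not
  available as a vector, the quadratic polynomial in the proof of that inequality is written as a double
  integral.\<close>

lemma integral_dirichlet_square_le:
  assumes f: "L2_representative T (H1_0 \<Omega>) f" and v: "v \<in> elems (H1_0 \<Omega>)"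
  shows "(LINT t|lborel. dirichlet_form \<Omega> v (f t))\<^sup>2
    \<le> (LINT t|lborel. LINT s|lborel. dirichlet_form \<Omega> (f t) (f s)) * dirichlet_form \<Omega> v v"
proof (rule nonneg_quadratic_discriminant)
  show "0 \<le> dirichlet_form \<Omega> v v" by (rule V_ip.nonneg[OF v])
  fix c
  let ?a = "dirichlet_form \<Omega>"
  define i :: "real \<Rightarrow> real" where "i t = indicator {0<..<1} t" for t
  define S where "S = max T 1"
  \<comment> \<open>The integral of \<open>h\<close> is \<open>v\<close>, so \<open>f + c h\<close> integrates to the vector whose square is needed.\<close>
  define h where "h t = (\<lambda>x. i t * v x)" for t
  have h: "L2_representative S (H1_0 \<Omega>) h"
    unfolding h_def i_def
    by (rule V.L2_representative_mono[OF V.L2_representative_cut[OF V.strongly_borel_const[OF v]]])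
       (auto simp: S_def)
  have fS: "L2_representative S (H1_0 \<Omega>) f"
    by (rule V.L2_representative_mono[OF f]) (simp add: S_def)
  note el = strongly_borel_elems[of "H1_0 \<Omega>" f]
  have fe: "f t \<in> elems (H1_0 \<Omega>)" for t
    using f strongly_borel_elems unfolding L2_representative_def by blast
  have he: "h t \<in> elems (H1_0 \<Omega>)" for t
    unfolding h_def by (rule V.scale_elems[OF v])
  have ah: "?a (h t) w = i t * ?a v w" "?a w (h t) = i t * ?a w v" if "w \<in> elems (H1_0 \<Omega>)" for t w
    using V_ip.lin_left[OF v v that, of "i t" 0] V_ip.lin_right[OF v v that, of "i t" 0] by (simp_all add: h_def)
  have i1: "integral\<^sup>L lborel i = 1" by (simp add: i_def[abs_def])
  note ints = VV.pairing_integrable2[OF f f] VV.pairing_integrable2[OF f h] VV.pairing_integrable2[OF h f]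
    VV.pairing_integrable2[OF h h]
  have "0 \<le> (LINT t|lborel. LINT s|lborel. ?a (\<lambda>x. 1 * f t x + c * h t x) (\<lambda>x. 1 * f s x + c * h s x))"
    by (rule double_integral_nonneg[OF V_ip.semi_inner_product_axioms VV.pairing_axioms
        V.L2_representative_lincomb[OF fS h]])
  also have "\<dots> = (LINT t|lborel. LINT s|lborel. ?a (f t) (f s) + c * ?a (f t) (h s) + (c * ?a (h t) (f s) + c\<^sup>2 * ?a (h t) (h s)))"
  proof -
    have "?a (\<lambda>x. 1 * f t x + c * h t x) (\<lambda>x. 1 * f s x + c * h s x)
      = ?a (f t) (f s) + c * ?a (f t) (h s) + (c * ?a (h t) (f s) + c\<^sup>2 * ?a (h t) (h s))" for t s
      unfolding V_ip.lin_left[OF fe he V_ip.lin_in[OF fe he]] V_ip.lin_right[OF fe he fe] V_ip.lin_right[OF fe he he]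
      by (simp add: algebra_simps power2_eq_square)
    then show ?thesis by simp
  qed
  also have "\<dots> = (LINT z|(lborel \<Otimes>\<^sub>M lborel). (case z of (t, s) \<Rightarrow> ?a (f t) (f s)) + c * (case z of (t, s) \<Rightarrow> ?a (f t) (h s))
      + (c * (case z of (t, s) \<Rightarrow> ?a (h t) (f s)) + c\<^sup>2 * (case z of (t, s) \<Rightarrow> ?a (h t) (h s))))"
    (is "_ = (LINT z|_. ?G z)")
  proof -
    have "integrable (lborel \<Otimes>\<^sub>M lborel) ?G"
      using ints by (intro Bochner_Integration.integrable_add integrable_mult_right)
    from lborel_pair.integral_fst'[OF this] show ?thesis by simp
  qed
  also have "\<dots> = (LINT t|lborel. LINT s|lborel. ?a (f t) (f s)) + c * (LINT t|lborel. LINT s|lborel. ?a (f t) (h s))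
      + (c * (LINT t|lborel. LINT s|lborel. ?a (h t) (f s)) + c\<^sup>2 * (LINT t|lborel. LINT s|lborel. ?a (h t) (h s)))"
    using ints lborel_pair.integral_fst'[OF ints(1)] lborel_pair.integral_fst'[OF ints(2)]
      lborel_pair.integral_fst'[OF ints(3)] lborel_pair.integral_fst'[OF ints(4)] by simp
  also have "\<dots> = (LINT t|lborel. LINT s|lborel. ?a (f t) (f s)) + 2 * c * (LINT t|lborel. ?a v (f t)) + c\<^sup>2 * ?a v v"
    using V_ip.sym[OF fe v] by (simp add: ah fe he v i1)
  finally show "0 \<le> (LINT t|lborel. LINT s|lborel. ?a (f t) (f s)) + 2 * c * (LINT t|lborel. ?a v (f t)) + c\<^sup>2 * ?a v v" .
qed

end

section \<open>The energy estimate for the time-integrated Cattaneo equation\<close>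

context bounded_domain
begin

lemma l2_time_integrable:
  assumes "L2_representative T (L2_space \<Omega>) f"
  shows "integrable lborel (\<lambda>t. l2_inner \<Omega> (f t) (f t))"
  using LL.pairing_integrable[OF assms assms] .

lemma primitive_before_end:
  assumes f: "L2_representative T (L2_space \<Omega>) f" and g: "L2_representative T (L2_space \<Omega>) g"
    and prim: "AE t in lborel. t \<in> {0<..<T} \<longrightarrow>
      (\<forall>\<psi>\<in>elems (L2_space \<Omega>). l2_inner \<Omega> (f t) \<psi> = (LINT r|lborel. indicator {..<t} r * l2_inner \<Omega> (g r) \<psi>))"
  shows "AE t in lborel. t < T \<longrightarrow>
      (\<forall>\<psi>\<in>elems (L2_space \<Omega>). l2_inner \<Omega> (f t) \<psi> = (LINT r|lborel. indicator {..<t} r * l2_inner \<Omega> (g r) \<psi>))"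
  using prim
proof eventually_elim
  case (elim t)
  show ?case
  proof (cases "t > 0")
    case False
    have z: "f t = (\<lambda>_. 0)" "\<And>r. r \<le> 0 \<Longrightarrow> g r = (\<lambda>_. 0)"
      using f g False by (auto simp: L2_representative_def)
    have "(LINT r|lborel. indicator {..<t} r * l2_inner \<Omega> (g r) \<psi>) = 0" if "\<psi> \<in> elems (L2_space \<Omega>)" for \<psi>
      using False that by (intro Bochner_Integration.integral_eq_zero_AE AE_I2) (auto simp: indicator_def z l2_zero)
    then show ?thesis by (simp add: z l2_zero)
  qed (use elim in simp)
qed

text \<open>A primitive tested with its derivative: by symmetry only half of the square contributes.\<close>

lemma integral_derivative_times_primitive:
  assumes g: "L2_representative T (L2_space \<Omega>) g" and f: "L2_representative T (L2_space \<Omega>) f"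
    and prim: "AE t in lborel. t < c \<longrightarrow>
      (\<forall>\<psi>\<in>elems (L2_space \<Omega>). l2_inner \<Omega> (f t) \<psi> = (LINT r|lborel. indicator {..<t} r * l2_inner \<Omega> (g r) \<psi>))"
  shows "(LINT t|lborel. indicator {..<c} t * l2_inner \<Omega> (g t) (f t))
    = (LINT t|lborel. LINT s|lborel. l2_inner \<Omega> (\<lambda>x. indicator {..<c} t * g t x) (\<lambda>x. indicator {..<c} s * g s x)) / 2"
proof -
  let ?l = "l2_inner \<Omega>"
  define h where "h t = (\<lambda>x. indicator {..<c} t * g t x)" for t
  have h: "L2_representative T (L2_space \<Omega>) h"
    unfolding h_def by (rule L.L2_representative_indicator[OF g]) simp
  note ge = L2_rep_elems[OF g] and fe = L2_rep_elems[OF f] and he = L2_rep_elems[OF h]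
  have lh: "?l (h t) w = indicator {..<c} t * ?l (g t) w" if "w \<in> elems (L2_space \<Omega>)" for t w
    using L_ip.lin_left[OF ge ge that, of "indicator {..<c} t" t 0 t] by (simp add: h_def)
  have lh': "?l w (h t) = indicator {..<c} t * ?l w (g t)" if "w \<in> elems (L2_space \<Omega>)" for t w
    using L_ip.lin_right[OF ge ge that, of "indicator {..<c} t" t 0 t] by (simp add: h_def)
  have tri: "integrable lborel (\<lambda>t. LINT s|lborel. indicator {..<t} s * ?l (h t) (h s))"
    "(LINT t|lborel. LINT s|lborel. indicator {..<t} s * ?l (h t) (h s)) = (LINT t|lborel. LINT s|lborel. ?l (h t) (h s)) / 2"
    using triangle_integral[OF LL.pairing_integrable2[OF h h]] L_ip.sym[OF he he] by auto
  have "(LINT t|lborel. indicator {..<c} t * ?l (g t) (f t)) = (LINT t|lborel. LINT s|lborel. indicator {..<t} s * ?l (h t) (h s))"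
  proof (rule integral_cong_AE)
    show "(\<lambda>t. indicator {..<c} t * ?l (g t) (f t)) \<in> borel_measurable lborel"
      using LL.pairing_integrable[OF g f] by auto
    show "AE t in lborel. indicator {..<c} t * ?l (g t) (f t) = (LINT s|lborel. indicator {..<t} s * ?l (h t) (h s))"
      using prim
    proof eventually_elim
      case (elim t)
      show ?case
      proof (cases "t < c")
        case True
        have "?l (g t) (f t) = ?l (f t) (g t)" by (rule L_ip.sym[OF ge fe])
        also have "\<dots> = (LINT r|lborel. indicator {..<t} r * ?l (g r) (g t))"
          using elim True ge by blast
        also have "\<dots> = (LINT s|lborel. indicator {..<t} s * ?l (h t) (h s))"
        proof (rule Bochner_Integration.integral_cong[OF refl])
          fix r
          show "indicator {..<t} r * ?l (g r) (g t) = indicator {..<t} r * ?l (h t) (h r)"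
            using True L_ip.sym[OF ge ge, of r t] by (simp add: lh lh' ge he split: split_indicator)
        qed
        finally show ?thesis using True by simp
      next
        case False
        then show ?thesis by (simp add: lh he)
      qed
    qed
  qed (use tri in auto)
  then show ?thesis using tri by (simp add: h_def)
qed

lemma triangle_integral_dirichlet:
  assumes f: "L2_representative T (H1_0 \<Omega>) f"
  shows "(LINT t|lborel. LINT s|lborel. indicator {..<t} s * dirichlet_form \<Omega> (f s) (f t))
      = (LINT t|lborel. LINT s|lborel. dirichlet_form \<Omega> (f t) (f s)) / 2"
    and "integrable lborel (\<lambda>t. LINT s|lborel. indicator {..<t} s * dirichlet_form \<Omega> (f s) (f t))"
proof -
  have "dirichlet_form \<Omega> (f s) (f t) = dirichlet_form \<Omega> (f t) (f s)" for s t
    by (rule V_ip.sym[OF L2_rep_elems[OF f] L2_rep_elems[OF f]])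
  then show "(LINT t|lborel. LINT s|lborel. indicator {..<t} s * dirichlet_form \<Omega> (f s) (f t))
      = (LINT t|lborel. LINT s|lborel. dirichlet_form \<Omega> (f t) (f s)) / 2"
    "integrable lborel (\<lambda>t. LINT s|lborel. indicator {..<t} s * dirichlet_form \<Omega> (f s) (f t))"
    using triangle_integral[OF VV.pairing_integrable2[OF f f]] by simp_all
qed

end

text \<open>The Cattaneo equation integrated once in time, for a displacement \<open>z\<close> with velocity \<open>z'\<close> that starts at
  rest; \<open>u'\<close> is the derivative of the control and \<open>y1\<close> the velocity of the motion from which the
  displacement is measured.  Integration in time replaces the second derivative, which is a functional,
  by a function.  That the right-hand side is a double primitive, without a term linear in \<open>t\<close>, reflects
  the compatibility of the initial data.\<close>

locale cattaneo = bounded_domain \<Omega> for \<Omega> :: "'a::euclidean_space set" +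
  fixes T \<tau> :: real and z z' u' :: "real \<Rightarrow> 'a \<Rightarrow> real" and y1 :: "'a \<Rightarrow> real"
  assumes T: "T > 0" and \<tau>: "\<tau> > 0"
    and z: "L2_representative T (H1_0 \<Omega>) z" and z': "L2_representative T (L2_space \<Omega>) z'"
    and u': "L2_representative T (L2_space \<Omega>) u'" and y1: "y1 \<in> elems (H1_0 \<Omega>)"
    and primitive: "AE t in lborel. t \<in> {0<..<T} \<longrightarrow>
      (\<forall>\<psi>\<in>elems (L2_space \<Omega>). l2_inner \<Omega> (z t) \<psi> = (LINT r|lborel. indicator {..<t} r * l2_inner \<Omega> (z' r) \<psi>))"
    and equation: "AE t in lborel. t \<in> {0<..<T} \<longrightarrow> (\<forall>v\<in>elems (H1_0 \<Omega>).
      \<tau> * l2_inner \<Omega> (z' t) v + l2_inner \<Omega> (z t) v + (LINT r|lborel. indicator {..<t} r * dirichlet_form \<Omega> (z r) v)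
      = (LINT s|lborel. max 0 (t - s) * (l2_inner \<Omega> (u' s) v - indicator {0<..<T} s * dirichlet_form \<Omega> y1 v)))"
begin

text \<open>In place of the acceleration, its approximation \<open>\<xi>\<close> serves as a test function, as it has values in
  \<open>H\<^sub>0\<^sup>1\<close>.\<close>

abbreviation "\<xi> \<epsilon> t \<equiv> (\<lambda>x. second_difference \<epsilon> (\<lambda>t. z t x) t)"
abbreviation "\<xi>' \<epsilon> t \<equiv> (\<lambda>x. second_difference \<epsilon> (\<lambda>t. z' t x) t)"

abbreviation "load v s \<equiv> l2_inner \<Omega> (u' s) v - indicator {0<..<T} s * dirichlet_form \<Omega> y1 v"

lemma zero_before:
  "t \<le> 0 \<Longrightarrow> z t = (\<lambda>_. 0)" "t \<le> 0 \<Longrightarrow> z' t = (\<lambda>_. 0)" "t \<le> 0 \<Longrightarrow> u' t = (\<lambda>_. 0)"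
  using z z' u' by (auto simp: L2_representative_def)

lemma load_integrable:
  assumes "v \<in> elems (H1_0 \<Omega>)" shows "integrable lborel (load v)"
proof -
  have "integrable lborel (\<lambda>s. indicator {0<..<T} s * dirichlet_form \<Omega> y1 v)"
    by (intro integrable_mult_left integrable_indicator_Ioo)
  then show ?thesis
    using L.L2_representative_functional[OF u' functional_l2[OF H1_0_to_L2(1)[OF assms]]]
    by (rule Bochner_Integration.integrable_diff[rotated])
qed

lemma load_zero: "v \<in> elems (H1_0 \<Omega>) \<Longrightarrow> s \<le> 0 \<Longrightarrow> load v s = 0"
  using l2_zero[OF H1_0_to_L2(1)] by (simp add: zero_before)

lemma all_times:
  "AE t in lborel. t < T \<longrightarrow>
    (\<forall>\<psi>\<in>elems (L2_space \<Omega>). l2_inner \<Omega> (z t) \<psi> = (LINT r|lborel. indicator {..<t} r * l2_inner \<Omega> (z' r) \<psi>)) \<and>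
    (\<forall>v\<in>elems (H1_0 \<Omega>). \<tau> * l2_inner \<Omega> (z' t) v + l2_inner \<Omega> (z t) v
        + (LINT r|lborel. indicator {..<t} r * dirichlet_form \<Omega> (z r) v) = (LINT s|lborel. max 0 (t - s) * load v s))"
  using primitive_before_end[OF L2_representative_H1_0_L2[OF z] z' primitive] equation
proof eventually_elim
  case (elim t)
  show ?case
  proof (cases "t > 0")
    case True
    then show ?thesis using elim by simp
  next
    case False
    have "(LINT r|lborel. indicator {..<t} r * dirichlet_form \<Omega> (z r) v) = 0" if "v \<in> elems (H1_0 \<Omega>)" for v
      using False that by (intro Bochner_Integration.integral_eq_zero_AE AE_I2) (auto simp: indicator_def zero_before dirichlet_zero)
    moreover have "(LINT s|lborel. max 0 (t - s) * load v s) = 0" if "v \<in> elems (H1_0 \<Omega>)" for v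
    proof (intro Bochner_Integration.integral_eq_zero_AE AE_I2)
      fix s
      show "max 0 (t - s) * load v s = 0"
      proof (cases "s \<le> 0")
        case True
        then show ?thesis using load_zero[OF that True] by simp
      next
        case s: False
        then show ?thesis using False by simp
      qed
    qed
    ultimately show ?thesis using False elim by (simp add: zero_before l2_zero H1_0_to_L2(1))
  qed
qed

text \<open>All operations in the equation commute with translations in time, and second differences turn the
  double primitive of the load into its average with the hat kernel.\<close>

lemma second_difference_equation:
  assumes "\<epsilon> > 0"
  shows "AE t in lborel. t < T \<longrightarrow>
    (\<forall>\<psi>\<in>elems (L2_space \<Omega>). l2_inner \<Omega> (\<xi> \<epsilon> t) \<psi> = (LINT r|lborel. indicator {..<t} r * l2_inner \<Omega> (\<xi>' \<epsilon> r) \<psi>)) \<and>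
    (\<forall>v\<in>elems (H1_0 \<Omega>). \<tau> * l2_inner \<Omega> (\<xi>' \<epsilon> t) v + l2_inner \<Omega> (\<xi> \<epsilon> t) v
        + (LINT r|lborel. indicator {..<t} r * dirichlet_form \<Omega> (\<xi> \<epsilon> r) v) = (LINT s|lborel. hat \<epsilon> (t - s) * load v s))"
  using all_times AE_shift[OF all_times, of \<epsilon>] AE_shift[OF all_times, of "2 * \<epsilon>"]
proof eventually_elim
  case (elim t)
  have ze: "z t \<in> elems (L2_space \<Omega>)" "z t \<in> elems (H1_0 \<Omega>)" "z' t \<in> elems (L2_space \<Omega>)" for t
    using L2_rep_elems[OF z] L2_rep_elems[OF z'] H1_0_to_L2(1) by auto
  have l_\<xi>: "l2_inner \<Omega> (\<xi> \<epsilon> t) \<psi> = second_difference \<epsilon> (\<lambda>t. l2_inner \<Omega> (z t) \<psi>) t"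
    "l2_inner \<Omega> (\<xi>' \<epsilon> t) \<psi> = second_difference \<epsilon> (\<lambda>t. l2_inner \<Omega> (z' t) \<psi>) t"
    if "\<psi> \<in> elems (L2_space \<Omega>)" for t \<psi>
    using L.functional_second_difference[OF functional_l2[OF that]] ze by auto
  have a_\<xi>: "dirichlet_form \<Omega> (\<xi> \<epsilon> t) v = second_difference \<epsilon> (\<lambda>t. dirichlet_form \<Omega> (z t) v) t"
    if "v \<in> elems (H1_0 \<Omega>)" for t v
    using V.functional_second_difference[OF functional_dirichlet[OF that]] ze by auto
  show ?case
  proof (intro impI conjI ballI)
    fix \<psi> assume t: "t < T" and \<psi>: "\<psi> \<in> elems (L2_space \<Omega>)"
    have "second_difference \<epsilon> (\<lambda>t. l2_inner \<Omega> (z t) \<psi>) t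
        = second_difference \<epsilon> (\<lambda>t. LINT r|lborel. indicator {..<t} r * l2_inner \<Omega> (z' r) \<psi>) t"
      using elim t assms \<psi> by (intro second_difference_cong) auto
    also have "\<dots> = (LINT r|lborel. indicator {..<t} r * second_difference \<epsilon> (\<lambda>r. l2_inner \<Omega> (z' r) \<psi>) r)"
      by (rule second_difference_primitive[OF L.L2_representative_functional[OF z' functional_l2[OF \<psi>]]])
    finally show "l2_inner \<Omega> (\<xi> \<epsilon> t) \<psi> = (LINT r|lborel. indicator {..<t} r * l2_inner \<Omega> (\<xi>' \<epsilon> r) \<psi>)"
      by (simp add: l_\<xi>[OF \<psi>])
  next
    fix v assume t: "t < T" and v: "v \<in> elems (H1_0 \<Omega>)"
    note v' = H1_0_to_L2(1)[OF v]
    have "second_difference \<epsilon> (\<lambda>t. \<tau> * l2_inner \<Omega> (z' t) v + l2_inner \<Omega> (z t) v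
        + (LINT r|lborel. indicator {..<t} r * dirichlet_form \<Omega> (z r) v)) t
       = second_difference \<epsilon> (\<lambda>t. LINT s|lborel. max 0 (t - s) * load v s) t"
      using elim t assms v by (intro second_difference_cong) auto
    also have "\<dots> = (LINT s|lborel. hat \<epsilon> (t - s) * load v s)"
      by (rule second_difference_double_primitive[OF load_integrable[OF v] load_zero[OF v]])
    finally show "\<tau> * l2_inner \<Omega> (\<xi>' \<epsilon> t) v + l2_inner \<Omega> (\<xi> \<epsilon> t) v
        + (LINT r|lborel. indicator {..<t} r * dirichlet_form \<Omega> (\<xi> \<epsilon> r) v) = (LINT s|lborel. hat \<epsilon> (t - s) * load v s)"
      unfolding second_difference_lincomb
        second_difference_primitive[OF V.L2_representative_functional[OF z functional_dirichlet[OF v]]]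
      by (simp add: l_\<xi>[OF v'] a_\<xi>[OF v])
  qed
qed

abbreviation "before \<epsilon> c t \<equiv> (\<lambda>x. indicator {..<c} t * \<xi> \<epsilon> t x)"

text \<open>Testing with \<open>\<xi>\<close> up to time \<open>c\<close> produces the formal Dirichlet square of the integral of \<open>\<xi>\<close>, an
  approximation of the velocity at time \<open>c\<close>, and the work of the damping.\<close>

definition "potential \<epsilon> c = (LINT t|lborel. LINT s|lborel. dirichlet_form \<Omega> (before \<epsilon> c t) (before \<epsilon> c s))"
definition "dissipation \<epsilon> c = (LINT t|lborel. l2_inner \<Omega> (before \<epsilon> c t) (before \<epsilon> c t))"

lemma \<xi>_rep: "\<epsilon> > 0 \<Longrightarrow> L2_representative (T + 2 * \<epsilon>) (H1_0 \<Omega>) (\<xi> \<epsilon>)"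
  by (rule V.L2_representative_second_difference[OF z])

lemma \<xi>'_rep: "\<epsilon> > 0 \<Longrightarrow> L2_representative (T + 2 * \<epsilon>) (L2_space \<Omega>) (\<xi>' \<epsilon>)"
  by (rule L.L2_representative_second_difference[OF z'])

lemma before_rep: "\<epsilon> > 0 \<Longrightarrow> L2_representative (T + 2 * \<epsilon>) (H1_0 \<Omega>) (before \<epsilon> c)"
  by (rule V.L2_representative_indicator[OF \<xi>_rep]) auto

lemma before_L2: "\<epsilon> > 0 \<Longrightarrow> L2_representative (T + 2 * \<epsilon>) (L2_space \<Omega>) (before \<epsilon> c)"
  by (rule L2_representative_H1_0_L2[OF before_rep])

text \<open>Young's inequality under the hat kernel, which is a probability density in each variable.\<close>

lemma work_of_control_le:
  assumes e: "\<epsilon> > 0"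
  shows "integrable (lborel \<Otimes>\<^sub>M lborel) (\<lambda>(t, s). hat \<epsilon> (t - s) * l2_inner \<Omega> (u' s) (before \<epsilon> c t))"
    and "(LINT t|lborel. LINT s|lborel. hat \<epsilon> (t - s) * l2_inner \<Omega> (u' s) (before \<epsilon> c t))
      \<le> (LINT t|lborel. l2_inner \<Omega> (u' t) (u' t)) / 2 + dissipation \<epsilon> c / 2"
proof -
  let ?l = "l2_inner \<Omega>"
  note cL = before_L2[OF e, of c]
  note el = L2_rep_elems[OF u'] L2_rep_elems[OF cL]
  define p q where "p s = ?l (u' s) (u' s)" and "q t = ?l (before \<epsilon> c t) (before \<epsilon> c t)" for s t
  have pq: "integrable lborel p" "integrable lborel q"
    unfolding p_def q_def by (rule l2_time_integrable[OF u'], rule l2_time_integrable[OF cL])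
  have young: "\<bar>?l (u' s) (before \<epsilon> c t)\<bar> \<le> p s / 2 + q t / 2" for s t
  proof -
    have "\<bar>?l (u' s) (before \<epsilon> c t)\<bar> \<le> sqrt (p s) * sqrt (q t)"
      unfolding p_def q_def by (rule L_ip.cauchy_schwarz[OF el])
    also have "2 * \<dots> \<le> (sqrt (p s))\<^sup>2 + (sqrt (q t))\<^sup>2"
      using sum_squares_bound[of "sqrt (p s)" "sqrt (q t)"] by simp
    finally show ?thesis
      using L_ip.nonneg[OF el(1)] L_ip.nonneg[OF el(2)] by (simp add: p_def q_def)
  qed
  note hp = hat_tensor_snd[OF pq(1) e] and hq = hat_tensor_fst[OF pq(2) e]
  have dom: "integrable (lborel \<Otimes>\<^sub>M lborel) (\<lambda>z. (case z of (t, s) \<Rightarrow> hat \<epsilon> (t - s) * p s) / 2 + (case z of (t, s) \<Rightarrow> hat \<epsilon> (t - s) * q t) / 2)"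
    using hp hq by (intro Bochner_Integration.integrable_add integrable_divide) auto
  have le: "\<bar>hat \<epsilon> (t - s) * ?l (u' s) (before \<epsilon> c t)\<bar> \<le> hat \<epsilon> (t - s) * p s / 2 + hat \<epsilon> (t - s) * q t / 2" for t s
    using mult_left_mono[OF young[of s t] hat_nonneg[OF e, of "t - s"]] hat_nonneg[OF e, of "t - s"]
    by (simp add: abs_mult distrib_left)
  have "integrable (lborel \<Otimes>\<^sub>M lborel) (\<lambda>(s, t). ?l (u' s) (before \<epsilon> c t))"
    by (rule LL.pairing_integrable2[OF u' cL])
  from lborel_pair.integrable_product_swap[OF this]
  have m: "(\<lambda>(t, s). ?l (u' s) (before \<epsilon> c t)) \<in> borel_measurable (lborel \<Otimes>\<^sub>M lborel)"
    by (auto dest!: borel_measurable_integrable simp: split_beta')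
  have m2: "(\<lambda>(t, s). hat \<epsilon> (t - s)) \<in> borel_measurable (lborel \<Otimes>\<^sub>M lborel)"
    by measurable
  show int: "integrable (lborel \<Otimes>\<^sub>M lborel) (\<lambda>(t, s). hat \<epsilon> (t - s) * ?l (u' s) (before \<epsilon> c t))"
  proof (rule Bochner_Integration.integrable_bound[OF dom])
    show "(\<lambda>(t, s). hat \<epsilon> (t - s) * ?l (u' s) (before \<epsilon> c t)) \<in> borel_measurable (lborel \<Otimes>\<^sub>M lborel)"
      using borel_measurable_times[OF m2 m] by (simp add: split_beta')
    show "AE z in lborel \<Otimes>\<^sub>M lborel. norm (case z of (t, s) \<Rightarrow> hat \<epsilon> (t - s) * ?l (u' s) (before \<epsilon> c t))
       \<le> norm ((case z of (t, s) \<Rightarrow> hat \<epsilon> (t - s) * p s) / 2 + (case z of (t, s) \<Rightarrow> hat \<epsilon> (t - s) * q t) / 2)"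
    proof (rule AE_I2, clarify)
      fix t s
      show "norm (hat \<epsilon> (t - s) * ?l (u' s) (before \<epsilon> c t)) \<le> norm (hat \<epsilon> (t - s) * p s / 2 + hat \<epsilon> (t - s) * q t / 2)"
        using order_trans[OF le abs_ge_self] by simp
    qed
  qed
  have "(LINT t|lborel. LINT s|lborel. hat \<epsilon> (t - s) * ?l (u' s) (before \<epsilon> c t))
     = (LINT z|(lborel \<Otimes>\<^sub>M lborel). (case z of (t, s) \<Rightarrow> hat \<epsilon> (t - s) * ?l (u' s) (before \<epsilon> c t)))"
    using lborel_pair.integral_fst'[OF int] by simp
  also have "\<dots> \<le> (LINT z|(lborel \<Otimes>\<^sub>M lborel). (case z of (t, s) \<Rightarrow> hat \<epsilon> (t - s) * p s) / 2 + (case z of (t, s) \<Rightarrow> hat \<epsilon> (t - s) * q t) / 2)"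
  proof (rule integral_mono[OF int dom], clarify)
    fix t s
    show "hat \<epsilon> (t - s) * ?l (u' s) (before \<epsilon> c t) \<le> hat \<epsilon> (t - s) * p s / 2 + hat \<epsilon> (t - s) * q t / 2"
      using order_trans[OF abs_ge_self le] .
  qed
  also have "\<dots> = integral\<^sup>L lborel p / 2 + integral\<^sup>L lborel q / 2"
    using hp hq lborel_pair.integral_fst'[OF hp(1)] lborel_pair.integral_fst'[OF hq(1)] by simp
  finally show "(LINT t|lborel. LINT s|lborel. hat \<epsilon> (t - s) * ?l (u' s) (before \<epsilon> c t))
      \<le> (LINT t|lborel. ?l (u' t) (u' t)) / 2 + dissipation \<epsilon> c / 2"
    by (simp add: p_def[abs_def] q_def[abs_def] dissipation_def)
qed

text \<open>The force exerted by \<open>y\<^sub>1\<close> is switched on at time 0, and the hat kernel spreads this moment over the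
  interval from 0 to \<open>2 \<epsilon>\<close>.  For a fixed moment the work is the product of \<open>y\<^sub>1\<close> with a difference of two
  values of the integral of \<open>\<xi>\<close>, which the potential energy controls.\<close>

lemma work_of_initial_velocity_le:
  assumes e: "\<epsilon> > 0" and c: "c \<le> T" and G: "\<And>r. r \<le> T \<Longrightarrow> potential \<epsilon> r \<le> G"
  shows "integrable (lborel \<Otimes>\<^sub>M lborel) (\<lambda>(t, s). hat \<epsilon> (t - s) * (indicator {0<..<T} s * dirichlet_form \<Omega> y1 (before \<epsilon> c t)))"
    and "\<bar>LINT t|lborel. LINT s|lborel. hat \<epsilon> (t - s) * (indicator {0<..<T} s * dirichlet_form \<Omega> y1 (before \<epsilon> c t))\<bar>
      \<le> 2 * (sqrt (dirichlet_form \<Omega> y1 y1) * sqrt G)"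
proof -
  let ?a = "dirichlet_form \<Omega>"
  have el: "before \<epsilon> r t \<in> elems (H1_0 \<Omega>)" "\<xi> \<epsilon> t \<in> elems (H1_0 \<Omega>)" for r t
    by (rule L2_rep_elems[OF before_rep[OF e]], rule L2_rep_elems[OF \<xi>_rep[OF e]])
  define m where "m t = ?a y1 (\<xi> \<epsilon> t)" for t
  have am: "?a y1 (before \<epsilon> r t) = indicator {..<r} t * m t" for r t
    using V_ip.lin_right[OF el(2) el(2) y1, of "indicator {..<r} t" t 0 t] by (simp add: m_def)
  have mi: "integrable lborel m"
  proof -
    have "m = (\<lambda>t. ?a (\<xi> \<epsilon> t) y1)" unfolding m_def using V_ip.sym[OF y1 el(2)] by auto
    then show ?thesis
      using V.L2_representative_functional[OF \<xi>_rep[OF e] functional_dirichlet[OF y1]] by simp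
  qed
  have mci: "integrable lborel (\<lambda>t. indicator {..<r} t * m t)" for r
    by (rule integrable_indicator_mult[OF mi]) simp
  have [measurable]: "m \<in> borel_measurable borel" using mi by auto
  have M: "\<bar>LINT t|lborel. indicator {..<r} t * m t\<bar> \<le> sqrt (?a y1 y1) * sqrt G" if "r \<le> T" for r
  proof -
    have "(LINT t|lborel. ?a y1 (before \<epsilon> r t))\<^sup>2 \<le> potential \<epsilon> r * ?a y1 y1"
      unfolding potential_def by (rule integral_dirichlet_square_le[OF before_rep[OF e] y1])
    also have "\<dots> \<le> G * ?a y1 y1"
      by (rule mult_right_mono[OF G[OF that] V_ip.nonneg[OF y1]])
    finally have "\<bar>LINT t|lborel. ?a y1 (before \<epsilon> r t)\<bar> \<le> sqrt (G * ?a y1 y1)"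
      by (simp add: real_le_rsqrt)
    then show ?thesis by (simp add: am real_sqrt_mult mult.commute)
  qed
  have MG: "0 \<le> sqrt (?a y1 y1) * sqrt G"
    using order_trans[OF abs_ge_zero M[OF c]] .
  let ?F = "\<lambda>(t, s). hat \<epsilon> (t - s) * (indicator {0<..<T} s * ?a y1 (before \<epsilon> c t))"
  show int: "integrable (lborel \<Otimes>\<^sub>M lborel) ?F"
  proof (rule Bochner_Integration.integrable_bound[OF hat_tensor_fst(1)[OF mci e]])
    show "?F \<in> borel_measurable (lborel \<Otimes>\<^sub>M lborel)" unfolding am by measurable
    show "AE z in lborel \<Otimes>\<^sub>M lborel. norm (?F z) \<le> norm (case z of (t, s) \<Rightarrow> hat \<epsilon> (t - s) * (indicator {..<c} t * m t))"
      unfolding am by (rule AE_I2) (auto simp: abs_mult split: split_indicator)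
  qed
  \<comment> \<open>\<open>w x\<close> is the work of the force if it is switched on at time \<open>x\<close>.\<close>
  define w where "w x = (LINT t|lborel. indicator {x<..} t * (indicator {..<c} t * m t))" for x
  have w_le: "\<bar>w x\<bar> \<le> 2 * (sqrt (?a y1 y1) * sqrt G)" for x
  proof (cases "x < c")
    case True
    have "w x = (LINT t|lborel. indicator {..<c} t * m t - indicator {..<x} t * m t)"
      unfolding w_def
    proof (rule integral_cong_AE)
      show "AE t in lborel. indicator {x<..} t * (indicator {..<c} t * m t) = indicator {..<c} t * m t - indicator {..<x} t * m t"
        using AE_lborel_singleton[of x] by eventually_elim (use True in \<open>auto simp: indicator_def\<close>)
    qed measurable
    also have "\<dots> = (LINT t|lborel. indicator {..<c} t * m t) - (LINT t|lborel. indicator {..<x} t * m t)"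
      by (rule Bochner_Integration.integral_diff[OF mci mci])
    finally show ?thesis using M[OF c] M[of x] True c by linarith
  next
    case False
    then have "w x = 0" unfolding w_def by (intro Bochner_Integration.integral_eq_zero_AE AE_I2) (auto simp: indicator_def)
    then show ?thesis using MG by simp
  qed
  have inner: "(LINT s|lborel. hat \<epsilon> (t - s) * (indicator {0<..<T} s * ?a y1 (before \<epsilon> c t)))
     = (LINT x|lborel. hat \<epsilon> x * (indicator {x<..} t * (indicator {..<c} t * m t)))" for t
  proof -
    have "(LINT s|lborel. hat \<epsilon> (t - s) * (indicator {0<..<T} s * ?a y1 (before \<epsilon> c t)))
       = (LINT x|lborel. hat \<epsilon> x * (indicator {0<..<T} (t - x) * ?a y1 (before \<epsilon> c t)))"
      using integral_reflect[of "\<lambda>x. hat \<epsilon> x * (indicator {0<..<T} (t - x) * ?a y1 (before \<epsilon> c t))" t] by simp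
    also have "\<dots> = (LINT x|lborel. hat \<epsilon> x * (indicator {x<..} t * (indicator {..<c} t * m t)))"
    proof (rule Bochner_Integration.integral_cong[OF refl])
      fix x
      show "hat \<epsilon> x * (indicator {0<..<T} (t - x) * ?a y1 (before \<epsilon> c t)) = hat \<epsilon> x * (indicator {x<..} t * (indicator {..<c} t * m t))"
        using hat_zero[OF e, of x] c unfolding am by (cases "x \<le> 0") (auto simp: indicator_def)
    qed
    finally show ?thesis .
  qed
  have int2: "integrable (lborel \<Otimes>\<^sub>M lborel) (\<lambda>(t, x). hat \<epsilon> x * (indicator {x<..} t * (indicator {..<c} t * m t)))"
  proof (rule Bochner_Integration.integrable_bound[OF integrable_tensor[OF mci hat_integral(1)[OF e]]])
    show "(\<lambda>(t, x). hat \<epsilon> x * (indicator {x<..} t * (indicator {..<c} t * m t))) \<in> borel_measurable (lborel \<Otimes>\<^sub>M lborel)"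
      unfolding split_beta' by measurable
    show "AE z in lborel \<Otimes>\<^sub>M lborel. norm (case z of (t, x) \<Rightarrow> hat \<epsilon> x * (indicator {x<..} t * (indicator {..<c} t * m t)))
       \<le> norm (case z of (t, s) \<Rightarrow> indicator {..<c} t * m t * hat \<epsilon> s)"
      by (rule AE_I2) (auto simp: abs_mult split: split_indicator)
  qed
  have "(LINT t|lborel. LINT s|lborel. hat \<epsilon> (t - s) * (indicator {0<..<T} s * ?a y1 (before \<epsilon> c t)))
     = (LINT t|lborel. LINT x|lborel. hat \<epsilon> x * (indicator {x<..} t * (indicator {..<c} t * m t)))"
    by (simp only: inner)
  also have "\<dots> = (LINT x|lborel. LINT t|lborel. hat \<epsilon> x * (indicator {x<..} t * (indicator {..<c} t * m t)))"
    using lborel_pair.Fubini_integral[OF int2] by simp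
  also have "\<dots> = (LINT x|lborel. hat \<epsilon> x * w x)"
    by (simp add: w_def)
  finally have eq: "(LINT t|lborel. LINT s|lborel. hat \<epsilon> (t - s) * (indicator {0<..<T} s * ?a y1 (before \<epsilon> c t)))
     = (LINT x|lborel. hat \<epsilon> x * w x)" .
  have "\<bar>LINT x|lborel. hat \<epsilon> x * w x\<bar> \<le> (LINT x|lborel. \<bar>hat \<epsilon> x * w x\<bar>)"
    using integral_norm_bound[of lborel "\<lambda>x. hat \<epsilon> x * w x"] by simp
  also have "\<dots> \<le> (LINT x|lborel. hat \<epsilon> x * (2 * (sqrt (?a y1 y1) * sqrt G)))"
  proof (rule integral_mono')
    show "integrable lborel (\<lambda>x. hat \<epsilon> x * (2 * (sqrt (?a y1 y1) * sqrt G)))"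
      using hat_integral[OF e] by simp
    fix x
    show "\<bar>hat \<epsilon> x * w x\<bar> \<le> hat \<epsilon> x * (2 * (sqrt (?a y1 y1) * sqrt G))"
      using mult_left_mono[OF w_le hat_nonneg[OF e]] hat_nonneg[OF e] by (simp add: abs_mult)
    show "0 \<le> hat \<epsilon> x * (2 * (sqrt (?a y1 y1) * sqrt G))"
    proof (rule mult_nonneg_nonneg[OF hat_nonneg[OF e]])
      show "0 \<le> 2 * (sqrt (?a y1 y1) * sqrt G)" using MG by linarith
    qed
  qed
  also have "\<dots> = 2 * (sqrt (?a y1 y1) * sqrt G)"
    using hat_integral[OF e] by simp
  finally show "\<bar>LINT t|lborel. LINT s|lborel. hat \<epsilon> (t - s) * (indicator {0<..<T} s * ?a y1 (before \<epsilon> c t))\<bar>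
      \<le> 2 * (sqrt (?a y1 y1) * sqrt G)"
    unfolding eq .
qed

text \<open>Test the equation for \<open>\<xi>\<close> with \<open>\<xi>\<close> and integrate up to \<open>c\<close>.  The term with \<open>\<tau>\<close> is half of a nonnegative
  double integral and is dropped, which makes the estimate uniform in \<open>\<tau>\<close>; half of the dissipation
  absorbs the work of the control.\<close>

lemma energy_inequality:
  assumes e: "\<epsilon> > 0" and c: "c \<le> T" and G: "\<And>r. r \<le> T \<Longrightarrow> potential \<epsilon> r \<le> G"
  shows "dissipation \<epsilon> c + potential \<epsilon> c
    \<le> (LINT t|lborel. l2_inner \<Omega> (u' t) (u' t)) + 4 * (sqrt (dirichlet_form \<Omega> y1 y1) * sqrt G)"
proof -
  let ?l = "l2_inner \<Omega>" and ?a = "dirichlet_form \<Omega>"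
  note cV = before_rep[OF e, of c] and cL = before_L2[OF e, of c]
  note xV = \<xi>_rep[OF e] and xL = L2_representative_H1_0_L2[OF \<xi>_rep[OF e]] and x'L = \<xi>'_rep[OF e]
  note el = L2_rep_elems[OF cV] L2_rep_elems[OF cL] L2_rep_elems[OF xV] L2_rep_elems[OF xL] L2_rep_elems[OF x'L]
  have w1: "integrable (lborel \<Otimes>\<^sub>M lborel) (\<lambda>(t, s). hat \<epsilon> (t - s) * (indicator {0<..<T} s * ?a y1 (before \<epsilon> c t)))"
    by (rule work_of_initial_velocity_le(1)[OF e c]) (rule G)
  have w2: "\<bar>LINT t|lborel. LINT s|lborel. hat \<epsilon> (t - s) * (indicator {0<..<T} s * ?a y1 (before \<epsilon> c t))\<bar>
      \<le> 2 * (sqrt (?a y1 y1) * sqrt G)"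
    by (rule work_of_initial_velocity_le(2)[OF e c]) (rule G)
  have eq: "AE t in lborel. \<tau> * (indicator {..<c} t * ?l (\<xi>' \<epsilon> t) (\<xi> \<epsilon> t)) + ?l (before \<epsilon> c t) (before \<epsilon> c t)
       + (LINT r|lborel. indicator {..<t} r * ?a (before \<epsilon> c r) (before \<epsilon> c t))
      = (LINT s|lborel. hat \<epsilon> (t - s) * ?l (u' s) (before \<epsilon> c t))
        - (LINT s|lborel. hat \<epsilon> (t - s) * (indicator {0<..<T} s * ?a y1 (before \<epsilon> c t)))"
    using second_difference_equation[OF e] lborel_pair.AE_integrable_fst'[OF work_of_control_le(1)[OF e, of c]]
      lborel_pair.AE_integrable_fst'[OF w1]
  proof eventually_elim
    case (elim t)
    show ?case
    proof (cases "t < c")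
      case True
      then have ct: "before \<epsilon> c t = \<xi> \<epsilon> t" by simp
      have "(LINT r|lborel. indicator {..<t} r * ?a (before \<epsilon> c r) (before \<epsilon> c t)) = (LINT r|lborel. indicator {..<t} r * ?a (\<xi> \<epsilon> r) (\<xi> \<epsilon> t))"
        using True by (intro Bochner_Integration.integral_cong) (auto simp: indicator_def)
      moreover have "\<tau> * ?l (\<xi>' \<epsilon> t) (\<xi> \<epsilon> t) + ?l (\<xi> \<epsilon> t) (\<xi> \<epsilon> t)
        + (LINT r|lborel. indicator {..<t} r * ?a (\<xi> \<epsilon> r) (\<xi> \<epsilon> t)) = (LINT s|lborel. hat \<epsilon> (t - s) * load (\<xi> \<epsilon> t) s)"
        using elim(1) True c el(3)[of t] by auto
      moreover have "(LINT s|lborel. hat \<epsilon> (t - s) * load (\<xi> \<epsilon> t) s)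
          = (LINT s|lborel. hat \<epsilon> (t - s) * ?l (u' s) (\<xi> \<epsilon> t)) - (LINT s|lborel. hat \<epsilon> (t - s) * (indicator {0<..<T} s * ?a y1 (\<xi> \<epsilon> t)))"
        using elim(2,3) unfolding right_diff_distrib ct by (intro Bochner_Integration.integral_diff) (simp_all add: ct)
      ultimately show ?thesis using True by (simp add: ct)
    next
      case False
      then have ct: "before \<epsilon> c t = (\<lambda>_. 0)" by simp
      have "?l w (\<lambda>_. 0) = 0" if "w \<in> elems (L2_space \<Omega>)" for w
        using L_ip.sym[OF that L_ip.zero_in] l2_zero[OF that] by simp
      moreover have "?a w (\<lambda>_. 0) = 0" if "w \<in> elems (H1_0 \<Omega>)" for w
        using V_ip.sym[OF that V_ip.zero_in] dirichlet_zero[OF that] by simp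
      ultimately show ?thesis
        using False el(1) L2_rep_elems[OF u'] y1 L_ip.zero_in unfolding ct by simp
    qed
  qed
  have i1: "integrable lborel (\<lambda>t. indicator {..<c} t * ?l (\<xi>' \<epsilon> t) (\<xi> \<epsilon> t))"
    by (rule integrable_indicator_mult[OF LL.pairing_integrable[OF x'L xL]]) simp
  have i2: "integrable lborel (\<lambda>t. ?l (before \<epsilon> c t) (before \<epsilon> c t))"
    by (rule l2_time_integrable[OF cL])
  note i3 = triangle_integral_dirichlet[OF cV]
  have i4: "integrable lborel (\<lambda>t. LINT s|lborel. hat \<epsilon> (t - s) * ?l (u' s) (before \<epsilon> c t))"
    using lborel_pair.integrable_fst'[OF work_of_control_le(1)[OF e, of c]] by simp
  have i5: "integrable lborel (\<lambda>t. LINT s|lborel. hat \<epsilon> (t - s) * (indicator {0<..<T} s * ?a y1 (before \<epsilon> c t)))"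
    using lborel_pair.integrable_fst'[OF w1] by simp
  have "(LINT t|lborel. \<tau> * (indicator {..<c} t * ?l (\<xi>' \<epsilon> t) (\<xi> \<epsilon> t)) + ?l (before \<epsilon> c t) (before \<epsilon> c t)
       + (LINT r|lborel. indicator {..<t} r * ?a (before \<epsilon> c r) (before \<epsilon> c t)))
     = (LINT t|lborel. (LINT s|lborel. hat \<epsilon> (t - s) * ?l (u' s) (before \<epsilon> c t))
        - (LINT s|lborel. hat \<epsilon> (t - s) * (indicator {0<..<T} s * ?a y1 (before \<epsilon> c t))))"
    by (rule integral_cong_AE[OF _ _ eq]) (use i1 i2 i3 i4 i5 in auto)
  then have "\<tau> * (LINT t|lborel. indicator {..<c} t * ?l (\<xi>' \<epsilon> t) (\<xi> \<epsilon> t)) + dissipation \<epsilon> c + potential \<epsilon> c / 2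
     = (LINT t|lborel. LINT s|lborel. hat \<epsilon> (t - s) * ?l (u' s) (before \<epsilon> c t))
        - (LINT t|lborel. LINT s|lborel. hat \<epsilon> (t - s) * (indicator {0<..<T} s * ?a y1 (before \<epsilon> c t)))"
    using i1 i2 i3 i4 i5 by (simp add: dissipation_def potential_def)
  moreover have "0 \<le> (LINT t|lborel. indicator {..<c} t * ?l (\<xi>' \<epsilon> t) (\<xi> \<epsilon> t))"
  proof -
    have "AE t in lborel. t < c \<longrightarrow> (\<forall>\<psi>\<in>elems (L2_space \<Omega>). ?l (\<xi> \<epsilon> t) \<psi> = (LINT r|lborel. indicator {..<t} r * ?l (\<xi>' \<epsilon> r) \<psi>))"
      using second_difference_equation[OF e] by eventually_elim (use c in auto)
    from integral_derivative_times_primitive[OF x'L xL this]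
    show ?thesis
      using double_integral_nonneg[OF L_ip.semi_inner_product_axioms LL.pairing_axioms L.L2_representative_indicator[OF x'L, of "{..<c}"]]
      by simp
  qed
  then have "0 \<le> \<tau> * (LINT t|lborel. indicator {..<c} t * ?l (\<xi>' \<epsilon> t) (\<xi> \<epsilon> t))" using \<tau> by simp
  ultimately show ?thesis
    using work_of_control_le(2)[OF e, of c] w2 by linarith
qed

text \<open>For the supremum \<open>G\<close> of the potential energies, the energy inequality reads \<open>G \<le> b + 4 sqrt A sqrt G\<close>,
  where Young's inequality absorbs \<open>G\<close>.  Finiteness of \<open>G\<close> follows from the norms of \<open>\<xi>\<close>, which may grow
  as \<open>\<epsilon>\<close> tends to 0, but these norms do not enter the final bound.\<close>

lemma dissipation_bound:
  assumes e: "\<epsilon> > 0"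
  shows "dissipation \<epsilon> T \<le> 2 * (LINT t|lborel. l2_inner \<Omega> (u' t) (u' t)) + 16 * dirichlet_form \<Omega> y1 y1"
proof -
  let ?b = "LINT t|lborel. l2_inner \<Omega> (u' t) (u' t)" and ?A = "dirichlet_form \<Omega> y1 y1"
  define G where "G = (SUP r\<in>{..T}. potential \<epsilon> r)"
  have pot_nonneg: "0 \<le> potential \<epsilon> r" for r
    unfolding potential_def
    by (rule double_integral_nonneg[OF V_ip.semi_inner_product_axioms VV.pairing_axioms before_rep[OF e]])
  have diss_nonneg: "0 \<le> dissipation \<epsilon> r" for r
    unfolding dissipation_def by (simp add: l2_inner_nonneg)
  have A: "0 \<le> ?A" by (rule V_ip.nonneg[OF y1])
  have bdd: "bdd_above (potential \<epsilon> ` {..T})"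
  proof (rule bdd_aboveI2)
    fix r
    let ?n = "\<lambda>t. fnorm (H1_0 \<Omega>) (\<xi> \<epsilon> t)"
    note xV = \<xi>_rep[OF e]
    have ni: "integrable (lborel \<Otimes>\<^sub>M lborel) (\<lambda>(t, s). ?n t * ?n s)"
      using V.L2_representative_integrable_norm[OF xV] by (intro integrable_tensor)
    note ci = VV.pairing_integrable2[OF before_rep[OF e] before_rep[OF e], of r r]
    have "potential \<epsilon> r = (LINT z|(lborel \<Otimes>\<^sub>M lborel). (case z of (t, s) \<Rightarrow> dirichlet_form \<Omega> (before \<epsilon> r t) (before \<epsilon> r s)))"
      unfolding potential_def using lborel_pair.integral_fst'[OF ci] by simp
    also have "\<dots> \<le> (LINT z|(lborel \<Otimes>\<^sub>M lborel). (case z of (t, s) \<Rightarrow> ?n t * ?n s))"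
    proof (rule integral_mono[OF ci ni], clarify)
      fix t s
      have nn: "0 \<le> ?n t" for t by (rule V.fnorm_nonneg[OF L2_rep_elems[OF xV]])
      have le: "fnorm (H1_0 \<Omega>) (before \<epsilon> r t) \<le> ?n t" for t
        using V.fnorm_scale[OF L2_rep_elems[OF xV], of "indicator {..<r} t" t] nn[of t] by (simp split: split_indicator)
      have "dirichlet_form \<Omega> (before \<epsilon> r t) (before \<epsilon> r s) \<le> fnorm (H1_0 \<Omega>) (before \<epsilon> r t) * fnorm (H1_0 \<Omega>) (before \<epsilon> r s)"
        using VV.bound[OF L2_rep_elems[OF before_rep[OF e]] L2_rep_elems[OF before_rep[OF e]], of r t r s] by linarith
      also have "\<dots> \<le> ?n t * ?n s"
        using le nn V.fnorm_nonneg[OF L2_rep_elems[OF before_rep[OF e]]] by (intro mult_mono) auto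
      finally show "dirichlet_form \<Omega> (before \<epsilon> r t) (before \<epsilon> r s) \<le> ?n t * ?n s" .
    qed
    finally show "potential \<epsilon> r \<le> (LINT z|(lborel \<Otimes>\<^sub>M lborel). (case z of (t, s) \<Rightarrow> ?n t * ?n s))" .
  qed
  have G: "potential \<epsilon> r \<le> G" if "r \<le> T" for r
    unfolding G_def using that by (intro cSUP_upper bdd) auto
  have G0: "0 \<le> G" using pot_nonneg G[of T] order_trans by blast
  have young: "4 * (sqrt ?A * sqrt G) \<le> G / 2 + 8 * ?A"
  proof -
    have "2 * (4 * sqrt ?A) * sqrt G \<le> (4 * sqrt ?A)\<^sup>2 + (sqrt G)\<^sup>2" by (rule sum_squares_bound)
    then show ?thesis using A G0 by (simp add: power_mult_distrib)
  qed
  have "G \<le> ?b + 4 * (sqrt ?A * sqrt G)"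
    unfolding G_def
  proof (rule cSUP_least)
    fix r assume "r \<in> {..T}"
    then show "potential \<epsilon> r \<le> ?b + 4 * (sqrt ?A * sqrt (SUP r\<in>{..T}. potential \<epsilon> r))"
      using energy_inequality[OF e _ G, of r] diss_nonneg[of r] by (simp add: G_def)
  qed simp
  then have "G \<le> 2 * ?b + 16 * ?A" using young by linarith
  then show ?thesis
    using energy_inequality[OF e order_refl G] young pot_nonneg[of T] by linarith
qed

end

section \<open>The bound of the acceleration\<close>

lemma primitive_measurable:
  fixes h :: "real \<Rightarrow> real"
  assumes "integrable lborel h"
  shows "(\<lambda>r. LINT s|lborel. indicator {..<r} s * h s) \<in> borel_measurable lborel"
proof -
  have [measurable]: "h \<in> borel_measurable borel" using assms by auto
  have "(\<lambda>(r, s). indicator {..<r} s * h s) \<in> borel_measurable (lborel \<Otimes>\<^sub>M lborel)"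
    unfolding split_beta' by measurable
  then show ?thesis by (rule lborel.borel_measurable_lebesgue_integral)
qed

lemma double_primitive:
  fixes h :: "real \<Rightarrow> real"
  assumes h: "integrable lborel h" "\<And>s. s \<le> 0 \<Longrightarrow> h s = 0"
  shows "(LINT r|lborel. indicator {..<t} r * (LINT s|lborel. indicator {..<r} s * h s)) = (LINT s|lborel. max 0 (t - s) * h s)"
proof -
  have [measurable]: "h \<in> borel_measurable borel" using h by auto
  have eq: "indicator {..<t} r * (indicator {..<r} s * h s) = indicator {s<..<t} r * h s" for r s
    by (auto simp: indicator_def)
  have int: "integrable (lborel \<Otimes>\<^sub>M lborel) (\<lambda>(r, s). indicator {s<..<t} r * h s)"
  proof (rule Bochner_Integration.integrable_bound[OF integrable_tensor[OF integrable_indicator_Ioo[of 0 t] h(1)]])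
    have "indicator {s<..<t} r * h s = indicator {s<..} r * indicator {..<t} r * h s" for r s
      by (simp split: split_indicator)
    then show "(\<lambda>(r, s). indicator {s<..<t} r * h s) \<in> borel_measurable (lborel \<Otimes>\<^sub>M lborel)"
      unfolding split_beta' by (simp only:) measurable
    show "AE z in lborel \<Otimes>\<^sub>M lborel. norm (case z of (r, s) \<Rightarrow> indicator {s<..<t} r * h s)
       \<le> norm (case z of (r, s) \<Rightarrow> indicator {0<..<t} r * h s)"
    proof (rule AE_I2, clarify)
      fix r s
      show "norm (indicator {s<..<t} r * h s) \<le> norm (indicator {0<..<t} r * h s)"
        using h(2)[of s] by (cases "s \<le> 0") (auto simp: indicator_def)
    qed
  qed
  have "(LINT r|lborel. indicator {..<t} r * (LINT s|lborel. indicator {..<r} s * h s))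
     = (LINT r|lborel. LINT s|lborel. indicator {s<..<t} r * h s)"
    by (simp only: integral_mult_right_zero[symmetric] eq)
  also have "\<dots> = (LINT s|lborel. LINT r|lborel. indicator {s<..<t} r * h s)"
    using lborel_pair.Fubini_integral[OF int] by simp
  also have "\<dots> = (LINT s|lborel. max 0 (t - s) * h s)"
  proof (rule Bochner_Integration.integral_cong[OF refl])
    fix s :: real
    show "(LINT r|lborel. indicator {s<..<t} r * h s) = max 0 (t - s) * h s"
      by (cases "s \<le> t") (simp_all add: measure_lborel_Ioo)
  qed
  finally show ?thesis .
qed

text \<open>\<open>z2\<close> is the second derivative of the displacement, a functional on \<open>H\<^sub>0\<^sup>1\<close> at each time, in the form of
  the twice integrated identity.\<close>

locale cattaneo_acceleration = cattaneo \<Omega> T \<tau> z z' u' y1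
  for \<Omega> :: "'a::euclidean_space set" and T \<tau> z z' u' y1 +
  fixes z2 :: "real \<Rightarrow> ('a \<Rightarrow> real) \<Rightarrow> real"
  assumes z2: "L2_representative T (H_minus_1 \<Omega>) z2"
    and acceleration: "AE t in lborel. t \<in> {0<..<T} \<longrightarrow>
      (\<forall>v\<in>elems (H1_0 \<Omega>). l2_inner \<Omega> (z t) v = (LINT s|lborel. max 0 (t - s) * z2 s v))"
begin

definition "bound = sqrt (2 * (LINT t|lborel. l2_inner \<Omega> (u' t) (u' t)) + 16 * dirichlet_form \<Omega> y1 y1)"

lemma bound_nonneg: "0 \<le> bound"
  unfolding bound_def using V_ip.nonneg[OF y1] by (simp add: l2_inner_nonneg)

lemma z2_integrable: "v \<in> elems (H1_0 \<Omega>) \<Longrightarrow> integrable lborel (\<lambda>s. z2 s v)"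
  by (rule D.L2_representative_functional[OF z2 functional_evaluation])

lemma z2_zero: "t \<notin> {0<..<T} \<Longrightarrow> z2 t v = 0"
  using z2 by (simp add: L2_representative_def)

lemma second_difference_acceleration:
  assumes "\<epsilon> > 0"
  shows "AE t in lborel. t < T \<longrightarrow> (\<forall>v\<in>elems (H1_0 \<Omega>). l2_inner \<Omega> (\<xi> \<epsilon> t) v = (LINT s|lborel. hat \<epsilon> (t - s) * z2 s v))"
proof -
  have all: "AE t in lborel. t < T \<longrightarrow> (\<forall>v\<in>elems (H1_0 \<Omega>). l2_inner \<Omega> (z t) v = (LINT s|lborel. max 0 (t - s) * z2 s v))"
    using acceleration
  proof eventually_elim
    case (elim t)
    show ?case
    proof (cases "t > 0")
      case False
      have "(LINT s|lborel. max 0 (t - s) * z2 s v) = 0" for v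
        using False z2_zero by (intro Bochner_Integration.integral_eq_zero_AE AE_I2) (auto simp: max_def)
      then show ?thesis using False by (simp add: zero_before l2_zero H1_0_to_L2(1))
    qed (use elim in simp)
  qed
  show ?thesis
    using all AE_shift[OF all, of \<epsilon>] AE_shift[OF all, of "2 * \<epsilon>"]
  proof eventually_elim
    case (elim t)
    show ?case
    proof (intro impI ballI)
      fix v assume t: "t < T" and v: "v \<in> elems (H1_0 \<Omega>)"
      have "l2_inner \<Omega> (\<xi> \<epsilon> t) v = second_difference \<epsilon> (\<lambda>t. l2_inner \<Omega> (z t) v) t"
        by (rule L.functional_second_difference[OF functional_l2[OF H1_0_to_L2(1)[OF v]] H1_0_to_L2(1)[OF L2_rep_elems[OF z]]])
      also have "\<dots> = second_difference \<epsilon> (\<lambda>t. LINT s|lborel. max 0 (t - s) * z2 s v) t"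
        using elim t assms v by (intro second_difference_cong) auto
      also have "\<dots> = (LINT s|lborel. hat \<epsilon> (t - s) * z2 s v)"
        using z2_zero by (intro second_difference_double_primitive z2_integrable v) auto
      finally show "l2_inner \<Omega> (\<xi> \<epsilon> t) v = (LINT s|lborel. hat \<epsilon> (t - s) * z2 s v)" .
    qed
  qed
qed

text \<open>The desired bound for a single test function, to be established for larger and larger classes of
  functions.\<close>

definition "controlled g \<longleftrightarrow> \<bar>LINT t|lborel. z2 t (g t)\<bar> \<le> bound * sqrt (LINT t|lborel. l2_inner \<Omega> (g t) (g t))"

lemma time_cauchy_schwarz:
  assumes f: "L2_representative S (L2_space \<Omega>) f" and g: "L2_representative S' (L2_space \<Omega>) g"
  shows "\<bar>LINT t|lborel. l2_inner \<Omega> (f t) (g t)\<bar>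
    \<le> sqrt (LINT t|lborel. l2_inner \<Omega> (f t) (f t)) * sqrt (LINT t|lborel. l2_inner \<Omega> (g t) (g t))"
proof -
  let ?f = "\<lambda>t. fnorm (L2_space \<Omega>) (f t)" and ?g = "\<lambda>t. fnorm (L2_space \<Omega>) (g t)"
  have m: "?f \<in> borel_measurable borel" "?g \<in> borel_measurable borel"
    using f g L.strongly_borel_norm unfolding L2_representative_def by blast+
  have i: "integrable lborel (\<lambda>t. (?f t)\<^sup>2)" "integrable lborel (\<lambda>t. (?g t)\<^sup>2)"
    using f g unfolding L2_representative_def by blast+
  have sq: "(?f t)\<^sup>2 = l2_inner \<Omega> (f t) (f t)" "(?g t)\<^sup>2 = l2_inner \<Omega> (g t) (g t)" for t
    by (simp_all add: fnorm_L2 l2_inner_nonneg)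
  have g': "L2_representative (max S S') (L2_space \<Omega>) g" and f': "L2_representative (max S S') (L2_space \<Omega>) f"
    using f g by (auto intro: L.L2_representative_mono)
  have "\<bar>LINT t|lborel. l2_inner \<Omega> (f t) (g t)\<bar> \<le> (LINT t|lborel. \<bar>l2_inner \<Omega> (f t) (g t)\<bar>)"
    using integral_norm_bound[of lborel "\<lambda>t. l2_inner \<Omega> (f t) (g t)"] by simp
  also have "\<dots> \<le> (LINT t|lborel. ?f t * ?g t)"
  proof (rule integral_mono)
    show "integrable lborel (\<lambda>t. \<bar>l2_inner \<Omega> (f t) (g t)\<bar>)"
      using LL.pairing_integrable[OF f' g'] by simp
    show "integrable lborel (\<lambda>t. ?f t * ?g t)"
    proof (rule Bochner_Integration.integrable_bound[OF Bochner_Integration.integrable_add[OF i]])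
      show "AE t in lborel. norm (?f t * ?g t) \<le> norm ((?f t)\<^sup>2 + (?g t)\<^sup>2)"
      proof (rule AE_I2)
        fix t
        have "2 * \<bar>?f t * ?g t\<bar> \<le> (?f t)\<^sup>2 + (?g t)\<^sup>2"
          using sum_squares_bound[of "\<bar>?f t\<bar>" "\<bar>?g t\<bar>"] by (simp add: abs_mult)
        then show "norm (?f t * ?g t) \<le> norm ((?f t)\<^sup>2 + (?g t)\<^sup>2)" by simp
      qed
    qed (use m in simp)
    show "\<bar>l2_inner \<Omega> (f t) (g t)\<bar> \<le> ?f t * ?g t" for t
      by (rule LL.bound[OF L2_rep_elems[OF f] L2_rep_elems[OF g]])
  qed
  also have "\<dots> \<le> sqrt (LINT t|lborel. (?f t)\<^sup>2) * sqrt (LINT t|lborel. (?g t)\<^sup>2)"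
    using integral_cauchy_schwarz[OF m i] by linarith
  finally show ?thesis by (simp add: sq)
qed

lemma controlled_limit:
  assumes g: "L2_representative T (H1_0 \<Omega>) g" and gn: "\<And>n::nat. L2_representative T (H1_0 \<Omega>) (gn n)"
    and lim: "AE t in lborel. (\<lambda>n. fnorm (H1_0 \<Omega>) (\<lambda>x. g t x - gn n t x)) \<longlonglongrightarrow> 0"
    and dom: "\<And>n t. fnorm (H1_0 \<Omega>) (gn n t) \<le> h t" and h: "integrable lborel (\<lambda>t. (h t)\<^sup>2)" "h \<in> borel_measurable borel"
    and c: "\<And>n. controlled (gn n)"
  shows "controlled g"
proof -
  let ?V = "H1_0 \<Omega>" and ?D = "H_minus_1 \<Omega>"
  note ge = L2_rep_elems[OF g] and gne = L2_rep_elems[OF gn] and ze = L2_rep_elems[OF z2]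
  have h0: "0 \<le> h t" for t using order_trans[OF V.fnorm_nonneg[OF gne] dom] .
  have 1: "(\<lambda>n. LINT t|lborel. z2 t (gn n t)) \<longlonglongrightarrow> (LINT t|lborel. z2 t (g t))"
  proof (rule integral_dominated_convergence[where w = "\<lambda>t. (fnorm ?D (z2 t))\<^sup>2 + (h t)\<^sup>2"])
    show "AE t in lborel. (\<lambda>n. z2 t (gn n t)) \<longlonglongrightarrow> z2 t (g t)"
      using lim by eventually_elim (rule DV.pairing_tendsto[OF ze gne ze ge], simp_all)
    show "AE t in lborel. norm (z2 t (gn n t)) \<le> (fnorm ?D (z2 t))\<^sup>2 + (h t)\<^sup>2" for n
    proof (rule AE_I2)
      fix t
      have "\<bar>z2 t (gn n t)\<bar> \<le> fnorm ?D (z2 t) * fnorm ?V (gn n t)" by (rule DV.bound[OF ze gne])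
      also have "\<dots> \<le> fnorm ?D (z2 t) * h t"
        by (rule mult_left_mono[OF dom D.fnorm_nonneg[OF ze]])
      also have "\<dots> \<le> (fnorm ?D (z2 t))\<^sup>2 + (h t)\<^sup>2"
      proof -
        have "2 * (fnorm ?D (z2 t) * h t) \<le> (fnorm ?D (z2 t))\<^sup>2 + (h t)\<^sup>2"
          using sum_squares_bound[of "fnorm ?D (z2 t)" "h t"] by (simp add: mult.assoc)
        moreover have "0 \<le> fnorm ?D (z2 t) * h t" using D.fnorm_nonneg[OF ze] h0 by simp
        ultimately show ?thesis by linarith
      qed
      finally show "norm (z2 t (gn n t)) \<le> (fnorm ?D (z2 t))\<^sup>2 + (h t)\<^sup>2" by simp
    qed
    show "integrable lborel (\<lambda>t. (fnorm ?D (z2 t))\<^sup>2 + (h t)\<^sup>2)"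
      using z2 h by (simp add: L2_representative_def)
  qed (use DV.pairing_integrable[OF z2 g] DV.pairing_integrable[OF z2 gn] in auto)
  note gL = L2_representative_H1_0_L2[OF g] and gnL = L2_representative_H1_0_L2[OF gn]
  have 2: "(\<lambda>n. LINT t|lborel. l2_inner \<Omega> (gn n t) (gn n t)) \<longlonglongrightarrow> (LINT t|lborel. l2_inner \<Omega> (g t) (g t))"
  proof (rule integral_dominated_convergence[where w = "\<lambda>t. (h t)\<^sup>2"])
    show "AE t in lborel. (\<lambda>n. l2_inner \<Omega> (gn n t) (gn n t)) \<longlonglongrightarrow> l2_inner \<Omega> (g t) (g t)"
      using lim
    proof eventually_elim
      case (elim t)
      have "(\<lambda>n. fnorm (L2_space \<Omega>) (\<lambda>x. g t x - gn n t x)) \<longlonglongrightarrow> 0"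
      proof (rule tendsto_sandwich[OF _ _ tendsto_const elim])
        show "\<forall>\<^sub>F n in sequentially. fnorm (L2_space \<Omega>) (\<lambda>x. g t x - gn n t x) \<le> fnorm ?V (\<lambda>x. g t x - gn n t x)"
          using H1_0_to_L2(2)[OF V.diff_elems[OF ge gne]] by simp
        show "\<forall>\<^sub>F n in sequentially. 0 \<le> fnorm (L2_space \<Omega>) (\<lambda>x. g t x - gn n t x)"
          by (simp add: fnorm_L2 l2_inner_nonneg)
      qed
      then show ?case
        by (intro LL.pairing_tendsto H1_0_to_L2(1) ge gne)
    qed
    show "AE t in lborel. norm (l2_inner \<Omega> (gn n t) (gn n t)) \<le> (h t)\<^sup>2" for n
    proof (rule AE_I2)
      fix t
      have "l2_inner \<Omega> (gn n t) (gn n t) \<le> (fnorm ?V (gn n t))\<^sup>2"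
        using l2_norm_le_sobolev_1[OF H1_0_subset[OF gne]] by (simp add: fnorm_H1_0)
      also have "\<dots> \<le> (h t)\<^sup>2" by (rule power_mono[OF dom V.fnorm_nonneg[OF gne]])
      finally show "norm (l2_inner \<Omega> (gn n t) (gn n t)) \<le> (h t)\<^sup>2" by (simp add: l2_inner_nonneg)
    qed
  qed (use h l2_time_integrable[OF gL] l2_time_integrable[OF gnL] in auto)
  show ?thesis
    unfolding controlled_def
  proof (rule LIMSEQ_le)
    show "(\<lambda>n. \<bar>LINT t|lborel. z2 t (gn n t)\<bar>) \<longlonglongrightarrow> \<bar>LINT t|lborel. z2 t (g t)\<bar>"
      by (intro tendsto_rabs 1)
    show "(\<lambda>n. bound * sqrt (LINT t|lborel. l2_inner \<Omega> (gn n t) (gn n t)))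
        \<longlonglongrightarrow> bound * sqrt (LINT t|lborel. l2_inner \<Omega> (g t) (g t))"
      by (intro tendsto_intros 2)
    show "\<exists>N. \<forall>n\<ge>N. \<bar>LINT t|lborel. z2 t (gn n t)\<bar> \<le> bound * sqrt (LINT t|lborel. l2_inner \<Omega> (gn n t) (gn n t))"
      using c unfolding controlled_def by blast
  qed
qed

text \<open>Step functions and their approximations with continuous coefficients have this common form.\<close>

abbreviation "combination U \<theta> t \<equiv> (\<lambda>x. indicator {0<..<T} t * (\<Sum>v\<in>U. \<theta> v t * v x))"

lemma combination_rep:
  assumes U: "finite U" "U \<subseteq> elems (H1_0 \<Omega>)" and \<theta>: "\<And>v. v \<in> U \<Longrightarrow> \<theta> v \<in> borel_measurable borel"
    "\<And>v t. v \<in> U \<Longrightarrow> \<bar>\<theta> v t\<bar> \<le> 1"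
  shows "L2_representative T (H1_0 \<Omega>) (combination U \<theta>)"
    and "fnorm (H1_0 \<Omega>) (combination U \<theta> t) \<le> indicator {0<..<T} t * (\<Sum>v\<in>U. fnorm (H1_0 \<Omega>) v)"
proof -
  let ?V = "H1_0 \<Omega>"
  have sb: "strongly_borel ?V (\<lambda>t x. \<Sum>v\<in>U. \<theta> v t * v x)"
    using U \<theta>(1)
  proof (induction U)
    case empty
    then show ?case using V.strongly_borel_const[OF V.zero_elems] by simp
  next
    case (insert v W)
    then show ?case
      using V.strongly_borel_add[OF V.strongly_borel_scale[OF V.strongly_borel_const[of v], of "\<theta> v"]] by simp
  qed
  have n: "fnorm ?V (\<lambda>x. \<Sum>v\<in>U. \<theta> v t * v x) \<le> (\<Sum>v\<in>U. fnorm ?V v)" for t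
  proof -
    have "fnorm ?V (\<lambda>x. \<Sum>v\<in>U. \<theta> v t * v x) \<le> (\<Sum>v\<in>U. \<bar>\<theta> v t\<bar> * fnorm ?V v)"
      by (rule V.linear_combination(3)[OF U])
    also have "\<dots> \<le> (\<Sum>v\<in>U. 1 * fnorm ?V v)"
      using \<theta>(2) U(2) V.fnorm_nonneg by (intro sum_mono mult_right_mono) auto
    finally show ?thesis by simp
  qed
  show "L2_representative T ?V (combination U \<theta>)"
    by (rule V.L2_representative_cut[OF sb n])
  have "fnorm ?V (combination U \<theta> t) = indicator {0<..<T} t * fnorm ?V (\<lambda>x. \<Sum>v\<in>U. \<theta> v t * v x)"
    using V.fnorm_scale[OF strongly_borel_elems[OF sb], of "indicator {0<..<T} t" t] by simp
  also have "\<dots> \<le> indicator {0<..<T} t * (\<Sum>v\<in>U. fnorm ?V v)"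
    by (rule mult_left_mono[OF n]) simp
  finally show "fnorm ?V (combination U \<theta> t) \<le> indicator {0<..<T} t * (\<Sum>v\<in>U. fnorm ?V v)" .
qed

lemma functional_combination:
  assumes F: "bounded_functional X F" and X: "seminormed_fspace X" and U: "finite U" "U \<subseteq> elems X"
  shows "F (combination U \<theta> t) = (\<Sum>v\<in>U. indicator {0<..<T} t * \<theta> v t * F v)"
proof -
  interpret X: seminormed_fspace X by fact
  show ?thesis
    using X.bounded_functional_scale[OF F X.linear_combination(1)[OF U], of "indicator {0<..<T} t" "\<lambda>v. \<theta> v t"]
      X.linear_combination(2)[OF U F, of "\<lambda>v. \<theta> v t"]
    by (simp add: sum_distrib_left mult.assoc)
qed

text \<open>Against continuous coefficients, the second difference quotients \<open>\<xi>\<close> converge to the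
  acceleration \<open>z2\<close>, because the hat kernels are an approximate identity.\<close>

lemma controlled_continuous:
  assumes U: "finite U" "U \<subseteq> elems (H1_0 \<Omega>)" and \<theta>: "\<And>v. v \<in> U \<Longrightarrow> continuous_on UNIV (\<theta> v)"
    "\<And>v t. v \<in> U \<Longrightarrow> \<bar>\<theta> v t\<bar> \<le> 1"
  shows "controlled (combination U \<theta>)"
proof -
  let ?g = "combination U \<theta>"
  let ?e = "\<lambda>n. 1 / real (Suc n)"
  have \<theta>m: "\<theta> v \<in> borel_measurable borel" if "v \<in> U" for v
    using \<theta>(1)[OF that] by (rule borel_measurable_continuous_onI)
  have g: "L2_representative T (H1_0 \<Omega>) ?g"
    by (rule combination_rep[OF U \<theta>m \<theta>(2)])
  note gL = L2_representative_H1_0_L2[OF g]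
  define \<eta> where "\<eta> v t = indicator {0<..<T} t * \<theta> v t" for v t
  have \<eta>m: "\<eta> v \<in> borel_measurable borel" if "v \<in> U" for v
    unfolding \<eta>_def[abs_def] using \<theta>m[OF that] by measurable
  have \<eta>1: "\<bar>\<eta> v t\<bar> \<le> 1" if "v \<in> U" for v t
    using \<theta>(2)[OF that] by (auto simp: \<eta>_def split: split_indicator)
  have \<eta>c: "isCont (\<eta> v) t" if "v \<in> U" "t \<in> {0<..<T}" for v t
  proof -
    have "isCont (\<theta> v) t" using \<theta>(1)[OF that(1)] continuous_on_eq_continuous_at[of UNIV] by auto
    moreover have "\<forall>\<^sub>F s in nhds t. s \<in> {0<..<T}"
      using that by (intro eventually_nhds_in_open) auto
    then have "\<forall>\<^sub>F s in nhds t. \<eta> v s = \<theta> v s"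
      by eventually_elim (auto simp: \<eta>_def)
    ultimately show ?thesis using isCont_cong by blast
  qed
  have UL: "U \<subseteq> elems (L2_space \<Omega>)" using U(2) H1_0_to_L2(1) by auto
  have I: "(LINT t|lborel. l2_inner \<Omega> (before (?e n) T t) (?g t))
     = (\<Sum>v\<in>U. (LINT s|lborel. z2 s v * (LINT t|lborel. hat (?e n) (t - s) * \<eta> v t)))" for n
  proof -
    have e: "?e n > 0" by simp
    have Fub: "integrable (lborel \<Otimes>\<^sub>M lborel) (\<lambda>(t, s). hat (?e n) (t - s) * (\<eta> v t * z2 s v))" if v: "v \<in> U" for v
    proof -
      have v': "v \<in> elems (H1_0 \<Omega>)" using v U(2) by blast
      have [measurable]: "(\<lambda>s. z2 s v) \<in> borel_measurable borel" "\<eta> v \<in> borel_measurable borel"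
        using borel_measurable_integrable[OF z2_integrable[OF v']] \<eta>m[OF v] by auto
      show ?thesis
      proof (rule Bochner_Integration.integrable_bound[OF hat_tensor_snd(1)[OF z2_integrable[OF v'] e]])
        show "(\<lambda>(t, s). hat (?e n) (t - s) * (\<eta> v t * z2 s v)) \<in> borel_measurable (lborel \<Otimes>\<^sub>M lborel)"
          by measurable
        show "AE z in lborel \<Otimes>\<^sub>M lborel. norm (case z of (t, s) \<Rightarrow> hat (?e n) (t - s) * (\<eta> v t * z2 s v))
            \<le> norm (case z of (t, s) \<Rightarrow> hat (?e n) (t - s) * z2 s v)"
        proof (rule AE_I2, clarify)
          fix t s
          have "\<bar>\<eta> v t\<bar> * \<bar>z2 s v\<bar> \<le> 1 * \<bar>z2 s v\<bar>" by (rule mult_right_mono[OF \<eta>1[OF v]]) simp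
          then show "norm (hat (?e n) (t - s) * (\<eta> v t * z2 s v)) \<le> norm (hat (?e n) (t - s) * z2 s v)"
            by (simp add: abs_mult mult_left_mono)
        qed
      qed
    qed
    note be = L2_rep_elems[OF before_L2[OF e, of T]]
    have "AE t in lborel. l2_inner \<Omega> (before (?e n) T t) (?g t)
        = (\<Sum>v\<in>U. (LINT s|lborel. hat (?e n) (t - s) * (\<eta> v t * z2 s v)))"
      using second_difference_acceleration[OF e]
    proof eventually_elim
      case (elim t)
      have F: "bounded_functional (L2_space \<Omega>) (l2_inner \<Omega> (before (?e n) T t))"
        using functional_l2[OF be] L_ip.sym[OF _ be] L_ip.lin_in unfolding bounded_functional_def by simp
      have "l2_inner \<Omega> (before (?e n) T t) (?g t) = (\<Sum>v\<in>U. \<eta> v t * l2_inner \<Omega> (before (?e n) T t) v)"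
        unfolding functional_combination[OF F fspace_L2 U(1) UL] by (simp add: \<eta>_def)
      also have "\<dots> = (\<Sum>v\<in>U. (LINT s|lborel. hat (?e n) (t - s) * (\<eta> v t * z2 s v)))"
      proof (rule sum.cong[OF refl])
        fix v assume v: "v \<in> U"
        then have v': "v \<in> elems (H1_0 \<Omega>)" using U(2) by blast
        show "\<eta> v t * l2_inner \<Omega> (before (?e n) T t) v = (LINT s|lborel. hat (?e n) (t - s) * (\<eta> v t * z2 s v))"
        proof (cases "t < T")
          case True
          then have "l2_inner \<Omega> (before (?e n) T t) v = (LINT s|lborel. hat (?e n) (t - s) * z2 s v)"
            using elim v' by simp
          moreover have "(LINT s|lborel. hat (?e n) (t - s) * (\<eta> v t * z2 s v)) = \<eta> v t * (LINT s|lborel. hat (?e n) (t - s) * z2 s v)"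
            by (simp add: mult.left_commute)
          ultimately show ?thesis by simp
        qed (simp add: \<eta>_def)
      qed
      finally show ?case .
    qed
    then have "(LINT t|lborel. l2_inner \<Omega> (before (?e n) T t) (?g t))
       = (LINT t|lborel. (\<Sum>v\<in>U. (LINT s|lborel. hat (?e n) (t - s) * (\<eta> v t * z2 s v))))"
    proof (rule integral_cong_AE[rotated 2])
      have "L2_representative (T + 2 * ?e n) (L2_space \<Omega>) ?g"
        by (rule L.L2_representative_mono[OF gL]) simp
      then show "(\<lambda>t. l2_inner \<Omega> (before (?e n) T t) (?g t)) \<in> borel_measurable lborel"
        using LL.pairing_integrable[OF before_L2[OF e]] by blast
      show "(\<lambda>t. \<Sum>v\<in>U. (LINT s|lborel. hat (?e n) (t - s) * (\<eta> v t * z2 s v))) \<in> borel_measurable lborel"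
        using lborel_pair.integrable_fst'[OF Fub] by (intro borel_measurable_sum) auto
    qed
    also have "\<dots> = (\<Sum>v\<in>U. (LINT t|lborel. LINT s|lborel. hat (?e n) (t - s) * (\<eta> v t * z2 s v)))"
      using lborel_pair.integrable_fst'[OF Fub] by (intro Bochner_Integration.integral_sum) auto
    also have "\<dots> = (\<Sum>v\<in>U. (LINT s|lborel. LINT t|lborel. hat (?e n) (t - s) * (\<eta> v t * z2 s v)))"
      using lborel_pair.Fubini_integral[OF Fub] by (intro sum.cong) auto
    also have "\<dots> = (\<Sum>v\<in>U. (LINT s|lborel. z2 s v * (LINT t|lborel. hat (?e n) (t - s) * \<eta> v t)))"
    proof (intro sum.cong[OF refl] Bochner_Integration.integral_cong[OF refl])
      fix v s
      show "(LINT t|lborel. hat (?e n) (t - s) * (\<eta> v t * z2 s v)) = z2 s v * (LINT t|lborel. hat (?e n) (t - s) * \<eta> v t)"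
        by (simp add: mult.assoc[symmetric] mult.commute[of "z2 s v"])
    qed
    finally show ?thesis .
  qed
  have lim_v: "(\<lambda>n. LINT s|lborel. z2 s v * (LINT t|lborel. hat (?e n) (t - s) * \<eta> v t)) \<longlonglongrightarrow> (LINT s|lborel. z2 s v * \<eta> v s)"
    if v: "v \<in> U" for v
  proof (rule integral_dominated_convergence[where w = "\<lambda>s. \<bar>z2 s v\<bar>"])
    have v': "v \<in> elems (H1_0 \<Omega>)" using v U(2) by blast
    have [measurable]: "(\<lambda>s. z2 s v) \<in> borel_measurable borel" "\<eta> v \<in> borel_measurable borel"
      using borel_measurable_integrable[OF z2_integrable[OF v']] \<eta>m[OF v] by auto
    show "integrable lborel (\<lambda>s. \<bar>z2 s v\<bar>)" using z2_integrable[OF v'] by simp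
    show "(\<lambda>s. z2 s v * \<eta> v s) \<in> borel_measurable lborel" by measurable
    show "(\<lambda>s. z2 s v * (LINT t|lborel. hat (?e n) (t - s) * \<eta> v t)) \<in> borel_measurable lborel" for n
    proof -
      have "(\<lambda>(s, t). hat (?e n) (t - s) * \<eta> v t) \<in> borel_measurable (lborel \<Otimes>\<^sub>M lborel)" by measurable
      from lborel.borel_measurable_lebesgue_integral[OF this]
      show ?thesis by (intro borel_measurable_times) auto
    qed
    show "AE s in lborel. (\<lambda>n. z2 s v * (LINT t|lborel. hat (?e n) (t - s) * \<eta> v t)) \<longlonglongrightarrow> z2 s v * \<eta> v s"
    proof (rule AE_I2)
      fix s
      show "(\<lambda>n. z2 s v * (LINT t|lborel. hat (?e n) (t - s) * \<eta> v t)) \<longlonglongrightarrow> z2 s v * \<eta> v s"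
      proof (cases "s \<in> {0<..<T}")
        case True
        show ?thesis
          by (intro tendsto_mult tendsto_const hat_mollify[of _ 1] \<eta>m \<eta>1 \<eta>c v True)
      next
        case False
        then show ?thesis using z2_zero by simp
      qed
    qed
    show "AE s in lborel. norm (z2 s v * (LINT t|lborel. hat (?e n) (t - s) * \<eta> v t)) \<le> \<bar>z2 s v\<bar>" for n
    proof (rule AE_I2)
      fix s
      have e: "?e n > 0" by simp
      have i: "integrable lborel (\<lambda>t. hat (?e n) (t - s))" by (rule integrable_shift[OF hat_integral(1)[OF e]])
      have "\<bar>LINT t|lborel. hat (?e n) (t - s) * \<eta> v t\<bar> \<le> (LINT t|lborel. \<bar>hat (?e n) (t - s) * \<eta> v t\<bar>)"
        using integral_norm_bound[of lborel "\<lambda>t. hat (?e n) (t - s) * \<eta> v t"] by simp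
      also have "\<dots> \<le> (LINT t|lborel. hat (?e n) (t - s))"
      proof (rule integral_mono'[OF i])
        fix t
        show "\<bar>hat (?e n) (t - s) * \<eta> v t\<bar> \<le> hat (?e n) (t - s)"
          using mult_left_mono[OF \<eta>1[OF v] hat_nonneg[OF e]] hat_nonneg[OF e] by (simp add: abs_mult)
      qed (rule hat_nonneg[OF e])
      also have "\<dots> = 1" using integral_shift[of "hat (?e n)" s] hat_integral(2)[OF e] by simp
      finally show "norm (z2 s v * (LINT t|lborel. hat (?e n) (t - s) * \<eta> v t)) \<le> \<bar>z2 s v\<bar>"
        by (simp add: abs_mult mult_left_le)
    qed
  qed
  have "(\<lambda>n. LINT t|lborel. l2_inner \<Omega> (before (?e n) T t) (?g t)) \<longlonglongrightarrow> (\<Sum>v\<in>U. (LINT s|lborel. z2 s v * \<eta> v s))"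
    unfolding I by (intro tendsto_sum lim_v)
  also have "(\<Sum>v\<in>U. (LINT s|lborel. z2 s v * \<eta> v s)) = (LINT s|lborel. (\<Sum>v\<in>U. z2 s v * \<eta> v s))"
  proof (rule Bochner_Integration.integral_sum[symmetric])
    fix v assume v: "v \<in> U"
    then have v': "v \<in> elems (H1_0 \<Omega>)" using U(2) by blast
    show "integrable lborel (\<lambda>s. z2 s v * \<eta> v s)"
    proof (rule Bochner_Integration.integrable_bound[OF z2_integrable[OF v']])
      show "(\<lambda>s. z2 s v * \<eta> v s) \<in> borel_measurable lborel"
        using borel_measurable_integrable[OF z2_integrable[OF v']] \<eta>m[OF v] by simp
      show "AE s in lborel. norm (z2 s v * \<eta> v s) \<le> norm (z2 s v)"
        using \<eta>1[OF v] by (intro AE_I2) (simp add: abs_mult mult_left_le)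
    qed
  qed
  also have "\<dots> = (LINT s|lborel. z2 s (?g s))"
  proof (rule Bochner_Integration.integral_cong[OF refl])
    fix s
    have "bounded_functional (H1_0 \<Omega>) (z2 s)"
      using L2_rep_elems[OF z2, of s] by (simp add: H_minus_1_def bounded_functional_def)
    from functional_combination[OF this fspace_H1_0 U]
    show "(\<Sum>v\<in>U. z2 s v * \<eta> v s) = z2 s (?g s)"
      by (simp add: \<eta>_def mult.commute)
  qed
  finally have lim: "(\<lambda>n. LINT t|lborel. l2_inner \<Omega> (before (?e n) T t) (?g t)) \<longlonglongrightarrow> (LINT s|lborel. z2 s (?g s))" .
  have le: "\<bar>LINT t|lborel. l2_inner \<Omega> (before (?e n) T t) (?g t)\<bar> \<le> bound * sqrt (LINT t|lborel. l2_inner \<Omega> (?g t) (?g t))" for n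
  proof -
    have e: "?e n > 0" by simp
    have "\<bar>LINT t|lborel. l2_inner \<Omega> (before (?e n) T t) (?g t)\<bar> \<le> sqrt (dissipation (?e n) T) * sqrt (LINT t|lborel. l2_inner \<Omega> (?g t) (?g t))"
      unfolding dissipation_def by (rule time_cauchy_schwarz[OF before_L2[OF e] gL])
    also have "\<dots> \<le> bound * sqrt (LINT t|lborel. l2_inner \<Omega> (?g t) (?g t))"
      unfolding bound_def by (intro mult_right_mono real_sqrt_le_mono dissipation_bound[OF e]) (simp add: l2_inner_nonneg)
    finally show ?thesis .
  qed
  show ?thesis
    unfolding controlled_def
    by (rule LIMSEQ_le_const2[OF tendsto_rabs[OF lim]]) (use le in blast)
qed

text \<open>Indicators of measurable sets of times are almost everywhere limits of continuous functions, which may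
  be clipped to values between 0 and 1.\<close>

lemma controlled_simple:
  assumes r: "simple_function borel r" and rep: "L2_representative T (H1_0 \<Omega>) r"
  shows "controlled r"
proof -
  let ?V = "H1_0 \<Omega>"
  define U where "U = range r"
  have U: "finite U" "U \<subseteq> elems ?V"
    using simple_functionD(1)[OF r] L2_rep_elems[OF rep] by (auto simp: U_def)
  define A where "A v = {t. r t = v}" for v
  have Ab: "A v \<in> sets borel" for v
    using simple_functionD(2)[OF r, of "{v}"] by (simp add: A_def vimage_def)
  have "\<exists>N g. negligible N \<and> (\<forall>n. continuous_on UNIV (g n)) \<and> (\<forall>t. t \<notin> N \<longrightarrow> (\<lambda>n::nat. g n t) \<longlonglongrightarrow> (indicator (A v) t :: real))" for v
  proof -
    have "(indicator (A v) :: real \<Rightarrow> real) \<in> borel_measurable lebesgue"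
      using Ab by (intro measurable_completion) simp
    then have "(indicator (A v) :: real \<Rightarrow> real) measurable_on UNIV"
      by (rule lebesgue_measurable_imp_measurable_on) simp
    then show ?thesis by (simp add: measurable_on_def)
  qed
  then obtain N g where N: "\<And>v. negligible (N v)" and gc: "\<And>v n. continuous_on UNIV (g v n)"
    and gl: "\<And>v t. t \<notin> N v \<Longrightarrow> (\<lambda>n::nat. g v n t) \<longlonglongrightarrow> (indicator (A v) t :: real)"
    by metis
  define \<theta> where "\<theta> n v t = max 0 (min 1 (g v n t))" for n v t
  have \<theta>c: "continuous_on UNIV (\<theta> n v)" for n v
    unfolding \<theta>_def[abs_def] by (intro continuous_intros gc)
  have \<theta>1: "\<bar>\<theta> n v t\<bar> \<le> 1" for n v t by (auto simp: \<theta>_def max_def min_def)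
  have \<theta>l: "(\<lambda>n. \<theta> n v t) \<longlonglongrightarrow> indicator (A v) t" if "t \<notin> N v" for v t
  proof -
    have "(\<lambda>n. \<theta> n v t) \<longlonglongrightarrow> max 0 (min 1 (indicator (A v) t))"
      unfolding \<theta>_def by (intro tendsto_intros gl that)
    then show ?thesis by (simp split: split_indicator_asm add: indicator_def)
  qed
  have \<theta>m: "\<theta> n v \<in> borel_measurable borel" for n v
    using \<theta>c by (rule borel_measurable_continuous_onI)
  have req: "r t = combination U (\<lambda>v. indicator (A v)) t" for t
  proof (cases "t \<in> {0<..<T}")
    case True
    show ?thesis
    proof
      fix x
      have "(\<Sum>v\<in>U. indicator (A v) t * v x) = (\<Sum>v\<in>U. if v = r t then v x else 0)"
        by (intro sum.cong) (auto simp: A_def indicator_def)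
      also have "\<dots> = r t x" using U(1) by (simp add: U_def)
      finally show "r t x = combination U (\<lambda>v. indicator (A v)) t x" using True by simp
    qed
  next
    case False
    then show ?thesis using rep by (auto simp: L2_representative_def)
  qed
  define h where "h t = indicator {0<..<T} t * (\<Sum>v\<in>U. fnorm ?V v)" for t
  have "AE t in lborel. \<forall>v\<in>U. t \<notin> N v"
  proof -
    have "AE t in lborel. t \<notin> N v" for v
    proof -
      have "AE t in lebesgue. t \<notin> N v"
        using N negligible_iff_null_sets AE_not_in by blast
      then show ?thesis by (simp add: AE_completion_iff)
    qed
    then show ?thesis using U(1) by (simp add: AE_finite_all)
  qed
  then have lim: "AE t in lborel. (\<lambda>n. fnorm ?V (\<lambda>x. r t x - combination U (\<theta> n) t x)) \<longlonglongrightarrow> 0"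
  proof eventually_elim
    case (elim t)
    show ?case
    proof (rule tendsto_sandwich[OF _ _ tendsto_const])
      have "(\<lambda>n. \<Sum>v\<in>U. \<bar>indicator (A v) t - \<theta> n v t\<bar> * fnorm ?V v) \<longlonglongrightarrow> (\<Sum>v\<in>U. \<bar>indicator (A v) t - indicator (A v) t\<bar> * fnorm ?V v)"
        using elim by (intro tendsto_intros \<theta>l) auto
      then show "(\<lambda>n. \<Sum>v\<in>U. \<bar>indicator (A v) t - \<theta> n v t\<bar> * fnorm ?V v) \<longlonglongrightarrow> 0" by simp
      have eq: "(\<lambda>x. r t x - combination U (\<theta> n) t x)
          = (\<lambda>x. indicator {0<..<T} t * (\<Sum>v\<in>U. (indicator (A v) t - \<theta> n v t) * v x))" for n
        unfolding req by (simp add: sum_subtractf left_diff_distrib right_diff_distrib)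
      show "\<forall>\<^sub>F n in sequentially. fnorm ?V (\<lambda>x. r t x - combination U (\<theta> n) t x)
          \<le> (\<Sum>v\<in>U. \<bar>indicator (A v) t - \<theta> n v t\<bar> * fnorm ?V v)"
      proof (rule always_eventually, rule allI)
        fix n
        let ?S = "\<lambda>x. \<Sum>v\<in>U. (indicator (A v) t - \<theta> n v t) * v x"
        note S = V.linear_combination(1,3)[OF U, of "\<lambda>v. indicator (A v) t - \<theta> n v t"]
        have "fnorm ?V (\<lambda>x. indicator {0<..<T} t * ?S x) = indicator {0<..<T} t * fnorm ?V ?S"
          using V.fnorm_scale[of ?S "indicator {0<..<T} t"] S by simp
        also have "\<dots> \<le> 1 * fnorm ?V ?S"
          using V.fnorm_nonneg[of ?S] S by (intro mult_right_mono) (auto simp: indicator_def)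
        finally show "fnorm ?V (\<lambda>x. r t x - combination U (\<theta> n) t x)
          \<le> (\<Sum>v\<in>U. \<bar>indicator (A v) t - \<theta> n v t\<bar> * fnorm ?V v)"
          unfolding eq using S by linarith
      qed
      show "\<forall>\<^sub>F n in sequentially. 0 \<le> fnorm ?V (\<lambda>x. r t x - combination U (\<theta> n) t x)"
        by (intro always_eventually allI V.fnorm_nonneg V.diff_elems L2_rep_elems[OF rep]
            L2_rep_elems[OF combination_rep(1)[OF U \<theta>m \<theta>1]])
    qed
  qed
  show ?thesis
  proof (rule controlled_limit[OF rep _ lim])
    show "L2_representative T ?V (combination U (\<theta> n))" for n
      by (rule combination_rep(1)[OF U \<theta>m \<theta>1])
    show "fnorm ?V (combination U (\<theta> n) t) \<le> h t" for n t
      unfolding h_def by (rule combination_rep(2)[OF U \<theta>m \<theta>1])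
    have "(h t)\<^sup>2 = indicator {0<..<T} t * (\<Sum>v\<in>U. fnorm ?V v)\<^sup>2" for t
      by (simp add: h_def split: split_indicator)
    then show "integrable lborel (\<lambda>t. (h t)\<^sup>2)" by (simp add: integrable_indicator_Ioo)
    show "h \<in> borel_measurable borel" unfolding h_def by measurable
    show "controlled (combination U (\<theta> n))" for n
      by (rule controlled_continuous[OF U \<theta>c \<theta>1])
  qed
qed

text \<open>The acceleration, a priori a functional on \<open>H\<^sub>0\<^sup>1\<close>, is bounded with respect to the norm of
  \<open>L\<^sup>2(0,T;L\<^sup>2)\<close>, with a constant that does not contain \<open>\<tau>\<close>.\<close>

lemma acceleration_bound:
  assumes g: "L2_representative T (H1_0 \<Omega>) g"
  shows "\<bar>LINT t|lborel. z2 t (g t)\<bar> \<le> bound * sqrt (LINT t|lborel. l2_inner \<Omega> (g t) (g t))"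
proof -
  obtain s where s: "\<And>n::nat. simple_function borel (s n)" "\<And>n. L2_representative T (H1_0 \<Omega>) (s n)"
     "\<And>t. (\<lambda>n. fnorm (H1_0 \<Omega>) (\<lambda>x. g t x - s n t x)) \<longlonglongrightarrow> 0"
     "\<And>n t. fnorm (H1_0 \<Omega>) (s n t) \<le> 2 * fnorm (H1_0 \<Omega>) (g t)"
    using V.L2_representative_simple_approximation[OF g] by blast
  have "controlled g"
  proof (rule controlled_limit[OF g s(2) _ s(4)])
    show "AE t in lborel. (\<lambda>n. fnorm (H1_0 \<Omega>) (\<lambda>x. g t x - s n t x)) \<longlonglongrightarrow> 0" using s(3) by simp
    show "integrable lborel (\<lambda>t. (2 * fnorm (H1_0 \<Omega>) (g t))\<^sup>2)"
      using g by (simp add: L2_representative_def power_mult_distrib)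
    show "(\<lambda>t. 2 * fnorm (H1_0 \<Omega>) (g t)) \<in> borel_measurable borel"
      using g V.strongly_borel_norm by (auto simp: L2_representative_def)
    show "controlled (s n)" for n by (rule controlled_simple[OF s(1,2)])
  qed
  then show ?thesis by (simp add: controlled_def)
qed

end

section \<open>The heat equation\<close>

context bounded_domain
begin

text \<open>Twice the integral of \<open>(e', e)\<close> up to time \<open>t\<close> is \<open>\<parallel>e t\<parallel>\<^sup>2\<close>, which is therefore at most \<open>2 D \<parallel>e\<parallel>\<close>, with
  the norm of \<open>e\<close> on the whole interval on the right.  Integration in time gives \<open>\<parallel>e\<parallel> \<le> 2 T D\<close>, and then
  the Dirichlet term is at most \<open>2 T D\<^sup>2\<close>.\<close>

lemma parabolic_estimate:
  assumes T: "T > 0" and e: "L2_representative T (H1_0 \<Omega>) e" and e': "L2_representative T (L2_space \<Omega>) e'"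
    and prim: "AE t in lborel. t \<in> {0<..<T} \<longrightarrow>
      (\<forall>\<psi>\<in>elems (L2_space \<Omega>). l2_inner \<Omega> (e t) \<psi> = (LINT r|lborel. indicator {..<t} r * l2_inner \<Omega> (e' r) \<psi>))"
    and D: "0 \<le> D"
    and test: "\<And>c. c \<in> {0<..T} \<Longrightarrow> (LINT t|lborel. indicator {..<c} t * l2_inner \<Omega> (e' t) (e t))
        + (LINT t|lborel. indicator {..<c} t * dirichlet_form \<Omega> (e t) (e t)) \<le> D * sqrt (LINT t|lborel. l2_inner \<Omega> (e t) (e t))"
  shows "sqrt (LINT t|lborel. (fnorm (H1_0 \<Omega>) (e t))\<^sup>2) \<le> sqrt (4 * T\<^sup>2 + 2 * T) * D"
proof -
  let ?l = "l2_inner \<Omega>" and ?a = "dirichlet_form \<Omega>"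
  note eL = L2_representative_H1_0_L2[OF e]
  note el = L2_rep_elems[OF eL] and eV = L2_rep_elems[OF e] and e'l = L2_rep_elems[OF e']
  define Q where "Q = (LINT t|lborel. ?l (e t) (e t))"
  have Q0: "0 \<le> Q" by (simp add: Q_def l2_inner_nonneg)
  note prim' = primitive_before_end[OF eL e' prim]
  have half: "(LINT t|lborel. indicator {..<c} t * ?l (e' t) (e t))
    = (LINT t|lborel. LINT s|lborel. ?l (\<lambda>x. indicator {..<c} t * e' t x) (\<lambda>x. indicator {..<c} s * e' s x)) / 2"
    if "c \<le> T" for c
    by (rule integral_derivative_times_primitive[OF e' eL]) (use prim' that in \<open>auto elim!: eventually_mono\<close>)
  have sq: "AE t in lborel. t < T \<longrightarrow> ?l (e t) (e t) = 2 * (LINT r|lborel. indicator {..<t} r * ?l (e' r) (e r))"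
    using prim'
  proof eventually_elim
    case (elim t)
    show ?case
    proof
      assume t: "t < T"
      have lin: "?l (\<lambda>x. c * e' r x) w = c * ?l (e' r) w" "?l w (\<lambda>x. c * e' r x) = c * ?l w (e' r)"
        if "w \<in> elems (L2_space \<Omega>)" for c r w
        using L_ip.lin_left[OF e'l e'l that, of c r 0 r] L_ip.lin_right[OF e'l e'l that, of c r 0 r] by simp_all
      have "?l (e t) (e t) = (LINT r|lborel. indicator {..<t} r * ?l (e' r) (e t))"
        using elim t el by blast
      also have "\<dots> = (LINT r|lborel. indicator {..<t} r * (LINT s|lborel. indicator {..<t} s * ?l (e' s) (e' r)))"
        using elim t e'l L_ip.sym[OF e'l el] by simp
      also have "\<dots> = (LINT r|lborel. LINT s|lborel. ?l (\<lambda>x. indicator {..<t} r * e' r x) (\<lambda>x. indicator {..<t} s * e' s x))"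
        using L_ip.sym[OF e'l e'l]
        by (simp add: lin L.scale_elems[OF e'l] e'l)
      also have "\<dots> = 2 * (LINT r|lborel. indicator {..<t} r * ?l (e' r) (e r))"
        using half[of t] t by simp
      finally show "?l (e t) (e t) = 2 * (LINT r|lborel. indicator {..<t} r * ?l (e' r) (e r))" .
    qed
  qed
  have a_nonneg: "0 \<le> (LINT t|lborel. indicator {..<c} t * ?a (e t) (e t))" for c
    using V_ip.nonneg[OF eV] by (intro Bochner_Integration.integral_nonneg) (auto intro!: mult_nonneg_nonneg)
  have int: "integrable lborel (\<lambda>t. ?l (e t) (e t))" by (rule l2_time_integrable[OF eL])
  have "Q \<le> (LINT t|lborel. indicator {0<..<T} t * (2 * (D * sqrt Q)))"
    unfolding Q_def[symmetric]
  proof (subst Q_def, rule integral_mono_AE[OF int])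
    show "integrable lborel (\<lambda>t. indicator {0<..<T} t * (2 * (D * sqrt Q)))"
      by (intro integrable_mult_left integrable_indicator_Ioo)
    show "AE t in lborel. ?l (e t) (e t) \<le> indicator {0<..<T} t * (2 * (D * sqrt Q))"
      using sq
    proof eventually_elim
      case (elim t)
      show ?case
      proof (cases "t \<in> {0<..<T}")
        case True
        then have "?l (e t) (e t) = 2 * (LINT r|lborel. indicator {..<t} r * ?l (e' r) (e r))" using elim by simp
        also have "\<dots> \<le> 2 * (D * sqrt Q)"
          using test[of t] a_nonneg[of t] True by (simp add: Q_def)
        finally show ?thesis using True by simp
      next
        case False
        then have "e t = (\<lambda>_. 0)" using e by (simp add: L2_representative_def)
        then show ?thesis using l2_zero[OF L_ip.zero_in] False by simp
      qed
    qed
  qed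
  also have "\<dots> = 2 * T * D * sqrt Q" using T by (simp add: measure_lborel_Ioo)
  finally have "sqrt Q * sqrt Q \<le> (2 * T * D) * sqrt Q" using Q0 by simp
  then have Q: "sqrt Q \<le> 2 * T * D"
  proof (cases "Q = 0")
    case False
    then have "sqrt Q > 0" using Q0 by simp
    with \<open>sqrt Q * sqrt Q \<le> (2 * T * D) * sqrt Q\<close> show ?thesis
      by (rule mult_right_le_imp_le)
  qed (use D T in simp)
  have "(LINT t|lborel. ?a (e t) (e t)) \<le> D * sqrt Q"
  proof -
    have "(LINT t|lborel. ?a (e t) (e t)) = (LINT t|lborel. indicator {..<T} t * ?a (e t) (e t))"
    proof (rule Bochner_Integration.integral_cong[OF refl])
      fix t
      show "?a (e t) (e t) = indicator {..<T} t * ?a (e t) (e t)"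
      proof (cases "t < T")
        case False
        then have "e t = (\<lambda>_. 0)" using e by (simp add: L2_representative_def)
        then show ?thesis using False dirichlet_zero[OF V_ip.zero_in] by simp
      qed simp
    qed
    moreover have "0 \<le> (LINT t|lborel. indicator {..<T} t * ?l (e' t) (e t))"
      using half[of T] double_integral_nonneg[OF L_ip.semi_inner_product_axioms LL.pairing_axioms L.L2_representative_indicator[OF e', of "{..<T}"]]
      by simp
    ultimately show ?thesis using test[of T] T by (simp add: Q_def)
  qed
  also have "\<dots> \<le> D * (2 * T * D)" by (rule mult_left_mono[OF Q D])
  finally have A: "(LINT t|lborel. ?a (e t) (e t)) \<le> 2 * T * D\<^sup>2" by (simp add: power2_eq_square mult_ac)
  have "Q \<le> (2 * T * D)\<^sup>2" using power_mono[OF Q, of 2] Q0 by simp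
  moreover have "(fnorm (H1_0 \<Omega>) (e t))\<^sup>2 = ?l (e t) (e t) + ?a (e t) (e t)" for t
    using sobolev_1_inner[OF H1_0_subset[OF eV] H1_0_subset[OF eV]] semi_inner_product.nonneg[OF sobolev_semi_inner_product H1_0_subset[OF eV]]
    by (simp add: fnorm_H1_0 fnorm_sobolev)
  then have "(LINT t|lborel. (fnorm (H1_0 \<Omega>) (e t))\<^sup>2) = Q + (LINT t|lborel. ?a (e t) (e t))"
    using int VV.pairing_integrable[OF e e] by (simp add: Q_def)
  ultimately have "(LINT t|lborel. (fnorm (H1_0 \<Omega>) (e t))\<^sup>2) \<le> (4 * T\<^sup>2 + 2 * T) * D\<^sup>2"
    using A by (simp add: power_mult_distrib distrib_right)
  from real_sqrt_le_mono[OF this] show ?thesis using D by (simp add: real_sqrt_mult)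
qed

end

section \<open>The initial value of the control\<close>

lemma time_deriv_is_time_deriv:
  "\<exists>g. is_time_deriv T X f g \<Longrightarrow> is_time_deriv T X f (time_deriv T X f)"
  unfolding time_deriv_def by (rule someI_ex[of "is_time_deriv T X f"])

lemma (in seminormed_fspace) L2_representative_mean:
  assumes f: "L2_representative T X f" and "T > 0"
  shows "(LINT t|lborel. fnorm X (f t)) \<le> sqrt T * sqrt (LINT t|lborel. (fnorm X (f t))\<^sup>2)"
proof -
  let ?i = "indicator {0<..<T} :: real \<Rightarrow> real"
  have m: "?i \<in> borel_measurable borel" "(\<lambda>t. fnorm X (f t)) \<in> borel_measurable borel"
    using f strongly_borel_norm by (auto simp: L2_representative_def)
  have i2: "(?i t)\<^sup>2 = ?i t" for t by (simp split: split_indicator)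
  have "(LINT t|lborel. fnorm X (f t)) = (LINT t|lborel. ?i t * fnorm X (f t))"
    using f by (intro Bochner_Integration.integral_cong refl) (auto simp: L2_representative_def split: split_indicator)
  also have "\<dots> \<le> sqrt (LINT t|lborel. (?i t)\<^sup>2) * sqrt (LINT t|lborel. (fnorm X (f t))\<^sup>2)"
    using integral_cauchy_schwarz[OF m] integrable_indicator_Ioo f by (simp add: i2 L2_representative_def abs_le_iff)
  also have "(LINT t|lborel. (?i t)\<^sup>2) = T"
    unfolding i2 using \<open>T > 0\<close> by (simp add: measure_lborel_Ioo)
  finally show ?thesis .
qed

lemma L2_representative_outside: "L2_representative T X f \<Longrightarrow> t \<notin> {0<..<T} \<Longrightarrow> f t = (\<lambda>_. 0)"
  by (simp add: L2_representative_def)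

context bounded_domain
begin

lemma sobolev_1_to_L2:
  "v \<in> elems (sobolev 1 \<Omega>) \<Longrightarrow> v \<in> elems (L2_space \<Omega>)"
  "v \<in> elems (sobolev 1 \<Omega>) \<Longrightarrow> fnorm (L2_space \<Omega>) v \<le> fnorm (sobolev 1 \<Omega>) v"
proof -
  assume v: "v \<in> elems (sobolev 1 \<Omega>)"
  then show "v \<in> elems (L2_space \<Omega>)"
    using sobolev_square_integrable[OF v] by (simp add: elems_L2)
  show "fnorm (L2_space \<Omega>) v \<le> fnorm (sobolev 1 \<Omega>) v"
    using real_sqrt_le_mono[OF l2_norm_le_sobolev_1[OF v]] S.fnorm_nonneg[OF v]
    by (simp add: fnorm_L2)
qed

lemma L2_representative_sobolev_1_L2:
  "L2_representative T (sobolev 1 \<Omega>) f \<Longrightarrow> L2_representative T (L2_space \<Omega>) f"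
  by (rule L2_representative_embedding[OF _ fspace_sobolev fspace_L2]) (auto intro: sobolev_1_to_L2)

lemma functional_l2_sobolev:
  assumes \<psi>: "\<psi> \<in> elems (L2_space \<Omega>)"
  shows "bounded_functional (sobolev 1 \<Omega>) (\<lambda>f. l2_inner \<Omega> f \<psi>)"
  unfolding bounded_functional_def
proof (intro conjI ballI allI exI[of _ "fnorm (L2_space \<Omega>) \<psi>"])
  fix v w a b assume "v \<in> elems (sobolev 1 \<Omega>)" "w \<in> elems (sobolev 1 \<Omega>)"
  then show "l2_inner \<Omega> (\<lambda>x. a * v x + b * w x) \<psi> = a * l2_inner \<Omega> v \<psi> + b * l2_inner \<Omega> w \<psi>"
    by (intro L_ip.lin_left sobolev_1_to_L2 \<psi>)
next
  fix v assume v: "v \<in> elems (sobolev 1 \<Omega>)"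
  have "\<bar>l2_inner \<Omega> v \<psi>\<bar> \<le> fnorm (L2_space \<Omega>) v * fnorm (L2_space \<Omega>) \<psi>"
    by (rule LL.bound[OF sobolev_1_to_L2(1)[OF v] \<psi>])
  also have "\<dots> \<le> fnorm (sobolev 1 \<Omega>) v * fnorm (L2_space \<Omega>) \<psi>"
    by (rule mult_right_mono[OF sobolev_1_to_L2(2)[OF v] L.fnorm_nonneg[OF \<psi>]])
  finally show "\<bar>l2_inner \<Omega> v \<psi>\<bar> \<le> fnorm (L2_space \<Omega>) \<psi> * fnorm (sobolev 1 \<Omega>) v"
    by (simp add: mult.commute)
qed

text \<open>Testing the integrated form of the initial condition with \<open>ubar\<close> shows that the norm of \<open>ubar\<close> is at most
  the norm of \<open>u t\<close> plus the integral of the norm of the derivative, for almost every \<open>t\<close>.  The claim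
  follows by averaging over \<open>t\<close>.\<close>

lemma initial_value_le_H1t_norm:
  assumes T: "T > 0" and u: "u \<in> H1t T (sobolev 1 \<Omega>)" and ini: "has_initial_value T (sobolev 1 \<Omega>) u ubar"
  shows "fnorm (sobolev 1 \<Omega>) ubar \<le> (sqrt T + T * sqrt T) / T * H1t_norm T (sobolev 1 \<Omega>) u"
proof -
  let ?X = "sobolev 1 \<Omega>" and ?B = "sobolev_inner 1 \<Omega>"
  interpret ip: semi_inner_product "elems ?X" ?B by (rule sobolev_semi_inner_product)
  define N where "N = fnorm ?X ubar"
  have ub: "ubar \<in> elems ?X" using ini by (simp add: has_initial_value_def)
  have N0: "0 \<le> N" unfolding N_def by (rule S.fnorm_nonneg[OF ub])
  have d: "is_time_deriv T ?X u (time_deriv T ?X u)"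
    using u unfolding H1t_def by (intro time_deriv_is_time_deriv) blast
  then have uX: "u \<in> L2t T ?X" "time_deriv T ?X u \<in> L2t T ?X" by (auto simp: is_time_deriv_def)
  obtain U where U: "L2_representative T ?X U" "AE t in lborel. t \<in> {0<..<T} \<longrightarrow> u t = U t"
    using uX(1) by (rule S.L2_representative_exists)
  obtain U' where U': "L2_representative T ?X U'" "AE t in lborel. t \<in> {0<..<T} \<longrightarrow> time_deriv T ?X u t = U' t"
    using uX(2) by (rule S.L2_representative_exists)
  have cs: "\<bar>?B v w\<bar> \<le> fnorm ?X v * fnorm ?X w" if "v \<in> elems ?X" "w \<in> elems ?X" for v w
    using ip.cauchy_schwarz[OF that] by (simp add: fnorm_sobolev)
  have F: "bounded_functional ?X (\<lambda>v. ?B v ubar)"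
    unfolding bounded_functional_def
    by (intro conjI ballI allI exI[of _ N] ip.lin_left ub) (use cs[OF _ ub] in \<open>auto simp: N_def mult.commute\<close>)
  define J where "J = (LINT r|lborel. fnorm ?X (U' r))"
  have iU': "integrable lborel (\<lambda>r. fnorm ?X (U' r))" by (rule S.L2_representative_integrable_norm[OF U'(1)])
  have U'0: "0 \<le> fnorm ?X (U' r)" for r by (rule S.fnorm_nonneg[OF L2_rep_elems[OF U'(1)]])
  have ae: "AE t in lborel. t \<in> {0<..<T} \<longrightarrow> N \<le> fnorm ?X (U t) + J"
    using S.has_initial_value_integral[OF d ini T U'] U(2)
  proof eventually_elim
    case (elim t)
    show ?case
    proof
      assume t: "t \<in> {0<..<T}"
      have eq: "?B (U t) ubar = ?B ubar ubar + (LINT r|lborel. indicator {0<..<t} r * ?B (U' r) ubar)"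
        using elim t F by auto
      have "\<bar>LINT r|lborel. indicator {0<..<t} r * ?B (U' r) ubar\<bar> \<le> (LINT r|lborel. \<bar>indicator {0<..<t} r * ?B (U' r) ubar\<bar>)"
        using integral_norm_bound[of lborel "\<lambda>r. indicator {0<..<t} r * ?B (U' r) ubar"] by simp
      also have "\<dots> \<le> (LINT r|lborel. fnorm ?X (U' r) * N)"
      proof (rule integral_mono')
        show "integrable lborel (\<lambda>r. fnorm ?X (U' r) * N)" using iU' by simp
        fix r
        show "\<bar>indicator {0<..<t} r * ?B (U' r) ubar\<bar> \<le> fnorm ?X (U' r) * N"
          using cs[OF L2_rep_elems[OF U'(1)] ub, of r] U'0[of r] N0 by (simp add: N_def split: split_indicator)
        show "0 \<le> fnorm ?X (U' r) * N" using U'0 N0 by simp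
      qed
      also have "\<dots> = J * N" by (simp add: J_def)
      finally have "?B ubar ubar \<le> fnorm ?X (U t) * N + J * N"
        using eq cs[OF L2_rep_elems[OF U(1)] ub, of t] by (simp add: N_def)
      moreover have "?B ubar ubar = N * N"
        using ip.nonneg[OF ub] by (simp add: N_def fnorm_sobolev)
      ultimately have "N * N \<le> (fnorm ?X (U t) + J) * N" by (simp add: distrib_right)
      moreover have "0 \<le> fnorm ?X (U t) + J"
        using S.fnorm_nonneg[OF L2_rep_elems[OF U(1)]] U'0 unfolding J_def
        by (intro add_nonneg_nonneg Bochner_Integration.integral_nonneg) auto
      ultimately show "N \<le> fnorm ?X (U t) + J"
        using N0 by (cases "N = 0") (auto simp: mult_le_cancel_right)
    qed
  qed
  note ioo = integrable_indicator_Ioo[of 0 T]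
  have iU: "integrable lborel (\<lambda>r. fnorm ?X (U r))" by (rule S.L2_representative_integrable_norm[OF U(1)])
  have "T * N = (LINT t|lborel. indicator {0<..<T} t * N)" using T by (simp add: measure_lborel_Ioo)
  also have "\<dots> \<le> (LINT t|lborel. fnorm ?X (U t) + indicator {0<..<T} t * J)"
  proof (rule integral_mono_AE)
    show "AE t in lborel. indicator {0<..<T} t * N \<le> fnorm ?X (U t) + indicator {0<..<T} t * J"
      using ae by eventually_elim (use S.fnorm_nonneg[OF L2_rep_elems[OF U(1)]] in \<open>auto split: split_indicator\<close>)
  qed (use ioo iU in auto)
  also have "\<dots> = (LINT t|lborel. fnorm ?X (U t)) + T * J"
    using ioo iU T by (simp add: measure_lborel_Ioo)
  also have "\<dots> \<le> sqrt T * sqrt (LINT t|lborel. (fnorm ?X (U t))\<^sup>2) + T * (sqrt T * sqrt (LINT t|lborel. (fnorm ?X (U' t))\<^sup>2))"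
    unfolding J_def using T S.L2_representative_mean[OF U(1) T] S.L2_representative_mean[OF U'(1) T]
    by (intro add_mono mult_left_mono) auto
  also have "\<dots> = sqrt T * L2t_norm T ?X u + T * (sqrt T * L2t_norm T ?X (time_deriv T ?X u))"
    using S.L2_representative_norm[OF U] S.L2_representative_norm[OF U'] by simp
  also have "\<dots> \<le> sqrt T * H1t_norm T ?X u + T * (sqrt T * H1t_norm T ?X u)"
    using T by (intro add_mono mult_left_mono) (auto simp: H1t_norm_def intro: real_le_rsqrt)
  finally have "T * N \<le> (sqrt T + T * sqrt T) * H1t_norm T ?X u" by (simp add: algebra_simps)
  then show ?thesis using T by (simp add: N_def field_simps)
qed

section \<open>From weak solutions to the time-integrated equation\<close>

text \<open>With representatives, each term of the weak formulation is integrable, so that the integral may be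
  split.\<close>

lemma cattaneo_weak_form:
  assumes cat: "cattaneo_weak_solution \<Omega> T \<tau> ut y0 y1 yt"
    and Y: "L2_representative T (H1_0 \<Omega>) Y" "AE t in lborel. t \<in> {0<..<T} \<longrightarrow> yt t = Y t"
    and Y': "L2_representative T (L2_space \<Omega>) Y'" "AE t in lborel. t \<in> {0<..<T} \<longrightarrow> first_deriv \<Omega> T yt t = Y' t"
    and Y2: "L2_representative T (H_minus_1 \<Omega>) Y2" "AE t in lborel. t \<in> {0<..<T} \<longrightarrow> second_deriv \<Omega> T yt t = Y2 t"
    and U: "L2_representative T (L2_space \<Omega>) U" "AE t in lborel. t \<in> {0<..<T} \<longrightarrow> ut t = U t"
    and w: "L2_representative T (H1_0 \<Omega>) w"
  shows "\<tau> * (LINT t|lborel. Y2 t (w t)) + (LINT t|lborel. l2_inner \<Omega> (Y' t) (w t))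
      + (LINT t|lborel. dirichlet_form \<Omega> (Y t) (w t)) = (LINT t|lborel. l2_inner \<Omega> (U t) (w t))"
proof -
  let ?l = "l2_inner \<Omega>" and ?a = "dirichlet_form \<Omega>" and ?I = "{0<..<T}"
  note wL = L2_representative_H1_0_L2[OF w] and we = L2_rep_elems[OF w] and weL = L2_rep_elems[OF L2_representative_H1_0_L2[OF w]]
  note i = DV.pairing_integrable[OF Y2(1) w] LL.pairing_integrable[OF Y'(1) wL] VV.pairing_integrable[OF Y(1) w]
    LL.pairing_integrable[OF U(1) wL]
  have "(LINT t|time_measure T. \<tau> * second_deriv \<Omega> T yt t (w t) + ?l (first_deriv \<Omega> T yt t) (w t) + ?a (yt t) (w t)) = (LINT t|time_measure T. ?l (ut t) (w t))"
    using cat V.L2_representative_L2t[OF w] unfolding cattaneo_weak_solution_def by blast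
  moreover have "(LINT t|time_measure T. \<tau> * second_deriv \<Omega> T yt t (w t) + ?l (first_deriv \<Omega> T yt t) (w t) + ?a (yt t) (w t))
    = (LINT t|lborel. \<tau> * Y2 t (w t) + ?l (Y' t) (w t) + ?a (Y t) (w t))"
  proof (rule time_measure_transfer(1))
    show "(\<lambda>t. \<tau> * Y2 t (w t) + ?l (Y' t) (w t) + ?a (Y t) (w t)) \<in> borel_measurable borel"
      using i[THEN borel_measurable_integrable] by simp
    show "AE t in lborel. t \<in> ?I \<longrightarrow> \<tau> * second_deriv \<Omega> T yt t (w t) + ?l (first_deriv \<Omega> T yt t) (w t) + ?a (yt t) (w t)
        = \<tau> * Y2 t (w t) + ?l (Y' t) (w t) + ?a (Y t) (w t)"
      using Y(2) Y'(2) Y2(2) by eventually_elim auto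
    show "\<tau> * Y2 t (w t) + ?l (Y' t) (w t) + ?a (Y t) (w t) = 0" if "t \<notin> ?I" for t
      using L2_representative_outside[OF Y(1) that] L2_representative_outside[OF Y'(1) that] L2_representative_outside[OF Y2(1) that] l2_zero[OF weL] dirichlet_zero[OF we] by simp
  qed
  moreover have "(LINT t|time_measure T. ?l (ut t) (w t)) = (LINT t|lborel. ?l (U t) (w t))"
  proof (rule time_measure_transfer(1))
    show "(\<lambda>t. ?l (U t) (w t)) \<in> borel_measurable borel"
      using i[THEN borel_measurable_integrable] by simp
    show "AE t in lborel. t \<in> ?I \<longrightarrow> ?l (ut t) (w t) = ?l (U t) (w t)"
      using U(2) by eventually_elim auto
    show "?l (U t) (w t) = 0" if "t \<notin> ?I" for t
      using L2_representative_outside[OF U(1) that] l2_zero[OF weL] by simp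
  qed
  ultimately show ?thesis using i by simp
qed

lemma heat_weak_form:
  assumes heat: "heat_weak_solution \<Omega> T u y0 y"
    and Z: "L2_representative T (H1_0 \<Omega>) Z" "AE t in lborel. t \<in> {0<..<T} \<longrightarrow> y t = Z t"
    and Z': "L2_representative T (L2_space \<Omega>) Z'" "AE t in lborel. t \<in> {0<..<T} \<longrightarrow> first_deriv \<Omega> T y t = Z' t"
    and W: "L2_representative T (L2_space \<Omega>) W" "AE t in lborel. t \<in> {0<..<T} \<longrightarrow> u t = W t"
    and w: "L2_representative T (H1_0 \<Omega>) w"
  shows "(LINT t|lborel. l2_inner \<Omega> (Z' t) (w t)) + (LINT t|lborel. dirichlet_form \<Omega> (Z t) (w t))
      = (LINT t|lborel. l2_inner \<Omega> (W t) (w t))"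
proof -
  let ?l = "l2_inner \<Omega>" and ?a = "dirichlet_form \<Omega>" and ?I = "{0<..<T}"
  note wL = L2_representative_H1_0_L2[OF w] and we = L2_rep_elems[OF w] and weL = L2_rep_elems[OF L2_representative_H1_0_L2[OF w]]
  note i = LL.pairing_integrable[OF Z'(1) wL] VV.pairing_integrable[OF Z(1) w] LL.pairing_integrable[OF W(1) wL]
  have "(LINT t|time_measure T. ?l (first_deriv \<Omega> T y t) (w t) + ?a (y t) (w t)) = (LINT t|time_measure T. ?l (u t) (w t))"
    using heat V.L2_representative_L2t[OF w] unfolding heat_weak_solution_def by blast
  moreover have "(LINT t|time_measure T. ?l (first_deriv \<Omega> T y t) (w t) + ?a (y t) (w t))
    = (LINT t|lborel. ?l (Z' t) (w t) + ?a (Z t) (w t))"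
  proof (rule time_measure_transfer(1))
    show "(\<lambda>t. ?l (Z' t) (w t) + ?a (Z t) (w t)) \<in> borel_measurable borel"
      using i[THEN borel_measurable_integrable] by simp
    show "AE t in lborel. t \<in> ?I \<longrightarrow> ?l (first_deriv \<Omega> T y t) (w t) + ?a (y t) (w t) = ?l (Z' t) (w t) + ?a (Z t) (w t)"
      using Z(2) Z'(2) by eventually_elim auto
    show "?l (Z' t) (w t) + ?a (Z t) (w t) = 0" if "t \<notin> ?I" for t
      using L2_representative_outside[OF Z(1) that] L2_representative_outside[OF Z'(1) that] l2_zero[OF weL] dirichlet_zero[OF we] by simp
  qed
  moreover have "(LINT t|time_measure T. ?l (u t) (w t)) = (LINT t|lborel. ?l (W t) (w t))"
  proof (rule time_measure_transfer(1))
    show "(\<lambda>t. ?l (W t) (w t)) \<in> borel_measurable borel"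
      using i[THEN borel_measurable_integrable] by simp
    show "AE t in lborel. t \<in> ?I \<longrightarrow> ?l (u t) (w t) = ?l (W t) (w t)"
      using W(2) by eventually_elim auto
    show "?l (W t) (w t) = 0" if "t \<notin> ?I" for t
      using L2_representative_outside[OF W(1) that] l2_zero[OF weL] by simp
  qed
  ultimately show ?thesis using i by simp
qed

end

text \<open>Representatives of a weak solution of the Cattaneo equation, with its initial conditions in
  integrated form.\<close>

locale cattaneo_solution = bounded_domain \<Omega> for \<Omega> :: "'a::euclidean_space set" +
  fixes T \<tau> :: real and y0 y1 ubar :: "'a \<Rightarrow> real" and Y Y' U U' :: "real \<Rightarrow> 'a \<Rightarrow> real"
    and Y2 :: "real \<Rightarrow> ('a \<Rightarrow> real) \<Rightarrow> real"
  assumes T: "T > 0" and \<tau>: "\<tau> > 0"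
    and y0: "y0 \<in> elems (sobolev 3 \<Omega>)" "y0 \<in> elems (H1_0 \<Omega>)" and ubar: "ubar \<in> elems (L2_space \<Omega>)"
    and y1_eq: "y1 = (\<lambda>x. weak_laplacian \<Omega> y0 x + ubar x)" and y1: "y1 \<in> elems (H1_0 \<Omega>)"
    and Y: "L2_representative T (H1_0 \<Omega>) Y" and Y': "L2_representative T (L2_space \<Omega>) Y'"
    and Y2: "L2_representative T (H_minus_1 \<Omega>) Y2"
    and U: "L2_representative T (L2_space \<Omega>) U" and U': "L2_representative T (L2_space \<Omega>) U'"
    and weak: "\<And>w. L2_representative T (H1_0 \<Omega>) w \<Longrightarrow>
      \<tau> * (LINT t|lborel. Y2 t (w t)) + (LINT t|lborel. l2_inner \<Omega> (Y' t) (w t))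
      + (LINT t|lborel. dirichlet_form \<Omega> (Y t) (w t)) = (LINT t|lborel. l2_inner \<Omega> (U t) (w t))"
    and initial_Y: "AE t in lborel. t \<in> {0<..<T} \<longrightarrow> (\<forall>\<psi>\<in>elems (L2_space \<Omega>).
      l2_inner \<Omega> (Y t) \<psi> = l2_inner \<Omega> y0 \<psi> + (LINT r|lborel. indicator {..<t} r * l2_inner \<Omega> (Y' r) \<psi>))"
    and initial_Y': "AE t in lborel. t \<in> {0<..<T} \<longrightarrow> (\<forall>v\<in>elems (H1_0 \<Omega>).
      l2_inner \<Omega> (Y' t) v = l2_inner \<Omega> y1 v + (LINT r|lborel. indicator {..<t} r * Y2 r v))"
    and initial_U: "AE t in lborel. t \<in> {0<..<T} \<longrightarrow> (\<forall>\<psi>\<in>elems (L2_space \<Omega>).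
      l2_inner \<Omega> (U t) \<psi> = l2_inner \<Omega> ubar \<psi> + (LINT r|lborel. indicator {..<t} r * l2_inner \<Omega> (U' r) \<psi>))"
begin

text \<open>The numerical factors match the closure rules for linear combinations.\<close>

definition "correction t = (\<lambda>x. indicator {0<..<T} t * (- 1 * y0 x + (- t) * y1 x))"
definition "correction' t = (\<lambda>x. indicator {0<..<T} t * (- 1 * y1 x))" for t :: real

text \<open>The displacement from the uniform motion \<open>y\<^sub>0 + t y\<^sub>1\<close> has vanishing initial values.\<close>

definition "displacement t = (\<lambda>x. 1 * Y t x + 1 * correction t x)"
definition "velocity t = (\<lambda>x. 1 * Y' t x + 1 * correction' t x)"

lemma Y2_outside: "t \<notin> {0<..<T} \<Longrightarrow> Y2 t v = 0"
  using L2_representative_outside[OF Y2] by simp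

lemma Y2_integrable: "v \<in> elems (H1_0 \<Omega>) \<Longrightarrow> integrable lborel (\<lambda>r. Y2 r v)"
  by (rule D.L2_representative_functional[OF Y2 functional_evaluation])

lemmas y0_L2 = H1_0_to_L2(1)[OF y0(2)] and y1_L2 = H1_0_to_L2(1)[OF y1]

lemma correction_H1_0: "L2_representative T (H1_0 \<Omega>) correction"
  unfolding correction_def[abs_def]
proof (rule V.L2_representative_cut)
  have "strongly_borel (H1_0 \<Omega>) (\<lambda>t x. - 1 * y0 x)" "strongly_borel (H1_0 \<Omega>) (\<lambda>t x. (- t) * y1 x)"
    by (rule V.strongly_borel_const[OF V.scale_elems[OF y0(2)]])
      (rule V.strongly_borel_scale[OF V.strongly_borel_const[OF y1]], simp)
  from V.strongly_borel_add[OF this] show "strongly_borel (H1_0 \<Omega>) (\<lambda>t x. - 1 * y0 x + (- t) * y1 x)" .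
  fix t assume t: "t \<in> {0<..<T}"
  have "fnorm (H1_0 \<Omega>) (\<lambda>x. - 1 * y0 x + (- t) * y1 x) \<le> \<bar>- 1\<bar> * fnorm (H1_0 \<Omega>) y0 + \<bar>- t\<bar> * fnorm (H1_0 \<Omega>) y1"
    using V.fnorm_triangle[OF V.scale_elems[OF y0(2), of "-1"] V.scale_elems[OF y1, of "- t"]]
    unfolding V.fnorm_scale[OF y0(2)] V.fnorm_scale[OF y1] .
  also have "\<dots> \<le> fnorm (H1_0 \<Omega>) y0 + T * fnorm (H1_0 \<Omega>) y1"
    using t V.fnorm_nonneg[OF y1] by (auto intro!: mult_right_mono)
  finally show "fnorm (H1_0 \<Omega>) (\<lambda>x. - 1 * y0 x + (- t) * y1 x) \<le> fnorm (H1_0 \<Omega>) y0 + T * fnorm (H1_0 \<Omega>) y1" .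
qed

lemma correction'_L2: "L2_representative T (L2_space \<Omega>) correction'"
  unfolding correction'_def[abs_def]
  by (rule L.L2_representative_cut[OF L.strongly_borel_const[OF L.scale_elems[OF y1_L2]] order_refl])

lemma displacement_H1_0: "L2_representative T (H1_0 \<Omega>) displacement"
  unfolding displacement_def[abs_def] by (rule V.L2_representative_lincomb[OF Y correction_H1_0])

lemma velocity_L2: "L2_representative T (L2_space \<Omega>) velocity"
  unfolding velocity_def[abs_def] by (rule L.L2_representative_lincomb[OF Y' correction'_L2])

lemma correction_inner:
  assumes \<psi>: "\<psi> \<in> elems (L2_space \<Omega>)"
  shows "l2_inner \<Omega> (correction t) \<psi> = indicator {0<..<T} t * (- l2_inner \<Omega> y0 \<psi> - t * l2_inner \<Omega> y1 \<psi>)"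
    and "l2_inner \<Omega> (correction' t) \<psi> = indicator {0<..<T} t * (- l2_inner \<Omega> y1 \<psi>)"
  using L.bounded_functional_scale[OF functional_l2[OF \<psi>] L_ip.lin_in[OF y0_L2 y1_L2], of "indicator {0<..<T} t" "-1" "- t"]
    L_ip.lin_left[OF y0_L2 y1_L2 \<psi>, of "-1" "- t"]
    L.bounded_functional_scale[OF functional_l2[OF \<psi>] L.scale_elems[OF y1_L2], of "indicator {0<..<T} t" "-1"]
    L.bounded_functional_scale[OF functional_l2[OF \<psi>] y1_L2, of "-1"]
  unfolding correction_def correction'_def by simp_all

lemma correction_dirichlet:
  assumes v: "v \<in> elems (H1_0 \<Omega>)"
  shows "dirichlet_form \<Omega> (correction t) v = indicator {0<..<T} t * (- dirichlet_form \<Omega> y0 v - t * dirichlet_form \<Omega> y1 v)"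
  using V.bounded_functional_scale[OF functional_dirichlet[OF v] V_ip.lin_in[OF y0(2) y1], of "indicator {0<..<T} t" "-1" "- t"]
    V_ip.lin_left[OF y0(2) y1 v, of "-1" "- t"] unfolding correction_def by simp

lemma motion_inner:
  assumes "\<psi> \<in> elems (L2_space \<Omega>)"
  shows "l2_inner \<Omega> (displacement t) \<psi> = l2_inner \<Omega> (Y t) \<psi> + l2_inner \<Omega> (correction t) \<psi>"
    and "l2_inner \<Omega> (velocity t) \<psi> = l2_inner \<Omega> (Y' t) \<psi> + l2_inner \<Omega> (correction' t) \<psi>"
  using L_ip.lin_left[OF H1_0_to_L2(1)[OF L2_rep_elems[OF Y]] H1_0_to_L2(1)[OF L2_rep_elems[OF correction_H1_0]] assms, of 1 t 1 t]
    L_ip.lin_left[OF L2_rep_elems[OF Y'] L2_rep_elems[OF correction'_L2] assms, of 1 t 1 t]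
  by (simp_all add: displacement_def velocity_def)

lemma displacement_dirichlet:
  assumes "v \<in> elems (H1_0 \<Omega>)"
  shows "dirichlet_form \<Omega> (displacement t) v = dirichlet_form \<Omega> (Y t) v + dirichlet_form \<Omega> (correction t) v"
  using V_ip.lin_left[OF L2_rep_elems[OF Y] L2_rep_elems[OF correction_H1_0] assms, of 1 t 1 t]
  by (simp add: displacement_def)

lemma integral_constant_load:
  assumes "t \<in> {0<..<T}"
  shows "(LINT r|lborel. indicator {..<t} r * (indicator {0<..<T} r * c)) = t * c"
proof -
  have "(LINT r|lborel. indicator {..<t} r * (indicator {0<..<T} r * c)) = (LINT r|lborel. indicator {0<..<t} r * c)"
    using assms by (intro Bochner_Integration.integral_cong) (auto simp: indicator_def)
  then show ?thesis using assms by (simp add: measure_lborel_Ioo)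
qed

lemma displacement_primitive: "AE t in lborel. t \<in> {0<..<T} \<longrightarrow>
    (\<forall>\<psi>\<in>elems (L2_space \<Omega>). l2_inner \<Omega> (displacement t) \<psi> = (LINT r|lborel. indicator {..<t} r * l2_inner \<Omega> (velocity r) \<psi>))"
  using initial_Y
proof eventually_elim
  case (elim t)
  show ?case
  proof (intro impI ballI)
    fix \<psi> assume t: "t \<in> {0<..<T}" and \<psi>: "\<psi> \<in> elems (L2_space \<Omega>)"
    have "(LINT r|lborel. indicator {..<t} r * l2_inner \<Omega> (velocity r) \<psi>)
      = (LINT r|lborel. indicator {..<t} r * l2_inner \<Omega> (Y' r) \<psi> + indicator {..<t} r * (indicator {0<..<T} r * (- l2_inner \<Omega> y1 \<psi>)))"
      using \<psi> by (simp add: motion_inner correction_inner right_diff_distrib)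
    also have "\<dots> = (LINT r|lborel. indicator {..<t} r * l2_inner \<Omega> (Y' r) \<psi>) + (LINT r|lborel. indicator {..<t} r * (indicator {0<..<T} r * (- l2_inner \<Omega> y1 \<psi>)))"
    proof (rule Bochner_Integration.integral_add)
      show "integrable lborel (\<lambda>r. indicator {..<t} r * l2_inner \<Omega> (Y' r) \<psi>)"
        by (intro integrable_indicator_mult L.L2_representative_functional[OF Y' functional_l2[OF \<psi>]]) simp
      show "integrable lborel (\<lambda>r. indicator {..<t} r * (indicator {0<..<T} r * (- l2_inner \<Omega> y1 \<psi>)))"
        by (intro integrable_indicator_mult integrable_mult_left integrable_indicator_Ioo) simp
    qed
    also have "\<dots> = l2_inner \<Omega> (displacement t) \<psi>"
      unfolding integral_constant_load[OF t] using elim t \<psi> by (simp add: motion_inner correction_inner)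
    finally show "l2_inner \<Omega> (displacement t) \<psi> = (LINT r|lborel. indicator {..<t} r * l2_inner \<Omega> (velocity r) \<psi>)" by simp
  qed
qed

lemma velocity_Y2: "AE t in lborel. t \<in> {0<..<T} \<longrightarrow> (\<forall>v\<in>elems (H1_0 \<Omega>). l2_inner \<Omega> (velocity t) v = (LINT r|lborel. indicator {..<t} r * Y2 r v))"
  using initial_Y' by eventually_elim (auto simp: motion_inner correction_inner H1_0_to_L2(1))

lemma displacement_acceleration: "AE t in lborel. t \<in> {0<..<T} \<longrightarrow>
    (\<forall>v\<in>elems (H1_0 \<Omega>). l2_inner \<Omega> (displacement t) v = (LINT s|lborel. max 0 (t - s) * Y2 s v))"
  using displacement_primitive
proof eventually_elim
  case (elim t)
  show ?case
  proof (intro impI ballI)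
    fix v assume t: "t \<in> {0<..<T}" and v: "v \<in> elems (H1_0 \<Omega>)"
    have "l2_inner \<Omega> (displacement t) v = (LINT r|lborel. indicator {..<t} r * l2_inner \<Omega> (velocity r) v)"
      using elim t H1_0_to_L2(1)[OF v] by blast
    also have "\<dots> = (LINT r|lborel. indicator {..<t} r * (LINT s|lborel. indicator {..<r} s * Y2 s v))"
    proof (rule integral_cong_AE)
      show "(\<lambda>r. indicator {..<t} r * l2_inner \<Omega> (velocity r) v) \<in> borel_measurable lborel"
        using borel_measurable_integrable[OF L.L2_representative_functional[OF velocity_L2 functional_l2[OF H1_0_to_L2(1)[OF v]]]] by simp
      show "(\<lambda>r. indicator {..<t} r * (LINT s|lborel. indicator {..<r} s * Y2 s v)) \<in> borel_measurable lborel"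
        using primitive_measurable[OF Y2_integrable[OF v]] by (intro borel_measurable_times) auto
      show "AE r in lborel. indicator {..<t} r * l2_inner \<Omega> (velocity r) v = indicator {..<t} r * (LINT s|lborel. indicator {..<r} s * Y2 s v)"
        using velocity_Y2
      proof eventually_elim
        case (elim r)
        show ?case
        proof (cases "r \<in> {0<..<T}")
          case True
          then show ?thesis using elim v by simp
        next
          case False
          show ?thesis
          proof (cases "r < t")
            case True
            then have r: "r \<le> 0" using False t by auto
            have "(LINT s|lborel. indicator {..<r} s * Y2 s v) = 0"
              using r Y2_outside by (intro Bochner_Integration.integral_eq_zero_AE AE_I2) (auto simp: indicator_def)
            then show ?thesis using L2_representative_outside[OF velocity_L2 False] l2_zero[OF H1_0_to_L2(1)[OF v]] by simp
          qed simp
        qed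
      qed
    qed
    also have "\<dots> = (LINT s|lborel. max 0 (t - s) * Y2 s v)"
      using Y2_outside by (intro double_primitive Y2_integrable v) auto
    finally show "l2_inner \<Omega> (displacement t) v = (LINT s|lborel. max 0 (t - s) * Y2 s v)" .
  qed
qed

text \<open>Test functions constant on the interval from 0 to \<open>t\<close> integrate the equation in time.  By Green's formula
  for \<open>y0\<close> and the relation between \<open>y1\<close>, \<open>y0\<close> and \<open>ubar\<close>, the terms linear in \<open>t\<close> cancel; this is the
  integrated form of the statement that the acceleration vanishes at time 0.\<close>

lemma displacement_equation: "AE t in lborel. t \<in> {0<..<T} \<longrightarrow> (\<forall>v\<in>elems (H1_0 \<Omega>).
    \<tau> * l2_inner \<Omega> (velocity t) v + l2_inner \<Omega> (displacement t) v + (LINT r|lborel. indicator {..<t} r * dirichlet_form \<Omega> (displacement r) v)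
    = (LINT s|lborel. max 0 (t - s) * (l2_inner \<Omega> (U' s) v - indicator {0<..<T} s * dirichlet_form \<Omega> y1 v)))"
  using velocity_Y2 initial_Y
proof eventually_elim
  case (elim t)
  show ?case
  proof (intro impI ballI)
    fix v assume t: "t \<in> {0<..<T}" and v: "v \<in> elems (H1_0 \<Omega>)"
    note vL = H1_0_to_L2(1)[OF v]
    define w where "w r = (\<lambda>x. indicator {0<..<t} r * v x)" for r
    have w: "L2_representative T (H1_0 \<Omega>) w"
      unfolding w_def
      by (rule V.L2_representative_mono[OF V.L2_representative_cut[OF V.strongly_borel_const[OF v] order_refl]]) (use t in auto)
    have lw: "l2_inner \<Omega> f (w r) = indicator {0<..<t} r * l2_inner \<Omega> f v" if "f \<in> elems (L2_space \<Omega>)" for f r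
      using L_ip.lin_right[OF vL vL that, of "indicator {0<..<t} r" 0] by (simp add: w_def)
    have aw: "dirichlet_form \<Omega> f (w r) = indicator {0<..<t} r * dirichlet_form \<Omega> f v" if "f \<in> elems (H1_0 \<Omega>)" for f r
      using V_ip.lin_right[OF v v that, of "indicator {0<..<t} r" 0] by (simp add: w_def)
    have Y2w: "Y2 r (w r) = indicator {0<..<t} r * Y2 r v" for r
    proof -
      have "bounded_functional (H1_0 \<Omega>) (Y2 r)"
        using L2_rep_elems[OF Y2, of r] by (simp add: H_minus_1_def bounded_functional_def)
      from V.bounded_functional_scale[OF this v] show ?thesis by (simp add: w_def)
    qed
    have I: "(LINT r|lborel. indicator {0<..<t} r * h r) = (LINT r|lborel. indicator {..<t} r * h r)"
      if "\<And>r. r \<notin> {0<..<T} \<Longrightarrow> h r = 0" for h :: "real \<Rightarrow> real"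
      using that by (intro integral_indicator_Ioo) auto
    have start: "\<tau> * (LINT r|lborel. indicator {..<t} r * Y2 r v) + (LINT r|lborel. indicator {..<t} r * l2_inner \<Omega> (Y' r) v)
        + (LINT r|lborel. indicator {..<t} r * dirichlet_form \<Omega> (Y r) v) = (LINT r|lborel. indicator {..<t} r * l2_inner \<Omega> (U r) v)"
      using weak[OF w] I[of "\<lambda>r. Y2 r v"] I[of "\<lambda>r. l2_inner \<Omega> (Y' r) v"] I[of "\<lambda>r. dirichlet_form \<Omega> (Y r) v"] I[of "\<lambda>r. l2_inner \<Omega> (U r) v"]
      by (simp add: Y2w lw[OF L2_rep_elems[OF Y']] aw[OF L2_rep_elems[OF Y]] lw[OF L2_rep_elems[OF U]]
          Y2_outside L2_representative_outside[OF Y'] L2_representative_outside[OF Y] L2_representative_outside[OF U] l2_zero[OF vL] dirichlet_zero[OF v])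
    have iY: "integrable lborel (\<lambda>r. indicator {..<t} r * dirichlet_form \<Omega> (Y r) v)"
      by (intro integrable_indicator_mult V.L2_representative_functional[OF Y functional_dirichlet[OF v]]) simp
    have ip: "integrable lborel (\<lambda>r. indicator {..<t} r * dirichlet_form \<Omega> (correction r) v)"
      by (intro integrable_indicator_mult V.L2_representative_functional[OF correction_H1_0 functional_dirichlet[OF v]]) simp
    have iU: "integrable lborel (\<lambda>r. indicator {..<t} r * l2_inner \<Omega> (U r) v)"
      by (intro integrable_indicator_mult L.L2_representative_functional[OF U functional_l2[OF vL]]) simp
    have ic: "integrable lborel (\<lambda>r. indicator {..<t} r * (indicator {0<..<T} r * c))" for c :: real
      by (intro integrable_indicator_mult integrable_mult_left integrable_indicator_Ioo) simp
    define \<phi> where "\<phi> s = l2_inner \<Omega> (U' s) v - indicator {0<..<T} s * dirichlet_form \<Omega> y1 v" for s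
    have \<phi>: "integrable lborel \<phi>" "\<And>s. s \<le> 0 \<Longrightarrow> \<phi> s = 0"
      unfolding \<phi>_def
      by (intro Bochner_Integration.integrable_diff L.L2_representative_functional[OF U' functional_l2[OF vL]] integrable_mult_left integrable_indicator_Ioo)
         (simp add: L2_representative_outside[OF U'] l2_zero[OF vL])
    have green: "dirichlet_form \<Omega> y0 v = - l2_inner \<Omega> (weak_laplacian \<Omega> y0) v"
      by (rule dirichlet_form_laplacian[OF y0(1) _ H1_0_subset[OF y0(2)] v]) simp
    have "weak_laplacian \<Omega> y0 \<in> elems (L2_space \<Omega>)"
      using weak_laplacian_square_integrable[OF y0(1)] by (simp add: elems_L2)
    then have y1v: "l2_inner \<Omega> y1 v = l2_inner \<Omega> (weak_laplacian \<Omega> y0) v + l2_inner \<Omega> ubar v"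
      using L_ip.lin_left[OF _ ubar vL, of "weak_laplacian \<Omega> y0" 1 1] by (simp add: y1_eq)
    \<comment> \<open>The primitive of the load, expressed by the control and the motion that is subtracted.\<close>
    have inner: "AE r in lborel. indicator {..<t} r * (LINT s|lborel. indicator {..<r} s * \<phi> s)
        = indicator {..<t} r * l2_inner \<Omega> (U r) v + indicator {..<t} r * dirichlet_form \<Omega> (correction r) v
          + indicator {..<t} r * (indicator {0<..<T} r * (dirichlet_form \<Omega> y0 v - l2_inner \<Omega> ubar v))"
      using initial_U
    proof eventually_elim
      case (elim r)
      show ?case
      proof (cases "r \<in> {0<..<T}")
        case True
        have "(LINT s|lborel. indicator {..<r} s * \<phi> s) = (LINT s|lborel. indicator {..<r} s * l2_inner \<Omega> (U' s) v - indicator {..<r} s * (indicator {0<..<T} s * dirichlet_form \<Omega> y1 v))"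
          by (simp add: \<phi>_def right_diff_distrib)
        also have "\<dots> = (LINT s|lborel. indicator {..<r} s * l2_inner \<Omega> (U' s) v) - (LINT s|lborel. indicator {..<r} s * (indicator {0<..<T} s * dirichlet_form \<Omega> y1 v))"
          by (intro Bochner_Integration.integral_diff integrable_indicator_mult
              L.L2_representative_functional[OF U' functional_l2[OF vL]] integrable_mult_left integrable_indicator_Ioo) simp_all
        also have "\<dots> = l2_inner \<Omega> (U r) v - l2_inner \<Omega> ubar v - r * dirichlet_form \<Omega> y1 v"
          unfolding integral_constant_load[OF True] using elim True vL by simp
        finally show ?thesis using True by (cases "r < t") (simp_all add: correction_dirichlet[OF v] algebra_simps)
      next
        case False
        show ?thesis
        proof (cases "r < t")
          case True
          then have r: "r \<le> 0" using False t by auto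
          have "(LINT s|lborel. indicator {..<r} s * \<phi> s) = 0"
            using r \<phi>(2) by (intro Bochner_Integration.integral_eq_zero_AE AE_I2) (auto simp: indicator_def)
          then show ?thesis using False by (simp add: L2_representative_outside[OF U] L2_representative_outside[OF correction_H1_0] l2_zero[OF vL] dirichlet_zero[OF v])
        qed simp
      qed
    qed
    have "(LINT s|lborel. max 0 (t - s) * \<phi> s) = (LINT r|lborel. indicator {..<t} r * (LINT s|lborel. indicator {..<r} s * \<phi> s))"
      by (rule double_primitive[OF \<phi>, symmetric])
    also have "\<dots> = (LINT r|lborel. indicator {..<t} r * l2_inner \<Omega> (U r) v + indicator {..<t} r * dirichlet_form \<Omega> (correction r) v
          + indicator {..<t} r * (indicator {0<..<T} r * (dirichlet_form \<Omega> y0 v - l2_inner \<Omega> ubar v)))"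
    proof (rule integral_cong_AE[OF _ _ inner])
      show "(\<lambda>r. indicator {..<t} r * (LINT s|lborel. indicator {..<r} s * \<phi> s)) \<in> borel_measurable lborel"
        using primitive_measurable[OF \<phi>(1)] by (intro borel_measurable_times) auto
      show "(\<lambda>r. indicator {..<t} r * l2_inner \<Omega> (U r) v + indicator {..<t} r * dirichlet_form \<Omega> (correction r) v
          + indicator {..<t} r * (indicator {0<..<T} r * (dirichlet_form \<Omega> y0 v - l2_inner \<Omega> ubar v))) \<in> borel_measurable lborel"
        by (intro borel_measurable_add borel_measurable_integrable iU ip ic)
    qed
    also have "\<dots> = (LINT r|lborel. indicator {..<t} r * l2_inner \<Omega> (U r) v) + (LINT r|lborel. indicator {..<t} r * dirichlet_form \<Omega> (correction r) v)
          + t * (dirichlet_form \<Omega> y0 v - l2_inner \<Omega> ubar v)"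
      using iU ip ic by (simp add: integral_constant_load[OF t])
    also have "(LINT r|lborel. indicator {..<t} r * l2_inner \<Omega> (U r) v) = \<tau> * l2_inner \<Omega> (velocity t) v + (l2_inner \<Omega> (Y t) v - l2_inner \<Omega> y0 v)
        + (LINT r|lborel. indicator {..<t} r * dirichlet_form \<Omega> (Y r) v)"
      using start elim t v vL by simp
    also have "(LINT r|lborel. indicator {..<t} r * dirichlet_form \<Omega> (Y r) v) = (LINT r|lborel. indicator {..<t} r * dirichlet_form \<Omega> (displacement r) v) - (LINT r|lborel. indicator {..<t} r * dirichlet_form \<Omega> (correction r) v)"
      using iY ip by (simp add: displacement_dirichlet[OF v] distrib_left)
    finally have "(LINT s|lborel. max 0 (t - s) * \<phi> s) = \<tau> * l2_inner \<Omega> (velocity t) v + (l2_inner \<Omega> (Y t) v - l2_inner \<Omega> y0 v)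
        + (LINT r|lborel. indicator {..<t} r * dirichlet_form \<Omega> (displacement r) v) + t * (dirichlet_form \<Omega> y0 v - l2_inner \<Omega> ubar v)"
      by simp
    moreover have "l2_inner \<Omega> (displacement t) v = l2_inner \<Omega> (Y t) v - l2_inner \<Omega> y0 v - t * l2_inner \<Omega> y1 v"
      using t by (simp add: motion_inner[OF vL] correction_inner[OF vL])
    ultimately show "\<tau> * l2_inner \<Omega> (velocity t) v + l2_inner \<Omega> (displacement t) v + (LINT r|lborel. indicator {..<t} r * dirichlet_form \<Omega> (displacement r) v)
      = (LINT s|lborel. max 0 (t - s) * (l2_inner \<Omega> (U' s) v - indicator {0<..<T} s * dirichlet_form \<Omega> y1 v))"
      unfolding \<phi>_def[symmetric] using green y1v by (simp add: algebra_simps)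
  qed
qed

sublocale cattaneo_acceleration \<Omega> T \<tau> displacement velocity U' y1 Y2
  by unfold_locales
    (fact T \<tau> displacement_H1_0 velocity_L2 U' y1 displacement_primitive displacement_equation Y2 displacement_acceleration)+

end

section \<open>The error estimate\<close>

context bounded_domain
begin

text \<open>The error \<open>e\<close> solves a heat equation with the load \<open>(ut - u) - \<tau> yt''\<close>.  Cut off at time \<open>c\<close>, it is a test
  function for both equations, and the part of the load with \<open>yt''\<close> is bounded by \<open>acceleration_bound\<close>.\<close>

lemma error_estimate:
  assumes T: "T > 0" and \<tau>: "\<tau> > 0"
    and y0: "y0 \<in> elems (sobolev 3 \<Omega>)" "y0 \<in> elems (H1_0 \<Omega>)" and ubar: "ubar \<in> elems (sobolev 1 \<Omega>)"
    and u: "u \<in> H1t T (sobolev 1 \<Omega>)"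
    and ut: "ut \<in> H1t T (sobolev 1 \<Omega>)" "has_initial_value T (sobolev 1 \<Omega>) ut ubar"
    and y1_def: "y1 = (\<lambda>x. weak_laplacian \<Omega> y0 x + ubar x)" and y1: "y1 \<in> elems (H1_0 \<Omega>)"
    and cat: "cattaneo_weak_solution \<Omega> T \<tau> ut y0 y1 yt" and heat: "heat_weak_solution \<Omega> T u y0 y"
  shows "L2t_norm T (H1_0 \<Omega>) (\<lambda>t x. yt t x - y t x) \<le> sqrt (4 * T\<^sup>2 + 2 * T) *
    (L2t_norm T (L2_space \<Omega>) (\<lambda>t x. ut t x - u t x) +
     \<tau> * (2 * H1t_norm T (sobolev 1 \<Omega>) ut + 4 * sqrt (dirichlet_form \<Omega> y1 y1)))"
proof -
  let ?L = "L2_space \<Omega>" and ?V = "H1_0 \<Omega>" and ?D = "H_minus_1 \<Omega>" and ?S = "sobolev 1 \<Omega>"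
  let ?l = "l2_inner \<Omega>" and ?a = "dirichlet_form \<Omega>" and ?I = "{0<..<T}"
  define yt' where "yt' = first_deriv \<Omega> T yt"
  define yt2 where "yt2 = second_deriv \<Omega> T yt"
  define y' where "y' = first_deriv \<Omega> T y"
  define ut' where "ut' = time_deriv T ?S ut"
  have d1: "is_time_deriv T ?L yt yt'"
    using cat unfolding yt'_def cattaneo_weak_solution_def Y_space_def by (intro time_deriv_is_time_deriv) blast
  have d2: "is_time_deriv T ?D (\<lambda>t. ?l (yt' t)) yt2"
    using cat unfolding yt2_def yt'_def cattaneo_weak_solution_def Y_space_def by (intro time_deriv_is_time_deriv) blast
  have d3: "is_time_deriv T ?L y y'"
    using heat unfolding y'_def heat_weak_solution_def W_space_def by (intro time_deriv_is_time_deriv) blast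
  have d4: "is_time_deriv T ?S ut ut'"
    using ut unfolding ut'_def H1t_def by (intro time_deriv_is_time_deriv) blast
  have "yt \<in> L2t T ?V" using cat by (simp add: cattaneo_weak_solution_def Y_space_def)
  then obtain Y where Y: "L2_representative T ?V Y" "AE t in lborel. t \<in> ?I \<longrightarrow> yt t = Y t"
    by (rule V.L2_representative_exists)
  have "yt' \<in> L2t T ?L" using d1 by (simp add: is_time_deriv_def)
  then obtain Y' where Y': "L2_representative T ?L Y'" "AE t in lborel. t \<in> ?I \<longrightarrow> yt' t = Y' t"
    by (rule L.L2_representative_exists)
  have "yt2 \<in> L2t T ?D" using d2 by (simp add: is_time_deriv_def)
  then obtain Y2 where Y2: "L2_representative T ?D Y2" "AE t in lborel. t \<in> ?I \<longrightarrow> yt2 t = Y2 t"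
    by (rule D.L2_representative_exists)
  have "y \<in> L2t T ?V" using heat by (simp add: heat_weak_solution_def W_space_def)
  then obtain Z where Z: "L2_representative T ?V Z" "AE t in lborel. t \<in> ?I \<longrightarrow> y t = Z t"
    by (rule V.L2_representative_exists)
  have "y' \<in> L2t T ?L" using d3 by (simp add: is_time_deriv_def)
  then obtain Z' where Z': "L2_representative T ?L Z'" "AE t in lborel. t \<in> ?I \<longrightarrow> y' t = Z' t"
    by (rule L.L2_representative_exists)
  have "ut \<in> L2t T ?S" using d4 by (simp add: is_time_deriv_def)
  then obtain U where U: "L2_representative T ?S U" "AE t in lborel. t \<in> ?I \<longrightarrow> ut t = U t"
    by (rule S.L2_representative_exists)
  have "ut' \<in> L2t T ?S" using d4 by (simp add: is_time_deriv_def)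
  then obtain U' where U': "L2_representative T ?S U'" "AE t in lborel. t \<in> ?I \<longrightarrow> ut' t = U' t"
    by (rule S.L2_representative_exists)
  have "u \<in> L2t T ?S" using u by (simp add: H1t_def)
  then obtain W where W: "L2_representative T ?S W" "AE t in lborel. t \<in> ?I \<longrightarrow> u t = W t"
    by (rule S.L2_representative_exists)
  note YL = L2_representative_H1_0_L2[OF Y(1)] and ZL = L2_representative_H1_0_L2[OF Z(1)]
    and UL = L2_representative_sobolev_1_L2[OF U(1)] and U'L = L2_representative_sobolev_1_L2[OF U'(1)]
    and WL = L2_representative_sobolev_1_L2[OF W(1)]

  have ini_Y: "AE t in lborel. t \<in> ?I \<longrightarrow> (\<forall>\<psi>\<in>elems ?L. ?l (Y t) \<psi> = ?l y0 \<psi> + (LINT r|lborel. indicator {..<t} r * ?l (Y' r) \<psi>))"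
    using cat by (intro L.initial_value_representatives[OF d1 _ T Y(2) Y'] functional_l2) (simp_all add: cattaneo_weak_solution_def)
  have ini_Z: "AE t in lborel. t \<in> ?I \<longrightarrow> (\<forall>\<psi>\<in>elems ?L. ?l (Z t) \<psi> = ?l y0 \<psi> + (LINT r|lborel. indicator {..<t} r * ?l (Z' r) \<psi>))"
    using heat by (intro L.initial_value_representatives[OF d3 _ T Z(2) Z'] functional_l2) (simp_all add: heat_weak_solution_def)
  have "AE t in lborel. t \<in> ?I \<longrightarrow> ?l (yt' t) = ?l (Y' t)"
    using Y'(2) by eventually_elim simp
  then have ini_Y': "AE t in lborel. t \<in> ?I \<longrightarrow> (\<forall>v\<in>elems ?V. ?l (Y' t) v = ?l y1 v + (LINT r|lborel. indicator {..<t} r * Y2 r v))"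
    using cat by (intro D.initial_value_representatives[OF d2 _ T _ Y2] functional_evaluation) (simp_all add: cattaneo_weak_solution_def yt'_def)
  have ini_U: "AE t in lborel. t \<in> ?I \<longrightarrow> (\<forall>\<psi>\<in>elems ?L. ?l (U t) \<psi> = ?l ubar \<psi> + (LINT r|lborel. indicator {..<t} r * ?l (U' r) \<psi>))"
    by (intro S.initial_value_representatives[OF d4 ut(2) T U(2) U'] functional_l2_sobolev)

  note weak_cat = cattaneo_weak_form[OF cat Y Y'[unfolded yt'_def] Y2[unfolded yt2_def] UL U(2)]
    and weak_heat = heat_weak_form[OF heat Z Z'[unfolded y'_def] WL W(2)]
  interpret C: cattaneo_solution \<Omega> T \<tau> y0 y1 ubar Y Y' U U' Y2
    by unfold_locales
      (fact T \<tau> y0 sobolev_1_to_L2(1)[OF ubar] y1_def y1 Y(1) Y'(1) Y2(1) UL U'L weak_cat ini_Y ini_Y' ini_U)+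

  define e where "e t = (\<lambda>x. 1 * Y t x + (-1) * Z t x)" for t
  define e' where "e' t = (\<lambda>x. 1 * Y' t x + (-1) * Z' t x)" for t
  define d where "d t = (\<lambda>x. 1 * U t x + (-1) * W t x)" for t
  have e: "L2_representative T ?V e" unfolding e_def by (rule V.L2_representative_lincomb[OF Y(1) Z(1)])
  have e': "L2_representative T ?L e'" unfolding e'_def by (rule L.L2_representative_lincomb[OF Y'(1) Z'(1)])
  have d: "L2_representative T ?L d" unfolding d_def by (rule L.L2_representative_lincomb[OF UL WL])
  note eL = L2_representative_H1_0_L2[OF e]
  have le: "?l (e t) \<psi> = ?l (Y t) \<psi> - ?l (Z t) \<psi>" "?l (e' t) \<psi> = ?l (Y' t) \<psi> - ?l (Z' t) \<psi>"
    "?l (d t) \<psi> = ?l (U t) \<psi> - ?l (W t) \<psi>" if "\<psi> \<in> elems ?L" for t \<psi>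
    using L_ip.lin_left[OF L2_rep_elems[OF YL] L2_rep_elems[OF ZL] that, of 1 t "-1" t]
      L_ip.lin_left[OF L2_rep_elems[OF Y'(1)] L2_rep_elems[OF Z'(1)] that, of 1 t "-1" t]
      L_ip.lin_left[OF L2_rep_elems[OF UL] L2_rep_elems[OF WL] that, of 1 t "-1" t]
    by (simp_all add: e_def e'_def d_def)
  have ae: "?a (e t) v = ?a (Y t) v - ?a (Z t) v" if "v \<in> elems ?V" for t v
    using V_ip.lin_left[OF L2_rep_elems[OF Y(1)] L2_rep_elems[OF Z(1)] that, of 1 t "-1" t] by (simp add: e_def)
  define E where "E = sqrt (LINT t|lborel. ?l (e t) (e t))"
  define A where "A = L2t_norm T ?L (\<lambda>t x. ut t x - u t x)"
  have A: "A = sqrt (LINT t|lborel. ?l (d t) (d t))"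
  proof -
    have "AE t in lborel. t \<in> ?I \<longrightarrow> (\<lambda>x. ut t x - u t x) = d t"
      using U(2) W(2) by eventually_elim (auto simp: d_def)
    from L.L2_representative_norm[OF d this] show ?thesis
      by (simp add: A_def fnorm_L2 l2_inner_nonneg)
  qed
  have A0: "0 \<le> A" by (simp add: A l2_inner_nonneg)
  have "sqrt (LINT t|lborel. (fnorm ?V (e t))\<^sup>2) \<le> sqrt (4 * T\<^sup>2 + 2 * T) * (A + \<tau> * C.bound)"
  proof (rule parabolic_estimate[OF T e e'])
    show "AE t in lborel. t \<in> ?I \<longrightarrow> (\<forall>\<psi>\<in>elems ?L. ?l (e t) \<psi> = (LINT r|lborel. indicator {..<t} r * ?l (e' r) \<psi>))"
      using ini_Y ini_Z
    proof eventually_elim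
      case (elim t)
      show ?case
      proof (intro impI ballI)
        fix \<psi> assume t: "t \<in> ?I" and \<psi>: "\<psi> \<in> elems ?L"
        have "integrable lborel (\<lambda>r. indicator {..<t} r * ?l (Y' r) \<psi>)" "integrable lborel (\<lambda>r. indicator {..<t} r * ?l (Z' r) \<psi>)"
          using L.L2_representative_functional[OF Y'(1) functional_l2[OF \<psi>]] L.L2_representative_functional[OF Z'(1) functional_l2[OF \<psi>]]
          by (auto intro: integrable_indicator_mult)
        then have "(LINT r|lborel. indicator {..<t} r * ?l (e' r) \<psi>)
            = (LINT r|lborel. indicator {..<t} r * ?l (Y' r) \<psi>) - (LINT r|lborel. indicator {..<t} r * ?l (Z' r) \<psi>)"
          by (simp add: le[OF \<psi>] right_diff_distrib)
        then show "?l (e t) \<psi> = (LINT r|lborel. indicator {..<t} r * ?l (e' r) \<psi>)"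
          using elim t \<psi> by (simp add: le[OF \<psi>])
      qed
    qed
    show "0 \<le> A + \<tau> * C.bound" using A0 \<tau> C.bound_nonneg by simp
    fix c assume c: "c \<in> {0<..T}"
    define w where "w t = (\<lambda>x. indicator {..<c} t * e t x)" for t
    have w: "L2_representative T ?V w"
      unfolding w_def by (rule V.L2_representative_indicator[OF e]) simp
    note wL = L2_representative_H1_0_L2[OF w] and we = L2_rep_elems[OF w] and weL = L2_rep_elems[OF L2_representative_H1_0_L2[OF w]]
    have lw: "?l f (w t) = indicator {..<c} t * ?l f (e t)" if "f \<in> elems ?L" for f t
      using L_ip.lin_right[OF L2_rep_elems[OF eL] L2_rep_elems[OF eL] that, of "indicator {..<c} t" t 0 t] by (simp add: w_def)
    have aw: "?a f (w t) = indicator {..<c} t * ?a f (e t)" if "f \<in> elems ?V" for f t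
      using V_ip.lin_right[OF L2_rep_elems[OF e] L2_rep_elems[OF e] that, of "indicator {..<c} t" t 0 t] by (simp add: w_def)
    have wE: "sqrt (LINT t|lborel. ?l (w t) (w t)) \<le> E"
      unfolding E_def
    proof (rule real_sqrt_le_mono, rule integral_mono[OF l2_time_integrable[OF wL] l2_time_integrable[OF eL]])
      fix t
      have "?l (w t) (w t) = indicator {..<c} t * (indicator {..<c} t * ?l (e t) (e t))"
        using lw[OF weL] L_ip.sym[OF weL L2_rep_elems[OF eL]] lw[OF L2_rep_elems[OF eL]] by simp
      then show "?l (w t) (w t) \<le> ?l (e t) (e t)"
        by (simp add: l2_inner_nonneg split: split_indicator)
    qed
    note i = LL.pairing_integrable[OF Y'(1) wL] VV.pairing_integrable[OF Y(1) w] LL.pairing_integrable[OF UL wL]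
      LL.pairing_integrable[OF Z'(1) wL] VV.pairing_integrable[OF Z(1) w] LL.pairing_integrable[OF WL wL]
    have "(LINT t|lborel. indicator {..<c} t * ?l (e' t) (e t)) + (LINT t|lborel. indicator {..<c} t * ?a (e t) (e t))
        = (LINT t|lborel. ?l (e' t) (w t)) + (LINT t|lborel. ?a (e t) (w t))"
      using lw[OF L2_rep_elems[OF e']] aw[OF L2_rep_elems[OF e]] by simp
    also have "\<dots> = ((LINT t|lborel. ?l (Y' t) (w t)) - (LINT t|lborel. ?l (Z' t) (w t)))
        + ((LINT t|lborel. ?a (Y t) (w t)) - (LINT t|lborel. ?a (Z t) (w t)))"
      using i by (simp add: le[OF weL] ae[OF we])
    also have "\<dots> = ((LINT t|lborel. ?l (U t) (w t)) - (LINT t|lborel. ?l (W t) (w t))) - \<tau> * (LINT t|lborel. Y2 t (w t))"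
      using weak_cat[OF w] weak_heat[OF w] by linarith
    also have "\<dots> = (LINT t|lborel. ?l (d t) (w t)) - \<tau> * (LINT t|lborel. Y2 t (w t))"
      using i by (simp add: le[OF weL])
    also have "\<dots> \<le> A * sqrt (LINT t|lborel. ?l (w t) (w t)) + \<tau> * (C.bound * sqrt (LINT t|lborel. ?l (w t) (w t)))"
    proof -
      have 1: "\<bar>LINT t|lborel. ?l (d t) (w t)\<bar> \<le> A * sqrt (LINT t|lborel. ?l (w t) (w t))"
        unfolding A by (rule C.time_cauchy_schwarz[OF d wL])
      have "\<bar>\<tau> * (LINT t|lborel. Y2 t (w t))\<bar> \<le> \<tau> * (C.bound * sqrt (LINT t|lborel. ?l (w t) (w t)))"
        using mult_left_mono[OF C.acceleration_bound[OF w], of \<tau>] \<tau> by (simp add: abs_mult)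
      with 1 show ?thesis by linarith
    qed
    also have "\<dots> = (A + \<tau> * C.bound) * sqrt (LINT t|lborel. ?l (w t) (w t))" by (simp add: algebra_simps)
    also have "\<dots> \<le> (A + \<tau> * C.bound) * E"
      using A0 \<tau> C.bound_nonneg by (intro mult_left_mono[OF wE]) simp
    finally show "(LINT t|lborel. indicator {..<c} t * ?l (e' t) (e t)) + (LINT t|lborel. indicator {..<c} t * ?a (e t) (e t))
        \<le> (A + \<tau> * C.bound) * sqrt (LINT t|lborel. ?l (e t) (e t))"
      by (simp add: E_def)
  qed
  moreover have "L2t_norm T ?V (\<lambda>t x. yt t x - y t x) = sqrt (LINT t|lborel. (fnorm ?V (e t))\<^sup>2)"
  proof (rule V.L2_representative_norm[OF e])
    show "AE t in lborel. t \<in> ?I \<longrightarrow> (\<lambda>x. yt t x - y t x) = e t"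
      using Y(2) Z(2) by eventually_elim (auto simp: e_def)
  qed
  moreover have "C.bound \<le> 2 * H1t_norm T ?S ut + 4 * sqrt (?a y1 y1)"
  proof -
    have H0: "0 \<le> H1t_norm T ?S ut" by (simp add: H1t_norm_def)
    have "(LINT t|lborel. ?l (U' t) (U' t)) \<le> (LINT t|lborel. (fnorm ?S (U' t))\<^sup>2)"
      using U'(1) by (intro integral_mono l2_time_integrable[OF U'L] l2_norm_le_sobolev_1 L2_rep_elems[OF U'(1)])
        (simp add: L2_representative_def)
    also have "\<dots> \<le> (H1t_norm T ?S ut)\<^sup>2"
      using S.L2_representative_norm[OF U'] by (simp add: H1t_norm_def ut'_def)
    finally have le: "(LINT t|lborel. ?l (U' t) (U' t)) \<le> (H1t_norm T ?S ut)\<^sup>2" .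
    have "(2 * H1t_norm T ?S ut + 4 * sqrt (?a y1 y1))\<^sup>2
        = 4 * (H1t_norm T ?S ut)\<^sup>2 + 16 * (H1t_norm T ?S ut * sqrt (?a y1 y1)) + 16 * ?a y1 y1"
      using V_ip.nonneg[OF y1] by (simp add: power2_sum power_mult_distrib)
    moreover have "0 \<le> H1t_norm T ?S ut * sqrt (?a y1 y1)" using H0 V_ip.nonneg[OF y1] by simp
    ultimately have "2 * (LINT t|lborel. ?l (U' t) (U' t)) + 16 * ?a y1 y1 \<le> (2 * H1t_norm T ?S ut + 4 * sqrt (?a y1 y1))\<^sup>2"
      using le zero_le_power2[of "H1t_norm T ?S ut"] by linarith
    then show ?thesis
      unfolding C.bound_def using V_ip.nonneg[OF y1] H0 by (intro real_le_lsqrt) auto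
  qed
  ultimately show ?thesis
  proof -
    assume 1: "sqrt (LINT t|lborel. (fnorm ?V (e t))\<^sup>2) \<le> sqrt (4 * T\<^sup>2 + 2 * T) * (A + \<tau> * C.bound)"
      and 2: "L2t_norm T ?V (\<lambda>t x. yt t x - y t x) = sqrt (LINT t|lborel. (fnorm ?V (e t))\<^sup>2)"
      and 3: "C.bound \<le> 2 * H1t_norm T ?S ut + 4 * sqrt (?a y1 y1)"
    have "sqrt (4 * T\<^sup>2 + 2 * T) * (A + \<tau> * C.bound)
      \<le> sqrt (4 * T\<^sup>2 + 2 * T) * (A + \<tau> * (2 * H1t_norm T ?S ut + 4 * sqrt (?a y1 y1)))"
      using 3 \<tau> T by (intro mult_left_mono add_left_mono) auto
    then show ?thesis using 1 2 by (simp add: A_def)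
  qed
qed

end

theorem theorem3p5:
  fixes \<Omega> :: "'a::euclidean_space set" and T M :: real and ubar :: "'a \<Rightarrow> real"
  assumes "bounded \<Omega>" and "lipschitz_domain \<Omega>" and "T > 0" and "M > 0"
    and "ubar \<in> elems (sobolev 1 \<Omega>)"
  shows "\<exists>C>0. \<forall>(y0 :: 'a \<Rightarrow> real) (y1 :: 'a \<Rightarrow> real) (u :: real \<Rightarrow> 'a \<Rightarrow> real)
      (u\<tau> :: real \<Rightarrow> real \<Rightarrow> 'a \<Rightarrow> real) (y :: real \<Rightarrow> 'a \<Rightarrow> real)
      (y\<tau> :: real \<Rightarrow> real \<Rightarrow> 'a \<Rightarrow> real).
    y0 \<in> elems (sobolev 3 \<Omega>) \<inter> elems (H1_0 \<Omega>) \<longrightarrow>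
    u \<in> admissible_controls \<Omega> T M ubar \<longrightarrow>
    (\<forall>\<tau>>0. u\<tau> \<tau> \<in> admissible_controls \<Omega> T M ubar) \<longrightarrow>
    y1 = (\<lambda>x. weak_laplacian \<Omega> y0 x + ubar x) \<longrightarrow>
    y1 \<in> elems (H1_0 \<Omega>) \<longrightarrow>
    (\<forall>\<tau>>0. cattaneo_weak_solution \<Omega> T \<tau> (u\<tau> \<tau>) y0 y1 (y\<tau> \<tau>)) \<longrightarrow>
    heat_weak_solution \<Omega> T u y0 y \<longrightarrow>
    (\<forall>\<tau>>0. L2t_norm T (H1_0 \<Omega>) (\<lambda>t x. y\<tau> \<tau> t x - y t x)
       \<le> C * L2t_norm T (L2_space \<Omega>) (\<lambda>t x. u\<tau> \<tau> t x - u t x)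
         + \<tau> * C * (H1t_norm T (sobolev 1 \<Omega>) (u\<tau> \<tau>) + fnorm (sobolev 3 \<Omega>) y0))"
proof -
  interpret bounded_domain \<Omega>
    using assms(1,2) by unfold_locales (auto simp: lipschitz_domain_def)
  note T = \<open>T > 0\<close>
  \<comment> \<open>\<open>R\<close> is the constant of the parabolic estimate; \<open>K\<close> and \<open>m\<close> are those in the bounds of \<open>ubar\<close> and \<open>y1\<close>.\<close>
  define R where "R = sqrt (4 * T\<^sup>2 + 2 * T)"
  define K where "K = (sqrt T + T * sqrt T) / T"
  define m where "m = real (DIM('a)) * real (Suc (DIM('a)))"
  define C where "C = R * (3 + 4 * (m * (1 + K)))"
  have R: "R > 0" using T by (simp add: R_def add_pos_pos)
  have K: "K \<ge> 0" using T by (simp add: K_def)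
  have m: "m \<ge> 0" by (simp add: m_def)
  have mK: "0 \<le> m * (1 + K)" using m K by simp
  have C: "C > 0" unfolding C_def using R mK by (intro mult_pos_pos) auto
  show ?thesis
  proof (intro exI[of _ C] conjI C allI impI)
    fix y0 y1 :: "'a \<Rightarrow> real" and u y :: "real \<Rightarrow> 'a \<Rightarrow> real" and u\<tau> y\<tau> :: "real \<Rightarrow> real \<Rightarrow> 'a \<Rightarrow> real" and \<tau> :: real
    assume y0: "y0 \<in> elems (sobolev 3 \<Omega>) \<inter> elems (H1_0 \<Omega>)"
      and u: "u \<in> admissible_controls \<Omega> T M ubar"
      and u\<tau>: "\<forall>\<tau>>0. u\<tau> \<tau> \<in> admissible_controls \<Omega> T M ubar"
      and y1: "y1 = (\<lambda>x. weak_laplacian \<Omega> y0 x + ubar x)" "y1 \<in> elems (H1_0 \<Omega>)"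
      and cat: "\<forall>\<tau>>0. cattaneo_weak_solution \<Omega> T \<tau> (u\<tau> \<tau>) y0 y1 (y\<tau> \<tau>)"
      and heat: "heat_weak_solution \<Omega> T u y0 y" and \<tau>: "0 < \<tau>"
    let ?A = "L2t_norm T (L2_space \<Omega>) (\<lambda>t x. u\<tau> \<tau> t x - u t x)"
    let ?H = "H1t_norm T (sobolev 1 \<Omega>) (u\<tau> \<tau>)" and ?F = "fnorm (sobolev 3 \<Omega>) y0"
    have ut: "u\<tau> \<tau> \<in> H1t T (sobolev 1 \<Omega>)" "has_initial_value T (sobolev 1 \<Omega>) (u\<tau> \<tau>) ubar"
      using u\<tau> \<tau> by (auto simp: admissible_controls_def)
    have uH: "u \<in> H1t T (sobolev 1 \<Omega>)" using u by (simp add: admissible_controls_def)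
    have F0: "0 \<le> ?F"
      using y0 seminormed_fspace.fnorm_nonneg[OF fspace_sobolev] by blast
    have H0: "0 \<le> ?H" by (simp add: H1t_norm_def)
    have A0: "0 \<le> ?A" by (simp add: L2t_norm_def)
    have "fnorm (sobolev 1 \<Omega>) ubar \<le> K * ?H"
      unfolding K_def by (rule initial_value_le_H1t_norm[OF T ut])
    then have "m * (?F + fnorm (sobolev 1 \<Omega>) ubar) \<le> m * (?F + K * ?H)"
      using m by (intro mult_left_mono) auto
    moreover have "sqrt (dirichlet_form \<Omega> y1 y1) \<le> m * (?F + fnorm (sobolev 1 \<Omega>) ubar)"
      unfolding y1(1) m_def using dirichlet_norm_laplacian_le[OF _ assms(5)] y0 by blast
    moreover have "m * (?F + K * ?H) \<le> m * ((1 + K) * (?H + ?F))"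
      using m K F0 H0 by (intro mult_left_mono) (simp_all add: algebra_simps)
    ultimately have y1_le: "sqrt (dirichlet_form \<Omega> y1 y1) \<le> m * (1 + K) * (?H + ?F)"
      by (simp add: mult.assoc)
    have sum_le: "2 * ?H + 4 * sqrt (dirichlet_form \<Omega> y1 y1) \<le> (3 + 4 * (m * (1 + K))) * (?H + ?F)"
    proof -
      have "2 * ?H \<le> 3 * (?H + ?F)" using F0 H0 by simp
      then show ?thesis using y1_le by (simp add: distrib_right)
    qed
    have "L2t_norm T (H1_0 \<Omega>) (\<lambda>t x. y\<tau> \<tau> t x - y t x)
      \<le> R * (?A + \<tau> * (2 * ?H + 4 * sqrt (dirichlet_form \<Omega> y1 y1)))"
      unfolding R_def using y0 cat \<tau>
      by (intro error_estimate[OF T \<tau> _ _ assms(5) uH ut y1 _ heat]) auto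
    also have "\<dots> \<le> R * (?A + \<tau> * ((3 + 4 * (m * (1 + K))) * (?H + ?F)))"
      using sum_le R \<tau> by (intro mult_left_mono add_left_mono) auto
    also have "\<dots> = R * ?A + \<tau> * C * (?H + ?F)" by (simp add: C_def algebra_simps)
    also have "\<dots> \<le> C * ?A + \<tau> * C * (?H + ?F)"
    proof -
      have "R * 1 \<le> C" unfolding C_def using R mK by (intro mult_left_mono) auto
      then show ?thesis using A0 by (intro add_right_mono mult_right_mono) auto
    qed
    finally show "L2t_norm T (H1_0 \<Omega>) (\<lambda>t x. y\<tau> \<tau> t x - y t x) \<le> C * ?A + \<tau> * C * (?H + ?F)" .
  qed
qed

end
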